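(* Let $s>1$. Then there exists $\delta>0$ sufficiently small and a constant $C=C(s,\delta)>0$ such that $$\big\|\partial_x(u_1u_2u_3)\big\|_{X^{s,-\frac12+3\delta}}\le C\prod_{j=1}^3\|u_j\|_{X^{s,\frac12+\delta}}$$ for all $u_1,u_2,u_3\in X^{s,\frac12+\delta}$.
   Context: Functions are defined on $\mathbb R\times\mathbb R\times\mathbb T$ with variables $(t,x,y)$, $\mathbb T=\mathbb R/2\pi\mathbb Z$; the dual Fourier variables are $(\tau,\xi,q)\in\mathbb R\times\mathbb R\times\mathbb Z$, and $\mathcal F$ is the space-time Fourier transform. Notation: $|(\xi,q)|:=\sqrt{3\xi^2+q^2}$, $\langle x\rangle:=(1+|x|^2)^{1/2}$, $\omega(\xi,q):=\xi^3+\xi q^2$. For $s,b\in\mathbb R$, $X^{s,b}$ is the space of $u\in\mathcal S'(\mathbb R\times\mathbb R\times\mathbb T)$ with $$\|u\|_{X^{s,b}}=\big\|\langle\tau-\omega(\xi,q)\rangle^b\langle|(\xi,q)|\rangle^s\mathcal F(u)(\tau,\xi,q)\big\|_{L^2_{\tau\xi}\ell^2_q}<\infty.$$ *)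

theory Defs
  imports "HOL-Analysis.Analysis"
begin

section \<open>Test functions and tempered distributions on R x R x T\<close>

definition partial_deriv ::
  "'a::euclidean_space \<Rightarrow> ('a \<Rightarrow> complex) \<Rightarrow> 'a \<Rightarrow> complex" where
  "partial_deriv e f z = vector_derivative (\<lambda>h::real. f (z + h *\<^sub>R e)) (at 0)"

abbreviation iter_partial ::
  "'a::euclidean_space list \<Rightarrow> ('a \<Rightarrow> complex) \<Rightarrow> 'a \<Rightarrow> complex" where
  "iter_partial es f \<equiv> foldr partial_deriv es f"

definition smooth_fun :: "('a::euclidean_space \<Rightarrow> complex) \<Rightarrow> bool" where
  "smooth_fun f \<longleftrightarrow>
     (\<forall>es\<in>lists Basis. continuous_on UNIV (iter_partial es f) \<and>
        (\<forall>e\<in>Basis. \<forall>z. (\<lambda>h::real. iter_partial es f (z + h *\<^sub>R e)) differentiable (at 0)))"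

text \<open>Functions of \<open>(t, x, y)\<close> on R x R x T are functions on \<open>real \<times> real \<times> real\<close> that are
  2 pi-periodic in \<open>y\<close>; they are integrated over the fundamental domain \<open>cylinder\<close>.\<close>

definition y_periodic :: "(real \<times> real \<times> real \<Rightarrow> complex) \<Rightarrow> bool" where
  "y_periodic f \<longleftrightarrow> (\<forall>t x y. f (t, x, y + 2 * pi) = f (t, x, y))"

definition cylinder :: "(real \<times> real \<times> real) set" where
  "cylinder = UNIV \<times> UNIV \<times> {0..2 * pi}"

definition schwartz :: "(real \<times> real \<times> real \<Rightarrow> complex) set" where
  "schwartz = {\<phi>. smooth_fun \<phi> \<and> y_periodic \<phi> \<and>
     (\<forall>es\<in>lists Basis. \<forall>N::nat. \<exists>C. \<forall>t x y.
        (1 + \<bar>t\<bar> + \<bar>x\<bar>) ^ N * cmod (iter_partial es \<phi> (t, x, y)) \<le> C)}"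

definition schwartz_seminorm :: "nat \<Rightarrow> (real \<times> real \<times> real \<Rightarrow> complex) \<Rightarrow> real" where
  "schwartz_seminorm N \<phi> =
     (SUP (es, t, x, y) \<in> {es \<in> lists Basis. length es \<le> N} \<times> UNIV.
        (1 + \<bar>t\<bar> + \<bar>x\<bar>) ^ N * cmod (iter_partial es \<phi> (t, x, y)))"

text \<open>A distribution is a functional on all functions, of which only the values on
  \<open>schwartz\<close> matter.\<close>

type_synonym distr = "(real \<times> real \<times> real \<Rightarrow> complex) \<Rightarrow> complex"

definition tempered :: "distr \<Rightarrow> bool" where
  "tempered u \<longleftrightarrow>
     (\<forall>\<phi>\<in>schwartz. \<forall>\<psi>\<in>schwartz. u (\<lambda>z. \<phi> z + \<psi> z) = u \<phi> + u \<psi>) \<and>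
     (\<forall>c. \<forall>\<phi>\<in>schwartz. u (\<lambda>z. c * \<phi> z) = c * u \<phi>) \<and>
     (\<exists>N C. \<forall>\<phi>\<in>schwartz. cmod (u \<phi>) \<le> C * schwartz_seminorm N \<phi>)"

definition dx_distr :: "distr \<Rightarrow> distr" where
  "dx_distr u = (\<lambda>\<phi>. - u (partial_deriv (0, 1, 0) \<phi>))"

text \<open>\<open>u\<close> is the regular distribution given by the function \<open>f\<close>.\<close>

definition represented_by :: "distr \<Rightarrow> (real \<times> real \<times> real \<Rightarrow> complex) \<Rightarrow> bool" where
  "represented_by u f \<longleftrightarrow> f \<in> borel_measurable lborel \<and> y_periodic f \<and>
     (\<forall>\<phi>\<in>schwartz. set_integrable lborel cylinder (\<lambda>z. f z * \<phi> z) \<and>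
        u \<phi> = (LINT z:cylinder|lborel. f z * \<phi> z))"

text \<open>The product of regular distributions is the regular distribution given by the pointwise
  product of the representing functions. The latter are unique almost everywhere, so the product
  is determined on \<open>schwartz\<close> whenever it exists; otherwise it is an unspecified functional.\<close>

definition distr_prod3 :: "distr \<Rightarrow> distr \<Rightarrow> distr \<Rightarrow> distr" where
  "distr_prod3 u v w = (SOME p. \<exists>f g h.
     represented_by u f \<and> represented_by v g \<and> represented_by w h \<and>
     represented_by p (\<lambda>z. f z * g z * h z))"


section \<open>Fourier transform\<close>

definition freq_measure :: "(real \<times> real \<times> int) measure" where
  "freq_measure = lborel \<Otimes>\<^sub>M (lborel \<Otimes>\<^sub>M count_space UNIV)"

definition schwartz_freq :: "(real \<times> real \<times> int \<Rightarrow> complex) set" where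
  "schwartz_freq = {\<psi>. (\<forall>q. smooth_fun (\<lambda>(\<tau>, \<xi>). \<psi> (\<tau>, \<xi>, q))) \<and>
     (\<forall>es\<in>lists Basis. \<forall>N::nat. \<exists>C. \<forall>\<tau> \<xi> q.
        (1 + \<bar>\<tau>\<bar> + \<bar>\<xi>\<bar> + \<bar>real_of_int q\<bar>) ^ N *
          cmod (iter_partial es (\<lambda>(\<tau>, \<xi>). \<psi> (\<tau>, \<xi>, q)) (\<tau>, \<xi>)) \<le> C)}"

definition fourier_test ::
  "(real \<times> real \<times> int \<Rightarrow> complex) \<Rightarrow> real \<times> real \<times> real \<Rightarrow> complex" where
  "fourier_test \<psi> = (\<lambda>(t, x, y).
     LINT (\<tau>, \<xi>, q)|freq_measure. cis (- (t * \<tau> + x * \<xi> + y * real_of_int q)) * \<psi> (\<tau>, \<xi>, q))"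

text \<open>\<open>u\<close> is a tempered distribution whose Fourier transform, defined by transposition as
  the functional \<open>\<lambda>\<psi>. u (fourier_test \<psi>)\<close> on \<open>schwartz_freq\<close>, is the function \<open>g\<close>.
  For an integrable function \<open>u\<close> this is the normalization without prefactor,
  in which \<open>g (\<tau>, \<xi>, q)\<close> is the integral of \<open>cis (- (t \<tau> + x \<xi> + y q)) u (t, x, y)\<close>.\<close>

definition has_fourier :: "distr \<Rightarrow> (real \<times> real \<times> int \<Rightarrow> complex) \<Rightarrow> bool" where
  "has_fourier u g \<longleftrightarrow> tempered u \<and> g \<in> borel_measurable freq_measure \<and>
     (\<forall>\<psi>\<in>schwartz_freq. integrable freq_measure (\<lambda>\<zeta>. g \<zeta> * \<psi> \<zeta>) \<and>
        u (fourier_test \<psi>) = (LINT \<zeta>|freq_measure. g \<zeta> * \<psi> \<zeta>))"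


section \<open>The spaces \<open>X\<^sup>s\<^sup>,\<^sup>b\<close>\<close>

definition jbracket :: "real \<Rightarrow> real" where
  "jbracket x = (1 + \<bar>x\<bar>\<^sup>2) powr (1/2)"

definition freq_abs :: "real \<Rightarrow> int \<Rightarrow> real" where
  "freq_abs \<xi> q = sqrt (3 * \<xi>\<^sup>2 + (real_of_int q)\<^sup>2)"

definition omega :: "real \<Rightarrow> int \<Rightarrow> real" where
  "omega \<xi> q = \<xi> ^ 3 + \<xi> * (real_of_int q)\<^sup>2"

definition L2_norm_freq :: "(real \<times> real \<times> int \<Rightarrow> real) \<Rightarrow> ennreal" where
  "L2_norm_freq g =
     (let I = (\<integral>\<^sup>+ \<zeta>. ennreal ((g \<zeta>)\<^sup>2) \<partial>freq_measure)
      in if I = \<infinity> then \<infinity> else ennreal (sqrt (enn2real I)))"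

text \<open>The function \<open>g\<close> with \<open>has_fourier u g\<close> is unique almost everywhere, so the infimum below
  is over a single value. If \<open>u\<close> is not tempered, or its Fourier transform is not a function,
  the infimum is over the empty set and the norm is \<open>\<infinity>\<close>.\<close>

definition X_norm :: "real \<Rightarrow> real \<Rightarrow> distr \<Rightarrow> ennreal" where
  "X_norm s b u = (INF g \<in> {g. has_fourier u g}.
     L2_norm_freq (\<lambda>(\<tau>, \<xi>, q).
       jbracket (\<tau> - omega \<xi> q) powr b * jbracket (freq_abs \<xi> q) powr s * cmod (g (\<tau>, \<xi>, q))))"

definition X_space :: "real \<Rightarrow> real \<Rightarrow> distr set" where
  "X_space s b = {u. tempered u \<and> X_norm s b u < \<infinity>}"

end

theory Submission
  imports Defs "HOL-Probability.Probability" "HOL-Real_Asymp.Real_Asymp"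
begin

text \<open>On the Fourier side, write \<open>\<sigma>\<close> for the modulation \<open>\<tau> - \<omega>(\<xi>, q)\<close> of a frequency \<open>\<zeta> = (\<tau>, \<xi>, q)\<close>, and \<open>m\<close> for
  the weight \<open>(1 + 3 \<xi>\<^sup>2 + q\<^sup>2) powr (s/2)\<close>. The Fourier transform of \<open>\<partial>\<^sub>x (u\<^sub>1 u\<^sub>2 u\<^sub>3)\<close> is, up to a constant,
  \<open>\<i> \<xi>\<close> times the convolution of the three transforms. So the assertion splits into an \<open>L\<^sup>2\<close> bound for a
  weighted threefold convolution of nonnegative functions, and a passage from distributions to
  such convolutions.

  The convolution bound. Let \<open>a, b, c\<close> be the three input frequencies, and \<open>r = s - 1/2 > 1/2\<close>. The
  symbol \<open>\<bar>\<xi>\<^sub>a + \<xi>\<^sub>b + \<xi>\<^sub>c\<bar> m(a + b + c)\<close> is at most a constant times \<open>m(a) m(b) m(c)\<close> times a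
  sum over the orderings of the inputs of two kinds of terms (\<open>multiplier_le\<close>). The curvature terms
  \<open>\<bar>\<xi>\<^sub>a + \<xi>\<^sub>b\<bar> powr (1/2)\<close> appear when the two largest frequencies are comparable, and half a
  derivative of the total loss can be put on the weight of the second largest one. The transversal
  terms \<open>\<bar>\<bar>a\<bar>\<^sup>2 - \<bar>b\<bar>\<^sup>2\<bar> powr (1/2)\<close> appear when one frequency dominates, and they control the full
  derivative. Both kinds come with powers of the brackets of the
  integer frequencies that make the sums over \<open>q\<close> converge.

  Each term factors into a bilinear estimate for two of the inputs followed by one for the result
  and the third input (\<open>trilinear_two_steps\<close>). By Cauchy-Schwarz a bilinear estimate reduces to the
  square integral of its kernel over one free frequency \<open>\<zeta>\<close>, the other one, \<open>\<eta>\<close>, being fixed. There the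
  modulation of \<open>\<zeta>\<close> and its integer component integrate out and leave an integral in \<open>\<xi>\<close> of a negative power of
  \<open>\<langle>\<theta> - \<omega>(\<xi>, q) - \<omega>(\<eta> - (\<xi>, q))\<rangle>\<close> (\<open>kernel_reduction\<close>). The argument is a quadratic polynomial
  in \<open>\<xi>\<close> with leading coefficient \<open>-3 \<xi>\<^sub>\<eta>\<close>, so the integral is \<open>O(\<bar>\<xi>\<^sub>\<eta>\<bar> powr (-1/2))\<close> (\<open>kernel_curvature\<close>), and its
  derivative is the difference \<open>\<bar>\<eta> - \<zeta>\<bar>\<^sup>2 - \<bar>\<zeta>\<bar>\<^sup>2\<close>, which serves as the Jacobian of a substitution
  (\<open>kernel_transversal\<close>). In the second step of a transversal term the hypothesis \<open>s > 1\<close> makes \<open>m powr (-2)\<close>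
  integrable over the spatial frequencies (\<open>kernel_sobolev\<close>).

  From distributions to convolutions. As \<open>s > 1\<close>, the transform \<open>g\<close> of an element of \<open>X\<^sup>s\<^sup>,\<^sup>b\<close> is integrable
  (\<open>integrable_from_X\<close>). Then the distribution is a bounded continuous function, namely the inverse
  transform of \<open>g\<close>; this needs Fourier inversion on the test functions (\<open>bt_ft\<close>, \<open>ft_bt\<close>).
  The product of distributions is defined through an arbitrary choice of representing functions, so
  these must be shown to be unique almost everywhere (\<open>represented_by_unique\<close>). After that the
  product is the pointwise product of inverse transforms, that is, the inverse transform of the
  convolution (\<open>distr_prod3_eq\<close>, \<open>has_fourier_dx_prod3\<close>), and its modulus is at most the
  convolution of the moduli.\<close>

section \<open>The frequency space\<close>

text \<open>Second countability makes the Borel sets of \<open>\<real> \<times> \<real> \<times> \<int>\<close> the product sigma-algebra, so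
  \<open>freq_measure\<close> is a measure on Borel sets and measurability can be argued through continuity.\<close>

instance int :: second_countable_topology
proof
  have "(\<exists>B::int set set. countable B \<and> (open :: int set \<Rightarrow> bool) = generate_topology B)"
  proof (intro exI conjI)
    show "countable (range (\<lambda>i::int. {i}))" by simp
    show "(open :: int set \<Rightarrow> bool) = generate_topology (range (\<lambda>i::int. {i}))"
    proof (rule ext, rule iffI)
      fix S :: "int set"
      show "open S" by (rule Topological_Spaces.open_discrete)
    next
      fix S :: "int set"
      have "generate_topology (range (\<lambda>i::int. {i})) (\<Union>((\<lambda>i. {i}) ` S))"
        by (rule generate_topology.UN) (auto intro: generate_topology.Basis)
      then show "generate_topology (range (\<lambda>i::int. {i})) S" by simp
    qed
  qed
  then show "\<exists>B::int set set. countable B \<and> open = generate_topology B" .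
qed

type_synonym freq = "real \<times> real \<times> int"

lemma sets_freq [measurable_cong]: "sets freq_measure = sets (borel :: freq measure)"
proof -
  have "sets (lborel \<Otimes>\<^sub>M (lborel \<Otimes>\<^sub>M count_space (UNIV::int set))) =
    sets (borel \<Otimes>\<^sub>M (borel \<Otimes>\<^sub>M (borel :: int measure)) :: freq measure)"
    by (intro sets_pair_measure_cong) (simp_all add: sets_borel_eq_count_space)
  also have "\<dots> = sets (borel :: freq measure)" by (simp only: borel_prod)
  finally show ?thesis unfolding freq_measure_def .
qed

lemma space_freq [simp]: "space freq_measure = UNIV"
  by (simp add: freq_measure_def space_pair_measure)

lemma sigma_finite_int: "sigma_finite_measure (count_space (UNIV::int set))"
  by (rule sigma_finite_measure_count_space_countable) simp

interpretation lbi: pair_sigma_finite lborel "count_space (UNIV::int set)"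
  by (intro pair_sigma_finite.intro sigma_finite_lborel sigma_finite_int)

interpretation lbi2: pair_sigma_finite "lborel::real measure" "lborel \<Otimes>\<^sub>M count_space (UNIV::int set)"
  by (intro pair_sigma_finite.intro sigma_finite_lborel lbi.sigma_finite_measure_axioms)

interpretation freq: sigma_finite_measure freq_measure
  unfolding freq_measure_def by (rule lbi2.sigma_finite_measure_axioms)

interpretation freq2: pair_sigma_finite freq_measure freq_measure
  by (intro pair_sigma_finite.intro freq.sigma_finite_measure_axioms)

lemma nn_integral_freq:
  fixes f :: "freq \<Rightarrow> ennreal"
  assumes [measurable]: "f \<in> borel_measurable borel"
  shows "(\<integral>\<^sup>+\<zeta>. f \<zeta> \<partial>freq_measure) =
    (\<integral>\<^sup>+\<tau>. \<integral>\<^sup>+\<xi>. \<integral>\<^sup>+q. f (\<tau>, \<xi>, q) \<partial>count_space UNIV \<partial>lborel \<partial>lborel)"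
proof -
  have [measurable]: "f \<in> borel_measurable (lborel \<Otimes>\<^sub>M (lborel \<Otimes>\<^sub>M count_space UNIV))"
    using assms sets_freq unfolding freq_measure_def by (metis measurable_cong_sets)
  show ?thesis
    unfolding freq_measure_def
    by (subst lbi.sigma_finite_measure_axioms[THEN sigma_finite_measure.nn_integral_fst, symmetric], simp)
       (simp add: sigma_finite_measure.nn_integral_fst[OF sigma_finite_int, symmetric])
qed

text \<open>In this order the innermost integral is the one over \<open>\<tau>\<close>, which is where a modulation can be
  shifted to a free variable.\<close>

lemma nn_integral_freq_swap:
  fixes f :: "freq \<Rightarrow> ennreal"
  assumes [measurable]: "f \<in> borel_measurable borel"
  shows "(\<integral>\<^sup>+\<zeta>. f \<zeta> \<partial>freq_measure) =
    (\<integral>\<^sup>+q. \<integral>\<^sup>+\<xi>. \<integral>\<^sup>+\<tau>. f (\<tau>, \<xi>, q) \<partial>lborel \<partial>lborel \<partial>count_space UNIV)"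
proof -
  have f[measurable]: "f \<in> borel_measurable (lborel \<Otimes>\<^sub>M (lborel \<Otimes>\<^sub>M count_space UNIV))"
    using assms sets_freq unfolding freq_measure_def by (metis measurable_cong_sets)
  have "(\<integral>\<^sup>+\<zeta>. f \<zeta> \<partial>freq_measure) = 
     (\<integral>\<^sup>+\<eta>. \<integral>\<^sup>+\<tau>. f (\<tau>, \<eta>) \<partial>lborel \<partial>(lborel \<Otimes>\<^sub>M count_space UNIV))"
    unfolding freq_measure_def by (rule lbi2.nn_integral_snd[symmetric]) simp
  also have "\<dots> = (\<integral>\<^sup>+q. \<integral>\<^sup>+\<xi>. \<integral>\<^sup>+\<tau>. f (\<tau>, \<xi>, q) \<partial>lborel \<partial>lborel \<partial>count_space UNIV)"
    by (subst lbi.nn_integral_snd[symmetric]) simp_all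
  finally show ?thesis .
qed

lemma continuous_freq_shift [continuous_intros]: "continuous_on A (\<lambda>\<zeta>::freq. \<eta> + \<zeta>)"
proof -
  have "(\<lambda>\<zeta>::freq. \<eta> + \<zeta>) = (\<lambda>\<zeta>. (fst \<eta> + fst \<zeta>, fst (snd \<eta>) + fst (snd \<zeta>), snd (snd \<eta>) + snd (snd \<zeta>)))"
    by (auto simp: fun_eq_iff prod_eq_iff)
  then show ?thesis by (simp only:) (intro continuous_intros)
qed

lemma continuous_freq_minus [continuous_intros]: "continuous_on A (\<lambda>\<zeta>::freq. - \<zeta>)"
proof -
  have "(\<lambda>\<zeta>::freq. - \<zeta>) = (\<lambda>\<zeta>. (- fst \<zeta>, - fst (snd \<zeta>), 0 - snd (snd \<zeta>)))"
    by (auto simp: fun_eq_iff prod_eq_iff)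
  moreover have "continuous_on UNIV (\<lambda>q::int. 0 - q)" by (rule Topological_Spaces.continuous_on_discrete)
  then have "continuous_on A (\<lambda>\<zeta>::freq. 0 - snd (snd \<zeta>))"
    by (rule continuous_on_compose2) (auto intro!: continuous_intros)
  ultimately show ?thesis by (simp only:) (intro continuous_intros, simp)
qed

lemma nn_integral_freq_shift:
  fixes f :: "freq \<Rightarrow> ennreal"
  assumes [measurable]: "f \<in> borel_measurable borel"
  shows "(\<integral>\<^sup>+\<zeta>. f (\<eta> + \<zeta>) \<partial>freq_measure) = (\<integral>\<^sup>+\<zeta>. f \<zeta> \<partial>freq_measure)"
proof -
  obtain a b c where e: "\<eta> = (a, b, c)" by (cases \<eta>)
  have m: "(\<lambda>\<zeta>. f (\<eta> + \<zeta>)) \<in> borel_measurable borel"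
    by (intro measurable_compose[OF borel_measurable_continuous_onI assms] continuous_intros)
  have 1: "(\<integral>\<^sup>+q. f (a + \<tau>, b + \<xi>, c + q) \<partial>count_space UNIV) = 
     (\<integral>\<^sup>+q. f (a + \<tau>, b + \<xi>, q) \<partial>count_space UNIV)" for \<tau> \<xi>
    by (rule nn_integral_bij_count_space[where g = "\<lambda>q. c + q" and f = "\<lambda>q. f (a + \<tau>, b + \<xi>, q)"]) 
       (auto intro!: bij_betwI[where g = "\<lambda>q. q - c"])
  have fm[measurable]: "f \<in> borel_measurable (lborel \<Otimes>\<^sub>M (lborel \<Otimes>\<^sub>M count_space UNIV))"
    using assms sets_freq unfolding freq_measure_def by (metis measurable_cong_sets)
  have 2: "(\<integral>\<^sup>+\<xi>. \<integral>\<^sup>+q. f (a + \<tau>, b + \<xi>, q) \<partial>count_space UNIV \<partial>lborel) = 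
     (\<integral>\<^sup>+\<xi>. \<integral>\<^sup>+q. f (a + \<tau>, \<xi>, q) \<partial>count_space UNIV \<partial>lborel)" for \<tau>
    using nn_integral_real_affine[of "\<lambda>\<xi>. \<integral>\<^sup>+q. f (a + \<tau>, \<xi>, q) \<partial>count_space UNIV" 1 b]
    by simp
  have 3: "(\<integral>\<^sup>+\<tau>. \<integral>\<^sup>+\<xi>. \<integral>\<^sup>+q. f (a + \<tau>, \<xi>, q) \<partial>count_space UNIV \<partial>lborel \<partial>lborel) = 
     (\<integral>\<^sup>+\<tau>. \<integral>\<^sup>+\<xi>. \<integral>\<^sup>+q. f (\<tau>, \<xi>, q) \<partial>count_space UNIV \<partial>lborel \<partial>lborel)"
    using nn_integral_real_affine[of "\<lambda>\<tau>. \<integral>\<^sup>+\<xi>. \<integral>\<^sup>+q. f (\<tau>, \<xi>, q) \<partial>count_space UNIV \<partial>lborel" 1 a]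
    by simp
  show ?thesis
    using m by (simp add: nn_integral_freq e 1 2 3)
qed

lemma nn_integral_freq_minus:
  fixes f :: "freq \<Rightarrow> ennreal"
  assumes [measurable]: "f \<in> borel_measurable borel"
  shows "(\<integral>\<^sup>+\<zeta>. f (- \<zeta>) \<partial>freq_measure) = (\<integral>\<^sup>+\<zeta>. f \<zeta> \<partial>freq_measure)"
proof -
  have m: "(\<lambda>\<zeta>. f (- \<zeta>)) \<in> borel_measurable borel"
    by (intro measurable_compose[OF borel_measurable_continuous_onI assms] continuous_intros)
  have 1: "(\<integral>\<^sup>+q. f (- \<tau>, - \<xi>, - q) \<partial>count_space UNIV) = 
     (\<integral>\<^sup>+q. f (- \<tau>, - \<xi>, q) \<partial>count_space UNIV)" for \<tau> \<xi>
    by (rule nn_integral_bij_count_space[where g = "\<lambda>q. - q" and f = "\<lambda>q. f (- \<tau>, - \<xi>, q)"]) 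
       (auto intro!: bij_betwI[where g = "\<lambda>q. - q"])
  have fm[measurable]: "f \<in> borel_measurable (lborel \<Otimes>\<^sub>M (lborel \<Otimes>\<^sub>M count_space UNIV))"
    using assms sets_freq unfolding freq_measure_def by (metis measurable_cong_sets)
  have 2: "(\<integral>\<^sup>+\<xi>. \<integral>\<^sup>+q. f (- \<tau>, - \<xi>, q) \<partial>count_space UNIV \<partial>lborel) = 
     (\<integral>\<^sup>+\<xi>. \<integral>\<^sup>+q. f (- \<tau>, \<xi>, q) \<partial>count_space UNIV \<partial>lborel)" for \<tau>
    using nn_integral_real_affine[of "\<lambda>\<xi>. \<integral>\<^sup>+q. f (- \<tau>, \<xi>, q) \<partial>count_space UNIV" "-1" 0]
    by simp
  have 3: "(\<integral>\<^sup>+\<tau>. \<integral>\<^sup>+\<xi>. \<integral>\<^sup>+q. f (- \<tau>, \<xi>, q) \<partial>count_space UNIV \<partial>lborel \<partial>lborel) = 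
     (\<integral>\<^sup>+\<tau>. \<integral>\<^sup>+\<xi>. \<integral>\<^sup>+q. f (\<tau>, \<xi>, q) \<partial>count_space UNIV \<partial>lborel \<partial>lborel)"
    using nn_integral_real_affine[of "\<lambda>\<tau>. \<integral>\<^sup>+\<xi>. \<integral>\<^sup>+q. f (\<tau>, \<xi>, q) \<partial>count_space UNIV \<partial>lborel" "-1" 0]
    by simp
  show ?thesis
    by (simp add: nn_integral_freq m 1 2 3)
qed

lemma nn_integral_freq_reflect:
  fixes f :: "freq \<Rightarrow> ennreal"
  assumes [measurable]: "f \<in> borel_measurable borel"
  shows "(\<integral>\<^sup>+\<zeta>. f (\<eta> - \<zeta>) \<partial>freq_measure) = (\<integral>\<^sup>+\<zeta>. f \<zeta> \<partial>freq_measure)"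
proof -
  have m: "(\<lambda>\<zeta>. f (\<eta> + \<zeta>)) \<in> borel_measurable borel"
    by (intro measurable_compose[OF borel_measurable_continuous_onI assms] continuous_intros)
  show ?thesis
    using nn_integral_freq_minus[OF m] nn_integral_freq_shift[OF assms, of \<eta>] by simp
qed

section \<open>Integrals of brackets of quadratic polynomials\<close>

text \<open>The modulus of \<open>y\<^sup>2 - k\<^sup>2\<close> factors as \<open>\<bar>\<bar>y\<bar> - k\<bar> (\<bar>y\<bar> + k)\<close>, and the second factor dominates the first. So a
  quadratic with real roots is bounded below by a translated square around each root, whatever the
  distance of the roots.\<close>

lemma sq_diff_ge: "\<bar>y\<^sup>2 - k\<^sup>2\<bar> \<ge> (\<bar>y\<bar> - k)\<^sup>2" if "k \<ge> 0" for y k :: real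
proof -
  have a: "\<bar>y\<bar> + k \<ge> \<bar>\<bar>y\<bar> - k\<bar>" using that by auto
  have "y\<^sup>2 - k\<^sup>2 = (\<bar>y\<bar> - k) * (\<bar>y\<bar> + k)"
    by (simp add: algebra_simps power2_eq_square)
  then have "\<bar>y\<^sup>2 - k\<^sup>2\<bar> = \<bar>\<bar>y\<bar> - k\<bar> * (\<bar>y\<bar> + k)"
    using that by (simp add: abs_mult)
  also have "\<dots> \<ge> \<bar>\<bar>y\<bar> - k\<bar> * \<bar>\<bar>y\<bar> - k\<bar>" using a by (intro mult_left_mono) auto
  finally show ?thesis by (simp add: power2_eq_square abs_mult_self_eq)
qed

lemma jbracket_ge1: "jbracket x \<ge> 1"
  unfolding jbracket_def by (rule ge_one_powr_ge_zero) auto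

lemma jbracket_pos [simp]: "jbracket x > 0" using jbracket_ge1[of x] by linarith

lemma jbracket_minus [simp]: "jbracket (- x) = jbracket x" by (simp add: jbracket_def)

lemma jbracket_mono: "\<bar>x\<bar> \<le> \<bar>y\<bar> \<Longrightarrow> jbracket x \<le> jbracket y"
  unfolding jbracket_def by (intro powr_mono2) (auto simp: abs_le_square_iff)

lemma jbracket_powr_mono: "\<bar>x\<bar> \<le> \<bar>y\<bar> \<Longrightarrow> 0 \<le> p \<Longrightarrow> jbracket y powr (- p) \<le> jbracket x powr (- p)"
  by (rule powr_mono2') (auto intro: jbracket_mono)

lemma jbracket_powr_le1: "0 \<le> p \<Longrightarrow> jbracket x powr (- p) \<le> 1"
  using powr_mono[of "- p" 0 "jbracket x"] jbracket_ge1[of x] by auto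

lemma jbracket_powr_sq: "jbracket x powr p = (1 + x\<^sup>2) powr (p / 2)"
  by (simp add: jbracket_def powr_powr)

lemma jbracket_meas [measurable]: "jbracket \<in> borel_measurable borel"
  unfolding jbracket_def by measurable

lemma abs_le_jbracket: "\<bar>x\<bar> \<le> jbracket x"
  by (simp add: jbracket_def powr_half_sqrt real_le_rsqrt)

lemma nn_integral_jbracket:
  assumes "p > 1"
  shows "(\<integral>\<^sup>+x. ennreal (jbracket x powr (- p)) \<partial>lborel) < \<infinity>"
proof -
  let ?f = "\<lambda>x. ennreal (jbracket x powr (- p))"
  let ?F = "\<lambda>x::real. x powr (1 - p) / (1 - p)"
  have 1: "(\<integral>\<^sup>+x. ennreal (x powr (- p)) * indicator {1..} x \<partial>lborel) = ennreal (0 - ?F 1)"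
  proof (rule nn_integral_FTC_atLeast[where F = ?F and f = "\<lambda>x. x powr (- p)"])
    fix x :: real assume "1 \<le> x"
    then show "(?F has_real_derivative x powr (- p)) (at x)"
      using assms by (auto intro!: derivative_eq_intros)
    show "0 \<le> x powr (- p)" by simp
  next
    have "((\<lambda>x::real. x powr (1 - p)) \<longlongrightarrow> 0) at_top"
      using assms by (intro tendsto_neg_powr filterlim_ident) auto
    then show "(?F \<longlongrightarrow> 0) at_top" by (rule tendsto_divide_zero)
  qed simp
  have 2: "(\<integral>\<^sup>+x. ?f x * indicator {1..} x \<partial>lborel) < \<infinity>"
  proof -
    have "(\<integral>\<^sup>+x. ?f x * indicator {1..} x \<partial>lborel) \<le> (\<integral>\<^sup>+x. ennreal (x powr (- p)) * indicator {1..} x \<partial>lborel)"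
    proof (intro nn_integral_mono)
      fix x :: real
      show "?f x * indicator {1..} x \<le> ennreal (x powr (- p)) * indicator {1..} x"
        using assms abs_le_jbracket[of x]
        by (auto simp: indicator_def intro!: ennreal_leI powr_mono2')
    qed
    then show ?thesis unfolding 1 by (simp add: top.extremum_strict order.strict_trans1)
  qed
  have 3: "(\<integral>\<^sup>+x. ?f x * indicator {..-1} x \<partial>lborel) < \<infinity>"
  proof -
    have "(\<integral>\<^sup>+x. ?f x * indicator {..-1} x \<partial>lborel) = (\<integral>\<^sup>+x. ?f x * indicator {1..} x \<partial>lborel)"
      by (subst nn_integral_real_affine[where c = "-1" and t = 0])
         (auto intro!: nn_integral_cong simp: indicator_def)
    then show ?thesis using 2 by simp
  qed
  have 4: "(\<integral>\<^sup>+x. indicator {-1..1::real} x \<partial>lborel) < \<infinity>" by simp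
  have "(\<integral>\<^sup>+x. ?f x \<partial>lborel) \<le> (\<integral>\<^sup>+x. ?f x * indicator {1..} x + ?f x * indicator {..-1} x + indicator {-1..1::real} x \<partial>lborel)"
    using jbracket_powr_le1[of p] assms by (intro nn_integral_mono) (auto simp: indicator_def)
  also have "\<dots> = (\<integral>\<^sup>+x. ?f x * indicator {1..} x \<partial>lborel) + (\<integral>\<^sup>+x. ?f x * indicator {..-1} x \<partial>lborel) + (\<integral>\<^sup>+x. indicator {-1..1::real} x \<partial>lborel)"
    by (simp add: nn_integral_add)
  also have "\<dots> < \<infinity>" using 2 3 4 by (simp only: infinity_ennreal_def ennreal_add_less_top simp_thms)
  finally show ?thesis .
qed

lemma nn_integral_jbracket_int:
  assumes "p > 1"
  shows "(\<integral>\<^sup>+q. ennreal (jbracket (real_of_int q) powr (- p)) \<partial>count_space (UNIV::int set)) < \<infinity>"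
proof -
  let ?f = "\<lambda>q::int. ennreal (jbracket (real_of_int q) powr (- p))"
  have s: "summable (\<lambda>n. jbracket (real n) powr (- p))"
  proof (rule summable_comparison_test_ev)
    show "summable (\<lambda>n. real n powr (- p))" using assms by (simp add: summable_real_powr_iff)
    show "\<forall>\<^sub>F n in sequentially. norm (jbracket (real n) powr - p) \<le> real n powr - p"
      using eventually_gt_at_top[of 0]
    proof eventually_elim
      case (elim n) then show ?case using abs_le_jbracket[of "real n"] assms by (auto intro!: powr_mono2')
    qed
  qed
  have N: "(\<integral>\<^sup>+n. ennreal (jbracket (real n) powr (- p)) \<partial>count_space (UNIV::nat set)) < \<infinity>"
    using s by (simp add: nn_integral_count_space_nat suminf_ennreal_eq[OF _ summable_sums] )
  have e: "(\<integral>\<^sup>+q. ?f q \<partial>count_space (range int)) = (\<integral>\<^sup>+n. ennreal (jbracket (real n) powr (- p)) \<partial>count_space (UNIV::nat set))"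
    by (subst nn_integral_bij_count_space[of int UNIV "range int", symmetric]) (auto simp: bij_betw_def)
  have e2: "(\<integral>\<^sup>+q. ?f q \<partial>count_space (range (\<lambda>n. - int n))) = (\<integral>\<^sup>+n. ennreal (jbracket (real n) powr (- p)) \<partial>count_space (UNIV::nat set))"
    by (subst nn_integral_bij_count_space[of "\<lambda>n. - int n" UNIV "range (\<lambda>n. - int n)", symmetric]) (auto simp: bij_betw_def inj_on_def)
  have "(\<integral>\<^sup>+q. ?f q \<partial>count_space UNIV) \<le> (\<integral>\<^sup>+q. ?f q * indicator (range int) q + ?f q * indicator (range (\<lambda>n. - int n)) q \<partial>count_space UNIV)"
  proof (intro nn_integral_mono)
    fix q :: int
    have "q \<in> range int \<or> q \<in> range (\<lambda>n. - int n)" 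
      by (cases "q \<ge> 0") (auto simp: image_iff intro: exI[of _ "nat (-q)"] exI[of _ "nat q"])
    then show "?f q \<le> ?f q * indicator (range int) q + ?f q * indicator (range (\<lambda>n. - int n)) q"
      by (auto simp: indicator_def)
  qed
  also have "\<dots> = (\<integral>\<^sup>+q. ?f q \<partial>count_space (range int)) + (\<integral>\<^sup>+q. ?f q \<partial>count_space (range (\<lambda>n. - int n)))"
    by (subst nn_integral_add) (auto simp: nn_integral_count_space_indicator)
  also have "\<dots> < \<infinity>" using N unfolding e e2 by (simp only: infinity_ennreal_def ennreal_add_less_top simp_thms)
  finally show ?thesis .
qed

text \<open>The sublevel sets of a quadratic polynomial with leading coefficient \<open>\<gamma>\<close> have measure
  \<open>O(\<bar>\<gamma>\<bar> powr (-1/2))\<close>, uniformly in the other coefficients. Completing the square and scaling reduces to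
  \<open>y\<^sup>2 + \<mu>\<close>; for \<open>\<mu> \<ge> 0\<close> the bracket only grows, and for \<open>\<mu> < 0\<close> \<open>sq_diff_ge\<close> compares it with two
  translates of \<open>y\<^sup>2\<close>.\<close>

lemma nn_integral_quadratic_le:
  assumes "p > 1/2"
  obtains C :: real where "C \<ge> 0"
    "\<And>\<alpha> \<beta> \<gamma> :: real. \<gamma> \<noteq> 0 \<Longrightarrow>
      (\<integral>\<^sup>+x. ennreal (jbracket (\<alpha> + \<beta> * x + \<gamma> * x\<^sup>2) powr (- p)) \<partial>lborel) \<le> ennreal (C * \<bar>\<gamma>\<bar> powr (- (1/2)))"
proof -
  define J where "J = (\<integral>\<^sup>+y. ennreal (jbracket (y\<^sup>2) powr (- p)) \<partial>lborel)"
  \<comment> \<open>The bracket of \<open>y\<^sup>2\<close> is comparable to the square of the bracket of \<open>y\<close>, so \<open>p > 1/2\<close> suffices.\<close>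
  have pp: "jbracket (y\<^sup>2) powr (- p) \<le> 2 powr (p / 2) * jbracket y powr (- (2 * p))" for y :: real
  proof -
    have pos: "0 < 1 + y\<^sup>2" by (simp add: add_pos_nonneg)
    have "(1 + y\<^sup>2)\<^sup>2 \<le> 2 * (1 + (y\<^sup>2)\<^sup>2)"
      using sum_squares_ge_zero[of "1 - y\<^sup>2" 0] by (simp add: power2_eq_square algebra_simps)
    then have "(2 * (1 + (y\<^sup>2)\<^sup>2)) powr (- p / 2) \<le> ((1 + y\<^sup>2)\<^sup>2) powr (- p / 2)"
      using assms pos by (intro powr_mono2') (simp_all add: zero_less_power)
    also have "(1 + y\<^sup>2)\<^sup>2 = (1 + y\<^sup>2) powr 2" by (simp add: add_pos_nonneg)
    also have "\<dots> powr (- p / 2) = (1 + y\<^sup>2) powr (- p)"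
    proof -
      have "2 * (- p / 2) = - p" by simp
      then show ?thesis by (simp only: powr_powr)
    qed
    finally have "2 powr (- p / 2) * (1 + (y\<^sup>2)\<^sup>2) powr (- p / 2) \<le> (1 + y\<^sup>2) powr (- p)"
      by (subst (asm) powr_mult) auto
    then have "2 powr (p/2) * (2 powr (- p / 2) * (1 + (y\<^sup>2)\<^sup>2) powr (- p / 2)) \<le> 2 powr (p/2) * (1 + y\<^sup>2) powr (- p)"
      by (intro mult_left_mono) auto
    moreover have "2 powr (p/2) * (2 powr (- p / 2) * (1 + (y\<^sup>2)\<^sup>2) powr (- p / 2)) = (1 + (y\<^sup>2)\<^sup>2) powr (- p / 2)"
    proof -
      have "2 powr (p/2) * 2 powr (- p / 2) = (1::real)" by (subst powr_add[symmetric]) simp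
      then show ?thesis by (simp only: mult.assoc[symmetric] mult_1_left)
    qed
    ultimately have "(1 + (y\<^sup>2)\<^sup>2) powr (- p / 2) \<le> 2 powr (p/2) * (1 + y\<^sup>2) powr (- p)" by (simp only:)
    moreover have "- (2 * p) / 2 = - p" by simp
    ultimately show ?thesis unfolding jbracket_powr_sq by (simp only:)
  qed
  have "J \<le> (\<integral>\<^sup>+y. ennreal (2 powr (p/2)) * ennreal (jbracket y powr (- (2 * p))) \<partial>lborel)"
    unfolding J_def by (intro nn_integral_mono) (simp add: ennreal_mult[symmetric] ennreal_leI pp)
  also have "\<dots> = ennreal (2 powr (p/2)) * (\<integral>\<^sup>+y. ennreal (jbracket y powr (- (2 * p))) \<partial>lborel)"
    by (rule nn_integral_cmult) simp
  also have "\<dots> < \<infinity>" using nn_integral_jbracket[of "2*p"] assms by (simp add: ennreal_mult_less_top)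
  finally have J: "J < \<infinity>" .
  have Js: "(\<integral>\<^sup>+y. ennreal (jbracket ((y - k)\<^sup>2) powr (- p)) \<partial>lborel) = J" for k :: real
    unfolding J_def using nn_integral_real_affine[of "\<lambda>y. ennreal (jbracket ((y - k)\<^sup>2) powr (- p))" 1 k] by simp
  have m: "(\<integral>\<^sup>+y. ennreal (jbracket (y\<^sup>2 + \<mu>) powr (- p)) \<partial>lborel) \<le> 2 * J" for \<mu> :: real
  proof (cases "\<mu> \<ge> 0")
    case True
    have "(\<integral>\<^sup>+y. ennreal (jbracket (y\<^sup>2 + \<mu>) powr (- p)) \<partial>lborel) \<le> J"
      unfolding J_def using True assms by (intro nn_integral_mono ennreal_leI jbracket_powr_mono) auto
    also have "\<dots> \<le> 2 * J" by (simp add: mult_2)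
    finally show ?thesis .
  next
    case False
    define k where "k = sqrt (- \<mu>)"
    have k: "k \<ge> 0" "\<mu> = - k\<^sup>2" using False by (auto simp: k_def)
    have "(\<integral>\<^sup>+y. ennreal (jbracket (y\<^sup>2 + \<mu>) powr (- p)) \<partial>lborel) \<le>
      (\<integral>\<^sup>+y. ennreal (jbracket ((y - k)\<^sup>2) powr (- p)) + ennreal (jbracket ((y - (- k))\<^sup>2) powr (- p)) \<partial>lborel)"
    proof (intro nn_integral_mono)
      fix y :: real
      have "jbracket (y\<^sup>2 + \<mu>) powr (- p) \<le> jbracket ((\<bar>y\<bar> - k)\<^sup>2) powr (- p)"
        using sq_diff_ge[of k y] k assms by (intro jbracket_powr_mono) auto
      also have "\<dots> \<le> jbracket ((y - k)\<^sup>2) powr (- p) + jbracket ((y - (- k))\<^sup>2) powr (- p)"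
      proof (cases "y \<ge> 0")
        case False
        have "(\<bar>y\<bar> - k)\<^sup>2 = (y - (- k))\<^sup>2" using False by (simp add: power2_eq_square algebra_simps)
        then show ?thesis by simp
      qed simp
      finally show "ennreal (jbracket (y\<^sup>2 + \<mu>) powr (- p)) \<le> 
          ennreal (jbracket ((y - k)\<^sup>2) powr (- p)) + ennreal (jbracket ((y - (- k))\<^sup>2) powr (- p))"
        by (simp add: ennreal_plus[symmetric] ennreal_leI del: ennreal_plus)
    qed
    also have "\<dots> = 2 * J" by (subst nn_integral_add) (simp_all add: Js[of k] Js[of "-k", simplified] mult_2)
    finally show ?thesis .
  qed
  define C where "C = 2 * enn2real J"
  have C: "2 * J = ennreal C" using J unfolding C_def by (simp add: ennreal_mult ennreal_enn2real)
  show thesis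
  proof
    show "C \<ge> 0" by (simp add: C_def)
    fix \<alpha> \<beta> \<gamma> :: real assume g: "\<gamma> \<noteq> 0"
    define c where "c = sqrt \<bar>\<gamma>\<bar>"
    have c: "c > 0" "c\<^sup>2 = \<bar>\<gamma>\<bar>" using g by (auto simp: c_def)
    define v where "v = - \<beta> / (2 * \<gamma>)"
    define \<mu> where "\<mu> = sgn \<gamma> * (\<alpha> - \<beta>\<^sup>2 / (4 * \<gamma>))"
    have e: "\<alpha> + \<beta> * (v + (1/c) * y) + \<gamma> * (v + (1/c) * y)\<^sup>2 = sgn \<gamma> * (y\<^sup>2 + \<mu>)" for y
    proof -
      have 1: "\<gamma> = sgn \<gamma> * c\<^sup>2" using c by (simp add: sgn_mult_abs)
      have "\<alpha> + \<beta> * x + \<gamma> * x\<^sup>2 = \<gamma> * (x - v)\<^sup>2 + (\<alpha> - \<beta>\<^sup>2 / (4 * \<gamma>))" for x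
        using g by (simp add: v_def field_simps power2_eq_square)
      from this[of "v + (1/c) * y"] have "\<alpha> + \<beta> * (v + (1/c) * y) + \<gamma> * (v + (1/c) * y)\<^sup>2 = \<gamma> * (y / c)\<^sup>2 + (\<alpha> - \<beta>\<^sup>2 / (4 * \<gamma>))"
        by simp
      also have "\<gamma> * (y / c)\<^sup>2 = sgn \<gamma> * y\<^sup>2" using c by (subst 1) (simp add: power_divide)
      also have "(\<alpha> - \<beta>\<^sup>2 / (4 * \<gamma>)) = sgn \<gamma> * \<mu>" using g by (simp add: \<mu>_def sgn_if)
      finally show ?thesis by (simp add: distrib_left)
    qed
    have e2: "jbracket (sgn \<gamma> * z) = jbracket z" for z using g by (auto simp: sgn_if)
    have "(\<integral>\<^sup>+x. ennreal (jbracket (\<alpha> + \<beta> * x + \<gamma> * x\<^sup>2) powr (- p)) \<partial>lborel) =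
       ennreal \<bar>1/c\<bar> * (\<integral>\<^sup>+y. ennreal (jbracket (\<alpha> + \<beta> * (v + (1/c) * y) + \<gamma> * (v + (1/c) * y)\<^sup>2) powr (- p)) \<partial>lborel)"
      using c by (intro nn_integral_real_affine) auto
    also have "\<dots> = ennreal \<bar>1/c\<bar> * (\<integral>\<^sup>+y. ennreal (jbracket (y\<^sup>2 + \<mu>) powr (- p)) \<partial>lborel)"
      unfolding e e2 ..
    also have "\<dots> \<le> ennreal \<bar>1/c\<bar> * ennreal C" using m[of \<mu>] unfolding C by (rule mult_left_mono) simp
    also have "\<dots> = ennreal (C * \<bar>\<gamma>\<bar> powr (- (1/2)))"
    proof -
      have "1 / c = \<bar>\<gamma>\<bar> powr (- (1/2))"
        unfolding powr_minus c_def by (simp add: powr_half_sqrt inverse_eq_divide)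
      then have "C * \<bar>\<gamma>\<bar> powr (- (1/2)) = \<bar>1/c\<bar> * C" using c by (simp add: abs_of_pos)
      moreover have "C \<ge> 0" by (simp add: C_def)
      ultimately show ?thesis by (simp only: ennreal_mult abs_ge_zero)
    qed
    finally show "(\<integral>\<^sup>+x. ennreal (jbracket (\<alpha> + \<beta> * x + \<gamma> * x\<^sup>2) powr (- p)) \<partial>lborel) \<le> ennreal (C * \<bar>\<gamma>\<bar> powr (- (1/2)))" .
  qed
qed

text \<open>Only an inequality holds, because \<open>g\<close> may have a bounded range.\<close>

lemma nn_integral_monotone_substitution_le:
  fixes h :: "real \<Rightarrow> real"
  assumes [measurable]: "h \<in> borel_measurable borel" and hnn: "\<And>x. h x \<ge> 0"
    and d: "\<And>x. x \<ge> a \<Longrightarrow> (g has_real_derivative g' x) (at x)"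
    and g': "continuous_on UNIV g'" "\<And>x. x \<ge> a \<Longrightarrow> g' x \<ge> 0"
  and [measurable]: "g \<in> borel_measurable borel"
  shows "(\<integral>\<^sup>+x. ennreal (h (g x) * g' x) * indicator {a..} x \<partial>lborel) \<le> (\<integral>\<^sup>+x. ennreal (h x) \<partial>lborel)"
proof -
  have [measurable]: "g' \<in> borel_measurable borel" by (rule borel_measurable_continuous_onI) fact
  let ?f = "\<lambda>(n::nat) x. ennreal (h (g x) * g' x) * indicator {a..a + real n} x"
  have le: "(\<integral>\<^sup>+x. ?f n x \<partial>lborel) \<le> (\<integral>\<^sup>+x. ennreal (h x) \<partial>lborel)" for n
  proof -
    have "(\<integral>\<^sup>+x. ?f n x \<partial>lborel) = (\<integral>\<^sup>+x. h (g x) * g' x * indicator {a..a + real n} x \<partial>lborel)"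
      by (intro nn_integral_cong) (auto simp: indicator_def)
    also have "\<dots> = (\<integral>\<^sup>+x. h x * indicator {g a..g (a + real n)} x \<partial>lborel)"
      by (rule nn_integral_substitution[symmetric])
         (auto intro!: d g' continuous_on_subset[OF g'(1)] simp: set_borel_measurable_def)
    also have "\<dots> \<le> (\<integral>\<^sup>+x. ennreal (h x) \<partial>lborel)"
      using hnn by (intro nn_integral_mono) (auto simp: indicator_def)
    finally show ?thesis .
  qed
  have "(\<integral>\<^sup>+x. ennreal (h (g x) * g' x) * indicator {a..} x \<partial>lborel) = (\<integral>\<^sup>+x. (SUP n. ?f n x) \<partial>lborel)"
  proof (intro nn_integral_cong)
    fix x :: real
    obtain N :: nat where N: "x \<le> a + real N" by (metis add.commute diff_le_eq real_arch_simple)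
    show "ennreal (h (g x) * g' x) * indicator {a..} x = (SUP n. ?f n x)"
    proof (rule antisym)
      show "ennreal (h (g x) * g' x) * indicator {a..} x \<le> (SUP n. ?f n x)"
        using N by (intro SUP_upper2[of N]) (auto simp: indicator_def)
      show "(SUP n. ?f n x) \<le> ennreal (h (g x) * g' x) * indicator {a..} x"
        by (intro SUP_least) (auto simp: indicator_def)
    qed
  qed
  also have "\<dots> = (SUP n. \<integral>\<^sup>+x. ?f n x \<partial>lborel)"
    by (intro nn_integral_monotone_convergence_SUP) (auto simp: incseq_def le_fun_def indicator_def)
  also have "\<dots> \<le> (\<integral>\<^sup>+x. ennreal (h x) \<partial>lborel)" by (intro SUP_least le)
  finally show ?thesis .
qed

text \<open>The factor in front of the bracket is the Jacobian of the quadratic polynomial, which is monotone on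
  either side of its vertex. Each of the two branches contributes at most the integral of the bracket
  itself, so the bound does not depend on the coefficients at all.\<close>

lemma nn_integral_quadratic_derivative_le:
  fixes \<alpha> \<beta> \<gamma> :: real
  assumes "p \<ge> 0"
  shows "(\<integral>\<^sup>+x. ennreal (\<bar>\<beta> + 2 * \<gamma> * x\<bar> * jbracket (\<alpha> + \<beta> * x + \<gamma> * x\<^sup>2) powr (- p)) \<partial>lborel) \<le>
    2 * (\<integral>\<^sup>+x. ennreal (jbracket x powr (- p)) \<partial>lborel)" (is "?L \<le> 2 * ?J")
proof -
  \<comment> \<open>For \<open>\<gamma> = 0\<close> the value is \<open>0\<close>, and the splitting at \<open>v\<close> is harmless because the function is monotone.\<close>
  define v where "v = - \<beta> / (2 * \<gamma>)"
  have s1: "((\<lambda>x. a + b * x + c * x\<^sup>2) has_real_derivative b + 2 * c * x) (at x)" for a b c x :: real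
    by (rule derivative_eq_intros refl)+ simp
  have m1: "(\<lambda>z. jbracket z powr (- p)) \<in> borel_measurable borel" by measurable
  have m2: "(\<lambda>x. a + b * x + c * x\<^sup>2) \<in> borel_measurable borel" for a b c :: real by measurable
  have m3: "(\<lambda>x. - (a + b * x + c * x\<^sup>2)) \<in> borel_measurable borel" for a b c :: real by measurable
  have half: "(\<integral>\<^sup>+x. ennreal (\<bar>b + 2 * c * x\<bar> * jbracket (a + b * x + c * x\<^sup>2) powr (- p)) * indicator {w..} x \<partial>lborel) \<le> ?J"
    if sg: "(\<forall>x\<ge>w. b + 2 * c * x \<ge> 0) \<or> (\<forall>x\<ge>w. b + 2 * c * x \<le> 0)" for a b c w :: real
    using sg
  proof
    assume s: "\<forall>x\<ge>w. b + 2 * c * x \<ge> 0"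
    have "(\<integral>\<^sup>+x. ennreal (\<bar>b + 2 * c * x\<bar> * jbracket (a + b * x + c * x\<^sup>2) powr (- p)) * indicator {w..} x \<partial>lborel) =
      (\<integral>\<^sup>+x. ennreal (jbracket (a + b * x + c * x\<^sup>2) powr (- p) * (b + 2 * c * x)) * indicator {w..} x \<partial>lborel)"
      using s by (intro nn_integral_cong) (auto simp: indicator_def mult.commute)
    also have "\<dots> \<le> ?J"
      by (rule nn_integral_monotone_substitution_le[OF m1 powr_ge_zero s1 _ s[rule_format] m2]) (intro continuous_intros)
    finally show ?thesis .
  next
    assume s: "\<forall>x\<ge>w. b + 2 * c * x \<le> 0"
    have s': "\<forall>x\<ge>w. 0 \<le> - (b + 2 * c * x)"
    proof (intro allI impI)
      fix x :: real assume "w \<le> x"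
      then have "b + 2 * c * x \<le> 0" by (rule s[rule_format])
      then show "0 \<le> - (b + 2 * c * x)" by linarith
    qed
    have j: "jbracket (- (a + b * x + c * x\<^sup>2)) = jbracket (a + b * x + c * x\<^sup>2)" for x by (rule jbracket_minus)
    have "(\<integral>\<^sup>+x. ennreal (\<bar>b + 2 * c * x\<bar> * jbracket (a + b * x + c * x\<^sup>2) powr (- p)) * indicator {w..} x \<partial>lborel) =
      (\<integral>\<^sup>+x. ennreal (jbracket (- (a + b * x + c * x\<^sup>2)) powr (- p) * (- (b + 2 * c * x))) * indicator {w..} x \<partial>lborel)"
      unfolding j using s by (intro nn_integral_cong) (auto simp: indicator_def mult.commute)
    also have "\<dots> \<le> ?J"
      by (rule nn_integral_monotone_substitution_le[OF m1 powr_ge_zero DERIV_minus[OF s1] _ s'[rule_format] m3]) (intro continuous_intros)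
    finally show ?thesis .
  qed
  let ?f = "\<lambda>x. ennreal (\<bar>\<beta> + 2 * \<gamma> * x\<bar> * jbracket (\<alpha> + \<beta> * x + \<gamma> * x\<^sup>2) powr (- p))"
  have g0: "\<beta> + 2 * \<gamma> * x = 2 * \<gamma> * (x - v)" if "\<gamma> \<noteq> 0" for x using that by (simp add: v_def field_simps)
  have sg: "(\<forall>x\<ge>w. 2 * \<gamma> * (x - w) \<ge> 0) \<or> (\<forall>x\<ge>w. 2 * \<gamma> * (x - w) \<le> 0)" for w
  proof (cases "\<gamma> \<ge> 0")
    case True
    then have "\<forall>x\<ge>w. 2 * \<gamma> * (x - w) \<ge> 0" by simp
    then show ?thesis ..
  next
    case False
    then have "\<forall>x\<ge>w. 2 * \<gamma> * (x - w) \<le> 0" by (simp add: mult_nonpos_nonneg)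
    then show ?thesis ..
  qed
  have sgn1: "(\<forall>x\<ge>v. \<beta> + 2 * \<gamma> * x \<ge> 0) \<or> (\<forall>x\<ge>v. \<beta> + 2 * \<gamma> * x \<le> 0)"
  proof (cases "\<gamma> = 0")
    case False
    show ?thesis unfolding g0[OF False] by (rule sg)
  next
    case True
    show ?thesis unfolding True by (cases "\<beta> \<ge> 0") simp_all
  qed
  have sgn2: "(\<forall>x\<ge>-v. - \<beta> + 2 * \<gamma> * x \<ge> 0) \<or> (\<forall>x\<ge>-v. - \<beta> + 2 * \<gamma> * x \<le> 0)"
  proof (cases "\<gamma> = 0")
    case False
    have "- \<beta> + 2 * \<gamma> * x = 2 * \<gamma> * (x - (- v))" for x using False by (simp add: v_def field_simps)
    then show ?thesis using sg[of "- v"] by (simp only:)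
  next
    case True
    show ?thesis unfolding True by (cases "\<beta> \<ge> 0") simp_all
  qed
  have spl: "y \<le> y * indicator {v..} x + y * indicator {..v} x" for x and y :: ennreal
    by (cases "v \<le> x") auto
  define R where "R = (\<integral>\<^sup>+x. ?f x * indicator {v..} x \<partial>lborel)"
  define L where "L = (\<integral>\<^sup>+x. ?f x * indicator {..v} x \<partial>lborel)"
  have 1: "?L \<le> R + L"
  proof -
    have "?L \<le> (\<integral>\<^sup>+x. ?f x * indicator {v..} x + ?f x * indicator {..v} x \<partial>lborel)"
      by (rule nn_integral_mono) (rule spl)
    also have "\<dots> = R + L" unfolding R_def L_def by (rule nn_integral_add) measurable
    finally show ?thesis .
  qed
  have 2: "R \<le> ?J" unfolding R_def by (rule half[OF sgn1, of \<alpha>])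
  have 3: "L \<le> ?J"
  proof -
    have a: "\<bar>\<beta> + 2 * \<gamma> * (0 + (-1) * x)\<bar> = \<bar>- \<beta> + 2 * \<gamma> * x\<bar>" for x
      using abs_minus_cancel[of "- \<beta> + 2 * \<gamma> * x"] by simp
    have b: "indicator {..v} (0 + (-1) * x) = (indicator {-v..} x :: ennreal)" for x :: real
      by (auto simp: indicator_def)
    have c: "\<alpha> + \<beta> * (0 + (-1) * x) + \<gamma> * (0 + (-1) * x)\<^sup>2 = \<alpha> + (- \<beta>) * x + \<gamma> * x\<^sup>2" for x
      by simp
    have m: "(\<lambda>x. ?f x * indicator {..v} x) \<in> borel_measurable borel" by measurable
    have "L = ennreal \<bar>-1\<bar> * (\<integral>\<^sup>+x. ?f (0 + (-1) * x) * indicator {..v} (0 + (-1) * x) \<partial>lborel)"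
      unfolding L_def by (rule nn_integral_real_affine[OF m]) simp
    then show ?thesis unfolding a b c using half[OF sgn2, of \<alpha>] by (simp only: abs_minus_cancel abs_1 ennreal_1 mult_1_left)
  qed
  have "?L \<le> ?J + ?J" using 1 add_mono[OF 2 3] by (rule order_trans)
  then show ?thesis by (simp only: mult_2)
qed

section \<open>Twisted convolutions\<close>

lemma measurable_of_int [measurable]: "real_of_int \<in> borel_measurable (borel :: int measure)"
  by (intro borel_measurable_continuous_onI Topological_Spaces.continuous_on_discrete)

definition tau :: "freq \<Rightarrow> real" where "tau \<zeta> = fst \<zeta>"
definition xi :: "freq \<Rightarrow> real" where "xi \<zeta> = fst (snd \<zeta>)"
definition qq :: "freq \<Rightarrow> real" where "qq \<zeta> = real_of_int (snd (snd \<zeta>))"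

lemma coord_simps [simp]:
  "tau (a, b, c) = a" "xi (a, b, c) = b" "qq (a, b, c) = real_of_int c"
  "tau (\<zeta> + \<eta>) = tau \<zeta> + tau \<eta>" "xi (\<zeta> + \<eta>) = xi \<zeta> + xi \<eta>" "qq (\<zeta> + \<eta>) = qq \<zeta> + qq \<eta>"
  "tau (\<zeta> - \<eta>) = tau \<zeta> - tau \<eta>" "xi (\<zeta> - \<eta>) = xi \<zeta> - xi \<eta>" "qq (\<zeta> - \<eta>) = qq \<zeta> - qq \<eta>"
  "tau (- \<zeta>) = - tau \<zeta>" "xi (- \<zeta>) = - xi \<zeta>" "qq (- \<zeta>) = - qq \<zeta>"
  by (simp_all add: tau_def xi_def qq_def)

lemma fst_borel [measurable]: 
  "(fst :: 'a::second_countable_topology \<times> 'b::second_countable_topology \<Rightarrow> 'a) \<in> borel \<rightarrow>\<^sub>M borel"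
  "(snd :: 'a::second_countable_topology \<times> 'b::second_countable_topology \<Rightarrow> 'b) \<in> borel \<rightarrow>\<^sub>M borel"
  by (simp_all only: borel_prod[symmetric] measurable_fst measurable_snd)

lemma coord_measurable [measurable]:
  "tau \<in> borel_measurable borel" "xi \<in> borel_measurable borel" "qq \<in> borel_measurable borel"
  unfolding tau_def[abs_def] xi_def[abs_def] qq_def[abs_def] by measurable

lemma freq_add_measurable [measurable (raw)]:
  fixes f g :: "'a \<Rightarrow> freq"
  assumes [measurable]: "f \<in> M \<rightarrow>\<^sub>M borel" "g \<in> M \<rightarrow>\<^sub>M borel"
  shows "(\<lambda>x. f x + g x) \<in> M \<rightarrow>\<^sub>M borel"
proof -
  have "continuous_on UNIV (\<lambda>p::freq \<times> freq. fst p + snd p)"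
  proof -
    have "(\<lambda>p::freq \<times> freq. fst p + snd p) = (\<lambda>p. (fst (fst p) + fst (snd p), 
      fst (snd (fst p)) + fst (snd (snd p)), snd (snd (fst p)) + snd (snd (snd p))))"
      by (auto simp: fun_eq_iff prod_eq_iff)
    then show ?thesis by (simp only:) (intro continuous_intros)
  qed
  from borel_measurable_continuous_onI[OF this]
  have "(\<lambda>p::freq \<times> freq. fst p + snd p) \<in> borel \<Otimes>\<^sub>M borel \<rightarrow>\<^sub>M borel" by (simp add: borel_prod)
  from measurable_compose[OF _ this, of "\<lambda>x. (f x, g x)"] show ?thesis by simp
qed

lemma freq_minus_measurable [measurable (raw)]:
  fixes f :: "'a \<Rightarrow> freq"
  assumes [measurable]: "f \<in> M \<rightarrow>\<^sub>M borel"
  shows "(\<lambda>x. - f x) \<in> M \<rightarrow>\<^sub>M borel"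
  by (rule measurable_compose[OF assms borel_measurable_continuous_onI[OF continuous_freq_minus]])

lemma freq_diff_measurable [measurable (raw)]:
  fixes f g :: "'a \<Rightarrow> freq"
  assumes [measurable]: "f \<in> M \<rightarrow>\<^sub>M borel" "g \<in> M \<rightarrow>\<^sub>M borel"
  shows "(\<lambda>x. f x - g x) \<in> M \<rightarrow>\<^sub>M borel"
  using freq_add_measurable[OF assms(1) freq_minus_measurable[OF assms(2)]] by simp

lemma freq_Fubini:
  fixes f :: "freq \<Rightarrow> freq \<Rightarrow> ennreal"
  assumes [measurable]: "(\<lambda>p. f (fst p) (snd p)) \<in> borel_measurable (borel \<Otimes>\<^sub>M borel)"
  shows "(\<integral>\<^sup>+\<eta>. \<integral>\<^sup>+\<zeta>. f \<eta> \<zeta> \<partial>freq_measure \<partial>freq_measure) = (\<integral>\<^sup>+\<zeta>. \<integral>\<^sup>+\<eta>. f \<eta> \<zeta> \<partial>freq_measure \<partial>freq_measure)"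
proof -
  have "case_prod f \<in> borel_measurable (freq_measure \<Otimes>\<^sub>M freq_measure)"
    using assms by (simp add: case_prod_beta')
  from freq2.Fubini'[OF this] show ?thesis by simp
qed

text \<open>Cauchy-Schwarz in \<open>\<zeta>\<close> for each fixed output frequency \<open>\<eta>\<close>. The kernel is square integrated over \<open>\<zeta>\<close>, and
  the remaining integral of \<open>(F (\<eta> - \<zeta>) G \<zeta>)\<^sup>2\<close> factors.\<close>

lemma conv_L2_output:
  fixes F G :: "freq \<Rightarrow> ennreal" and k :: "freq \<Rightarrow> freq \<Rightarrow> ennreal"
  assumes [measurable]: "F \<in> borel_measurable borel" "G \<in> borel_measurable borel"
    "(\<lambda>p. k (fst p) (snd p)) \<in> borel_measurable (borel \<Otimes>\<^sub>M borel)"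
    and D: "\<And>\<eta>. (\<integral>\<^sup>+\<zeta>. (k \<eta> \<zeta>)\<^sup>2 \<partial>freq_measure) \<le> D"
  shows "(\<integral>\<^sup>+\<eta>. (\<integral>\<^sup>+\<zeta>. k \<eta> \<zeta> * (F (\<eta> - \<zeta>) * G \<zeta>) \<partial>freq_measure)\<^sup>2 \<partial>freq_measure) \<le>
    D * ((\<integral>\<^sup>+\<zeta>. (F \<zeta>)\<^sup>2 \<partial>freq_measure) * (\<integral>\<^sup>+\<zeta>. (G \<zeta>)\<^sup>2 \<partial>freq_measure))"
proof -
  have "(\<integral>\<^sup>+\<eta>. (\<integral>\<^sup>+\<zeta>. k \<eta> \<zeta> * (F (\<eta> - \<zeta>) * G \<zeta>) \<partial>freq_measure)\<^sup>2 \<partial>freq_measure) \<le> 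
    (\<integral>\<^sup>+\<eta>. D * (\<integral>\<^sup>+\<zeta>. (F (\<eta> - \<zeta>) * G \<zeta>)\<^sup>2 \<partial>freq_measure) \<partial>freq_measure)"
  proof (intro nn_integral_mono)
    fix \<eta> :: freq
    have [measurable]: "(\<lambda>\<zeta>. k \<eta> \<zeta>) \<in> borel_measurable borel"
      using measurable_compose[OF measurable_Pair1' assms(3), of \<eta>] by simp
    have "(\<integral>\<^sup>+\<zeta>. k \<eta> \<zeta> * (F (\<eta> - \<zeta>) * G \<zeta>) \<partial>freq_measure)\<^sup>2 \<le> 
      (\<integral>\<^sup>+\<zeta>. (k \<eta> \<zeta>)\<^sup>2 \<partial>freq_measure) * (\<integral>\<^sup>+\<zeta>. (F (\<eta> - \<zeta>) * G \<zeta>)\<^sup>2 \<partial>freq_measure)"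
      by (rule Cauchy_Schwarz_nn_integral) measurable
    also have "\<dots> \<le> D * (\<integral>\<^sup>+\<zeta>. (F (\<eta> - \<zeta>) * G \<zeta>)\<^sup>2 \<partial>freq_measure)"
      by (intro mult_right_mono D) simp
    finally show "(\<integral>\<^sup>+\<zeta>. k \<eta> \<zeta> * (F (\<eta> - \<zeta>) * G \<zeta>) \<partial>freq_measure)\<^sup>2 \<le> D * (\<integral>\<^sup>+\<zeta>. (F (\<eta> - \<zeta>) * G \<zeta>)\<^sup>2 \<partial>freq_measure)" .
  qed
  also have "\<dots> = D * (\<integral>\<^sup>+\<eta>. (\<integral>\<^sup>+\<zeta>. (F (\<eta> - \<zeta>) * G \<zeta>)\<^sup>2 \<partial>freq_measure) \<partial>freq_measure)"
    by (rule nn_integral_cmult) measurable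
  also have "(\<integral>\<^sup>+\<eta>. (\<integral>\<^sup>+\<zeta>. (F (\<eta> - \<zeta>) * G \<zeta>)\<^sup>2 \<partial>freq_measure) \<partial>freq_measure) =
     (\<integral>\<^sup>+\<zeta>. (\<integral>\<^sup>+\<eta>. (F (\<eta> - \<zeta>) * G \<zeta>)\<^sup>2 \<partial>freq_measure) \<partial>freq_measure)"
    by (rule freq_Fubini) measurable
  also have "\<dots> = (\<integral>\<^sup>+\<zeta>. (G \<zeta>)\<^sup>2 * (\<integral>\<^sup>+\<eta>. (F \<eta>)\<^sup>2 \<partial>freq_measure) \<partial>freq_measure)"
  proof (rule nn_integral_cong)
    fix \<zeta> :: freq
    have "(\<integral>\<^sup>+\<eta>. (F (\<eta> - \<zeta>) * G \<zeta>)\<^sup>2 \<partial>freq_measure) = (\<integral>\<^sup>+\<eta>. (G \<zeta>)\<^sup>2 * (F (- \<zeta> + \<eta>))\<^sup>2 \<partial>freq_measure)"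
      by (simp add: power_mult_distrib mult.commute)
    also have "\<dots> = (G \<zeta>)\<^sup>2 * (\<integral>\<^sup>+\<eta>. (F (- \<zeta> + \<eta>))\<^sup>2 \<partial>freq_measure)"
      by (rule nn_integral_cmult) measurable
    also have "(\<integral>\<^sup>+\<eta>. (F (- \<zeta> + \<eta>))\<^sup>2 \<partial>freq_measure) = (\<integral>\<^sup>+\<eta>. (F \<eta>)\<^sup>2 \<partial>freq_measure)"
      by (rule nn_integral_freq_shift[where f = "\<lambda>\<eta>. (F \<eta>)\<^sup>2"]) measurable
    finally show "(\<integral>\<^sup>+\<eta>. (F (\<eta> - \<zeta>) * G \<zeta>)\<^sup>2 \<partial>freq_measure) = (G \<zeta>)\<^sup>2 * (\<integral>\<^sup>+\<eta>. (F \<eta>)\<^sup>2 \<partial>freq_measure)" .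
  qed
  also have "\<dots> = (\<integral>\<^sup>+\<zeta>. (G \<zeta>)\<^sup>2 \<partial>freq_measure) * (\<integral>\<^sup>+\<eta>. (F \<eta>)\<^sup>2 \<partial>freq_measure)"
    by (rule nn_integral_multc) measurable
  finally show ?thesis by (simp add: mult.commute)
qed

text \<open>The dual form: Cauchy-Schwarz separates \<open>G\<close> alone, and afterwards the kernel is square integrated
  with the frequency of \<open>F\<close> fixed instead of the output frequency. It is the form for kernels in which
  one decaying factor depends on the output.\<close>

lemma conv_L2_input:
  fixes F G :: "freq \<Rightarrow> ennreal" and k :: "freq \<Rightarrow> freq \<Rightarrow> ennreal"
  assumes [measurable]: "F \<in> borel_measurable borel" "G \<in> borel_measurable borel"
    "(\<lambda>p. k (fst p) (snd p)) \<in> borel_measurable (borel \<Otimes>\<^sub>M borel)"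
    and D: "\<And>\<eta>. (\<integral>\<^sup>+\<zeta>. (k (\<eta> + \<zeta>) \<zeta>)\<^sup>2 \<partial>freq_measure) \<le> D"
  shows "(\<integral>\<^sup>+\<eta>. (\<integral>\<^sup>+\<zeta>. k \<eta> \<zeta> * (F (\<eta> - \<zeta>) * G \<zeta>) \<partial>freq_measure)\<^sup>2 \<partial>freq_measure) \<le>
    D * ((\<integral>\<^sup>+\<zeta>. (F \<zeta>)\<^sup>2 \<partial>freq_measure) * (\<integral>\<^sup>+\<zeta>. (G \<zeta>)\<^sup>2 \<partial>freq_measure))"
proof -
  let ?N = "\<integral>\<^sup>+\<zeta>. (G \<zeta>)\<^sup>2 \<partial>freq_measure"
  have k[measurable]: "(\<lambda>x. k (f x) (g x)) \<in> borel_measurable M" if [measurable]: "f \<in> M \<rightarrow>\<^sub>M borel" "g \<in> M \<rightarrow>\<^sub>M borel" for f g and M :: "'c measure"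
    using measurable_compose[OF _ assms(3), of "\<lambda>x. (f x, g x)" M] by simp
  have k1: "(\<lambda>x. k (f x) (g x)) \<in> borel_measurable M" if [measurable]: "f \<in> M \<rightarrow>\<^sub>M borel" "g \<in> M \<rightarrow>\<^sub>M borel" for f g and M :: "freq measure"
    using measurable_compose[OF _ assms(3), of "\<lambda>x. (f x, g x)" M] by simp
  have "(\<integral>\<^sup>+\<eta>. (\<integral>\<^sup>+\<zeta>. k \<eta> \<zeta> * (F (\<eta> - \<zeta>) * G \<zeta>) \<partial>freq_measure)\<^sup>2 \<partial>freq_measure) \<le> 
    (\<integral>\<^sup>+\<eta>. (\<integral>\<^sup>+\<zeta>. (k \<eta> \<zeta> * F (\<eta> - \<zeta>))\<^sup>2 \<partial>freq_measure) * ?N \<partial>freq_measure)"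
  proof (intro nn_integral_mono)
    fix \<eta> :: freq
    note [measurable] = k1[of "\<lambda>_. \<eta>" _ "\<lambda>x. x"]
    have "(\<integral>\<^sup>+\<zeta>. k \<eta> \<zeta> * (F (\<eta> - \<zeta>) * G \<zeta>) \<partial>freq_measure)\<^sup>2 = (\<integral>\<^sup>+\<zeta>. (k \<eta> \<zeta> * F (\<eta> - \<zeta>)) * G \<zeta> \<partial>freq_measure)\<^sup>2"
      by (simp add: mult.assoc)
    also have "\<dots> \<le> (\<integral>\<^sup>+\<zeta>. (k \<eta> \<zeta> * F (\<eta> - \<zeta>))\<^sup>2 \<partial>freq_measure) * ?N"
      by (rule Cauchy_Schwarz_nn_integral) measurable
    finally show "(\<integral>\<^sup>+\<zeta>. k \<eta> \<zeta> * (F (\<eta> - \<zeta>) * G \<zeta>) \<partial>freq_measure)\<^sup>2 \<le> (\<integral>\<^sup>+\<zeta>. (k \<eta> \<zeta> * F (\<eta> - \<zeta>))\<^sup>2 \<partial>freq_measure) * ?N" .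
  qed
  also have "\<dots> = (\<integral>\<^sup>+\<eta>. (\<integral>\<^sup>+\<zeta>. (k \<eta> \<zeta> * F (\<eta> - \<zeta>))\<^sup>2 \<partial>freq_measure) \<partial>freq_measure) * ?N"
    by (rule nn_integral_multc) measurable
  also have "(\<integral>\<^sup>+\<eta>. (\<integral>\<^sup>+\<zeta>. (k \<eta> \<zeta> * F (\<eta> - \<zeta>))\<^sup>2 \<partial>freq_measure) \<partial>freq_measure) =
     (\<integral>\<^sup>+\<zeta>. (\<integral>\<^sup>+\<eta>. (k \<eta> \<zeta> * F (\<eta> - \<zeta>))\<^sup>2 \<partial>freq_measure) \<partial>freq_measure)"
    by (rule freq_Fubini) measurable
  also have "\<dots> = (\<integral>\<^sup>+\<zeta>. (\<integral>\<^sup>+\<eta>. (k (\<eta> + \<zeta>) \<zeta> * F \<eta>)\<^sup>2 \<partial>freq_measure) \<partial>freq_measure)"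
  proof (rule nn_integral_cong)
    fix \<zeta> :: freq
    note [measurable] = k1[of "\<lambda>x. x" _ "\<lambda>_. \<zeta>"]
    have "(\<integral>\<^sup>+\<eta>. (k (\<zeta> + \<eta>) \<zeta> * F ((\<zeta> + \<eta>) - \<zeta>))\<^sup>2 \<partial>freq_measure) = (\<integral>\<^sup>+\<eta>. (k \<eta> \<zeta> * F (\<eta> - \<zeta>))\<^sup>2 \<partial>freq_measure)"
      by (rule nn_integral_freq_shift[where f = "\<lambda>\<eta>. (k \<eta> \<zeta> * F (\<eta> - \<zeta>))\<^sup>2"]) measurable
    then show "(\<integral>\<^sup>+\<eta>. (k \<eta> \<zeta> * F (\<eta> - \<zeta>))\<^sup>2 \<partial>freq_measure) = (\<integral>\<^sup>+\<eta>. (k (\<eta> + \<zeta>) \<zeta> * F \<eta>)\<^sup>2 \<partial>freq_measure)"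
      by (simp add: add.commute)
  qed
  also have "\<dots> = (\<integral>\<^sup>+\<eta>. (\<integral>\<^sup>+\<zeta>. (k (\<eta> + \<zeta>) \<zeta> * F \<eta>)\<^sup>2 \<partial>freq_measure) \<partial>freq_measure)"
    by (rule freq_Fubini[symmetric]) measurable
  also have "\<dots> \<le> (\<integral>\<^sup>+\<eta>. D * (F \<eta>)\<^sup>2 \<partial>freq_measure)"
  proof (rule nn_integral_mono)
    fix \<eta> :: freq
    note [measurable] = k1[of "\<lambda>x. \<eta> + x" _ "\<lambda>x. x"]
    have "(\<integral>\<^sup>+\<zeta>. (k (\<eta> + \<zeta>) \<zeta> * F \<eta>)\<^sup>2 \<partial>freq_measure) = (\<integral>\<^sup>+\<zeta>. (k (\<eta> + \<zeta>) \<zeta>)\<^sup>2 * (F \<eta>)\<^sup>2 \<partial>freq_measure)"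
      by (simp add: power_mult_distrib)
    also have "\<dots> = (\<integral>\<^sup>+\<zeta>. (k (\<eta> + \<zeta>) \<zeta>)\<^sup>2 \<partial>freq_measure) * (F \<eta>)\<^sup>2"
      by (rule nn_integral_multc) measurable
    also have "\<dots> \<le> D * (F \<eta>)\<^sup>2" by (intro mult_right_mono D) simp
    finally show "(\<integral>\<^sup>+\<zeta>. (k (\<eta> + \<zeta>) \<zeta> * F \<eta>)\<^sup>2 \<partial>freq_measure) \<le> D * (F \<eta>)\<^sup>2" .
  qed
  also have "\<dots> = D * (\<integral>\<^sup>+\<eta>. (F \<eta>)\<^sup>2 \<partial>freq_measure)" by (rule nn_integral_cmult) measurable
  finally show ?thesis by (simp add: mult.assoc mult_right_mono)
qed

text \<open>The integral of \<open>h\<close> over all triples of frequencies with sum \<open>\<zeta>\<close>. It does not depend on which of the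
  three variables is eliminated, hence is invariant under permutations of the arguments of \<open>h\<close>.\<close>

definition tri :: "(freq \<Rightarrow> freq \<Rightarrow> freq \<Rightarrow> ennreal) \<Rightarrow> freq \<Rightarrow> ennreal" where
  "tri h \<zeta> = (\<integral>\<^sup>+c. \<integral>\<^sup>+b. h (\<zeta> - c - b) b c \<partial>freq_measure \<partial>freq_measure)"

definition tri_meas :: "(freq \<Rightarrow> freq \<Rightarrow> freq \<Rightarrow> ennreal) \<Rightarrow> bool" where
  "tri_meas h \<longleftrightarrow> (\<lambda>p. h (fst p) (fst (snd p)) (snd (snd p))) \<in> borel_measurable (borel \<Otimes>\<^sub>M (borel \<Otimes>\<^sub>M borel))"

lemma tri_meas_comp:
  assumes "tri_meas h" "f \<in> M \<rightarrow>\<^sub>M borel" "g \<in> M \<rightarrow>\<^sub>M borel" "k \<in> M \<rightarrow>\<^sub>M borel"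
  shows "(\<lambda>x. h (f x) (g x) (k x)) \<in> borel_measurable M"
proof -
  note [measurable] = assms(2-4)
  have "(\<lambda>x. (f x, g x, k x)) \<in> M \<rightarrow>\<^sub>M borel \<Otimes>\<^sub>M (borel \<Otimes>\<^sub>M borel)" by measurable
  from measurable_compose[OF this assms(1)[unfolded tri_meas_def]] show ?thesis by simp
qed

lemma tri_swap12:
  assumes "tri_meas h"
  shows "tri (\<lambda>a b c. h b a c) \<zeta> = tri h \<zeta>"
  unfolding tri_def
proof (rule nn_integral_cong)
  fix c :: freq
  have "(\<lambda>b. h (\<zeta> - c - b) b c) \<in> borel_measurable borel"
    by (rule tri_meas_comp[OF assms]) measurable
  from nn_integral_freq_reflect[OF this, of "\<zeta> - c"] 
  show "(\<integral>\<^sup>+b. h b (\<zeta> - c - b) c \<partial>freq_measure) = (\<integral>\<^sup>+b. h (\<zeta> - c - b) b c \<partial>freq_measure)"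
    by simp
qed

lemma tri_swap23:
  assumes "tri_meas h"
  shows "tri (\<lambda>a b c. h a c b) \<zeta> = tri h \<zeta>"
proof -
  have "(\<integral>\<^sup>+b. \<integral>\<^sup>+c. h (\<zeta> - c - b) b c \<partial>freq_measure \<partial>freq_measure) =
    (\<integral>\<^sup>+c. \<integral>\<^sup>+b. h (\<zeta> - c - b) b c \<partial>freq_measure \<partial>freq_measure)"
    by (rule freq_Fubini, rule tri_meas_comp[OF assms]) measurable
  moreover have "\<zeta> - c - b = \<zeta> - b - c" for b c :: freq by (simp add: algebra_simps)
  ultimately show ?thesis unfolding tri_def by (simp only:)
qed

section \<open>The bilinear kernels\<close>

definition phase :: "real \<Rightarrow> real \<Rightarrow> real" where "phase x q = x ^ 3 + x * q\<^sup>2"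
definition modulation :: "freq \<Rightarrow> real" where "modulation \<zeta> = tau \<zeta> - phase (xi \<zeta>) (qq \<zeta>)"
definition freq_sq :: "freq \<Rightarrow> real" where "freq_sq \<zeta> = 3 * (xi \<zeta>)\<^sup>2 + (qq \<zeta>)\<^sup>2"

lemma phase_minus [simp]: "phase (- x) (- q) = - phase x q"
  by (simp add: phase_def)

lemma modulation_minus [simp]: "modulation (- \<zeta>) = - modulation \<zeta>"
  by (simp add: modulation_def)

lemma modulation_measurable [measurable]:
  "modulation \<in> borel_measurable borel" "freq_sq \<in> borel_measurable borel"
  unfolding modulation_def[abs_def] freq_sq_def[abs_def] phase_def by measurable

lemma freq_sq_nonneg [simp]: "freq_sq \<zeta> \<ge> 0" by (simp add: freq_sq_def)

lemma measurable_triple [measurable (raw)]: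
  assumes [measurable]: "f \<in> borel_measurable M" "g \<in> borel_measurable M" 
  shows "(\<lambda>x. (f x, g x, c::int)) \<in> M \<rightarrow>\<^sub>M (borel :: freq measure)"
  unfolding borel_prod[symmetric] by measurable

text \<open>In the variable \<open>\<tau> - \<omega>(\<xi>, q)\<close> the bracket of the modulation of \<open>\<zeta>\<close> is integrable by itself, and
  the other modulation becomes a constant minus the sum of two phases. What is left to bound
  is a one-dimensional integral in \<open>\<xi>\<close>, uniformly in \<open>q\<close> and in that constant; then the sum over \<open>q\<close>
  converges because of its own bracket.\<close>

lemma kernel_reduction:
  fixes a :: "real \<Rightarrow> real \<Rightarrow> real"
  assumes p: "p \<ge> 0" and anm[measurable]: "\<And>q. a q \<in> borel_measurable borel" "(\<lambda>\<zeta>. a (qq \<zeta>) (xi \<zeta>)) \<in> borel_measurable borel" 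
    and ann: "\<And>q x. a q x \<ge> 0"
    and D: "\<And>q \<theta>. (\<integral>\<^sup>+x. ennreal (a q x * jbracket (\<theta> - phase x q - phase (xi \<eta> - x) (qq \<eta> - q)) powr (- p)) \<partial>lborel) \<le> D"
  shows "(\<integral>\<^sup>+\<zeta>. ennreal (a (qq \<zeta>) (xi \<zeta>) * jbracket (qq \<zeta>) powr (- (2 * r)) * jbracket (modulation \<zeta>) powr (- (2 * b)) *
      jbracket (modulation (\<eta> - \<zeta>)) powr (- p)) \<partial>freq_measure) \<le>
    (\<integral>\<^sup>+q. ennreal (jbracket (real_of_int q) powr (- (2 * r))) \<partial>count_space UNIV) *
    (\<integral>\<^sup>+x. ennreal (jbracket x powr (- (2 * b))) \<partial>lborel) * D" (is "?L \<le> ?Q * ?T * D")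
proof -
  obtain T X Q where eta: "\<eta> = (T, X, Q)" by (cases \<eta>)
  let ?q = "\<lambda>q::int. ennreal (jbracket (real_of_int q) powr (- (2 * r)))"
  let ?h = "\<lambda>q \<tau> \<xi>. ennreal (a (real_of_int q) \<xi> * jbracket (T - \<tau> - phase \<xi> q - phase (X - \<xi>) (real_of_int Q - q)) powr (- p))"
  let ?f = "\<lambda>\<zeta>. ennreal (a (qq \<zeta>) (xi \<zeta>) * jbracket (qq \<zeta>) powr (- (2 * r)) * jbracket (modulation \<zeta>) powr (- (2 * b)) *
      jbracket (modulation (\<eta> - \<zeta>)) powr (- p))"
  have [measurable]: "?f \<in> borel_measurable borel" by measurable
  have ph[measurable]: "(\<lambda>x. phase (f x) (g x)) \<in> borel_measurable M" if [measurable]: "f \<in> borel_measurable M" "g \<in> borel_measurable M" for f g and M :: "real measure"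
    unfolding phase_def by measurable
  have ph2[measurable]: "(\<lambda>x. phase (f x) (g x)) \<in> borel_measurable M" if [measurable]: "f \<in> borel_measurable M" "g \<in> borel_measurable M" for f g and M :: "(real \<times> real) measure"
    unfolding phase_def by measurable
  have inner: "(\<integral>\<^sup>+\<xi>. \<integral>\<^sup>+\<tau>. ?f (\<tau>, \<xi>, q) \<partial>lborel \<partial>lborel) \<le> ?q q * (?T * D)" for q
  proof -
    have "(\<integral>\<^sup>+\<tau>. ?f (\<tau>, \<xi>, q) \<partial>lborel) = (\<integral>\<^sup>+\<tau>. ?q q * (ennreal (jbracket \<tau> powr (- (2 * b))) * ?h q \<tau> \<xi>) \<partial>lborel)" for \<xi>
    proof -
      have e: "?f (phase \<xi> q + 1 * \<tau>, \<xi>, q) = ?q q * (ennreal (jbracket \<tau> powr (- (2 * b))) * ?h q \<tau> \<xi>)" for \<tau>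
      proof -
        have 1: "modulation (phase \<xi> q + 1 * \<tau>, \<xi>, q) = \<tau>" by (simp add: modulation_def)
        have 2: "modulation (\<eta> - (phase \<xi> q + 1 * \<tau>, \<xi>, q)) = T - \<tau> - phase \<xi> q - phase (X - \<xi>) (real_of_int Q - q)"
          by (simp add: modulation_def eta)
        show ?thesis unfolding 1 2 using ann by (simp add: ennreal_mult[symmetric] mult_ac)
      qed
      have m: "(\<lambda>\<tau>. ?f (\<tau>, \<xi>, q)) \<in> borel_measurable borel"
        by (rule measurable_compose[OF _ \<open>?f \<in> borel_measurable borel\<close>]) measurable
      show ?thesis using nn_integral_real_affine[OF m, of 1 "phase \<xi> q"] unfolding e by simp
    qed
    then have "(\<integral>\<^sup>+\<xi>. \<integral>\<^sup>+\<tau>. ?f (\<tau>, \<xi>, q) \<partial>lborel \<partial>lborel) = 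
      (\<integral>\<^sup>+\<xi>. \<integral>\<^sup>+\<tau>. ?q q * (ennreal (jbracket \<tau> powr (- (2 * b))) * ?h q \<tau> \<xi>) \<partial>lborel \<partial>lborel)" by (simp only:)
    also have "\<dots> = (\<integral>\<^sup>+\<tau>. \<integral>\<^sup>+\<xi>. ?q q * (ennreal (jbracket \<tau> powr (- (2 * b))) * ?h q \<tau> \<xi>) \<partial>lborel \<partial>lborel)"
      by (rule lborel_pair.Fubini') measurable
    also have "\<dots> \<le> (\<integral>\<^sup>+\<tau>. ?q q * (ennreal (jbracket \<tau> powr (- (2 * b))) * D) \<partial>lborel)"
    proof (rule nn_integral_mono)
      fix \<tau> :: real
      have "(\<integral>\<^sup>+\<xi>. ?q q * (ennreal (jbracket \<tau> powr (- (2 * b))) * ?h q \<tau> \<xi>) \<partial>lborel) = 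
        ?q q * (ennreal (jbracket \<tau> powr (- (2 * b))) * (\<integral>\<^sup>+\<xi>. ?h q \<tau> \<xi> \<partial>lborel))"
        by (simp add: nn_integral_cmult)
      also have "\<dots> \<le> ?q q * (ennreal (jbracket \<tau> powr (- (2 * b))) * D)"
        using D[of "real_of_int q" "T - \<tau>"] by (intro mult_left_mono) (simp_all add: eta)
      finally show "(\<integral>\<^sup>+\<xi>. ?q q * (ennreal (jbracket \<tau> powr (- (2 * b))) * ?h q \<tau> \<xi>) \<partial>lborel) \<le> ?q q * (ennreal (jbracket \<tau> powr (- (2 * b))) * D)" .
    qed
    also have "\<dots> = ?q q * (?T * D)" by (simp add: nn_integral_cmult nn_integral_multc)
    finally show ?thesis .
  qed
  have "?L = (\<integral>\<^sup>+q. \<integral>\<^sup>+\<xi>. \<integral>\<^sup>+\<tau>. ?f (\<tau>, \<xi>, q) \<partial>lborel \<partial>lborel \<partial>count_space UNIV)"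
    by (rule nn_integral_freq_swap) fact
  also have "\<dots> \<le> (\<integral>\<^sup>+q. ?q q * (?T * D) \<partial>count_space UNIV)"
    by (rule nn_integral_mono) (rule inner)
  also have "\<dots> = ?Q * (?T * D)" by (rule nn_integral_multc) simp
  finally show ?thesis by (simp add: mult.assoc)
qed

text \<open>The cubic terms of the two phases cancel. This is why the one-dimensional integrals are
  governed by quadratic polynomials.\<close>

lemma phase_sum_quadratic:
  "\<theta> - phase x q - phase (X - x) (Q - q) =
    (\<theta> - X ^ 3 - X * (Q - q)\<^sup>2) + (3 * X\<^sup>2 - q\<^sup>2 + (Q - q)\<^sup>2) * x + (- 3 * X) * x\<^sup>2"
  by (simp add: phase_def power2_eq_square power3_eq_cube algebra_simps)

lemma ennreal_prod_finite: "A < \<infinity> \<Longrightarrow> B < \<infinity> \<Longrightarrow> D < \<infinity> \<Longrightarrow> (A::ennreal) * B * D < \<infinity>"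
  by (simp add: ennreal_mult_less_top)

text \<open>The leading coefficient of the quadratic is \<open>-3\<close> times the \<open>\<xi>\<close>-component of \<open>\<eta>\<close>, so
  \<open>nn_integral_quadratic_le\<close> gains exactly the power that the kernel contains. If this component vanishes, so does
  the kernel.\<close>

lemma kernel_curvature:
  assumes "r > 1/2" "b > 1/2" "p > 1/2"
  obtains C where "C < (\<infinity>::ennreal)"
   "\<And>\<eta>. (\<integral>\<^sup>+\<zeta>. ennreal (\<bar>xi \<eta>\<bar> powr (1/2) * jbracket (qq \<zeta>) powr (- (2 * r)) * jbracket (modulation \<zeta>) powr (- (2 * b)) *
      jbracket (modulation (\<eta> - \<zeta>)) powr (- p)) \<partial>freq_measure) \<le> C"
proof -
  obtain K where K: "K \<ge> 0" "\<And>\<alpha> \<beta> \<gamma> :: real. \<gamma> \<noteq> 0 \<Longrightarrow>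
      (\<integral>\<^sup>+x. ennreal (jbracket (\<alpha> + \<beta> * x + \<gamma> * x\<^sup>2) powr (- p)) \<partial>lborel) \<le> ennreal (K * \<bar>\<gamma>\<bar> powr (- (1/2)))"
    by (rule nn_integral_quadratic_le[OF assms(3)]) (rule that)
  let ?C = "(\<integral>\<^sup>+q. ennreal (jbracket (real_of_int q) powr (- (2 * r))) \<partial>count_space UNIV) *
    (\<integral>\<^sup>+x. ennreal (jbracket x powr (- (2 * b))) \<partial>lborel) * ennreal K"
  show thesis
  proof
    show "?C < \<infinity>" using assms nn_integral_jbracket[of "2*b"] nn_integral_jbracket_int[of "2*r"]
      by (intro ennreal_prod_finite) auto
    fix \<eta>
    show "(\<integral>\<^sup>+\<zeta>. ennreal (\<bar>xi \<eta>\<bar> powr (1/2) * jbracket (qq \<zeta>) powr (- (2 * r)) * jbracket (modulation \<zeta>) powr (- (2 * b)) *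
      jbracket (modulation (\<eta> - \<zeta>)) powr (- p)) \<partial>freq_measure) \<le> ?C"
    proof (rule kernel_reduction)
      fix q \<theta> :: real
      let ?X = "xi \<eta>"
      let ?q = "\<lambda>x. (\<theta> - ?X ^ 3 - ?X * (qq \<eta> - q)\<^sup>2) + (3 * ?X\<^sup>2 - q\<^sup>2 + (qq \<eta> - q)\<^sup>2) * x + (- 3 * ?X) * x\<^sup>2"
      have "(\<integral>\<^sup>+x. ennreal (\<bar>?X\<bar> powr (1/2) * jbracket (?q x) powr (- p)) \<partial>lborel) \<le> ennreal K"
      proof (cases "?X = 0")
        case False
        have "(\<integral>\<^sup>+x. ennreal (\<bar>?X\<bar> powr (1/2) * jbracket (?q x) powr (- p)) \<partial>lborel) = 
          ennreal (\<bar>?X\<bar> powr (1/2)) * (\<integral>\<^sup>+x. ennreal (jbracket (?q x) powr (- p)) \<partial>lborel)"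
          by (simp add: ennreal_mult nn_integral_cmult)
        also have "\<dots> \<le> ennreal (\<bar>?X\<bar> powr (1/2)) * ennreal (K * \<bar>- 3 * ?X\<bar> powr (- (1/2)))"
          by (intro mult_left_mono K(2)) (use False in simp_all)
        also have "\<dots> = ennreal (K * (\<bar>?X\<bar> powr (1/2) * \<bar>- 3 * ?X\<bar> powr (- (1/2))))"
          using K(1) by (simp add: ennreal_mult[symmetric] mult_ac)
        also have "\<dots> \<le> ennreal K"
        proof -
          have "\<bar>- 3 * ?X\<bar> powr (- (1/2)) \<le> \<bar>?X\<bar> powr (- (1/2))" using False by (intro powr_mono2') (auto simp: abs_mult)
          then have "\<bar>?X\<bar> powr (1/2) * \<bar>- 3 * ?X\<bar> powr (- (1/2)) \<le> \<bar>?X\<bar> powr (1/2) * \<bar>?X\<bar> powr (- (1/2))"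
            by (rule mult_left_mono) simp
          also have "\<dots> = 1" using False by (simp add: powr_add[symmetric])
          finally show ?thesis using K(1) by (intro ennreal_leI mult_left_le) auto
        qed
        finally show ?thesis .
      qed simp
      then show "(\<integral>\<^sup>+x. ennreal (\<bar>?X\<bar> powr (1/2) * jbracket (\<theta> - phase x q - phase (?X - x) (qq \<eta> - q)) powr (- p)) \<partial>lborel) \<le> ennreal K"
        unfolding phase_sum_quadratic .
    qed (use assms in simp_all)
  qed
qed

text \<open>The phase is odd, so the reflection of \<open>\<zeta>\<close> leaves all brackets unchanged. This is the version for fixing
  an input frequency \<open>\<eta>\<close> and pairing another input with the output \<open>\<eta> + \<zeta>\<close>.\<close>

lemma kernel_curvature_plus:
  assumes "r > 1/2" "b > 1/2" "p > 1/2"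
  obtains C where "C < (\<infinity>::ennreal)"
   "\<And>\<eta>. (\<integral>\<^sup>+\<zeta>. ennreal (\<bar>xi \<eta>\<bar> powr (1/2) * jbracket (qq \<zeta>) powr (- (2 * r)) * jbracket (modulation \<zeta>) powr (- (2 * b)) *
      jbracket (modulation (\<eta> + \<zeta>)) powr (- p)) \<partial>freq_measure) \<le> C"
proof -
  obtain C where C: "C < (\<infinity>::ennreal)"
   "\<And>\<eta>. (\<integral>\<^sup>+\<zeta>. ennreal (\<bar>xi \<eta>\<bar> powr (1/2) * jbracket (qq \<zeta>) powr (- (2 * r)) * jbracket (modulation \<zeta>) powr (- (2 * b)) *
      jbracket (modulation (\<eta> - \<zeta>)) powr (- p)) \<partial>freq_measure) \<le> C"
    by (rule kernel_curvature[OF assms]) (rule that)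
  show thesis
  proof
    fix \<eta> :: freq
    let ?f = "\<lambda>\<zeta>. ennreal (\<bar>xi \<eta>\<bar> powr (1/2) * jbracket (qq \<zeta>) powr (- (2 * r)) * jbracket (modulation \<zeta>) powr (- (2 * b)) *
      jbracket (modulation (\<eta> - \<zeta>)) powr (- p))"
    have "?f \<in> borel_measurable borel" by measurable
    from nn_integral_freq_minus[OF this] C(2)[of \<eta>]
    show "(\<integral>\<^sup>+\<zeta>. ennreal (\<bar>xi \<eta>\<bar> powr (1/2) * jbracket (qq \<zeta>) powr (- (2 * r)) * jbracket (modulation \<zeta>) powr (- (2 * b)) *
      jbracket (modulation (\<eta> + \<zeta>)) powr (- p)) \<partial>freq_measure) \<le> C" by simp
  qed (rule C(1))
qed

text \<open>The \<open>\<xi>\<close>-derivative of the phase \<open>\<omega>\<close> is \<open>\<bar>\<zeta>\<bar>\<^sup>2 = 3 \<xi>\<^sup>2 + q\<^sup>2\<close>. Hence the first factor of the kernel is the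
  derivative of the quadratic polynomial in the last bracket, and
  \<open>nn_integral_quadratic_derivative_le\<close> applies.\<close>

lemma kernel_transversal:
  assumes "r > 1/2" "b > 1/2"
  obtains C where "C < (\<infinity>::ennreal)"
   "\<And>\<eta>. (\<integral>\<^sup>+\<zeta>. ennreal (\<bar>freq_sq (\<eta> - \<zeta>) - freq_sq \<zeta>\<bar> * jbracket (qq \<zeta>) powr (- (2 * r)) * jbracket (modulation \<zeta>) powr (- (2 * b)) *
      jbracket (modulation (\<eta> - \<zeta>)) powr (- (2 * b))) \<partial>freq_measure) \<le> C"
proof -
  let ?J = "\<integral>\<^sup>+x. ennreal (jbracket x powr (- (2 * b))) \<partial>lborel"
  let ?C = "(\<integral>\<^sup>+q. ennreal (jbracket (real_of_int q) powr (- (2 * r))) \<partial>count_space UNIV) * ?J * (2 * ?J)"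
  have J: "?J < \<infinity>" using nn_integral_jbracket[of "2*b"] assms by auto
  show thesis
  proof
    show "?C < \<infinity>" using assms nn_integral_jbracket_int[of "2*r"] J
      by (intro ennreal_prod_finite) (auto simp: ennreal_mult_less_top)
    fix \<eta> :: freq
    define a where "a q x = \<bar>(3 * (xi \<eta> - x)\<^sup>2 + (qq \<eta> - q)\<^sup>2) - (3 * x\<^sup>2 + q\<^sup>2)\<bar>" for q x
    have "(\<integral>\<^sup>+\<zeta>. ennreal (a (qq \<zeta>) (xi \<zeta>) * jbracket (qq \<zeta>) powr (- (2 * r)) * jbracket (modulation \<zeta>) powr (- (2 * b)) *
      jbracket (modulation (\<eta> - \<zeta>)) powr (- (2 * b))) \<partial>freq_measure) \<le> ?C"
    proof (rule kernel_reduction)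
      fix q \<theta> :: real
      have e: "a q x = \<bar>(3 * (xi \<eta>)\<^sup>2 - q\<^sup>2 + (qq \<eta> - q)\<^sup>2) + 2 * (- 3 * xi \<eta>) * x\<bar>" for x
        unfolding a_def by (rule arg_cong[where f = abs]) (simp add: power2_eq_square algebra_simps)
      show "(\<integral>\<^sup>+x. ennreal (a q x * jbracket (\<theta> - phase x q - phase (xi \<eta> - x) (qq \<eta> - q)) powr (- (2 * b))) \<partial>lborel) \<le> 2 * ?J"
        unfolding phase_sum_quadratic e by (rule nn_integral_quadratic_derivative_le) (use assms in simp)
    qed (use assms in \<open>simp_all add: a_def\<close>)
    then show "(\<integral>\<^sup>+\<zeta>. ennreal (\<bar>freq_sq (\<eta> - \<zeta>) - freq_sq \<zeta>\<bar> * jbracket (qq \<zeta>) powr (- (2 * r)) * jbracket (modulation \<zeta>) powr (- (2 * b)) *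
      jbracket (modulation (\<eta> - \<zeta>)) powr (- (2 * b))) \<partial>freq_measure) \<le> ?C"
      by (simp add: a_def freq_sq_def)
  qed
qed

text \<open>The weight \<open>\<langle>\<bar>(\<xi>, q)\<bar>\<rangle> powr s\<close> of the Bourgain norm.\<close>

definition sob_weight :: "real \<Rightarrow> freq \<Rightarrow> real" where "sob_weight s \<zeta> = (1 + freq_sq \<zeta>) powr (s / 2)"

lemma sob_weight_pos [simp]: "sob_weight s \<zeta> > 0" 
proof -
  have "1 + freq_sq \<zeta> > 0" by (simp add: add_pos_nonneg)
  then show ?thesis by (simp add: sob_weight_def)
qed

lemma sob_weight_measurable [measurable]: "sob_weight s \<in> borel_measurable borel"
  unfolding sob_weight_def[abs_def] by measurable

text \<open>Half of the decay is spent on each of the two spatial frequencies, since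
  \<open>(1 + \<xi>\<^sup>2) (1 + q\<^sup>2) \<le> (1 + 3 \<xi>\<^sup>2 + q\<^sup>2)\<^sup>2\<close>. Then \<open>s > 1\<close> is exactly what both one-dimensional integrals
  need.\<close>

lemma kernel_sobolev:
  assumes "s > 1" "b > 1/2"
  shows "(\<integral>\<^sup>+\<zeta>. ennreal ((sob_weight s \<zeta>) powr (- 2) * jbracket (modulation \<zeta>) powr (- (2 * b))) \<partial>freq_measure) < \<infinity>"
    (is "?L < \<infinity>")
proof -
  let ?f = "\<lambda>\<zeta>. ennreal ((sob_weight s \<zeta>) powr (- 2) * jbracket (modulation \<zeta>) powr (- (2 * b)))"
  let ?Q = "\<integral>\<^sup>+q. ennreal (jbracket (real_of_int q) powr (- s)) \<partial>count_space UNIV"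
  let ?X = "\<integral>\<^sup>+x. ennreal (jbracket x powr (- s)) \<partial>lborel"
  let ?T = "\<integral>\<^sup>+x. ennreal (jbracket x powr (- (2 * b))) \<partial>lborel"
  have [measurable]: "?f \<in> borel_measurable borel" by measurable
  have w: "sob_weight s \<zeta> powr (- 2) \<le> jbracket (qq \<zeta>) powr (- s) * jbracket (xi \<zeta>) powr (- s)" for \<zeta>
  proof -
    let ?A = "1 + (qq \<zeta>)\<^sup>2" and ?B = "1 + (xi \<zeta>)\<^sup>2" and ?N = "1 + freq_sq \<zeta>"
    have p: "?A > 0" "?B > 0" "?N > 0" by (simp_all add: add_pos_nonneg)
    have "?A * ?B \<le> ?N * ?N" by (rule mult_mono) (auto simp: freq_sq_def)
    then have "(?N * ?N) powr (- s / 2) \<le> (?A * ?B) powr (- s / 2)"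
      using p assms by (intro powr_mono2') (auto intro: mult_pos_pos)
    moreover have "(?N * ?N) powr (- s / 2) = ?N powr (- s)" 
      using p by (simp add: powr_mult powr_add[symmetric])
    moreover have "(?A * ?B) powr (- s / 2) = ?A powr (- s / 2) * ?B powr (- s / 2)"
      using p by (simp add: powr_mult)
    moreover have "sob_weight s \<zeta> powr (- 2) = ?N powr (- s)" by (simp add: sob_weight_def powr_powr)
    ultimately show ?thesis by (simp add: jbracket_powr_sq)
  qed
  have inner: "(\<integral>\<^sup>+\<tau>. ?f (\<tau>, \<xi>, q) \<partial>lborel) \<le> ennreal (jbracket (real_of_int q) powr (- s)) * (ennreal (jbracket \<xi> powr (- s)) * ?T)" for \<xi> q
  proof -
    have m: "(\<lambda>\<tau>. ?f (\<tau>, \<xi>, q)) \<in> borel_measurable borel"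
      by (rule measurable_compose[OF _ \<open>?f \<in> borel_measurable borel\<close>]) measurable
    have "(\<integral>\<^sup>+\<tau>. ?f (\<tau>, \<xi>, q) \<partial>lborel) = (\<integral>\<^sup>+\<tau>. ?f (phase \<xi> q + 1 * \<tau>, \<xi>, q) \<partial>lborel)"
      using nn_integral_real_affine[OF m, of 1 "phase \<xi> q"] by simp
    also have "\<dots> \<le> (\<integral>\<^sup>+\<tau>. ennreal (jbracket (real_of_int q) powr (- s)) * (ennreal (jbracket \<xi> powr (- s)) * ennreal (jbracket \<tau> powr (- (2 * b)))) \<partial>lborel)"
    proof (rule nn_integral_mono)
      fix \<tau>
      have 1: "modulation (phase \<xi> q + 1 * \<tau>, \<xi>, q) = \<tau>" by (simp add: modulation_def)
      show "?f (phase \<xi> q + 1 * \<tau>, \<xi>, q) \<le> ennreal (jbracket (real_of_int q) powr (- s)) * (ennreal (jbracket \<xi> powr (- s)) * ennreal (jbracket \<tau> powr (- (2 * b))))"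
        unfolding 1 using w[of "(phase \<xi> q + 1 * \<tau>, \<xi>, q)"]
        by (simp add: ennreal_mult[symmetric] mult.assoc[symmetric] ennreal_leI mult_right_mono)
    qed
    also have "\<dots> = ennreal (jbracket (real_of_int q) powr (- s)) * (ennreal (jbracket \<xi> powr (- s)) * ?T)"
      by (simp add: nn_integral_cmult)
    finally show ?thesis .
  qed
  have "?L = (\<integral>\<^sup>+q. \<integral>\<^sup>+\<xi>. \<integral>\<^sup>+\<tau>. ?f (\<tau>, \<xi>, q) \<partial>lborel \<partial>lborel \<partial>count_space UNIV)"
    by (rule nn_integral_freq_swap) fact
  also have "\<dots> \<le> (\<integral>\<^sup>+q. \<integral>\<^sup>+\<xi>. ennreal (jbracket (real_of_int q) powr (- s)) * (ennreal (jbracket \<xi> powr (- s)) * ?T) \<partial>lborel \<partial>count_space UNIV)"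
    by (intro nn_integral_mono inner)
  also have "\<dots> = ?Q * (?X * ?T)" by (simp add: nn_integral_cmult nn_integral_multc)
  also have "\<dots> = ?Q * ?X * ?T" by (simp add: mult.assoc)
  also have "\<dots> < \<infinity>" using assms nn_integral_jbracket_int[of s] nn_integral_jbracket[of s] nn_integral_jbracket[of "2 * b"]
    by (intro ennreal_prod_finite) auto
  finally show ?thesis .
qed

section \<open>The trilinear estimate\<close>

definition sqnorm :: "(freq \<Rightarrow> ennreal) \<Rightarrow> ennreal" where
  "sqnorm F = (\<integral>\<^sup>+\<zeta>. (F \<zeta>)\<^sup>2 \<partial>freq_measure)"

lemma sqnorm_mono: "(\<And>\<zeta>. F \<zeta> \<le> G \<zeta>) \<Longrightarrow> sqnorm F \<le> sqnorm G"
  unfolding sqnorm_def by (intro nn_integral_mono power_mono) auto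

lemma sqnorm_add:
  assumes [measurable]: "F \<in> borel_measurable borel" "G \<in> borel_measurable borel"
  shows "sqnorm (\<lambda>\<zeta>. F \<zeta> + G \<zeta>) \<le> 2 * sqnorm F + 2 * sqnorm G"
proof -
  have "(x + y)\<^sup>2 \<le> 2 * x\<^sup>2 + 2 * y\<^sup>2" for x y :: ennreal
  proof -
    have "2 * x * y = x * y + x * y" by (simp add: mult_2 distrib_right)
    then have "(x + y)\<^sup>2 = x\<^sup>2 + y\<^sup>2 + 2 * x * y" 
      by (simp add: power2_eq_square distrib_left distrib_right mult.commute add_ac)
    also have "\<dots> \<le> x\<^sup>2 + y\<^sup>2 + (x\<^sup>2 + y\<^sup>2)" by (intro add_left_mono sum_of_squares_ge_ennreal)
    also have "\<dots> = 2 * x\<^sup>2 + 2 * y\<^sup>2" by (simp add: mult_2 add_ac)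
    finally show ?thesis .
  qed
  then have "sqnorm (\<lambda>\<zeta>. F \<zeta> + G \<zeta>) \<le> (\<integral>\<^sup>+\<zeta>. 2 * (F \<zeta>)\<^sup>2 + 2 * (G \<zeta>)\<^sup>2 \<partial>freq_measure)"
    unfolding sqnorm_def by (intro nn_integral_mono)
  also have "\<dots> = 2 * sqnorm F + 2 * sqnorm G"
    unfolding sqnorm_def by (simp add: nn_integral_add nn_integral_cmult)
  finally show ?thesis .
qed

lemma sqnorm_cmult:
  assumes [measurable]: "F \<in> borel_measurable borel"
  shows "sqnorm (\<lambda>\<zeta>. c * F \<zeta>) = c\<^sup>2 * sqnorm F"
  unfolding sqnorm_def by (simp add: power_mult_distrib nn_integral_cmult)

lemma tri_meas_slice:
  assumes "tri_meas h"
  shows "(\<lambda>b. h (\<zeta> - c - b) b c) \<in> borel_measurable freq_measure"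
  by (rule tri_meas_comp[OF assms]) measurable

lemma tri_meas_slice2:
  assumes "tri_meas h"
  shows "(\<lambda>c. \<integral>\<^sup>+b. h (\<zeta> - c - b) b c \<partial>freq_measure) \<in> borel_measurable freq_measure"
  by (measurable, rule tri_meas_comp[OF assms]) measurable

lemma tri_measurable [measurable]:
  assumes "tri_meas h"
  shows "tri h \<in> borel_measurable borel"
  unfolding tri_def by (measurable, rule tri_meas_comp[OF assms]) measurable

lemma tri_add:
  assumes "tri_meas h" "tri_meas h'"
  shows "tri (\<lambda>a b c. h a b c + h' a b c) \<zeta> = tri h \<zeta> + tri h' \<zeta>"
proof -
  have "(\<integral>\<^sup>+b. h (\<zeta> - c - b) b c + h' (\<zeta> - c - b) b c \<partial>freq_measure) = 
    (\<integral>\<^sup>+b. h (\<zeta> - c - b) b c \<partial>freq_measure) + (\<integral>\<^sup>+b. h' (\<zeta> - c - b) b c \<partial>freq_measure)" for c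
    by (rule nn_integral_add[OF tri_meas_slice tri_meas_slice]) (rule assms)+
  then show ?thesis
    unfolding tri_def using assms by (simp add: nn_integral_add tri_meas_slice2)
qed

lemma tri_cmult:
  assumes "tri_meas h"
  shows "tri (\<lambda>a b c. C * h a b c) \<zeta> = C * tri h \<zeta>"
proof -
  have "(\<integral>\<^sup>+b. C * h (\<zeta> - c - b) b c \<partial>freq_measure) = 
    C * (\<integral>\<^sup>+b. h (\<zeta> - c - b) b c \<partial>freq_measure)" for c
    by (rule nn_integral_cmult[OF tri_meas_slice]) (rule assms)
  then show ?thesis
    unfolding tri_def using assms by (simp add: nn_integral_cmult tri_meas_slice2)
qed

lemma measurable_kernel_at:
  assumes "(\<lambda>p. k (fst p) (snd p)) \<in> borel_measurable (borel \<Otimes>\<^sub>M borel)"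
    "f \<in> M \<rightarrow>\<^sub>M borel" "g \<in> M \<rightarrow>\<^sub>M borel"
  shows "(\<lambda>x. k (f x) (g x)) \<in> borel_measurable M"
  using measurable_compose[OF measurable_Pair[OF assms(2,3)] assms(1)] by simp

text \<open>The product \<open>V\<close> of the first two factors is bounded with its own output frequency fixed, and then the product of
  \<open>V\<close> with \<open>H\<close> with the frequency of \<open>V\<close> fixed. The output weight \<open>w\<close> enters the second kernel, which
  is where the decay in the output modulation is used.\<close>

lemma trilinear_two_steps:
  fixes k1 k2 :: "freq \<Rightarrow> freq \<Rightarrow> ennreal"
  assumes [measurable]: "F \<in> borel_measurable borel" "G \<in> borel_measurable borel" "H \<in> borel_measurable borel" "w \<in> borel_measurable borel"
   and k1: "(\<lambda>p. k1 (fst p) (snd p)) \<in> borel_measurable (borel \<Otimes>\<^sub>M borel)"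
   and k2: "(\<lambda>p. k2 (fst p) (snd p)) \<in> borel_measurable (borel \<Otimes>\<^sub>M borel)"
   and K: "tri_meas K"
   and le: "\<And>\<eta> b c. w \<eta> * K (\<eta> - c - b) b c \<le> k2 \<eta> c * k1 (\<eta> - c) b"
   and D1: "\<And>\<eta>. (\<integral>\<^sup>+\<zeta>. (k1 \<eta> \<zeta>)\<^sup>2 \<partial>freq_measure) \<le> D1"
   and D2: "\<And>\<eta>. (\<integral>\<^sup>+\<zeta>. (k2 (\<eta> + \<zeta>) \<zeta>)\<^sup>2 \<partial>freq_measure) \<le> D2"
 shows "sqnorm (\<lambda>\<eta>. w \<eta> * tri (\<lambda>a b c. K a b c * (F a * (G b * H c))) \<eta>) \<le> D2 * D1 * (sqnorm F * sqnorm G * sqnorm H)"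
proof -
  define V where "V \<eta> = (\<integral>\<^sup>+\<zeta>. k1 \<eta> \<zeta> * (F (\<eta> - \<zeta>) * G \<zeta>) \<partial>freq_measure)" for \<eta>
  have [measurable]: "V \<in> borel_measurable borel"
    unfolding V_def by (measurable, rule measurable_kernel_at[OF k1]) measurable
  have Km: "tri_meas (\<lambda>a b c. K a b c * (F a * (G b * H c)))"
    unfolding tri_meas_def by (intro borel_measurable_times_ennreal tri_meas_comp[OF K]) measurable
  have "w \<eta> * tri (\<lambda>a b c. K a b c * (F a * (G b * H c))) \<eta> \<le> (\<integral>\<^sup>+c. k2 \<eta> c * (V (\<eta> - c) * H c) \<partial>freq_measure)" for \<eta>
  proof -
    have "w \<eta> * tri (\<lambda>a b c. K a b c * (F a * (G b * H c))) \<eta> = tri (\<lambda>a b c. w \<eta> * (K a b c * (F a * (G b * H c)))) \<eta>"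
      by (rule tri_cmult[OF Km, symmetric])
    also have "\<dots> \<le> (\<integral>\<^sup>+c. k2 \<eta> c * (V (\<eta> - c) * H c) \<partial>freq_measure)"
      unfolding tri_def
    proof (rule nn_integral_mono)
      fix c
      let ?g = "\<lambda>b. k1 (\<eta> - c) b * (F (\<eta> - c - b) * G b)"
      have gm: "?g \<in> borel_measurable borel"
        by (intro borel_measurable_times_ennreal measurable_kernel_at[OF k1]) measurable
      have "(\<integral>\<^sup>+b. w \<eta> * (K (\<eta> - c - b) b c * (F (\<eta> - c - b) * (G b * H c))) \<partial>freq_measure)
        \<le> (\<integral>\<^sup>+b. (k2 \<eta> c * H c) * ?g b \<partial>freq_measure)"
      proof (rule nn_integral_mono)
        fix b
        have "w \<eta> * (K (\<eta> - c - b) b c * (F (\<eta> - c - b) * (G b * H c))) = 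
          (w \<eta> * K (\<eta> - c - b) b c) * (F (\<eta> - c - b) * (G b * H c))" by (simp add: mult_ac)
        also have "\<dots> \<le> (k2 \<eta> c * k1 (\<eta> - c) b) * (F (\<eta> - c - b) * (G b * H c))"
          by (intro mult_right_mono le) simp
        also have "\<dots> = (k2 \<eta> c * H c) * ?g b" by (simp add: mult_ac)
        finally show "w \<eta> * (K (\<eta> - c - b) b c * (F (\<eta> - c - b) * (G b * H c))) \<le> (k2 \<eta> c * H c) * ?g b" .
      qed
      also have "\<dots> = (k2 \<eta> c * H c) * V (\<eta> - c)" 
        unfolding V_def using gm by (subst nn_integral_cmult) (simp_all add: measurable_cong_sets[OF sets_freq refl])
      finally show "(\<integral>\<^sup>+b. w \<eta> * (K (\<eta> - c - b) b c * (F (\<eta> - c - b) * (G b * H c))) \<partial>freq_measure) \<le> k2 \<eta> c * (V (\<eta> - c) * H c)"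
        by (simp add: mult_ac)
    qed
    finally show ?thesis .
  qed
  then have "sqnorm (\<lambda>\<eta>. w \<eta> * tri (\<lambda>a b c. K a b c * (F a * (G b * H c))) \<eta>) \<le> 
    sqnorm (\<lambda>\<eta>. \<integral>\<^sup>+c. k2 \<eta> c * (V (\<eta> - c) * H c) \<partial>freq_measure)" by (rule sqnorm_mono)
  also have "\<dots> \<le> D2 * (sqnorm V * sqnorm H)"
    unfolding sqnorm_def by (rule conv_L2_input[OF _ _ k2 D2]) measurable
  also have "\<dots> \<le> D2 * ((D1 * (sqnorm F * sqnorm G)) * sqnorm H)"
  proof -
    have "sqnorm V \<le> D1 * (sqnorm F * sqnorm G)"
      unfolding sqnorm_def V_def by (rule conv_L2_output[OF _ _ k1 D1]) measurable
    then show ?thesis by (intro mult_left_mono mult_right_mono) auto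
  qed
  finally show ?thesis by (simp add: mult_ac)
qed

text \<open>The exponent is negated: \<open>mod_weight b\<close> is the decaying weight \<open>\<langle>\<sigma>\<rangle> powr (-b)\<close>, as it occurs
  in the kernels.\<close>

definition mod_weight :: "real \<Rightarrow> freq \<Rightarrow> real" where "mod_weight b \<zeta> = jbracket (modulation \<zeta>) powr (- b)"

text \<open>The curvature kernel. It is split evenly between the two bilinear steps, because the sum of the frequencies
  of the first two factors is the output frequency of the first step and the fixed
  frequency of the second.\<close>

definition curv :: "real \<Rightarrow> freq \<Rightarrow> freq \<Rightarrow> freq \<Rightarrow> real" where
  "curv r a b c = \<bar>xi a + xi b\<bar> powr (1/2) * jbracket (qq b) powr (- r) * jbracket (qq c) powr (- r)"

text \<open>The transversal kernel. The difference of the two squared frequencies is used up in the first step, and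
  the third factor only has to be integrable.\<close>

definition transv :: "real \<Rightarrow> real \<Rightarrow> freq \<Rightarrow> freq \<Rightarrow> freq \<Rightarrow> real" where
  "transv r s a b c = \<bar>freq_sq a - freq_sq b\<bar> powr (1/2) * jbracket (qq b) powr (- r) * sob_weight s c powr (- 1)"

lemma mod_weight_measurable [measurable]: "mod_weight b \<in> borel_measurable borel"
  unfolding mod_weight_def[abs_def] by measurable

lemma mod_weight_pos [simp]: "mod_weight b \<zeta> \<ge> 0" by (simp add: mod_weight_def)

lemma curv_transv_nonneg [simp]: "curv r a b c \<ge> 0" "transv r s a b c \<ge> 0"
  by (simp_all add: curv_def transv_def)

lemma powr_sq: "(x powr a)\<^sup>2 = x powr (2 * a)" for x :: real
  by (simp add: power2_eq_square powr_add[symmetric])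

lemma mod_weight_sq: "(mod_weight b \<zeta>)\<^sup>2 = jbracket (modulation \<zeta>) powr (- (2 * b))"
  by (simp add: mod_weight_def powr_sq)

text \<open>The first step uses both input modulations, the second one the modulation of the third input and
  the output modulation, of which only the power \<open>p/2 > 1/4\<close> is available. The curvature bound
  tolerates this: after squaring, any power above \<open>1/2\<close> of the bracket of a quadratic is integrable.\<close>

lemma core_curv:
  assumes "r > 1/2" "b > 1/2" "p > 1/2" "p \<le> 2 * b"
  obtains C where "C < (\<infinity>::ennreal)"
   "\<And>F G H. F \<in> borel_measurable borel \<Longrightarrow> G \<in> borel_measurable borel \<Longrightarrow> H \<in> borel_measurable borel \<Longrightarrow>
     sqnorm (\<lambda>\<eta>. ennreal (mod_weight (p/2) \<eta>) * tri (\<lambda>x y z. ennreal (curv r x y z * mod_weight b x * mod_weight b y * mod_weight b z) * (F x * (G y * H z))) \<eta>) \<le>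
      C * (sqnorm F * sqnorm G * sqnorm H)"
proof -
  obtain D1 where D1: "D1 < (\<infinity>::ennreal)"
   "\<And>\<eta>. (\<integral>\<^sup>+\<zeta>. ennreal (\<bar>xi \<eta>\<bar> powr (1/2) * jbracket (qq \<zeta>) powr (- (2 * r)) * jbracket (modulation \<zeta>) powr (- (2 * b)) *
      jbracket (modulation (\<eta> - \<zeta>)) powr (- (2 * b))) \<partial>freq_measure) \<le> D1"
    by (rule kernel_curvature[of r b "2 * b"]) (use assms in auto)
  obtain D2 where D2: "D2 < (\<infinity>::ennreal)"
   "\<And>\<eta>. (\<integral>\<^sup>+\<zeta>. ennreal (\<bar>xi \<eta>\<bar> powr (1/2) * jbracket (qq \<zeta>) powr (- (2 * r)) * jbracket (modulation \<zeta>) powr (- (2 * b)) *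
      jbracket (modulation (\<eta> + \<zeta>)) powr (- p)) \<partial>freq_measure) \<le> D2"
    by (rule kernel_curvature_plus[OF assms(1-3)]) (rule that)
  show thesis
  proof
    show "D2 * D1 < \<infinity>" using D1 D2 by (simp add: ennreal_mult_less_top)
    fix F G H :: "freq \<Rightarrow> ennreal"
    assume m: "F \<in> borel_measurable borel" "G \<in> borel_measurable borel" "H \<in> borel_measurable borel"
    define k1 where "k1 \<eta> \<zeta> = ennreal (\<bar>xi \<eta>\<bar> powr (1/4) * jbracket (qq \<zeta>) powr (- r) * mod_weight b \<zeta> * mod_weight b (\<eta> - \<zeta>))" for \<eta> \<zeta>
    define k2 where "k2 \<eta> \<zeta> = ennreal (\<bar>xi (\<eta> - \<zeta>)\<bar> powr (1/4) * jbracket (qq \<zeta>) powr (- r) * mod_weight b \<zeta> * mod_weight (p/2) \<eta>)" for \<eta> \<zeta>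
    show "sqnorm (\<lambda>\<eta>. ennreal (mod_weight (p/2) \<eta>) * tri (\<lambda>x y z. ennreal (curv r x y z * mod_weight b x * mod_weight b y * mod_weight b z) * (F x * (G y * H z))) \<eta>) \<le>
      D2 * D1 * (sqnorm F * sqnorm G * sqnorm H)"
    proof (rule trilinear_two_steps[OF m, where ?k1.0 = k1 and ?k2.0 = k2])
      show "(\<lambda>p. k1 (fst p) (snd p)) \<in> borel_measurable (borel \<Otimes>\<^sub>M borel)" unfolding k1_def by measurable
      show "(\<lambda>p. k2 (fst p) (snd p)) \<in> borel_measurable (borel \<Otimes>\<^sub>M borel)" unfolding k2_def by measurable
      show "tri_meas (\<lambda>x y z. ennreal (curv r x y z * mod_weight b x * mod_weight b y * mod_weight b z))"
        unfolding tri_meas_def curv_def by measurable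
      fix \<eta> :: freq
      show "(\<integral>\<^sup>+\<zeta>. (k1 \<eta> \<zeta>)\<^sup>2 \<partial>freq_measure) \<le> D1"
        using D1(2)[of \<eta>] by (simp add: k1_def ennreal_power power_mult_distrib mod_weight_sq powr_sq)
      show "(\<integral>\<^sup>+\<zeta>. (k2 (\<eta> + \<zeta>) \<zeta>)\<^sup>2 \<partial>freq_measure) \<le> D2"
        using D2(2)[of \<eta>] by (simp add: k2_def ennreal_power power_mult_distrib mod_weight_sq powr_sq)
      fix y z :: freq
      have e: "\<bar>xi (\<eta> - z)\<bar> powr (1/2) = \<bar>xi (\<eta> - z)\<bar> powr (1/4) * \<bar>xi (\<eta> - z)\<bar> powr (1/4)" 
        by (simp add: powr_add[symmetric])
      have x: "xi (\<eta> - z - y) + xi y = xi (\<eta> - z)" by simp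
      show "ennreal (mod_weight (p/2) \<eta>) * ennreal (curv r (\<eta> - z - y) y z * mod_weight b (\<eta> - z - y) * mod_weight b y * mod_weight b z) \<le> k2 \<eta> z * k1 (\<eta> - z) y"
        unfolding k1_def k2_def curv_def x e by (simp add: ennreal_mult[symmetric] mult_ac)
    qed measurable
  qed
qed

text \<open>The Sobolev kernel of the second step depends only on the frequency of the third
  factor, so the decay in the output modulation can be discarded.\<close>

lemma core_transv:
  assumes "r > 1/2" "b > 1/2" "p \<ge> 0" "s > 1"
  obtains C where "C < (\<infinity>::ennreal)"
   "\<And>F G H. F \<in> borel_measurable borel \<Longrightarrow> G \<in> borel_measurable borel \<Longrightarrow> H \<in> borel_measurable borel \<Longrightarrow>
     sqnorm (\<lambda>\<eta>. ennreal (mod_weight (p/2) \<eta>) * tri (\<lambda>x y z. ennreal (transv r s x y z * mod_weight b x * mod_weight b y * mod_weight b z) * (F x * (G y * H z))) \<eta>) \<le>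
      C * (sqnorm F * sqnorm G * sqnorm H)"
proof -
  obtain D1 where D1: "D1 < (\<infinity>::ennreal)"
   "\<And>\<eta>. (\<integral>\<^sup>+\<zeta>. ennreal (\<bar>freq_sq (\<eta> - \<zeta>) - freq_sq \<zeta>\<bar> * jbracket (qq \<zeta>) powr (- (2 * r)) * jbracket (modulation \<zeta>) powr (- (2 * b)) *
      jbracket (modulation (\<eta> - \<zeta>)) powr (- (2 * b))) \<partial>freq_measure) \<le> D1"
    by (rule kernel_transversal[OF assms(1,2)]) (rule that)
  let ?D2 = "\<integral>\<^sup>+\<zeta>. ennreal ((sob_weight s \<zeta>) powr (- 2) * jbracket (modulation \<zeta>) powr (- (2 * b))) \<partial>freq_measure"
  have D2: "?D2 < \<infinity>" by (rule kernel_sobolev[OF assms(4,2)])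
  show thesis
  proof
    show "?D2 * D1 < \<infinity>" using D1 D2 by (simp add: ennreal_mult_less_top)
    fix F G H :: "freq \<Rightarrow> ennreal"
    assume m: "F \<in> borel_measurable borel" "G \<in> borel_measurable borel" "H \<in> borel_measurable borel"
    define k1 where "k1 \<eta> \<zeta> = ennreal (\<bar>freq_sq (\<eta> - \<zeta>) - freq_sq \<zeta>\<bar> powr (1/2) * jbracket (qq \<zeta>) powr (- r) * mod_weight b \<zeta> * mod_weight b (\<eta> - \<zeta>))" for \<eta> \<zeta>
    define k2 where "k2 \<eta> \<zeta> = ennreal (sob_weight s \<zeta> powr (- 1) * mod_weight b \<zeta>)" for \<eta> \<zeta> :: freq
    show "sqnorm (\<lambda>\<eta>. ennreal (mod_weight (p/2) \<eta>) * tri (\<lambda>x y z. ennreal (transv r s x y z * mod_weight b x * mod_weight b y * mod_weight b z) * (F x * (G y * H z))) \<eta>) \<le>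
      ?D2 * D1 * (sqnorm F * sqnorm G * sqnorm H)"
    proof (rule trilinear_two_steps[OF m, where ?k1.0 = k1 and ?k2.0 = k2])
      show "(\<lambda>p. k1 (fst p) (snd p)) \<in> borel_measurable (borel \<Otimes>\<^sub>M borel)" unfolding k1_def by measurable
      show "(\<lambda>p. k2 (fst p) (snd p)) \<in> borel_measurable (borel \<Otimes>\<^sub>M borel)" unfolding k2_def by measurable
      show "tri_meas (\<lambda>x y z. ennreal (transv r s x y z * mod_weight b x * mod_weight b y * mod_weight b z))"
        unfolding tri_meas_def transv_def by measurable
      fix \<eta> :: freq
      show "(\<integral>\<^sup>+\<zeta>. (k1 \<eta> \<zeta>)\<^sup>2 \<partial>freq_measure) \<le> D1"
        using D1(2)[of \<eta>] by (simp add: k1_def ennreal_power power_mult_distrib mod_weight_sq powr_sq)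
      show "(\<integral>\<^sup>+\<zeta>. (k2 (\<eta> + \<zeta>) \<zeta>)\<^sup>2 \<partial>freq_measure) \<le> ?D2"
      proof -
        have "(sob_weight s \<zeta> powr (- 1) * mod_weight b \<zeta>)\<^sup>2 = sob_weight s \<zeta> powr (- 2) * jbracket (modulation \<zeta>) powr (- (2 * b))" for \<zeta>
          by (simp only: power_mult_distrib powr_sq mod_weight_sq) simp
        then have "(k2 (\<eta> + \<zeta>) \<zeta>)\<^sup>2 = ennreal (sob_weight s \<zeta> powr (- 2) * jbracket (modulation \<zeta>) powr (- (2 * b)))" for \<zeta>
          unfolding k2_def by (subst ennreal_power) (simp_all only: mult_nonneg_nonneg powr_ge_zero mod_weight_pos)
        then show ?thesis by simp
      qed
      fix y z :: freq
      have "mod_weight (p/2) \<eta> \<le> 1" unfolding mod_weight_def using assms by (intro jbracket_powr_le1) simp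
      then have "ennreal (mod_weight (p/2) \<eta>) * ennreal (transv r s (\<eta> - z - y) y z * mod_weight b (\<eta> - z - y) * mod_weight b y * mod_weight b z) 
        \<le> 1 * ennreal (transv r s (\<eta> - z - y) y z * mod_weight b (\<eta> - z - y) * mod_weight b y * mod_weight b z)"
        by (intro mult_right_mono) simp_all
      also have "\<dots> = k2 \<eta> z * k1 (\<eta> - z) y"
        unfolding k1_def k2_def transv_def by (simp add: ennreal_mult[symmetric] mult_ac)
      finally show "ennreal (mod_weight (p/2) \<eta>) * ennreal (transv r s (\<eta> - z - y) y z * mod_weight b (\<eta> - z - y) * mod_weight b y * mod_weight b z) \<le> k2 \<eta> z * k1 (\<eta> - z) y" .
    qed measurable
  qed
qed

lemma freq_sq_add3: "freq_sq (a + b + c) \<le> 3 * (freq_sq a + freq_sq b + freq_sq c)"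
proof -
  have t: "(x + y + z)\<^sup>2 \<le> 3 * (x\<^sup>2 + y\<^sup>2 + z\<^sup>2)" for x y z :: real
    using sum_squares_ge_zero[of "x - y" "y - z"] zero_le_power2[of "x - z"] by (simp add: power2_eq_square algebra_simps)
  show ?thesis using t[of "xi a" "xi b" "xi c"] t[of "qq a" "qq b" "qq c"] by (simp add: freq_sq_def)
qed

text \<open>An input frequency whose weight is not spent on the derivative pays for the bracket of its integer component, which
  makes the sum over \<open>q\<close> converge.\<close>

lemma sob_weight_jbracket: "0 \<le> r \<Longrightarrow> r \<le> s \<Longrightarrow> 1 \<le> sob_weight s \<zeta> * jbracket (qq \<zeta>) powr (- r)"
proof -
  assume r: "0 \<le> r" "r \<le> s"
  have "jbracket (qq \<zeta>) powr r \<le> jbracket (qq \<zeta>) powr s" using r by (intro powr_mono) (simp_all add: jbracket_ge1)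
  also have "\<dots> = (1 + (qq \<zeta>)\<^sup>2) powr (s/2)" by (simp add: jbracket_powr_sq)
  also have "\<dots> \<le> sob_weight s \<zeta>" unfolding sob_weight_def using r by (intro powr_mono2) (auto simp: freq_sq_def)
  finally have "jbracket (qq \<zeta>) powr r * jbracket (qq \<zeta>) powr (- r) \<le> sob_weight s \<zeta> * jbracket (qq \<zeta>) powr (- r)"
    by (rule mult_right_mono) simp
  moreover have "jbracket (qq \<zeta>) powr r * jbracket (qq \<zeta>) powr (- r) = 1"
  proof -
    have "jbracket (qq \<zeta>) \<noteq> 0" using jbracket_pos[of "qq \<zeta>"] by (metis less_irrefl)
    then show ?thesis by (simp add: powr_add[symmetric])
  qed
  ultimately show ?thesis by simp
qed

text \<open>Let \<open>a\<close> be the largest and \<open>c\<close> the smallest frequency. If \<open>\<bar>b\<bar>\<^sup>2 \<le> \<bar>a\<bar>\<^sup>2/4\<close>, then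
  \<open>\<bar>\<bar>a\<bar>\<^sup>2 - \<bar>b\<bar>\<^sup>2\<bar> powr (1/2)\<close> is comparable to \<open>\<bar>a\<bar>\<close> and hence controls the derivative.

  Otherwise \<open>\<bar>b\<bar>\<close> and \<open>\<bar>a\<bar>\<close> are comparable, of size \<open>n powr (1/2)\<close> say. The three pair sums \<open>\<xi>\<^sub>a + \<xi>\<^sub>b\<close>,
  \<open>\<xi>\<^sub>a + \<xi>\<^sub>c\<close>, \<open>\<xi>\<^sub>b + \<xi>\<^sub>c\<close> add up to twice the output, so one of them, of modulus \<open>M\<close>, is at least half as
  large as the output. Half of the derivative is bounded by \<open>M powr (1/2)\<close>, the other half by \<open>n powr (1/4)\<close>. The
  weight of \<open>b\<close> is of size \<open>n powr (s/2)\<close>, and it pays for \<open>n powr (1/4)\<close> together with the bracket of the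
  integer component of \<open>a\<close> or \<open>b\<close>, which costs \<open>n powr (r/2)\<close>; this is the reason for \<open>r = s - 1/2\<close>.\<close>

lemma xi_le_ordered:
  assumes s: "s > 1" and r: "r = s - 1/2"
    and o: "freq_sq b \<le> freq_sq a" "freq_sq c \<le> freq_sq b"
  shows "\<bar>xi (a + b + c)\<bar> \<le> 4 * 2 powr s * (sob_weight s b * sob_weight s c) *
    (curv r a b c + curv r a c b + curv r b c a + transv r s a b c)"
proof -
  define n where "n = 1 + freq_sq a"
  have n: "n \<ge> 1" by (simp add: n_def)
  have xi0: "\<bar>xi (a + b + c)\<bar> \<le> 2 * sqrt (freq_sq a)"
  proof -
    have "3 * (xi (a + b + c))\<^sup>2 \<le> freq_sq (a + b + c)" by (simp add: freq_sq_def)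
    also have "\<dots> \<le> 9 * freq_sq a" using freq_sq_add3[of a b c] o by simp
    finally have "(xi (a + b + c))\<^sup>2 \<le> 4 * freq_sq a" using freq_sq_nonneg[of a] by linarith
    then have "sqrt ((xi (a + b + c))\<^sup>2) \<le> sqrt (4 * freq_sq a)" by (rule real_sqrt_le_mono)
    then show ?thesis by (simp add: real_sqrt_mult)
  qed
  have s1: "1 \<le> sob_weight s c * jbracket (qq c) powr (- r)" "1 \<le> sob_weight s b * jbracket (qq b) powr (- r)"
    using s r by (intro sob_weight_jbracket; simp)+
  have nn: "sob_weight s b \<ge> 0" "sob_weight s c \<ge> 0" by (auto intro: less_imp_le)
  have two: "(1::real) \<le> 2 powr s" using s by (intro ge_one_powr_ge_zero) auto
  show ?thesis
  proof (cases "freq_sq b \<le> freq_sq a / 4")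
    case True
    have "sqrt (freq_sq a) = 2 * sqrt (freq_sq a / 4)" by (simp add: real_sqrt_divide)
    also have "\<dots> \<le> 2 * sqrt (\<bar>freq_sq a - freq_sq b\<bar>)" using True freq_sq_nonneg[of b] freq_sq_nonneg[of a] abs_ge_self[of "freq_sq a - freq_sq b"]
      by (intro mult_left_mono real_sqrt_le_mono) linarith+
    finally have 1: "\<bar>xi (a + b + c)\<bar> \<le> 4 * \<bar>freq_sq a - freq_sq b\<bar> powr (1/2)"
      using xi0 by (simp add: powr_half_sqrt)
    have 2: "sob_weight s b * sob_weight s c * transv r s a b c = \<bar>freq_sq a - freq_sq b\<bar> powr (1/2) * (sob_weight s b * jbracket (qq b) powr (- r))"
    proof -
      have c: "sob_weight s c powr (- 1) = inverse (sob_weight s c)" "sob_weight s c \<noteq> 0"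
        using sob_weight_pos[of s c] by (simp_all add: powr_minus abs_of_pos less_imp_neq[symmetric])
      show ?thesis unfolding transv_def c(1) using c(2) by (simp add: mult_ac)
    qed
    have "\<bar>freq_sq a - freq_sq b\<bar> powr (1/2) * 1 \<le> \<bar>freq_sq a - freq_sq b\<bar> powr (1/2) * (sob_weight s b * jbracket (qq b) powr (- r))"
      using s1 by (intro mult_left_mono) auto
    then have "\<bar>xi (a + b + c)\<bar> \<le> 4 * (sob_weight s b * sob_weight s c * transv r s a b c)" using 1 2 by linarith
    also have "\<dots> \<le> (4 * 2 powr s) * (sob_weight s b * sob_weight s c * transv r s a b c)"
      using two nn by (intro mult_right_mono) auto
    also have "\<dots> = 4 * 2 powr s * (sob_weight s b * sob_weight s c) * transv r s a b c" by (simp add: mult_ac)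
    also have "\<dots> \<le> 4 * 2 powr s * (sob_weight s b * sob_weight s c) * (curv r a b c + curv r a c b + curv r b c a + transv r s a b c)"
      using nn by (intro mult_left_mono) auto
    finally show ?thesis .
  next
    case False
    \<comment> \<open>One pair sum carries at least half of the output frequency.\<close>
    define M where "M = Max {\<bar>xi a + xi b\<bar>, \<bar>xi a + xi c\<bar>, \<bar>xi b + xi c\<bar>}"
    have M: "\<bar>xi a + xi b\<bar> \<le> M" "\<bar>xi a + xi c\<bar> \<le> M" "\<bar>xi b + xi c\<bar> \<le> M" by (auto simp: M_def)
    have x: "\<bar>xi (a + b + c)\<bar> \<le> 2 * M" using M by auto
    have M0: "M \<ge> 0" using M(1) by linarith
    have bb: "n / 4 \<le> 1 + freq_sq b" using False by (simp add: n_def)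
    have sb: "sob_weight s b \<ge> (1/2) powr s * n powr (s/2)"
    proof -
      have "(n/4) powr (s/2) \<le> sob_weight s b" unfolding sob_weight_def using bb n s by (intro powr_mono2) auto
      moreover have "(n/4) powr (s/2) = (1/2) powr s * n powr (s/2)"
      proof -
        have "(n/4) powr (s/2) = (1/4) powr (s/2) * n powr (s/2)" using n by (subst powr_mult[symmetric]) auto
        also have "(1/4::real) powr (s/2) = ((1/2) powr 2) powr (s/2)" by (simp add: power2_eq_square)
        also have "\<dots> = (1/2) powr s" by (subst powr_powr) simp
        finally show ?thesis .
      qed
      ultimately show ?thesis by simp
    qed
    have jq: "n powr (- r/2) \<le> jbracket (qq d) powr (- r)" if "d = a \<or> d = b" for d
    proof -
      have "(qq d)\<^sup>2 \<le> freq_sq d" by (simp add: freq_sq_def)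
      moreover have "freq_sq d \<le> freq_sq a" using that o by auto
      ultimately have "1 + (qq d)\<^sup>2 \<le> n" by (simp add: n_def)
      then have "n powr (- r/2) \<le> (1 + (qq d)\<^sup>2) powr (- r / 2)"
        using s r by (intro powr_mono2') (auto simp: add_pos_nonneg)
      then show ?thesis by (simp add: jbracket_powr_sq)
    qed
    \<comment> \<open>The exponents add up to \<open>s/2 - r/2 = 1/4\<close>.\<close>
    have gain: "(1/2) powr s * n powr (1/4) \<le> sob_weight s b * jbracket (qq d) powr (- r)" if "d = a \<or> d = b" for d
    proof -
      have "(1/2) powr s * n powr (1/4) = ((1/2) powr s * n powr (s/2)) * n powr (- r/2)"
      proof -
        have "n powr (s/2) * n powr (- r/2) = n powr (1/4)" by (simp add: powr_add[symmetric] r field_simps)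
        then show ?thesis by (simp add: mult.assoc)
      qed
      also have "\<dots> \<le> sob_weight s b * jbracket (qq d) powr (- r)"
        by (intro mult_mono sb jq that) (auto simp: nn)
      finally show ?thesis .
    qed
    have x2: "\<bar>xi (a + b + c)\<bar> \<le> 2 * n powr (1/4) * M powr (1/2)"
    proof -
      have "\<bar>xi (a + b + c)\<bar> = \<bar>xi (a + b + c)\<bar> powr (1/2) * \<bar>xi (a + b + c)\<bar> powr (1/2)"
        by (simp add: powr_add[symmetric])
      also have "\<dots> \<le> (2 * n powr (1/2)) powr (1/2) * (2 * M) powr (1/2)"
      proof (intro mult_mono powr_mono2)
        have "sqrt (freq_sq a) \<le> n powr (1/2)" using n by (simp add: powr_half_sqrt n_def)
        then show "\<bar>xi (a + b + c)\<bar> \<le> 2 * n powr (1/2)" using xi0 by linarith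
      qed (use x in auto)
      also have "\<dots> = (2 powr (1/2) * 2 powr (1/2)) * (n powr (1/2)) powr (1/2) * M powr (1/2)"
        using n M0 by (simp add: powr_mult)
      also have "(2 powr (1/2) * 2 powr (1/2)) = (2::real)" by (simp add: powr_add[symmetric])
      also have "(n powr (1/2)) powr (1/2) = n powr (1/4)" by (simp add: powr_powr)
      finally show ?thesis .
    qed
    have fin: "\<bar>xi (a + b + c)\<bar> \<le> 4 * 2 powr s * (sob_weight s b * sob_weight s c) * A"
      if A: "A = M powr (1/2) * jbracket (qq d) powr (- r) * jbracket (qq c) powr (- r)" and d: "d = a \<or> d = b" for A d
    proof -
      have "n powr (1/4) = 2 powr s * ((1/2) powr s * n powr (1/4))"
        by (simp add: mult.assoc[symmetric] powr_mult[symmetric])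
      also have "\<dots> \<le> 2 powr s * ((sob_weight s b * jbracket (qq d) powr (- r)) * (sob_weight s c * jbracket (qq c) powr (- r)))"
      proof (rule mult_left_mono)
        have "(1/2) powr s * n powr (1/4) * 1 \<le> (sob_weight s b * jbracket (qq d) powr (- r)) * (sob_weight s c * jbracket (qq c) powr (- r))"
          by (rule mult_mono[OF gain[OF d] s1(1)]) (use nn in auto)
        then show "(1/2) powr s * n powr (1/4) \<le> (sob_weight s b * jbracket (qq d) powr (- r)) * (sob_weight s c * jbracket (qq c) powr (- r))" by simp
      qed simp
      finally have g: "n powr (1/4) \<le> 2 powr s * ((sob_weight s b * jbracket (qq d) powr (- r)) * (sob_weight s c * jbracket (qq c) powr (- r)))" .
      have "\<bar>xi (a + b + c)\<bar> \<le> (2 * M powr (1/2)) * n powr (1/4)" using x2 by (simp add: mult_ac)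
      also have "\<dots> \<le> (4 * M powr (1/2)) * (2 powr s * ((sob_weight s b * jbracket (qq d) powr (- r)) * (sob_weight s c * jbracket (qq c) powr (- r))))"
        using g by (intro mult_mono) auto
      also have "\<dots> = 4 * 2 powr s * (sob_weight s b * sob_weight s c) * A" unfolding A by (simp add: mult_ac)
      finally show ?thesis .
    qed
    have up: "4 * 2 powr s * (sob_weight s b * sob_weight s c) * A \<le> 4 * 2 powr s * (sob_weight s b * sob_weight s c) * (curv r a b c + curv r a c b + curv r b c a + transv r s a b c)"
      if "A = curv r a b c \<or> A = curv r a c b \<or> A = curv r b c a" for A
      using that nn by (intro mult_left_mono) auto
    have "M \<in> {\<bar>xi a + xi b\<bar>, \<bar>xi a + xi c\<bar>, \<bar>xi b + xi c\<bar>}"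
      unfolding M_def by (rule Max_in) auto
    then consider "M = \<bar>xi a + xi b\<bar>" | "M = \<bar>xi a + xi c\<bar>" | "M = \<bar>xi b + xi c\<bar>" by blast
    then show ?thesis
    proof cases
      case 1
      from fin[of "curv r a b c" b] 1 have "\<bar>xi (a + b + c)\<bar> \<le> 4 * 2 powr s * (sob_weight s b * sob_weight s c) * curv r a b c"
        by (simp add: curv_def)
      then show ?thesis using up[of "curv r a b c"] by linarith
    next
      case 2
      from fin[of "curv r a c b" b] 2 have "\<bar>xi (a + b + c)\<bar> \<le> 4 * 2 powr s * (sob_weight s b * sob_weight s c) * curv r a c b"
        by (simp add: curv_def mult_ac)
      then show ?thesis using up[of "curv r a c b"] by linarith
    next
      case 3
      from fin[of "curv r b c a" a] 3 have "\<bar>xi (a + b + c)\<bar> \<le> 4 * 2 powr s * (sob_weight s b * sob_weight s c) * curv r b c a"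
        by (simp add: curv_def mult_ac)
      then show ?thesis using up[of "curv r b c a"] by linarith
    qed
  qed
qed

definition ker :: "real \<Rightarrow> real \<Rightarrow> freq \<Rightarrow> freq \<Rightarrow> freq \<Rightarrow> real" where
  "ker r s a b c = curv r a b c + transv r s a b c"

definition ker_sym :: "real \<Rightarrow> real \<Rightarrow> freq \<Rightarrow> freq \<Rightarrow> freq \<Rightarrow> real" where
  "ker_sym r s a b c = ((ker r s a b c + ker r s b a c) + (ker r s a c b + ker r s b c a)) + (ker r s c a b + ker r s c b a)"

lemma ker_nonneg [simp]: "ker r s a b c \<ge> 0" by (simp add: ker_def)

text \<open>The output frequency is at most three times the largest input frequency, so \<open>m(a)\<close> absorbs the
  weight of the output at the cost of \<open>3 powr s\<close>.\<close>

lemma multiplier_le_ordered: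
  assumes s: "s > 1" and r: "r = s - 1/2"
    and o: "freq_sq b \<le> freq_sq a" "freq_sq c \<le> freq_sq b"
  shows "\<bar>xi (a + b + c)\<bar> * sob_weight s (a + b + c) \<le> 4 * 6 powr s * (sob_weight s a * sob_weight s b * sob_weight s c) * ker_sym r s a b c"
proof -
  have s0: "sob_weight s (a + b + c) \<le> 3 powr s * sob_weight s a"
  proof -
    have "1 + freq_sq (a + b + c) \<le> 9 * (1 + freq_sq a)" using freq_sq_add3[of a b c] o by simp
    then have "sob_weight s (a + b + c) \<le> (9 * (1 + freq_sq a)) powr (s/2)"
      unfolding sob_weight_def using s by (intro powr_mono2) auto
    also have "\<dots> = 9 powr (s/2) * sob_weight s a" unfolding sob_weight_def by (rule powr_mult)
    also have "(9::real) powr (s/2) = (3 powr 2) powr (s/2)" by simp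
    also have "\<dots> = 3 powr s" by (subst powr_powr) simp
    finally show ?thesis .
  qed
  have k: "curv r a b c + curv r a c b + curv r b c a + transv r s a b c \<le> ker_sym r s a b c"
    using curv_transv_nonneg[of r _ _ _] curv_transv_nonneg(2)[of r s _ _ _] unfolding ker_sym_def ker_def
    by (simp add: add_increasing add_increasing2)
  have nn: "sob_weight s a \<ge> 0" "sob_weight s b \<ge> 0" "sob_weight s c \<ge> 0" "sob_weight s (a + b + c) \<ge> 0" by (auto intro: less_imp_le)
  have "\<bar>xi (a + b + c)\<bar> * sob_weight s (a + b + c) \<le> (4 * 2 powr s * (sob_weight s b * sob_weight s c) * ker_sym r s a b c) * (3 powr s * sob_weight s a)"
  proof (rule mult_mono)
    show "\<bar>xi (a + b + c)\<bar> \<le> 4 * 2 powr s * (sob_weight s b * sob_weight s c) * ker_sym r s a b c"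
      using xi_le_ordered[OF s r o] by (rule order_trans) (intro mult_left_mono k mult_nonneg_nonneg nn, simp_all)
  qed (use s0 nn in \<open>auto simp: ker_sym_def intro!: mult_nonneg_nonneg add_nonneg_nonneg\<close>)
  also have "\<dots> = 4 * (2 powr s * 3 powr s) * (sob_weight s a * sob_weight s b * sob_weight s c) * ker_sym r s a b c" by (simp add: mult_ac)
  also have "2 powr s * 3 powr s = (6::real) powr s" by (simp add: powr_mult[symmetric])
  finally show ?thesis .
qed

lemma multiplier_le:
  assumes s: "s > 1" and r: "r = s - 1/2"
  shows "\<bar>xi (a + b + c)\<bar> * sob_weight s (a + b + c) \<le> 4 * 6 powr s * (sob_weight s a * sob_weight s b * sob_weight s c) * ker_sym r s a b c"
proof -
  have *: ?thesis if "a + b + c = x + y + z" "sob_weight s a * sob_weight s b * sob_weight s c = sob_weight s x * sob_weight s y * sob_weight s z" "ker_sym r s a b c = ker_sym r s x y z"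
    "freq_sq y \<le> freq_sq x" "freq_sq z \<le> freq_sq y" for x y z
    using multiplier_le_ordered[OF s r that(4,5)] that by (simp only:)
  consider "freq_sq b \<le> freq_sq a \<and> freq_sq c \<le> freq_sq b" | "freq_sq c \<le> freq_sq a \<and> freq_sq b \<le> freq_sq c"
    | "freq_sq a \<le> freq_sq b \<and> freq_sq c \<le> freq_sq a" | "freq_sq c \<le> freq_sq b \<and> freq_sq a \<le> freq_sq c"
    | "freq_sq a \<le> freq_sq c \<and> freq_sq b \<le> freq_sq a" | "freq_sq b \<le> freq_sq c \<and> freq_sq a \<le> freq_sq b"
    by linarith
  then show ?thesis
  proof cases
    case 1 then show ?thesis using multiplier_le_ordered[OF s r] by blast
  next
    case 2 then show ?thesis by (intro *[of a c b]) (auto simp: ker_sym_def add_ac mult_ac)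
  next
    case 3 then show ?thesis by (intro *[of b a c]) (auto simp: ker_sym_def add_ac mult_ac)
  next
    case 4 then show ?thesis by (intro *[of b c a]) (auto simp: ker_sym_def add_ac mult_ac)
  next
    case 5 then show ?thesis by (intro *[of c a b]) (auto simp: ker_sym_def add_ac mult_ac)
  next
    case 6 then show ?thesis by (intro *[of c b a]) (auto simp: ker_sym_def add_ac mult_ac)
  qed
qed

text \<open>The terms of \<open>ker_sym\<close> have their arguments permuted. Together with the inputs they become integrals
  of one and the same kernel against the inputs in a different order.\<close>

lemma tri_permutations:
  assumes g: "tri_meas g"
  shows "tri (\<lambda>a b c. g b a c) \<zeta> = tri g \<zeta>" "tri (\<lambda>a b c. g a c b) \<zeta> = tri g \<zeta>"
    "tri (\<lambda>a b c. g b c a) \<zeta> = tri g \<zeta>" "tri (\<lambda>a b c. g c a b) \<zeta> = tri g \<zeta>"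
    "tri (\<lambda>a b c. g c b a) \<zeta> = tri g \<zeta>"
proof -
  have p: "tri_meas (\<lambda>a b c. g b a c)" "tri_meas (\<lambda>a b c. g a c b)" "tri_meas (\<lambda>a b c. g b c a)"
    unfolding tri_meas_def by (rule tri_meas_comp[OF g]; measurable)+
  show "tri (\<lambda>a b c. g b a c) \<zeta> = tri g \<zeta>" by (rule tri_swap12[OF g])
  show "tri (\<lambda>a b c. g a c b) \<zeta> = tri g \<zeta>" by (rule tri_swap23[OF g])
  show 3: "tri (\<lambda>a b c. g b c a) \<zeta> = tri g \<zeta>"
    using tri_swap12[OF p(2), of \<zeta>] tri_swap23[OF g, of \<zeta>] by simp
  show "tri (\<lambda>a b c. g c a b) \<zeta> = tri g \<zeta>"
    using tri_swap23[OF p(1), of \<zeta>] tri_swap12[OF g, of \<zeta>] by simp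
  show "tri (\<lambda>a b c. g c b a) \<zeta> = tri g \<zeta>"
    using tri_swap23[OF p(3), of \<zeta>] 3 by simp
qed

lemma core_estimate:
  assumes "s > 1" "b > 1/2" "p > 1/2" "p \<le> 2 * b" and r: "r = s - 1/2"
  obtains C where "C < (\<infinity>::ennreal)"
   "\<And>F G H. F \<in> borel_measurable borel \<Longrightarrow> G \<in> borel_measurable borel \<Longrightarrow> H \<in> borel_measurable borel \<Longrightarrow>
     sqnorm (\<lambda>\<eta>. ennreal (mod_weight (p/2) \<eta>) * tri (\<lambda>x y z. ennreal (ker r s x y z * mod_weight b x * mod_weight b y * mod_weight b z) * (F x * (G y * H z))) \<eta>) \<le>
      C * (sqnorm F * sqnorm G * sqnorm H)"
proof -
  let ?T = "\<lambda>k F G H \<eta>. ennreal (mod_weight (p/2) \<eta>) * tri (\<lambda>x y z. ennreal (k x y z * mod_weight b x * mod_weight b y * mod_weight b z) * (F x * (G y * H z))) \<eta>"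
  have r2: "r > 1/2" "p \<ge> 0" using assms by auto
  obtain C1 where C1: "C1 < (\<infinity>::ennreal)"
   "\<And>F G H. F \<in> borel_measurable borel \<Longrightarrow> G \<in> borel_measurable borel \<Longrightarrow> H \<in> borel_measurable borel \<Longrightarrow>
     sqnorm (?T (curv r) F G H) \<le> C1 * (sqnorm F * sqnorm G * sqnorm H)"
    by (rule core_curv[OF r2(1) assms(2-4)]) (rule that)
  obtain C2 where C2: "C2 < (\<infinity>::ennreal)"
   "\<And>F G H. F \<in> borel_measurable borel \<Longrightarrow> G \<in> borel_measurable borel \<Longrightarrow> H \<in> borel_measurable borel \<Longrightarrow>
     sqnorm (?T (transv r s) F G H) \<le> C2 * (sqnorm F * sqnorm G * sqnorm H)"
    by (rule core_transv[OF r2(1) assms(2) r2(2) assms(1)]) (rule that)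
  show thesis
  proof
    show "2 * C1 + 2 * C2 < \<infinity>" using C1 C2 by (simp add: ennreal_mult_less_top)
    fix F G H :: "freq \<Rightarrow> ennreal"
    assume m[measurable]: "F \<in> borel_measurable borel" "G \<in> borel_measurable borel" "H \<in> borel_measurable borel"
    have ma: "tri_meas (\<lambda>x y z. ennreal (curv r x y z * mod_weight b x * mod_weight b y * mod_weight b z) * (F x * (G y * H z)))"
      unfolding tri_meas_def curv_def by measurable
    have mb: "tri_meas (\<lambda>x y z. ennreal (transv r s x y z * mod_weight b x * mod_weight b y * mod_weight b z) * (F x * (G y * H z)))"
      unfolding tri_meas_def transv_def by measurable
    have e: "ennreal (ker r s x y z * mod_weight b x * mod_weight b y * mod_weight b z) * (F x * (G y * H z)) =
      ennreal (curv r x y z * mod_weight b x * mod_weight b y * mod_weight b z) * (F x * (G y * H z)) +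
      ennreal (transv r s x y z * mod_weight b x * mod_weight b y * mod_weight b z) * (F x * (G y * H z))" for x y z
      by (simp add: ker_def distrib_right ennreal_plus)
    have "?T (ker r s) F G H = (\<lambda>\<eta>. ?T (curv r) F G H \<eta> + ?T (transv r s) F G H \<eta>)"
      unfolding e tri_add[OF ma mb] by (simp add: distrib_left)
    then have "sqnorm (?T (ker r s) F G H) \<le> 2 * sqnorm (?T (curv r) F G H) + 2 * sqnorm (?T (transv r s) F G H)"
      using ma mb by (simp only:) (rule sqnorm_add; intro borel_measurable_times_ennreal tri_measurable; measurable)
    also have "\<dots> \<le> 2 * (C1 * (sqnorm F * sqnorm G * sqnorm H)) + 2 * (C2 * (sqnorm F * sqnorm G * sqnorm H))"
      by (intro add_mono mult_left_mono C1 C2 m) auto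
    also have "\<dots> = (2 * C1 + 2 * C2) * (sqnorm F * sqnorm G * sqnorm H)"
      by (simp add: distrib_right mult.assoc)
    finally show "sqnorm (?T (ker r s) F G H) \<le> (2 * C1 + 2 * C2) * (sqnorm F * sqnorm G * sqnorm H)" .
  qed
qed

lemma sqnorm_add_bound:
  assumes "F \<in> borel_measurable borel" "G \<in> borel_measurable borel" "sqnorm F \<le> A" "sqnorm G \<le> A"
  shows "sqnorm (\<lambda>\<zeta>. F \<zeta> + G \<zeta>) \<le> 4 * A"
proof -
  have "sqnorm (\<lambda>\<zeta>. F \<zeta> + G \<zeta>) \<le> 2 * sqnorm F + 2 * sqnorm G" by (rule sqnorm_add) fact+
  also have "\<dots> \<le> 2 * A + 2 * A" by (intro add_mono mult_left_mono assms) auto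
  also have "\<dots> = (2 + 2) * A" by (simp only: distrib_right)
  finally show ?thesis by simp
qed

text \<open>This is the assertion on the Fourier side, for \<open>p/2 = 1/2 - 3 \<delta>\<close> and \<open>b = 1/2 + \<delta>\<close>. The modulation
  weights and \<open>m\<close> are moved from the kernel to the inputs, the symbol is bounded by the symmetrized kernel, and
  the six resulting terms all satisfy the bound for the ordered kernel.\<close>

theorem trilinear_estimate:
  assumes "s > 1" "b > 1/2" "p > 1/2" "p \<le> 2 * b"
  obtains C where "C < (\<infinity>::ennreal)"
   "\<And>A1 A2 A3. A1 \<in> borel_measurable borel \<Longrightarrow> A2 \<in> borel_measurable borel \<Longrightarrow> A3 \<in> borel_measurable borel \<Longrightarrow>
     sqnorm (\<lambda>\<eta>. ennreal (\<bar>xi \<eta>\<bar> * mod_weight (p/2) \<eta> * sob_weight s \<eta>) * tri (\<lambda>x y z. A1 x * (A2 y * A3 z)) \<eta>) \<le>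
      C * (sqnorm (\<lambda>\<zeta>. ennreal (mod_weight (- b) \<zeta> * sob_weight s \<zeta>) * A1 \<zeta>) * sqnorm (\<lambda>\<zeta>. ennreal (mod_weight (- b) \<zeta> * sob_weight s \<zeta>) * A2 \<zeta>) *
        sqnorm (\<lambda>\<zeta>. ennreal (mod_weight (- b) \<zeta> * sob_weight s \<zeta>) * A3 \<zeta>))"
proof -
  define r where "r = s - 1/2"
  let ?w = "\<lambda>\<eta>. ennreal (mod_weight (p/2) \<eta>)"
  let ?h = "\<lambda>F G H x y z. ennreal (ker r s x y z * mod_weight b x * mod_weight b y * mod_weight b z) * (F x * (G y * H z))"
  obtain C where C: "C < (\<infinity>::ennreal)"
   "\<And>F G H. F \<in> borel_measurable borel \<Longrightarrow> G \<in> borel_measurable borel \<Longrightarrow> H \<in> borel_measurable borel \<Longrightarrow>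
     sqnorm (\<lambda>\<eta>. ?w \<eta> * tri (?h F G H) \<eta>) \<le> C * (sqnorm F * sqnorm G * sqnorm H)"
    by (rule core_estimate[OF assms r_def]) (rule that)
  define C0 where "C0 = ennreal (4 * 6 powr s)"
  show thesis
  proof
    show "C0\<^sup>2 * (4 * (4 * (4 * C))) < \<infinity>" using C by (simp add: ennreal_mult_less_top C0_def ennreal_power)
    fix A1 A2 A3 :: "freq \<Rightarrow> ennreal"
    assume [measurable]: "A1 \<in> borel_measurable borel" "A2 \<in> borel_measurable borel" "A3 \<in> borel_measurable borel"
    define W where "W \<zeta> = ennreal (mod_weight (- b) \<zeta> * sob_weight s \<zeta>)" for \<zeta>
    define F1 where "F1 \<zeta> = W \<zeta> * A1 \<zeta>" for \<zeta>
    define F2 where "F2 \<zeta> = W \<zeta> * A2 \<zeta>" for \<zeta>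
    define F3 where "F3 \<zeta> = W \<zeta> * A3 \<zeta>" for \<zeta>
    have [measurable]: "W \<in> borel_measurable borel" unfolding W_def by measurable
    have m[measurable]: "F1 \<in> borel_measurable borel" "F2 \<in> borel_measurable borel" "F3 \<in> borel_measurable borel"
      unfolding F1_def F2_def F3_def by measurable
    define N where "N = sqnorm F1 * sqnorm F2 * sqnorm F3"
    have hm: "tri_meas (?h F G H)" if [measurable]: "F \<in> borel_measurable borel" "G \<in> borel_measurable borel" "H \<in> borel_measurable borel" for F G H
      unfolding tri_meas_def ker_def curv_def transv_def by measurable
    note hms = hm[OF m(1) m(2) m(3)] hm[OF m(2) m(1) m(3)] hm[OF m(1) m(3) m(2)] hm[OF m(2) m(3) m(1)] hm[OF m(3) m(1) m(2)] hm[OF m(3) m(2) m(1)]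
    let ?k = "\<lambda>x y z. ker r s x y z * mod_weight b x * mod_weight b y * mod_weight b z"
    let ?X = "\<lambda>F G H \<eta>. ?w \<eta> * tri (?h F G H) \<eta>"
    have Xm: "?X F G H \<in> borel_measurable borel" if "F \<in> borel_measurable borel" "G \<in> borel_measurable borel" "H \<in> borel_measurable borel" for F G H
      using tri_measurable[OF hm[OF that]] by measurable
    note Xms = Xm[OF m(1) m(2) m(3)] Xm[OF m(2) m(1) m(3)] Xm[OF m(1) m(3) m(2)] Xm[OF m(2) m(3) m(1)] Xm[OF m(3) m(1) m(2)] Xm[OF m(3) m(2) m(1)]
    have Xb: "sqnorm (?X F1 F2 F3) \<le> C * N" "sqnorm (?X F2 F1 F3) \<le> C * N" "sqnorm (?X F1 F3 F2) \<le> C * N"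
      "sqnorm (?X F2 F3 F1) \<le> C * N" "sqnorm (?X F3 F1 F2) \<le> C * N" "sqnorm (?X F3 F2 F1) \<le> C * N"
      using C(2)[OF m(1) m(2) m(3)] C(2)[OF m(2) m(1) m(3)] C(2)[OF m(1) m(3) m(2)] C(2)[OF m(2) m(3) m(1)] C(2)[OF m(3) m(1) m(2)] C(2)[OF m(3) m(2) m(1)]
      by (simp_all only: N_def mult_ac)
    let ?S = "\<lambda>\<eta>. ((?X F1 F2 F3 \<eta> + ?X F2 F1 F3 \<eta>) + (?X F1 F3 F2 \<eta> + ?X F2 F3 F1 \<eta>)) + (?X F3 F1 F2 \<eta> + ?X F3 F2 F1 \<eta>)"
    let ?A = "\<lambda>x y z. A1 x * (A2 y * A3 z)"
    have Am: "tri_meas ?A" unfolding tri_meas_def by measurable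
    \<comment> \<open>The weights of the inputs cancel against those that were put into the \<open>F\<close>s.\<close>
    have AF: "A1 x * (A2 y * A3 z) * ennreal (sob_weight s x * sob_weight s y * sob_weight s z) = ennreal (mod_weight b x * mod_weight b y * mod_weight b z) * (F1 x * (F2 y * F3 z))" for x y z
    proof -
      have c: "mod_weight b u * mod_weight (- b) u = 1" for u
      proof -
        have "jbracket (modulation u) \<noteq> 0" by (metis less_irrefl jbracket_pos)
        then show ?thesis by (simp add: mod_weight_def powr_add[symmetric])
      qed
      have "mod_weight b x * mod_weight b y * mod_weight b z * ((mod_weight (- b) x * sob_weight s x) * ((mod_weight (- b) y * sob_weight s y) * (mod_weight (- b) z * sob_weight s z))) = 
        (mod_weight b x * mod_weight (- b) x) * (mod_weight b y * mod_weight (- b) y) * (mod_weight b z * mod_weight (- b) z) * (sob_weight s x * sob_weight s y * sob_weight s z)"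
        by (simp only: mult_ac)
      then have "ennreal (mod_weight b x * mod_weight b y * mod_weight b z) * (W x * (W y * W z)) = ennreal (sob_weight s x * sob_weight s y * sob_weight s z)"
        unfolding W_def c by (simp add: ennreal_mult[symmetric] less_imp_le)
      moreover have "ennreal (mod_weight b x * mod_weight b y * mod_weight b z) * (F1 x * (F2 y * F3 z)) = 
        (A1 x * (A2 y * A3 z)) * (ennreal (mod_weight b x * mod_weight b y * mod_weight b z) * (W x * (W y * W z)))"
        unfolding F1_def F2_def F3_def by (simp only: mult_ac)
      ultimately show ?thesis by simp
    qed
    have le: "ennreal (\<bar>xi \<eta>\<bar> * mod_weight (p/2) \<eta> * sob_weight s \<eta>) * tri ?A \<eta> \<le> C0 * ?S \<eta>" for \<eta>
    proof -
      let ?t1 = "\<lambda>x y z. ?h F1 F2 F3 x y z" and ?t2 = "\<lambda>x y z. ?h F2 F1 F3 y x z" and ?t3 = "\<lambda>x y z. ?h F1 F3 F2 x z y"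
       and ?t4 = "\<lambda>x y z. ?h F2 F3 F1 y z x" and ?t5 = "\<lambda>x y z. ?h F3 F1 F2 z x y" and ?t6 = "\<lambda>x y z. ?h F3 F2 F1 z y x"
      have tm: "tri_meas ?t1" "tri_meas ?t2" "tri_meas ?t3" "tri_meas ?t4" "tri_meas ?t5" "tri_meas ?t6"
        unfolding tri_meas_def ker_def curv_def transv_def by measurable
      have tm12: "tri_meas (\<lambda>x y z. ?t1 x y z + ?t2 x y z)" "tri_meas (\<lambda>x y z. ?t3 x y z + ?t4 x y z)" "tri_meas (\<lambda>x y z. ?t5 x y z + ?t6 x y z)"
        "tri_meas (\<lambda>x y z. (?t1 x y z + ?t2 x y z) + (?t3 x y z + ?t4 x y z))"
        "tri_meas (\<lambda>x y z. ((?t1 x y z + ?t2 x y z) + (?t3 x y z + ?t4 x y z)) + (?t5 x y z + ?t6 x y z))"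
        using tm unfolding tri_meas_def by (auto intro!: borel_measurable_add)
      have w_eq: "ennreal (\<bar>xi \<eta>\<bar> * mod_weight (p/2) \<eta> * sob_weight s \<eta>) * tri ?A \<eta> = ?w \<eta> * (ennreal (\<bar>xi \<eta>\<bar> * sob_weight s \<eta>) * tri ?A \<eta>)"
        by (simp add: ennreal_mult mult_ac less_imp_le)
      have "ennreal (\<bar>xi \<eta>\<bar> * sob_weight s \<eta>) * tri ?A \<eta> = tri (\<lambda>x y z. ennreal (\<bar>xi \<eta>\<bar> * sob_weight s \<eta>) * ?A x y z) \<eta>"
        by (rule tri_cmult[OF Am, symmetric])
      also have "\<dots> \<le> tri (\<lambda>x y z. C0 * (((?t1 x y z + ?t2 x y z) + (?t3 x y z + ?t4 x y z)) + (?t5 x y z + ?t6 x y z))) \<eta>"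
        unfolding tri_def
      proof (intro nn_integral_mono)
        fix y z
        define x where "x = \<eta> - z - y"
        have eta: "\<eta> = x + y + z" by (simp add: x_def)
        have "ennreal (\<bar>xi \<eta>\<bar> * sob_weight s \<eta>) * ?A x y z \<le> ennreal (4 * 6 powr s * (sob_weight s x * sob_weight s y * sob_weight s z) * ker_sym r s x y z) * ?A x y z"
          unfolding eta by (intro mult_right_mono ennreal_leI multiplier_le[OF assms(1) r_def]) simp
        also have "\<dots> = C0 * ennreal (ker_sym r s x y z) * (A1 x * (A2 y * A3 z) * ennreal (sob_weight s x * sob_weight s y * sob_weight s z))"
          unfolding C0_def by (simp add: ennreal_mult less_imp_le ker_sym_def mult_ac)
        also have "\<dots> = C0 * (ennreal (ker_sym r s x y z) * ennreal (mod_weight b x * mod_weight b y * mod_weight b z) * (F1 x * (F2 y * F3 z)))"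
          unfolding AF by (simp only: mult.assoc)
        finally have fin: "ennreal (\<bar>xi \<eta>\<bar> * sob_weight s \<eta>) * ?A x y z \<le> C0 * (ennreal (ker_sym r s x y z) * ennreal (mod_weight b x * mod_weight b y * mod_weight b z) * (F1 x * (F2 y * F3 z)))" .
        have k6: "ennreal (ker_sym r s x y z) * ennreal (mod_weight b x * mod_weight b y * mod_weight b z) * (F1 x * (F2 y * F3 z)) =
          (((?t1 x y z + ?t2 x y z) + (?t3 x y z + ?t4 x y z)) + (?t5 x y z + ?t6 x y z))"
        proof -
          define m where "m = mod_weight b x * mod_weight b y * mod_weight b z"
          have t: "?t1 x y z = ennreal (ker r s x y z) * ennreal m * (F1 x * (F2 y * F3 z))"
            "?t2 x y z = ennreal (ker r s y x z) * ennreal m * (F1 x * (F2 y * F3 z))"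
            "?t3 x y z = ennreal (ker r s x z y) * ennreal m * (F1 x * (F2 y * F3 z))"
            "?t4 x y z = ennreal (ker r s y z x) * ennreal m * (F1 x * (F2 y * F3 z))"
            "?t5 x y z = ennreal (ker r s z x y) * ennreal m * (F1 x * (F2 y * F3 z))"
            "?t6 x y z = ennreal (ker r s z y x) * ennreal m * (F1 x * (F2 y * F3 z))"
            unfolding m_def by (simp_all add: ennreal_mult mult_ac)
          show ?thesis unfolding t unfolding m_def[symmetric] ker_sym_def
            by (simp add: distrib_right)
        qed
        show "ennreal (\<bar>xi \<eta>\<bar> * sob_weight s \<eta>) * ?A (\<eta> - z - y) y z \<le> C0 * (((?t1 (\<eta> - z - y) y z + ?t2 (\<eta> - z - y) y z) + (?t3 (\<eta> - z - y) y z + ?t4 (\<eta> - z - y) y z)) + (?t5 (\<eta> - z - y) y z + ?t6 (\<eta> - z - y) y z))"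
          using fin unfolding k6 unfolding x_def .
      qed
      also have "\<dots> = C0 * (((tri ?t1 \<eta> + tri ?t2 \<eta>) + (tri ?t3 \<eta> + tri ?t4 \<eta>)) + (tri ?t5 \<eta> + tri ?t6 \<eta>))"
        unfolding tri_cmult[OF tm12(5)] tri_add[OF tm12(4) tm12(3)] tri_add[OF tm12(1) tm12(2)] tri_add[OF tm(1) tm(2)] tri_add[OF tm(3) tm(4)] tri_add[OF tm(5) tm(6)] ..
      also have "\<dots> = C0 * (((tri (?h F1 F2 F3) \<eta> + tri (?h F2 F1 F3) \<eta>) + (tri (?h F1 F3 F2) \<eta> + tri (?h F2 F3 F1) \<eta>)) + (tri (?h F3 F1 F2) \<eta> + tri (?h F3 F2 F1) \<eta>))"
        unfolding tri_permutations(1)[OF hms(2)] tri_permutations(2)[OF hms(3)] tri_permutations(3)[OF hms(4)]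
          tri_permutations(4)[OF hms(5)] tri_permutations(5)[OF hms(6)] ..
      finally have "ennreal (\<bar>xi \<eta>\<bar> * sob_weight s \<eta>) * tri ?A \<eta> \<le> \<dots>" .
      then have "?w \<eta> * (ennreal (\<bar>xi \<eta>\<bar> * sob_weight s \<eta>) * tri ?A \<eta>) \<le> ?w \<eta> * (C0 * (((tri (?h F1 F2 F3) \<eta> + tri (?h F2 F1 F3) \<eta>) + (tri (?h F1 F3 F2) \<eta> + tri (?h F2 F3 F1) \<eta>)) + (tri (?h F3 F1 F2) \<eta> + tri (?h F3 F2 F1) \<eta>)))"
        by (rule mult_left_mono) simp
      also have "\<dots> = C0 * ?S \<eta>" by (simp only: distrib_left mult.left_commute[of "?w \<eta>"])
      finally show ?thesis unfolding w_eq .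
    qed
    have "sqnorm (\<lambda>\<eta>. ennreal (\<bar>xi \<eta>\<bar> * mod_weight (p/2) \<eta> * sob_weight s \<eta>) * tri ?A \<eta>) \<le> sqnorm (\<lambda>\<eta>. C0 * ?S \<eta>)"
      by (rule sqnorm_mono) (rule le)
    also have "\<dots> = C0\<^sup>2 * sqnorm ?S"
      by (rule sqnorm_cmult) (intro borel_measurable_add Xms)
    \<comment> \<open>A sum of two terms costs a factor of \<open>4\<close>; the six terms are summed in three rounds.\<close>
    also have "\<dots> \<le> C0\<^sup>2 * (4 * (4 * (4 * (C * N))))"
    proof (rule mult_left_mono)
      have 1: "sqnorm (\<lambda>\<eta>. ?X F1 F2 F3 \<eta> + ?X F2 F1 F3 \<eta>) \<le> 4 * (C * N)" "sqnorm (\<lambda>\<eta>. ?X F1 F3 F2 \<eta> + ?X F2 F3 F1 \<eta>) \<le> 4 * (C * N)"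
        "sqnorm (\<lambda>\<eta>. ?X F3 F1 F2 \<eta> + ?X F3 F2 F1 \<eta>) \<le> 4 * (C * N)"
        by (intro sqnorm_add_bound Xms Xb)+
      have 2: "sqnorm (\<lambda>\<eta>. (?X F1 F2 F3 \<eta> + ?X F2 F1 F3 \<eta>) + (?X F1 F3 F2 \<eta> + ?X F2 F3 F1 \<eta>)) \<le> 4 * (4 * (C * N))"
        by (intro sqnorm_add_bound 1 borel_measurable_add Xms)
      have "4 * (C * N) * 1 \<le> 4 * (C * N) * 4" by (intro mult_left_mono) auto
      then have 3: "4 * (C * N) \<le> 4 * (4 * (C * N))" by (simp add: mult_ac)
      show "sqnorm ?S \<le> 4 * (4 * (4 * (C * N)))"
        by (intro sqnorm_add_bound 2 order_trans[OF 1(3) 3] borel_measurable_add Xms)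
    qed simp
    also have "\<dots> = (C0\<^sup>2 * (4 * (4 * (4 * C)))) * N" by (simp only: mult.assoc)
    finally show "sqnorm (\<lambda>\<eta>. ennreal (\<bar>xi \<eta>\<bar> * mod_weight (p/2) \<eta> * sob_weight s \<eta>) * tri ?A \<eta>) \<le> (C0\<^sup>2 * (4 * (4 * (4 * C)))) * 
      (sqnorm (\<lambda>\<zeta>. ennreal (mod_weight (- b) \<zeta> * sob_weight s \<zeta>) * A1 \<zeta>) * sqnorm (\<lambda>\<zeta>. ennreal (mod_weight (- b) \<zeta> * sob_weight s \<zeta>) * A2 \<zeta>) *
        sqnorm (\<lambda>\<zeta>. ennreal (mod_weight (- b) \<zeta> * sob_weight s \<zeta>) * A3 \<zeta>))"
      unfolding N_def F1_def F2_def F3_def W_def .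
  qed
qed

section \<open>Rapidly decreasing functions\<close>

text \<open>A common form of the Schwartz classes in \<open>(t, x, y)\<close> and in \<open>(\<tau>, \<xi>, q)\<close>: the functions that lie
  in some family of continuous functions decaying faster than every power of \<open>w\<close>, closed under
  the derivatives along the translations \<open>sh\<close>. As the largest such family it comes with a
  coinduction rule. To show that a transform maps one class into the other it is enough
  to exhibit the image as a closed family; no formula for iterated derivatives is needed.\<close>

definition rapid :: "('i::euclidean_space \<Rightarrow> real \<Rightarrow> 'a \<Rightarrow> 'a) \<Rightarrow> ('a \<Rightarrow> real) \<Rightarrow> ('a::topological_space \<Rightarrow> complex) set" where
  "rapid sh w = \<Union>{S. \<forall>f\<in>S. continuous_on UNIV f \<and> (\<forall>N::nat. \<exists>C. \<forall>z. w z ^ N * cmod (f z) \<le> C) \<and>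
     (\<forall>e\<in>Basis. \<exists>f'\<in>S. \<forall>z. ((\<lambda>h. f (sh e h z)) has_vector_derivative f' z) (at 0))}"

lemma rapid_coinduct:
  assumes "f \<in> S"
    and "\<And>f. f \<in> S \<Longrightarrow> continuous_on UNIV f"
    and "\<And>f N. f \<in> S \<Longrightarrow> \<exists>C. \<forall>z. w z ^ N * cmod (f z) \<le> C"
    and "\<And>f e. f \<in> S \<Longrightarrow> e \<in> Basis \<Longrightarrow> \<exists>f'\<in>S. \<forall>z. ((\<lambda>h. f (sh e h z)) has_vector_derivative f' z) (at 0)"
  shows "f \<in> rapid sh w"
  unfolding rapid_def using assms by (intro UnionI[of S]) auto

lemma rapid_continuous: "f \<in> rapid sh w \<Longrightarrow> continuous_on UNIV f"
  unfolding rapid_def by auto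

lemma rapid_decay:
  assumes "f \<in> rapid sh w"
  obtains C where "C \<ge> 0" "\<And>z. w z ^ N * cmod (f z) \<le> C"
proof -
  from assms have "\<exists>C. \<forall>z. w z ^ N * cmod (f z) \<le> C" unfolding rapid_def by auto
  then obtain C where "\<forall>z. w z ^ N * cmod (f z) \<le> C" ..
  then show thesis by (intro that[of "max C 0"]) (auto simp: le_max_iff_disj)
qed

lemma rapid_deriv:
  assumes "f \<in> rapid sh w" "e \<in> Basis"
  obtains f' where "f' \<in> rapid sh w" "\<And>z. ((\<lambda>h. f (sh e h z)) has_vector_derivative f' z) (at 0)"
proof -
  from assms(1) obtain S where S: "f \<in> S" "\<forall>f\<in>S. continuous_on UNIV f \<and> (\<forall>N::nat. \<exists>C. \<forall>z. w z ^ N * cmod (f z) \<le> C) \<and>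
     (\<forall>e\<in>Basis. \<exists>f'\<in>S. \<forall>z. ((\<lambda>h. f (sh e h z)) has_vector_derivative f' z) (at 0))"
    unfolding rapid_def by auto
  then obtain f' where f': "f' \<in> S" "\<forall>z. ((\<lambda>h. f (sh e h z)) has_vector_derivative f' z) (at 0)" using assms(2) by blast
  have "f' \<in> rapid sh w" unfolding rapid_def using f'(1) S(2) by blast
  then show thesis using f' that by blast
qed

text \<open>The functions \<open>c f + m g\<close> with \<open>f, g\<close> rapidly decreasing form a closed family, for an affine function
  \<open>m\<close> along the translations: the derivative of \<open>m g\<close> is \<open>m g'\<close> plus a multiple of \<open>g\<close>.\<close>

lemma rapid_lin_mult:
  assumes f: "f \<in> rapid sh w" and g: "g \<in> rapid sh w"
    and m: "continuous_on UNIV m" "\<And>z. \<bar>m z\<bar> \<le> w z" "\<And>e h z. e \<in> Basis \<Longrightarrow> m (sh e h z) = m z + h * d e"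
    and s0: "\<And>e z. e \<in> Basis \<Longrightarrow> sh e 0 z = z"
  shows "(\<lambda>z. c * f z + of_real (m z) * g z) \<in> rapid sh w"
proof -
  define S where "S = {\<lambda>z. c * f z + of_real (m z) * g z | c f g. f \<in> rapid sh w \<and> g \<in> rapid sh w}"
  show ?thesis
  proof (rule rapid_coinduct[where S = S])
    show "(\<lambda>z. c * f z + of_real (m z) * g z) \<in> S" unfolding S_def using f g by blast
  next
    fix u assume "u \<in> S"
    then obtain c f g where u: "u = (\<lambda>z. c * f z + of_real (m z) * g z)" and fg: "f \<in> rapid sh w" "g \<in> rapid sh w"
      unfolding S_def by blast
    show "continuous_on UNIV u" unfolding u using fg[THEN rapid_continuous] m(1) by (intro continuous_intros)
  next
    fix u and N :: nat assume "u \<in> S"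
    then obtain c f g where u: "u = (\<lambda>z. c * f z + of_real (m z) * g z)" and fg: "f \<in> rapid sh w" "g \<in> rapid sh w"
      unfolding S_def by blast
    obtain C1 where C1: "\<And>z. w z ^ N * cmod (f z) \<le> C1" using rapid_decay[OF fg(1)] by metis
    obtain C2 where C2: "\<And>z. w z ^ Suc N * cmod (g z) \<le> C2" using rapid_decay[OF fg(2)] by metis
    have "w z ^ N * cmod (u z) \<le> cmod c * C1 + C2" for z
    proof -
      have w: "w z \<ge> 0" using m(2)[of z] by linarith
      have "cmod (u z) \<le> cmod c * cmod (f z) + \<bar>m z\<bar> * cmod (g z)"
        unfolding u by (rule order_trans[OF norm_triangle_ineq]) (simp add: norm_mult)
      also have "\<dots> \<le> cmod c * cmod (f z) + w z * cmod (g z)"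
        by (intro add_left_mono mult_right_mono m) auto
      finally have "w z ^ N * cmod (u z) \<le> w z ^ N * (cmod c * cmod (f z) + w z * cmod (g z))"
        using w by (intro mult_left_mono) auto
      also have "\<dots> = cmod c * (w z ^ N * cmod (f z)) + w z ^ Suc N * cmod (g z)" by (simp add: algebra_simps)
      also have "\<dots> \<le> cmod c * C1 + C2" by (intro add_mono mult_left_mono C1 C2) auto
      finally show ?thesis .
    qed
    then show "\<exists>C. \<forall>z. w z ^ N * cmod (u z) \<le> C" by blast
  next
    fix u and e :: 'b assume "u \<in> S" and e: "e \<in> Basis"
    then obtain c f g where u: "u = (\<lambda>z. c * f z + of_real (m z) * g z)" and fg: "f \<in> rapid sh w" "g \<in> rapid sh w"
      unfolding S_def by blast
    obtain f' where f': "f' \<in> rapid sh w" "\<And>z. ((\<lambda>h. f (sh e h z)) has_vector_derivative f' z) (at 0)"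
      by (rule rapid_deriv[OF fg(1) e]) (rule that)
    obtain g' where g': "g' \<in> rapid sh w" "\<And>z. ((\<lambda>h. g (sh e h z)) has_vector_derivative g' z) (at 0)"
      by (rule rapid_deriv[OF fg(2) e]) (rule that)
    define S0 where "S0 = {\<lambda>z. a * f z + b * g z | a b f g. f \<in> rapid sh w \<and> g \<in> rapid sh w}"
    have lin: "(\<lambda>z. c * f' z + of_real (d e) * g z) \<in> rapid sh w"
    proof (rule rapid_coinduct[where S = S0])
      show "(\<lambda>z. c * f' z + of_real (d e) * g z) \<in> S0" unfolding S0_def using f' fg by blast
    next
      fix u assume "u \<in> S0"
      then obtain a b f g where u: "u = (\<lambda>z. a * f z + b * g z)" and fg: "f \<in> rapid sh w" "g \<in> rapid sh w"
        unfolding S0_def by blast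
      show "continuous_on UNIV u" unfolding u using fg[THEN rapid_continuous] by (intro continuous_intros)
      fix N
      obtain C1 where C1: "\<And>z. w z ^ N * cmod (f z) \<le> C1" using rapid_decay[OF fg(1)] by metis
      obtain C2 where C2: "\<And>z. w z ^ N * cmod (g z) \<le> C2" using rapid_decay[OF fg(2)] by metis
      have "w z ^ N * cmod (u z) \<le> cmod a * C1 + cmod b * C2" for z
      proof -
        have w: "w z \<ge> 0" using m(2)[of z] by linarith
        have "cmod (u z) \<le> cmod a * cmod (f z) + cmod b * cmod (g z)"
          unfolding u by (rule order_trans[OF norm_triangle_ineq]) (simp add: norm_mult)
        then have "w z ^ N * cmod (u z) \<le> w z ^ N * (cmod a * cmod (f z) + cmod b * cmod (g z))"
          using w by (intro mult_left_mono) auto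
        also have "\<dots> = cmod a * (w z ^ N * cmod (f z)) + cmod b * (w z ^ N * cmod (g z))" by (simp add: algebra_simps)
        also have "\<dots> \<le> cmod a * C1 + cmod b * C2" by (intro add_mono mult_left_mono C1 C2) auto
        finally show ?thesis .
      qed
      then show "\<exists>C. \<forall>z. w z ^ N * cmod (u z) \<le> C" by blast
    next
      fix u and e :: 'b assume "u \<in> S0" and e: "e \<in> Basis"
      then obtain a b f g where u: "u = (\<lambda>z. a * f z + b * g z)" and fg: "f \<in> rapid sh w" "g \<in> rapid sh w"
        unfolding S0_def by blast
      obtain f' where f': "f' \<in> rapid sh w" "\<And>z. ((\<lambda>h. f (sh e h z)) has_vector_derivative f' z) (at 0)"
        by (rule rapid_deriv[OF fg(1) e]) (rule that)
      obtain g' where g': "g' \<in> rapid sh w" "\<And>z. ((\<lambda>h. g (sh e h z)) has_vector_derivative g' z) (at 0)"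
        by (rule rapid_deriv[OF fg(2) e]) (rule that)
      have "((\<lambda>h. u (sh e h z)) has_vector_derivative a * f' z + b * g' z) (at 0)" for z
        unfolding u by (intro has_vector_derivative_add has_vector_derivative_mult_right f' g')
      then show "\<exists>f'\<in>S0. \<forall>z. ((\<lambda>h. u (sh e h z)) has_vector_derivative f' z) (at 0)"
        unfolding S0_def using f' g' by (intro bexI[of _ "\<lambda>z. a * f' z + b * g' z"]) blast+
    qed
    have der: "((\<lambda>h. u (sh e h z)) has_vector_derivative 1 * (c * f' z + of_real (d e) * g z) + of_real (m z) * g' z) (at 0)" for z
    proof -
      have mm: "((\<lambda>h. complex_of_real (m (sh e h z))) has_vector_derivative of_real (d e)) (at 0)"
      proof -
        have "((\<lambda>h. m z + h * d e) has_real_derivative d e) (at 0)" by (auto intro!: derivative_eq_intros)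
        then show ?thesis using m(3)[OF e] by (simp only: has_vector_derivative_of_real)
      qed
      have "((\<lambda>h. u (sh e h z)) has_vector_derivative c * f' z + (of_real (m (sh e 0 z)) * g' z + of_real (d e) * g (sh e 0 z))) (at 0)"
        unfolding u by (intro has_vector_derivative_add has_vector_derivative_mult_right has_vector_derivative_mult f' g' mm)
      then show ?thesis using s0[OF e] by (simp add: algebra_simps)
    qed
    show "\<exists>f'\<in>S. \<forall>z. ((\<lambda>h. u (sh e h z)) has_vector_derivative f' z) (at 0)"
    proof (rule bexI, rule allI, rule der)
      have SI: "(\<lambda>z. c * f z + of_real (m z) * g z) \<in> S" if "f \<in> rapid sh w" "g \<in> rapid sh w" for c f g
        unfolding S_def using that by blast
      from SI[OF lin g'(1), of 1] show "(\<lambda>z. 1 * (c * f' z + of_real (d e) * g z) + of_real (m z) * g' z) \<in> S" .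
    qed
  qed
qed

text \<open>For a family closed under multiplication by the coordinates, boundedness already implies
  decay of every order. This is how decay of a Fourier transform follows from integration by parts.\<close>

lemma rapid_from_mult:
  fixes S :: "('a \<Rightarrow> complex) set"
  assumes w: "\<And>z. 0 \<le> w z" "\<And>z. w z \<le> 1 + (\<Sum>m\<in>I. \<bar>m z\<bar>)" and I: "finite I"
    and b: "\<And>f. f \<in> S \<Longrightarrow> \<exists>C. \<forall>z. cmod (f z) \<le> C"
    and m: "\<And>f m. f \<in> S \<Longrightarrow> m \<in> I \<Longrightarrow> (\<lambda>z. complex_of_real (m z) * f z) \<in> S"
  shows "f \<in> S \<Longrightarrow> \<exists>C. \<forall>z. w z ^ N * cmod (f z) \<le> C"
proof (induction N arbitrary: f)
  case 0
  then show ?case using b by auto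
next
  case (Suc N)
  from Suc.IH[OF Suc.prems] obtain C0 where C0: "\<And>z. w z ^ N * cmod (f z) \<le> C0" by blast
  have "\<exists>C. \<forall>m\<in>I. \<forall>z. w z ^ N * cmod (complex_of_real (m z) * f z) \<le> C m"
    by (rule bchoice) (use Suc.IH[OF m[OF Suc.prems]] in blast)
  then obtain C where C: "\<And>m z. m \<in> I \<Longrightarrow> w z ^ N * cmod (complex_of_real (m z) * f z) \<le> C m" by blast
  have "w z ^ Suc N * cmod (f z) \<le> C0 + (\<Sum>m\<in>I. C m)" for z
  proof -
    have "w z ^ Suc N * cmod (f z) = w z * (w z ^ N * cmod (f z))" by simp
    also have "\<dots> \<le> (1 + (\<Sum>m\<in>I. \<bar>m z\<bar>)) * (w z ^ N * cmod (f z))"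
      using w by (intro mult_right_mono) auto
    also have "\<dots> = w z ^ N * cmod (f z) + (\<Sum>m\<in>I. w z ^ N * cmod (complex_of_real (m z) * f z))"
      by (simp add: algebra_simps sum_distrib_left norm_mult)
    also have "\<dots> \<le> C0 + (\<Sum>m\<in>I. C m)" by (intro add_mono sum_mono C0 C)
    finally show ?thesis .
  qed
  then show ?case by blast
qed

text \<open>There is no decay in \<open>y\<close>, which is periodic, and there are no derivatives in the integer
  frequency. Accordingly \<open>weight_phys\<close> omits \<open>y\<close> and \<open>shift_freq\<close> fixes the third component.\<close>

definition shift_phys :: "real \<times> real \<times> real \<Rightarrow> real \<Rightarrow> real \<times> real \<times> real \<Rightarrow> real \<times> real \<times> real" where
  "shift_phys e h z = z + h *\<^sub>R e"

definition weight_phys :: "real \<times> real \<times> real \<Rightarrow> real" where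
  "weight_phys z = 1 + \<bar>fst z\<bar> + \<bar>fst (snd z)\<bar>"

definition shift_freq :: "real \<times> real \<Rightarrow> real \<Rightarrow> freq \<Rightarrow> freq" where
  "shift_freq e h \<zeta> = (fst \<zeta> + h * fst e, fst (snd \<zeta>) + h * snd e, snd (snd \<zeta>))"

definition weight_freq :: "freq \<Rightarrow> real" where
  "weight_freq \<zeta> = 1 + \<bar>tau \<zeta>\<bar> + \<bar>xi \<zeta>\<bar> + \<bar>qq \<zeta>\<bar>"

lemma schwartz_rapid: "schwartz = {\<phi> \<in> rapid shift_phys weight_phys. y_periodic \<phi>}"
proof (intro set_eqI iffI)
  fix \<phi> assume s: "\<phi> \<in> schwartz"
  define S where "S = {iter_partial es \<phi> | es. es \<in> lists Basis}"
  have "\<phi> \<in> rapid shift_phys weight_phys"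
  proof (rule rapid_coinduct[where S = S])
    show "\<phi> \<in> S" unfolding S_def by (intro CollectI exI[of _ "[]"]) auto
  next
    fix f assume "f \<in> S"
    then obtain es where es: "es \<in> lists Basis" "f = iter_partial es \<phi>" unfolding S_def by blast
    show "continuous_on UNIV f" using s es unfolding schwartz_def smooth_fun_def by blast
    fix N
    from s es have "\<exists>C. \<forall>t x y. (1 + \<bar>t\<bar> + \<bar>x\<bar>) ^ N * cmod (f (t, x, y)) \<le> C" unfolding schwartz_def by blast
    then show "\<exists>C. \<forall>z. weight_phys z ^ N * cmod (f z) \<le> C" by (auto simp: weight_phys_def)
  next
    fix f and e :: "real \<times> real \<times> real" assume "f \<in> S" and e: "e \<in> Basis"
    then obtain es where es: "es \<in> lists Basis" "f = iter_partial es \<phi>" unfolding S_def by blast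
    have d: "(\<lambda>h::real. f (z + h *\<^sub>R e)) differentiable (at 0)" for z
    proof -
      have "\<forall>es\<in>lists Basis. \<forall>e\<in>Basis. \<forall>z. (\<lambda>h::real. iter_partial es \<phi> (z + h *\<^sub>R e)) differentiable (at 0)"
        using s unfolding schwartz_def smooth_fun_def by simp
      from this[THEN bspec, OF es(1), THEN bspec, OF e, THEN spec, of z] show ?thesis unfolding es(2) .
    qed
    have "e # es \<in> lists Basis" using es(1) e by simp
    then have "iter_partial (e # es) \<phi> \<in> S" unfolding S_def by (intro CollectI exI[of _ "e # es"] conjI refl)
    moreover have "((\<lambda>h. f (shift_phys e h z)) has_vector_derivative iter_partial (e # es) \<phi> z) (at 0)" for z
      using d[of z] unfolding shift_phys_def by (simp add: partial_deriv_def es vector_derivative_works)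
    ultimately show "\<exists>f'\<in>S. \<forall>z. ((\<lambda>h. f (shift_phys e h z)) has_vector_derivative f' z) (at 0)" by blast
  qed
  then show "\<phi> \<in> {\<phi> \<in> rapid shift_phys weight_phys. y_periodic \<phi>}" using s by (simp add: schwartz_def)
next
  fix \<phi> assume "\<phi> \<in> {\<phi> \<in> rapid shift_phys weight_phys. y_periodic \<phi>}"
  then have s: "\<phi> \<in> rapid shift_phys weight_phys" and y: "y_periodic \<phi>" by auto
  have pd: "partial_deriv e f \<in> rapid shift_phys weight_phys \<and> (\<forall>z. (\<lambda>h::real. f (z + h *\<^sub>R e)) differentiable (at 0))"
    if f: "f \<in> rapid shift_phys weight_phys" and e: "e \<in> Basis" for f e
  proof -
    obtain f' where f': "f' \<in> rapid shift_phys weight_phys" "\<And>z. ((\<lambda>h. f (shift_phys e h z)) has_vector_derivative f' z) (at 0)"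
      by (rule rapid_deriv[OF f e]) (rule that)
    have "partial_deriv e f = f'"
      unfolding partial_deriv_def using f'(2) unfolding shift_phys_def by (auto simp: fun_eq_iff intro!: vector_derivative_at)
    then show ?thesis using f' unfolding shift_phys_def by (auto intro: differentiableI_vector)
  qed
  have it: "iter_partial es \<phi> \<in> rapid shift_phys weight_phys" if "es \<in> lists Basis" for es
    using that by (induction es) (auto simp: s pd)
  have "\<exists>C. \<forall>t x y. (1 + \<bar>t\<bar> + \<bar>x\<bar>) ^ N * cmod (iter_partial es \<phi> (t, x, y)) \<le> C" if es: "es \<in> lists Basis" for es and N :: nat
  proof -
    obtain C where "\<And>z. weight_phys z ^ N * cmod (iter_partial es \<phi> z) \<le> C" using rapid_decay[OF it[OF es]] by metis
    from this[of "(_, _, _)"] show ?thesis by (intro exI[of _ C]) (simp add: weight_phys_def)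
  qed
  then show "\<phi> \<in> schwartz"
    unfolding schwartz_def smooth_fun_def using y it[THEN rapid_continuous] it[THEN pd] by simp
qed

lemma continuous_freq_slices:
  fixes f :: "freq \<Rightarrow> 'b::topological_space"
  shows "continuous_on UNIV f \<longleftrightarrow> (\<forall>q. continuous_on UNIV (\<lambda>(\<tau>, \<xi>). f (\<tau>, \<xi>, q)))"
proof
  assume c: "continuous_on UNIV f"
  have "continuous_on UNIV (\<lambda>p. f (fst p, snd p, q))" for q
    by (rule continuous_on_compose2[OF c]) (auto intro!: continuous_intros)
  then show "\<forall>q. continuous_on UNIV (\<lambda>(\<tau>, \<xi>). f (\<tau>, \<xi>, q))" by (simp add: case_prod_beta')
next
  assume a: "\<forall>q. continuous_on UNIV (\<lambda>(\<tau>, \<xi>). f (\<tau>, \<xi>, q))"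
  have op: "open (UNIV \<times> UNIV \<times> {q} :: freq set)" for q :: int
    by (intro open_Times open_UNIV Topological_Spaces.open_discrete)
  have "continuous_on (\<Union>q. (UNIV \<times> UNIV \<times> {q} :: freq set)) f"
  proof (rule continuous_on_open_UN)
    fix q :: int
    have "continuous_on (UNIV \<times> UNIV \<times> {q}) ((\<lambda>(\<tau>, \<xi>). f (\<tau>, \<xi>, q)) \<circ> (\<lambda>\<zeta>. (fst \<zeta>, fst (snd \<zeta>))))"
      by (rule continuous_on_compose[OF _ continuous_on_subset[OF a[rule_format]]]) (auto intro!: continuous_intros)
    then show "continuous_on (UNIV \<times> UNIV \<times> {q}) f"
      by (rule continuous_on_eq) auto
  qed (use op in auto)
  moreover have "(\<Union>q. (UNIV \<times> UNIV \<times> {q} :: freq set)) = UNIV" by auto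
  ultimately show "continuous_on UNIV f" by simp
qed

lemma schwartz_freq_rapid: "schwartz_freq = rapid shift_freq weight_freq"
proof (intro set_eqI iffI)
  fix \<psi> assume s: "\<psi> \<in> schwartz_freq"
  let ?sl = "\<lambda>q. (\<lambda>(\<tau>, \<xi>). \<psi> (\<tau>, \<xi>, q))"
  let ?it = "\<lambda>es. (\<lambda>(\<tau>, \<xi>, q). iter_partial es (?sl q) (\<tau>, \<xi>))"
  define S where "S = {?it es | es. es \<in> lists (Basis :: (real \<times> real) set)}"
  have slice: "(\<lambda>(\<tau>, \<xi>). ?it es (\<tau>, \<xi>, q)) = iter_partial es (?sl q)" for es q by auto
  show "\<psi> \<in> rapid shift_freq weight_freq"
  proof (rule rapid_coinduct[where S = S])
    show "\<psi> \<in> S" unfolding S_def by (intro CollectI exI[of _ "[]"]) auto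
  next
    fix f assume "f \<in> S"
    then obtain es where es: "es \<in> lists Basis" "f = ?it es" unfolding S_def by blast
    show "continuous_on UNIV f" 
      unfolding continuous_freq_slices es(2) slice using s es(1) unfolding schwartz_freq_def smooth_fun_def by blast
    fix N
    from s es(1) have "\<exists>C. \<forall>\<tau> \<xi> q. (1 + \<bar>\<tau>\<bar> + \<bar>\<xi>\<bar> + \<bar>real_of_int q\<bar>) ^ N * cmod (iter_partial es (?sl q) (\<tau>, \<xi>)) \<le> C"
      unfolding schwartz_freq_def by blast
    then show "\<exists>C. \<forall>z. weight_freq z ^ N * cmod (f z) \<le> C" by (auto simp: weight_freq_def es(2))
  next
    fix f and e :: "real \<times> real" assume "f \<in> S" and e: "e \<in> Basis"
    then obtain es where es: "es \<in> lists Basis" "f = ?it es" unfolding S_def by blast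
    have d: "(\<lambda>h::real. iter_partial es (?sl q) (z + h *\<^sub>R e)) differentiable (at 0)" for z q
      
    proof -
      have "\<forall>q. \<forall>es\<in>lists Basis. \<forall>e\<in>Basis. \<forall>z. (\<lambda>h::real. iter_partial es (?sl q) (z + h *\<^sub>R e)) differentiable (at 0)"
        using s unfolding schwartz_freq_def smooth_fun_def by simp
      from this[THEN spec, of q, THEN bspec, OF es(1), THEN bspec, OF e, THEN spec, of z] show ?thesis .
    qed
    have "e # es \<in> lists Basis" using es(1) e by simp
    then have "?it (e # es) \<in> S" unfolding S_def by (intro CollectI exI[of _ "e # es"] conjI refl)
    moreover have "((\<lambda>h. f (shift_freq e h z)) has_vector_derivative ?it (e # es) z) (at 0)" for z
    proof (cases z)
      case (fields \<tau> \<xi> q)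
      have "(\<lambda>h. f (shift_freq e h z)) = (\<lambda>h. iter_partial es (?sl q) ((\<tau>, \<xi>) + h *\<^sub>R e))"
        by (cases e) (simp add: fields es(2) shift_freq_def)
      then show ?thesis using d[of q "(\<tau>, \<xi>)"] unfolding fields by (simp add: partial_deriv_def vector_derivative_works)
    qed
    ultimately show "\<exists>f'\<in>S. \<forall>z. ((\<lambda>h. f (shift_freq e h z)) has_vector_derivative f' z) (at 0)" by blast
  qed
next
  fix \<psi> assume s: "\<psi> \<in> rapid shift_freq weight_freq"
  let ?sl = "\<lambda>f q. (\<lambda>(\<tau>, \<xi>). f (\<tau>, \<xi>, q))"
  have pd: "\<exists>f'\<in>rapid shift_freq weight_freq. \<forall>q. partial_deriv e (?sl f q) = ?sl f' q \<and> (\<forall>z. (\<lambda>h::real. ?sl f q (z + h *\<^sub>R e)) differentiable (at 0))"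
    if f: "f \<in> rapid shift_freq weight_freq" and e: "e \<in> Basis" for f and e :: "real \<times> real"
  proof -
    obtain f' where f': "f' \<in> rapid shift_freq weight_freq" "\<And>z. ((\<lambda>h. f (shift_freq e h z)) has_vector_derivative f' z) (at 0)"
      by (rule rapid_deriv[OF f e]) (rule that)
    have "((\<lambda>h. ?sl f q (z + h *\<^sub>R e)) has_vector_derivative ?sl f' q z) (at 0)" for q z
    proof (cases z)
      case (Pair a b)
      have "(\<lambda>h. ?sl f q (z + h *\<^sub>R e)) = (\<lambda>h. f (shift_freq e h (a, b, q)))"
        by (cases e) (simp add: Pair shift_freq_def)
      then show ?thesis using f'(2)[of "(a, b, q)"] by (simp add: Pair)
    qed
    then have "partial_deriv e (?sl f q) = ?sl f' q \<and> (\<forall>z. (\<lambda>h::real. ?sl f q (z + h *\<^sub>R e)) differentiable (at 0))" for q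
      unfolding partial_deriv_def by (auto simp: fun_eq_iff intro!: vector_derivative_at intro: differentiableI_vector)
    then show ?thesis using f'(1) by blast
  qed
  have it: "\<exists>f\<in>rapid shift_freq weight_freq. \<forall>q. iter_partial es (?sl \<psi> q) = ?sl f q" if "es \<in> lists Basis" for es
    using that
  proof (induction es)
    case (Cons e es)
    then obtain f where f: "f \<in> rapid shift_freq weight_freq" "\<And>q. iter_partial es (?sl \<psi> q) = ?sl f q" by auto
    from pd[OF f(1), of e] Cons obtain f' where "f' \<in> rapid shift_freq weight_freq" "\<forall>q. partial_deriv e (?sl f q) = ?sl f' q" by auto
    then show ?case using f(2) by (intro bexI[of _ f']) auto
  qed (use s in auto)
  show "\<psi> \<in> schwartz_freq"
    unfolding schwartz_freq_def smooth_fun_def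
  proof (intro CollectI conjI allI ballI)
    fix q and es :: "(real \<times> real) list" assume es: "es \<in> lists Basis"
    from it[OF es] obtain f where f: "f \<in> rapid shift_freq weight_freq" "\<And>q. iter_partial es (?sl \<psi> q) = ?sl f q" by blast
    show "continuous_on UNIV (iter_partial es (?sl \<psi> q))"
      unfolding f(2) using rapid_continuous[OF f(1)] continuous_freq_slices by blast
    fix e :: "real \<times> real" and z assume "e \<in> Basis"
    from pd[OF f(1) this] show "(\<lambda>h::real. iter_partial es (?sl \<psi> q) (z + h *\<^sub>R e)) differentiable (at 0)"
      unfolding f(2) by blast
  next
    fix es :: "(real \<times> real) list" and N :: nat assume es: "es \<in> lists Basis"
    from it[OF es] obtain f where f: "f \<in> rapid shift_freq weight_freq" "\<And>q. iter_partial es (?sl \<psi> q) = ?sl f q" by blast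
    obtain C where "\<And>z. weight_freq z ^ N * cmod (f z) \<le> C" using rapid_decay[OF f(1)] by metis
    from this[of "(_, _, _)"] show "\<exists>C. \<forall>\<tau> \<xi> q. (1 + \<bar>\<tau>\<bar> + \<bar>\<xi>\<bar> + \<bar>real_of_int q\<bar>) ^ N *
          cmod (iter_partial es (?sl \<psi> q) (\<tau>, \<xi>)) \<le> C"
      unfolding f(2) by (intro exI[of _ C]) (simp add: weight_freq_def)
  qed
qed

type_synonym phys = "real \<times> real \<times> real"

section \<open>Integration on the cylinder\<close>

text \<open>As a product, the measure on the fundamental domain gives access to Fubini's theorem and
  to integration by parts in each variable separately.\<close>

definition circle_measure :: "real measure" where "circle_measure = density lborel (indicator {0..2 * pi})"
definition cyl :: "phys measure" where "cyl = lborel \<Otimes>\<^sub>M (lborel \<Otimes>\<^sub>M circle_measure)"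

lemma sets_circle_measure [measurable_cong, simp]: "sets circle_measure = sets borel" by (simp add: circle_measure_def)
lemma space_circle_measure [simp]: "space circle_measure = UNIV" by (simp add: circle_measure_def)

lemma emeasure_circle_measure: "emeasure circle_measure (space circle_measure) = ennreal (2 * pi)"
  by (simp add: circle_measure_def emeasure_density nn_integral_indicator)

lemma finite_circle_measure: "finite_measure circle_measure"
  by (rule finite_measureI) (simp only: emeasure_circle_measure, simp)

interpretation circle_measure: finite_measure circle_measure by (rule finite_circle_measure)

interpretation lly: pair_sigma_finite "lborel :: real measure" circle_measure
  by (intro pair_sigma_finite.intro sigma_finite_lborel circle_measure.sigma_finite_measure_axioms)

interpretation llly: pair_sigma_finite "lborel :: real measure" "lborel \<Otimes>\<^sub>M circle_measure"
  by (intro pair_sigma_finite.intro sigma_finite_lborel sigma_finite_pair_measure circle_measure.sigma_finite_measure_axioms)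

interpretation cyl: sigma_finite_measure cyl
  unfolding cyl_def by (intro sigma_finite_lborel sigma_finite_pair_measure circle_measure.sigma_finite_measure_axioms)

interpretation cylfreq: pair_sigma_finite cyl freq_measure
  by (intro pair_sigma_finite.intro cyl.sigma_finite_measure_axioms freq.sigma_finite_measure_axioms)

lemma sets_cyl [measurable_cong, simp]: "sets cyl = sets (borel :: phys measure)"
proof -
  have "sets cyl = sets (borel \<Otimes>\<^sub>M (borel \<Otimes>\<^sub>M borel) :: phys measure)"
    unfolding cyl_def by (intro sets_pair_measure_cong) simp_all
  also have "\<dots> = sets (borel :: phys measure)" by (simp only: borel_prod)
  finally show ?thesis .
qed

lemma space_cyl [simp]: "space cyl = UNIV" by (simp add: cyl_def space_pair_measure)

lemma cylinder_sets [measurable]: "cylinder \<in> sets borel"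
proof -
  have "cylinder = UNIV \<times> (UNIV \<times> {0..2*pi})" by (auto simp: cylinder_def)
  also have "\<dots> \<in> sets (borel \<Otimes>\<^sub>M (borel \<Otimes>\<^sub>M borel))" by (intro pair_measureI) auto
  finally show ?thesis by (simp only: borel_prod)
qed

lemma cyl_density: "cyl = density lborel (indicator cylinder)"
proof -
  have d1: "lborel = density lborel (\<lambda>_. 1 :: ennreal)" by (simp add: density_1)
  have s1: "sigma_finite_measure (density (lborel :: real measure) (indicator {0..2*pi}))"
    using circle_measure.sigma_finite_measure_axioms by (simp add: circle_measure_def)
  have 1: "lborel \<Otimes>\<^sub>M circle_measure = density (lborel \<Otimes>\<^sub>M lborel) (\<lambda>(x::real, y). 1 * indicator {0..2*pi} y)"
    unfolding circle_measure_def by (subst d1, rule pair_measure_density) (auto intro: s1 sigma_finite_lborel)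
  have s2: "sigma_finite_measure (density (lborel \<Otimes>\<^sub>M lborel) (\<lambda>(x::real, y::real). 1 * indicator {0..2*pi} y :: ennreal))"
    unfolding 1[symmetric] by (intro sigma_finite_pair_measure sigma_finite_lborel circle_measure.sigma_finite_measure_axioms)
  have s3: "sigma_finite_measure (lborel \<Otimes>\<^sub>M lborel :: (real \<times> real) measure)"
    by (intro sigma_finite_pair_measure sigma_finite_lborel)
  have 2: "lborel \<Otimes>\<^sub>M (lborel \<Otimes>\<^sub>M circle_measure) = density (lborel \<Otimes>\<^sub>M (lborel \<Otimes>\<^sub>M lborel)) (\<lambda>(t::real, z). 1 * (\<lambda>(x::real, y). 1 * indicator {0..2*pi} y) z)"
  proof -
    have "density lborel (\<lambda>_::real. 1 :: ennreal) \<Otimes>\<^sub>M density (lborel \<Otimes>\<^sub>M lborel) (\<lambda>(x::real, y::real). 1 * indicator {0..2*pi} y :: ennreal) =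
      density (lborel \<Otimes>\<^sub>M (lborel \<Otimes>\<^sub>M lborel)) (\<lambda>(t::real, z). 1 * (\<lambda>(x::real, y). 1 * indicator {0..2*pi} y) z)"
      by (rule pair_measure_density[OF _ _ s3 s2]) measurable
    then show ?thesis unfolding 1 density_1 .
  qed
  have 3: "(\<lambda>(t::real, z::real \<times> real). 1 * (\<lambda>(x::real, y). 1 * indicator {0..2*pi} y) z) = (indicator cylinder :: phys \<Rightarrow> ennreal)"
    by (auto simp: fun_eq_iff cylinder_def indicator_def)
  show ?thesis unfolding cyl_def 2 3 by (simp only: lborel_prod)
qed

lemma cyl_density': "cyl = density lborel (\<lambda>z. ennreal (indicator cylinder z))"
  unfolding cyl_density by (intro density_cong) (auto simp: indicator_def)

lemma cyl_integrable_iff: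
  fixes f :: "phys \<Rightarrow> complex"
  assumes [measurable]: "f \<in> borel_measurable borel"
  shows "set_integrable lborel cylinder f \<longleftrightarrow> integrable cyl f"
  unfolding set_integrable_def cyl_density' by (subst integrable_density) auto

lemma cyl_integral:
  fixes f :: "phys \<Rightarrow> complex"
  assumes [measurable]: "f \<in> borel_measurable borel"
  shows "(LINT z:cylinder|lborel. f z) = (LINT z|cyl. f z)"
  unfolding set_lebesgue_integral_def cyl_density' by (subst integral_density) auto

lemma AE_cyl_cylinder: "AE z in cyl. z \<in> cylinder"
  unfolding cyl_density by (subst AE_density) (auto simp: indicator_def)

lemma nn_integral_cyl:
  fixes f :: "phys \<Rightarrow> ennreal"
  assumes [measurable]: "f \<in> borel_measurable borel"
  shows "(\<integral>\<^sup>+z. f z \<partial>cyl) = (\<integral>\<^sup>+t. \<integral>\<^sup>+x. \<integral>\<^sup>+y. f (t, x, y) \<partial>circle_measure \<partial>lborel \<partial>lborel)"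
proof -
  have [measurable]: "f \<in> borel_measurable (lborel \<Otimes>\<^sub>M (lborel \<Otimes>\<^sub>M circle_measure))"
    using assms sets_cyl unfolding cyl_def by (metis measurable_cong_sets)
  show ?thesis
    unfolding cyl_def
    by (subst sigma_finite_pair_measure[OF sigma_finite_lborel circle_measure.sigma_finite_measure_axioms, THEN sigma_finite_measure.nn_integral_fst, symmetric], simp)
       (simp add: sigma_finite_measure.nn_integral_fst[OF circle_measure.sigma_finite_measure_axioms, symmetric])
qed

lemma jbracket_powr_minus2: "jbracket x powr (- 2) = inverse (1 + x\<^sup>2)"
  by (simp add: jbracket_powr_sq powr_minus add_pos_nonneg)

lemma coord_phys [measurable]: "(fst :: phys \<Rightarrow> real) \<in> borel_measurable borel"
  "(\<lambda>z::phys. fst (snd z)) \<in> borel_measurable borel" "(\<lambda>z::phys. snd (snd z)) \<in> borel_measurable borel"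
  by measurable

lemma weight_phys_ge1: "weight_phys z \<ge> 1" by (simp add: weight_phys_def)
lemma weight_freq_ge1: "weight_freq \<zeta> \<ge> 1" by (simp add: weight_freq_def)

lemma sq_le_w: "\<bar>a\<bar> + 1 \<le> w \<Longrightarrow> 1 + a\<^sup>2 \<le> w\<^sup>2" for a w :: real
proof -
  assume "\<bar>a\<bar> + 1 \<le> w"
  then have "(\<bar>a\<bar> + 1)\<^sup>2 \<le> w\<^sup>2" by (intro power_mono) auto
  then show ?thesis by (simp add: power2_eq_square algebra_simps)
qed

text \<open>The fourth power leaves the bracket of order \<open>2\<close> in each of \<open>t\<close> and \<open>x\<close>.\<close>

lemma integrable_weight_phys: "integrable cyl (\<lambda>z. inverse (weight_phys z ^ 4))"
proof (rule integrableI_bounded)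
  have [measurable]: "weight_phys \<in> borel_measurable borel" unfolding weight_phys_def[abs_def] by measurable
  then show "(\<lambda>z. inverse (weight_phys z ^ 4)) \<in> borel_measurable cyl" by measurable
  let ?J = "\<integral>\<^sup>+x. ennreal (jbracket x powr (- 2)) \<partial>lborel"
  have J: "?J < \<infinity>" by (rule nn_integral_jbracket) simp
  have "(\<integral>\<^sup>+z. ennreal (norm (inverse (weight_phys z ^ 4))) \<partial>cyl) = 
     (\<integral>\<^sup>+t. \<integral>\<^sup>+x. \<integral>\<^sup>+y. ennreal (norm (inverse (weight_phys (t, x, y) ^ 4))) \<partial>circle_measure \<partial>lborel \<partial>lborel)"
    by (rule nn_integral_cyl) measurable
  also have "\<dots> \<le> (\<integral>\<^sup>+t. \<integral>\<^sup>+x. \<integral>\<^sup>+y. ennreal (jbracket t powr (- 2)) * ennreal (jbracket x powr (- 2)) \<partial>circle_measure \<partial>lborel \<partial>lborel)"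
  proof (intro nn_integral_mono)
    fix t x y :: real
    let ?w = "weight_phys (t, x, y)"
    have w: "?w \<ge> 1" by (rule weight_phys_ge1)
    have "(1 + t\<^sup>2) * (1 + x\<^sup>2) \<le> ?w\<^sup>2 * ?w\<^sup>2"
      by (intro mult_mono sq_le_w) (auto simp: weight_phys_def)
    also have "\<dots> = ?w ^ 4" by (simp add: power2_eq_square power4_eq_xxxx)
    finally have "inverse (?w ^ 4) \<le> inverse ((1 + t\<^sup>2) * (1 + x\<^sup>2))"
      by (intro le_imp_inverse_le) (auto intro!: mult_pos_pos simp: add_pos_nonneg)
    then show "ennreal (norm (inverse (?w ^ 4))) \<le> ennreal (jbracket t powr (- 2)) * ennreal (jbracket x powr (- 2))"
      using w by (simp add: jbracket_powr_minus2 ennreal_mult[symmetric] ennreal_leI)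
  qed
  also have "\<dots> = ?J * (?J * ennreal (2 * pi))"
    using emeasure_circle_measure by (simp add: nn_integral_cmult nn_integral_multc mult.assoc)
  also have "\<dots> < \<infinity>" using J by (simp add: ennreal_mult_less_top)
  finally show "(\<integral>\<^sup>+z. ennreal (norm (inverse (weight_phys z ^ 4))) \<partial>cyl) < \<infinity>" .
qed

text \<open>The sixth power leaves the bracket of order \<open>2\<close> in each of the three components.\<close>

lemma integrable_weight_freq: "integrable freq_measure (\<lambda>z. inverse (weight_freq z ^ 6))"
proof (rule integrableI_bounded)
  have [measurable]: "weight_freq \<in> borel_measurable borel" unfolding weight_freq_def[abs_def] by measurable
  then show "(\<lambda>z. inverse (weight_freq z ^ 6)) \<in> borel_measurable freq_measure" by measurable
  let ?J = "\<integral>\<^sup>+x. ennreal (jbracket x powr (- 2)) \<partial>lborel"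
  let ?Q = "\<integral>\<^sup>+q. ennreal (jbracket (real_of_int q) powr (- 2)) \<partial>count_space UNIV"
  have J: "?J < \<infinity>" "?Q < \<infinity>" by (rule nn_integral_jbracket nn_integral_jbracket_int, simp)+
  have "(\<integral>\<^sup>+z. ennreal (norm (inverse (weight_freq z ^ 6))) \<partial>freq_measure) = 
     (\<integral>\<^sup>+t. \<integral>\<^sup>+x. \<integral>\<^sup>+q. ennreal (norm (inverse (weight_freq (t, x, q) ^ 6))) \<partial>count_space UNIV \<partial>lborel \<partial>lborel)"
    by (rule nn_integral_freq) measurable
  also have "\<dots> \<le> (\<integral>\<^sup>+t. \<integral>\<^sup>+x. \<integral>\<^sup>+q. ennreal (jbracket t powr (- 2)) * (ennreal (jbracket x powr (- 2)) * ennreal (jbracket (real_of_int q) powr (- 2))) \<partial>count_space UNIV \<partial>lborel \<partial>lborel)"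
  proof (intro nn_integral_mono)
    fix t x :: real and q :: int
    let ?w = "weight_freq (t, x, q)"
    have w: "?w \<ge> 1" by (rule weight_freq_ge1)
    have "(1 + t\<^sup>2) * ((1 + x\<^sup>2) * (1 + (real_of_int q)\<^sup>2)) \<le> ?w\<^sup>2 * (?w\<^sup>2 * ?w\<^sup>2)"
      by (intro mult_mono sq_le_w) (auto simp: weight_freq_def)
    also have "\<dots> = ?w ^ 6" by (simp add: power_add[symmetric])
    finally have "inverse (?w ^ 6) \<le> inverse ((1 + t\<^sup>2) * ((1 + x\<^sup>2) * (1 + (real_of_int q)\<^sup>2)))"
      by (intro le_imp_inverse_le) (auto intro!: mult_pos_pos simp: add_pos_nonneg)
    then show "ennreal (norm (inverse (?w ^ 6))) \<le> ennreal (jbracket t powr (- 2)) * (ennreal (jbracket x powr (- 2)) * ennreal (jbracket (real_of_int q) powr (- 2)))"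
      using w by (simp add: jbracket_powr_minus2 ennreal_mult[symmetric] ennreal_leI)
  qed
  also have "\<dots> = ?J * (?J * ?Q)"
    by (simp add: nn_integral_cmult nn_integral_multc mult.assoc)
  also have "\<dots> < \<infinity>" using J by (simp add: ennreal_mult_less_top)
  finally show "(\<integral>\<^sup>+z. ennreal (norm (inverse (weight_freq z ^ 6))) \<partial>freq_measure) < \<infinity>" .
qed

lemma integrable_from_decay:
  fixes f :: "'a \<Rightarrow> complex"
  assumes "integrable M (\<lambda>z. inverse (w z ^ N))" "\<And>z. w z \<ge> 1" "f \<in> borel_measurable M" "\<And>z. w z ^ N * cmod (f z) \<le> C"
  shows "integrable M f"
proof (rule Bochner_Integration.integrable_bound)
  show "integrable M (\<lambda>z. C * inverse (w z ^ N))" using assms(1) by simp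
  show "AE z in M. norm (f z) \<le> norm (C * inverse (w z ^ N))"
  proof (rule AE_I2)
    fix z
    have w: "w z ^ N > 0" using assms(2)[of z] by (intro zero_less_power) linarith
    have "cmod (f z) \<le> C * inverse (w z ^ N)"
      using assms(4)[of z] w by (simp add: field_simps)
    then show "norm (f z) \<le> norm (C * inverse (w z ^ N))" by (metis abs_ge_self order_trans real_norm_def)
  qed
qed fact

lemma rapid_integrable:
  "f \<in> rapid shift_phys weight_phys \<Longrightarrow> integrable cyl f"
  "g \<in> rapid shift_freq weight_freq \<Longrightarrow> integrable freq_measure g"
proof -
  assume f: "f \<in> rapid shift_phys weight_phys"
  obtain C where C: "\<And>z. weight_phys z ^ 4 * cmod (f z) \<le> C" using rapid_decay[OF f] by metis
  show "integrable cyl f"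
    by (rule integrable_from_decay[OF integrable_weight_phys weight_phys_ge1 _ C])
       (use borel_measurable_continuous_onI[OF rapid_continuous[OF f]] in measurable)
next
  assume f: "g \<in> rapid shift_freq weight_freq"
  obtain C where C: "\<And>z. weight_freq z ^ 6 * cmod (g z) \<le> C" using rapid_decay[OF f] by metis
  show "integrable freq_measure g"
    by (rule integrable_from_decay[OF integrable_weight_freq weight_freq_ge1 _ C])
       (use borel_measurable_continuous_onI[OF rapid_continuous[OF f]] in measurable)
qed

section \<open>Oscillatory integrals\<close>

lemma cis_le_abs: "cmod (cis a - 1) \<le> \<bar>a\<bar>"
proof -
  have "cmod (cis a - 1) = 2 * \<bar>sin (a / 2)\<bar>" unfolding cis_conv_exp by (rule dist_exp_i_1)
  also have "\<dots> \<le> 2 * \<bar>a / 2\<bar>" by (intro mult_left_mono abs_sin_x_le_abs_x) auto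
  finally show ?thesis by simp
qed

lemma osc_integrable:
  fixes g :: "'a \<Rightarrow> complex"
  assumes "integrable M g" "L \<in> borel_measurable M"
  shows "integrable M (\<lambda>v. cis (L v) * g v)"
proof (rule Bochner_Integration.integrable_bound[OF assms(1)])
  have [measurable]: "g \<in> borel_measurable M" using assms(1) by simp
  note [measurable] = assms(2)
  show "(\<lambda>v. cis (L v) * g v) \<in> borel_measurable M"
    by (intro borel_measurable_times) (auto intro!: measurable_compose[OF assms(2)] borel_measurable_continuous_onI continuous_intros)
qed (simp add: norm_mult)

lemma osc_bound:
  fixes g :: "'a \<Rightarrow> complex"
  shows "cmod (LINT v|M. cis (L v) * g v) \<le> (LINT v|M. cmod (g v))"
  using integral_norm_bound[of M "\<lambda>v. cis (L v) * g v"] by (simp add: norm_mult)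

lemma cis_measurable [measurable (raw)]:
  "L \<in> borel_measurable M \<Longrightarrow> (\<lambda>v. cis (L v)) \<in> borel_measurable M"
  by (rule measurable_compose[of L M borel], assumption) (intro borel_measurable_continuous_onI continuous_intros)

lemma osc_continuous:
  fixes g :: "'a \<Rightarrow> complex" and L :: "'p::{first_countable_topology, t2_space} \<Rightarrow> 'a \<Rightarrow> real"
  assumes g: "integrable M g" and L: "\<And>p. L p \<in> borel_measurable M" "\<And>v. continuous_on UNIV (\<lambda>p. L p v)"
  shows "continuous_on UNIV (\<lambda>p. LINT v|M. cis (L p v) * g v)"
proof (rule continuous_on_sequentiallyI)
  fix x :: "nat \<Rightarrow> 'p" and a assume x: "x \<longlonglongrightarrow> a"
  have [measurable]: "g \<in> borel_measurable M" using g by simp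
  note [measurable] = L(1)
  show "(\<lambda>n. LINT v|M. cis (L (x n) v) * g v) \<longlonglongrightarrow> (LINT v|M. cis (L a v) * g v)"
  proof (rule integral_dominated_convergence[where w = "\<lambda>v. cmod (g v)"])
    show "AE v in M. (\<lambda>n. cis (L (x n) v) * g v) \<longlonglongrightarrow> cis (L a v) * g v"
    proof (rule AE_I2)
      fix v
      have "(\<lambda>n. L (x n) v) \<longlonglongrightarrow> L a v"
        using continuous_on_tendsto_compose[OF L(2) x, of v] by simp
      then show "(\<lambda>n. cis (L (x n) v) * g v) \<longlonglongrightarrow> cis (L a v) * g v" by (intro tendsto_intros)
    qed
    show "integrable M (\<lambda>v. cmod (g v))" using g by simp
  qed (auto simp: norm_mult)
qed

text \<open>Differentiation under the integral sign by dominated convergence. The difference quotients of \<open>cis\<close>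
  are bounded by \<open>2 \<bar>\<theta>\<bar>\<close>, and their errors are quadratic.\<close>

lemma osc_derivative:
  fixes g :: "'a \<Rightarrow> complex"
  assumes g: "integrable M g" and tg: "integrable M (\<lambda>v. of_real (\<theta> v) * g v)"
    and L: "L \<in> borel_measurable M" "\<theta> \<in> borel_measurable M"
  shows "((\<lambda>h. LINT v|M. cis (L v + h * \<theta> v) * g v) has_vector_derivative
    (LINT v|M. cis (L v) * (\<i> * (of_real (\<theta> v) * g v)))) (at 0)"
proof -
  have [measurable]: "g \<in> borel_measurable M" using g by simp
  note [measurable] = L
  let ?F = "\<lambda>h. LINT v|M. cis (L v + h * \<theta> v) * g v"
  let ?D = "LINT v|M. cis (L v) * (\<i> * (of_real (\<theta> v) * g v))"
  have iF: "integrable M (\<lambda>v. cis (L v + h * \<theta> v) * g v)" for h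
    by (rule osc_integrable[OF g]) measurable
  have iD: "integrable M (\<lambda>v. cis (L v) * (\<i> * (of_real (\<theta> v) * g v)))"
    by (rule osc_integrable) (use tg in auto)
  let ?s = "\<lambda>h v. (cis (L v) * (cis (h * \<theta> v) - 1 - \<i> * of_real (h * \<theta> v)) / of_real h) * g v"
  have quot: "(?F h - ?F 0 - h *\<^sub>R ?D) /\<^sub>R h = (LINT v|M. ?s h v)" if "h \<noteq> 0" for h
  proof -
    have e: "?s h v = (cis (L v + h * \<theta> v) * g v - cis (L v + 0 * \<theta> v) * g v - h *\<^sub>R (cis (L v) * (\<i> * (of_real (\<theta> v) * g v)))) /\<^sub>R h" for v
      using that by (simp add: cis_mult[symmetric] scaleR_conv_of_real field_simps)
    show ?thesis unfolding e
      by (subst integral_scaleR_right, subst Bochner_Integration.integral_diff, (intro Bochner_Integration.integrable_diff iF integrable_scaleR_right iD)+,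
          subst Bochner_Integration.integral_diff, (intro iF)+, subst integral_scaleR_right, rule refl)
  qed
  have lim: "(\<lambda>n. LINT v|M. ?s (X n) v) \<longlonglongrightarrow> (LINT v|M. 0)" if X: "\<And>n. X n \<noteq> 0" "X \<longlonglongrightarrow> 0" for X :: "nat \<Rightarrow> real"
  proof (rule integral_dominated_convergence[where w = "\<lambda>v. 2 * cmod (of_real (\<theta> v) * g v)"])
    show "integrable M (\<lambda>v. 2 * cmod (of_real (\<theta> v) * g v))" using tg by simp
    show "AE v in M. norm (?s (X n) v) \<le> 2 * cmod (of_real (\<theta> v) * g v)" for n
    proof (rule AE_I2)
      fix v
      have "cmod (cis (X n * \<theta> v) - 1 - \<i> * of_real (X n * \<theta> v)) \<le> cmod (cis (X n * \<theta> v) - 1) + cmod (\<i> * of_real (X n * \<theta> v))"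
        by (rule norm_triangle_ineq4)
      also have "\<dots> \<le> \<bar>X n * \<theta> v\<bar> + \<bar>X n * \<theta> v\<bar>" by (intro add_mono cis_le_abs) (simp add: norm_mult abs_mult)
      finally have "cmod (cis (X n * \<theta> v) - 1 - \<i> * of_real (X n * \<theta> v)) / \<bar>X n\<bar> \<le> 2 * \<bar>\<theta> v\<bar>"
        using X(1)[of n] by (simp add: divide_le_eq abs_mult mult_ac)
      then have "cmod (cis (X n * \<theta> v) - 1 - \<i> * of_real (X n * \<theta> v)) / \<bar>X n\<bar> * cmod (g v) \<le> 2 * \<bar>\<theta> v\<bar> * cmod (g v)"
        by (rule mult_right_mono) simp
      then show "norm (?s (X n) v) \<le> 2 * cmod (of_real (\<theta> v) * g v)"
        by (simp add: norm_mult norm_divide mult_ac)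
    qed
    show "AE v in M. (\<lambda>n. ?s (X n) v) \<longlonglongrightarrow> 0"
    proof (rule AE_I2)
      fix v
      have b: "norm (?s (X n) v) \<le> \<bar>X n\<bar> * ((\<theta> v)\<^sup>2 / 2 * cmod (g v))" for n
      proof -
        have "cmod (cis (X n * \<theta> v) - 1 - \<i> * of_real (X n * \<theta> v)) \<le> \<bar>X n * \<theta> v\<bar>\<^sup>2 / 2"
          using iexp_approx1[of "X n * \<theta> v" 1] by (simp add: cis_conv_exp diff_diff_eq power2_eq_square)
        then have "cmod (cis (X n * \<theta> v) - 1 - \<i> * of_real (X n * \<theta> v)) / \<bar>X n\<bar> \<le> \<bar>X n\<bar> * ((\<theta> v)\<^sup>2 / 2)"
          using X(1)[of n] by (simp add: divide_le_eq power2_eq_square abs_mult mult_ac)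
        then have "cmod (cis (X n * \<theta> v) - 1 - \<i> * of_real (X n * \<theta> v)) / \<bar>X n\<bar> * cmod (g v) \<le> \<bar>X n\<bar> * ((\<theta> v)\<^sup>2 / 2) * cmod (g v)"
          by (rule mult_right_mono) simp
        then show ?thesis by (simp add: norm_mult norm_divide mult_ac)
      qed
      have "(\<lambda>n. \<bar>X n\<bar> * ((\<theta> v)\<^sup>2 / 2 * cmod (g v))) \<longlonglongrightarrow> \<bar>0\<bar> * ((\<theta> v)\<^sup>2 / 2 * cmod (g v))"
        by (intro tendsto_intros X)
      then show "(\<lambda>n. ?s (X n) v) \<longlonglongrightarrow> 0" 
        by (intro Lim_null_comparison[OF always_eventually[OF allI[OF b]]]) simp
    qed
  qed measurable
  have "((\<lambda>h. (?F h - ?F 0 - h *\<^sub>R ?D) /\<^sub>R h) \<longlongrightarrow> 0) (at 0)"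
    unfolding tendsto_at_iff_sequentially
  proof (intro allI impI)
    fix X :: "nat \<Rightarrow> real" assume X: "\<forall>i. X i \<in> UNIV - {0}" "X \<longlonglongrightarrow> 0"
    then have n: "X n \<noteq> 0" for n by auto
    show "((\<lambda>h. (?F h - ?F 0 - h *\<^sub>R ?D) /\<^sub>R h) \<circ> X) \<longlonglongrightarrow> 0"
      using lim[OF n X(2)] unfolding comp_def quot[OF n] by simp
  qed
  then have "((\<lambda>h. (?F h - ?F 0 - (h - 0) *\<^sub>R ?D) /\<^sub>R norm (h - 0)) \<longlongrightarrow> 0) (at 0)"
    by (subst tendsto_norm_zero_iff[symmetric], subst (asm) tendsto_norm_zero_iff[symmetric]) simp
  then show ?thesis
    unfolding has_vector_derivative_def has_derivative_def by (simp add: bounded_linear_scaleR_left)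
qed

text \<open>Integration by parts for a flow that preserves the measure. The integral of \<open>f\<close> along the
  flow does not change with time, and by the fundamental theorem its change over unit time is the
  integral of the derivative.\<close>

lemma integral_of_derivative_zero:
  fixes f f' :: "'a \<Rightarrow> complex" and sh :: "real \<Rightarrow> 'a \<Rightarrow> 'a"
  assumes M: "sigma_finite_measure M"
    and sh: "(\<lambda>p. sh (fst p) (snd p)) \<in> lborel \<Otimes>\<^sub>M M \<rightarrow>\<^sub>M M" "\<And>s. distr M M (sh s) = M"
    "\<And>s h z. sh (s + h) z = sh h (sh s z)" "\<And>z. sh 0 z = z"
    and f: "integrable M f" "integrable M f'"
    and der: "\<And>z. ((\<lambda>h. f (sh h z)) has_vector_derivative f' z) (at 0)"
    and cont: "\<And>z. continuous_on UNIV (\<lambda>s. f' (sh s z))"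
  shows "(LINT z|M. f' z) = 0"
proof -
  interpret M: sigma_finite_measure M by fact
  interpret P: pair_sigma_finite "lborel :: real measure" M
    by (intro pair_sigma_finite.intro sigma_finite_lborel M)
  have [measurable]: "f \<in> borel_measurable M" "f' \<in> borel_measurable M" using f by auto
  note [measurable] = sh(1)
  have shm[measurable]: "sh s \<in> M \<rightarrow>\<^sub>M M" for s
    using measurable_compose[OF measurable_Pair1' sh(1), of s] by simp
  have inv: "(LINT z|M. g (sh s z)) = (LINT z|M. g z)" if "g \<in> borel_measurable M" for g :: "'a \<Rightarrow> 'b::{banach, second_countable_topology}" and s
    using integral_distr[OF shm that, of s] by (simp add: sh(2))
  have invi: "integrable M (\<lambda>z. g (sh s z))" if "integrable M g" for g :: "'a \<Rightarrow> complex" and s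
    using integrable_distr_eq[OF shm, of g s] that by (simp add: sh(2))
  have der': "((\<lambda>h. f (sh h z)) has_vector_derivative f' (sh s z)) (at s)" for z s
  proof -
    have e: "(\<lambda>h. f (sh h z)) = (\<lambda>h. f (sh h (sh s z))) \<circ> (\<lambda>h. h - s)"
      using sh(3)[of s _ z] by (auto simp: fun_eq_iff) (metis add.commute diff_add_cancel)
    have "((\<lambda>h. h - s) has_vector_derivative 1) (at s)" by (auto intro!: derivative_eq_intros)
    from vector_diff_chain_at[OF this, of "\<lambda>h. f (sh h (sh s z))" "f' (sh s z)"] der[of "sh s z"]
    show ?thesis unfolding e by simp
  qed
  have ftc: "has_bochner_integral lborel (\<lambda>s. indicator {0..1} s *\<^sub>R f' (sh s z)) (f (sh 1 z) - f (sh 0 z))" for z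
    by (rule has_bochner_integral_FTC_Icc) (auto intro!: has_vector_derivative_at_within der' continuous_on_subset[OF cont])
  let ?G = "\<lambda>s z. indicator {0..1::real} s *\<^sub>R f' (sh s z)"
  have G: "integrable (lborel \<Otimes>\<^sub>M M) (case_prod ?G)"
  proof (rule P.Fubini_integrable)
    show "case_prod ?G \<in> borel_measurable (lborel \<Otimes>\<^sub>M M)" unfolding case_prod_beta' by measurable
    have e: "(LINT z|M. norm (case (s, z) of (s, z) \<Rightarrow> ?G s z)) = indicator {0..1} s *\<^sub>R (LINT z|M. norm (f' z))" for s :: real
      using inv[of "\<lambda>z. norm (f' z)" s] by simp
    show "integrable lborel (\<lambda>s. LINT z|M. norm (case (s, z) of (s, z) \<Rightarrow> ?G s z))"
      unfolding e by (intro integrable_scaleR_left) auto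
    show "AE s in lborel. integrable M (\<lambda>z. case (s, z) of (s, z) \<Rightarrow> ?G s z)"
      by (auto intro!: AE_I2 integrable_scaleR_right invi f)
  qed
  have "(LINT z|M. (LINT s|lborel. ?G s z)) = (LINT s|lborel. (LINT z|M. ?G s z))"
    by (rule P.Fubini_integral[OF G])
  moreover have "(LINT z|M. (LINT s|lborel. ?G s z)) = 0"
  proof -
    have "(LINT z|M. (LINT s|lborel. ?G s z)) = (LINT z|M. f (sh 1 z) - f z)"
      using ftc[THEN has_bochner_integral_integral_eq] sh(4) by simp
    also have "\<dots> = (LINT z|M. f (sh 1 z)) - (LINT z|M. f z)"
      by (rule Bochner_Integration.integral_diff[OF invi[OF f(1)] f(1)])
    also have "\<dots> = 0" using inv[of f 1] by simp
    finally show ?thesis .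
  qed
  moreover have "(LINT s|lborel. (LINT z|M. ?G s z)) = (LINT z|M. f' z)"
  proof -
    have "(LINT z|M. ?G s z) = indicator {0..1} s *\<^sub>R (LINT z|M. f' z)" for s :: real
      using inv[of f' s] by simp
    then have "(LINT s|lborel. (LINT z|M. ?G s z)) = (LINT s|lborel. indicator {0..1::real} s *\<^sub>R (LINT z|M. f' z))"
      by (simp only:)
    then show ?thesis by (simp add: measure_def)
  qed
  ultimately show ?thesis by simp
qed

section \<open>The Fourier transforms\<close>

definition dot :: "phys \<Rightarrow> freq \<Rightarrow> real" where
  "dot z \<zeta> = fst z * tau \<zeta> + fst (snd z) * xi \<zeta> + snd (snd z) * qq \<zeta>"

definition ft :: "(freq \<Rightarrow> complex) \<Rightarrow> phys \<Rightarrow> complex" where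
  "ft g z = (LINT \<zeta>|freq_measure. cis (- dot z \<zeta>) * g \<zeta>)"

text \<open>The adjoint of \<open>ft\<close> up to conjugation, and up to a constant its inverse. The transform \<open>synth\<close> has the same
  phase, but integrates over the frequencies.\<close>

definition bt :: "(phys \<Rightarrow> complex) \<Rightarrow> freq \<Rightarrow> complex" where
  "bt \<phi> \<zeta> = (LINT z|cyl. cis (dot z \<zeta>) * \<phi> z)"

definition synth :: "(freq \<Rightarrow> complex) \<Rightarrow> phys \<Rightarrow> complex" where
  "synth g z = (LINT \<zeta>|freq_measure. cis (dot z \<zeta>) * g \<zeta>)"

lemma fourier_test_ft: "fourier_test g = ft g"
  unfolding fourier_test_def ft_def[abs_def] dot_def tau_def xi_def qq_def by (simp only: case_prod_beta' fst_conv snd_conv prod.collapse)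

lemma dot_shift_phys: "dot (shift_phys e h z) \<zeta> = dot z \<zeta> + h * dot e \<zeta>"
  by (simp add: dot_def shift_phys_def algebra_simps)

lemma dot_shift_freq: "dot z (shift_freq e h \<zeta>) = dot z \<zeta> + h * (fst z * fst e + fst (snd z) * snd e)"
  by (simp add: dot_def shift_freq_def tau_def xi_def qq_def algebra_simps)

lemma coord_continuous [continuous_intros]:
  "continuous_on A tau" "continuous_on A xi" "continuous_on A qq"
proof -
  show "continuous_on A tau" "continuous_on A xi" unfolding tau_def[abs_def] xi_def[abs_def] by (intro continuous_intros)+
  have "continuous_on UNIV real_of_int" by (rule Topological_Spaces.continuous_on_discrete)
  then show "continuous_on A qq" unfolding qq_def[abs_def] 
    by (rule continuous_on_compose2) (auto intro!: continuous_intros)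
qed

lemma dot_continuous: "continuous_on UNIV (\<lambda>z. dot z \<zeta>)" "continuous_on UNIV (\<lambda>\<zeta>. dot z \<zeta>)"
  unfolding dot_def by (intro continuous_intros)+

lemma dot_measurable [measurable]: "(\<lambda>z. dot z \<zeta>) \<in> borel_measurable borel" "(\<lambda>\<zeta>. dot z \<zeta>) \<in> borel_measurable borel"
  "(\<lambda>p. dot (fst p) (snd p)) \<in> borel_measurable (borel \<Otimes>\<^sub>M borel)"
  unfolding dot_def by measurable

lemma dot_meas_cf [measurable]: "dot z \<in> borel_measurable freq_measure" "(\<lambda>z. dot z \<zeta>) \<in> borel_measurable cyl"
  by measurable

lemma shift_phys_0 [simp]: "shift_phys e 0 z = z" by (simp add: shift_phys_def)
lemma shift_freq_0 [simp]: "shift_freq e 0 z = z" by (cases z) (simp add: shift_freq_def)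

abbreviation "SF \<equiv> rapid shift_freq weight_freq"
abbreviation "SP \<equiv> rapid shift_phys weight_phys"

lemma SF_cmult: "g \<in> SF \<Longrightarrow> (\<lambda>\<zeta>. c * g \<zeta>) \<in> SF"
  using rapid_lin_mult[of g shift_freq weight_freq g "\<lambda>_. 0" "\<lambda>_. 0" c] weight_freq_ge1 by (simp add: order.trans[OF _ weight_freq_ge1])

lemma SP_cmult: "g \<in> SP \<Longrightarrow> (\<lambda>\<zeta>. c * g \<zeta>) \<in> SP"
  using rapid_lin_mult[of g shift_phys weight_phys g "\<lambda>_. 0" "\<lambda>_. 0" c] weight_phys_ge1 by (simp add: order.trans[OF _ weight_phys_ge1])

lemma SF_lin: "f \<in> SF \<Longrightarrow> g \<in> SF \<Longrightarrow> (\<lambda>\<zeta>. c * f \<zeta> + g \<zeta>) \<in> SF"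
  using rapid_lin_mult[of f shift_freq weight_freq g "\<lambda>_. 1" "\<lambda>_. 0" c] weight_freq_ge1 by simp

lemma SP_lin: "f \<in> SP \<Longrightarrow> g \<in> SP \<Longrightarrow> (\<lambda>\<zeta>. c * f \<zeta> + g \<zeta>) \<in> SP"
  using rapid_lin_mult[of f shift_phys weight_phys g "\<lambda>_. 1" "\<lambda>_. 0" c] weight_phys_ge1 by simp

lemma SF_coord: 
  assumes "g \<in> SF"
  shows "(\<lambda>\<zeta>. of_real (tau \<zeta>) * g \<zeta>) \<in> SF" "(\<lambda>\<zeta>. of_real (xi \<zeta>) * g \<zeta>) \<in> SF" "(\<lambda>\<zeta>. of_real (qq \<zeta>) * g \<zeta>) \<in> SF"
proof -
  have "(\<lambda>\<zeta>. 0 * g \<zeta> + of_real (tau \<zeta>) * g \<zeta>) \<in> SF"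
    by (rule rapid_lin_mult[OF assms assms, where d = fst]) (auto intro!: continuous_intros simp: weight_freq_def shift_freq_def)
  then show "(\<lambda>\<zeta>. of_real (tau \<zeta>) * g \<zeta>) \<in> SF" by simp
  have "(\<lambda>\<zeta>. 0 * g \<zeta> + of_real (xi \<zeta>) * g \<zeta>) \<in> SF"
    by (rule rapid_lin_mult[OF assms assms, where d = snd]) (auto intro!: continuous_intros simp: weight_freq_def shift_freq_def)
  then show "(\<lambda>\<zeta>. of_real (xi \<zeta>) * g \<zeta>) \<in> SF" by simp
  have "(\<lambda>\<zeta>. 0 * g \<zeta> + of_real (qq \<zeta>) * g \<zeta>) \<in> SF"
    by (rule rapid_lin_mult[OF assms assms, where d = "\<lambda>_. 0"]) (auto intro!: continuous_intros simp: weight_freq_def shift_freq_def qq_def)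
  then show "(\<lambda>\<zeta>. of_real (qq \<zeta>) * g \<zeta>) \<in> SF" by simp
qed

lemma SP_coord:
  assumes "g \<in> SP"
  shows "(\<lambda>z. of_real (fst z * a + fst (snd z) * b) * g z) \<in> SP"
proof -
  have 1: "(\<lambda>z. 0 * g z + of_real (fst z) * g z) \<in> SP"
    by (rule rapid_lin_mult[OF assms assms, where d = fst]) (auto intro!: continuous_intros simp: weight_phys_def shift_phys_def)
  have 2: "(\<lambda>z. 0 * g z + of_real (fst (snd z)) * g z) \<in> SP"
    by (rule rapid_lin_mult[OF assms assms, where d = "\<lambda>e. fst (snd e)"]) (auto intro!: continuous_intros simp: weight_phys_def shift_phys_def)
  have "(\<lambda>z. of_real a * (of_real (fst z) * g z) + of_real b * (of_real (fst (snd z)) * g z)) \<in> SP"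
    by (rule SP_lin[OF _ SP_cmult]) (use 1 2 in simp_all)
  then show ?thesis by (simp add: algebra_simps)
qed

lemma Basis_phys: "(Basis :: phys set) = {(1, 0, 0), (0, 1, 0), (0, 0, 1)}"
  by (auto simp: Basis_prod_def zero_prod_def)

lemma Basis_r2: "(Basis :: (real \<times> real) set) = {(1, 0), (0, 1)}"
  by (auto simp: Basis_prod_def)

lemma freq_distr_shift: "distr freq_measure freq_measure (\<lambda>\<zeta>. \<eta> + \<zeta>) = freq_measure"
proof (rule measure_eqI)
  fix A assume A: "A \<in> sets (distr freq_measure freq_measure (\<lambda>\<zeta>. \<eta> + \<zeta>))"
  then have [measurable]: "A \<in> sets borel" by (simp add: sets_freq)
  have m: "(\<lambda>\<zeta>. \<eta> + \<zeta>) \<in> freq_measure \<rightarrow>\<^sub>M freq_measure" by measurable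
  have "emeasure (distr freq_measure freq_measure (\<lambda>\<zeta>. \<eta> + \<zeta>)) A = (\<integral>\<^sup>+\<zeta>. indicator A \<zeta> \<partial>distr freq_measure freq_measure (\<lambda>\<zeta>. \<eta> + \<zeta>))"
    using A by (simp add: nn_integral_indicator)
  also have "\<dots> = (\<integral>\<^sup>+\<zeta>. indicator A (\<eta> + \<zeta>) \<partial>freq_measure)"
    by (rule nn_integral_distr[OF m]) measurable
  also have "\<dots> = (\<integral>\<^sup>+\<zeta>. indicator A \<zeta> \<partial>freq_measure)" by (rule nn_integral_freq_shift) measurable
  also have "\<dots> = emeasure freq_measure A" using A by (simp add: nn_integral_indicator)
  finally show "emeasure (distr freq_measure freq_measure (\<lambda>\<zeta>. \<eta> + \<zeta>)) A = emeasure freq_measure A" .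
qed simp

text \<open>Translations in \<open>y\<close> do not preserve the measure on the fundamental domain; that direction is
  handled by periodicity in \<open>integral_cyl_y_derivative\<close>.\<close>

lemma cyl_distr_shift:
  assumes "snd (snd e) = 0"
  shows "distr cyl cyl (shift_phys e s) = cyl"
proof (rule measure_eqI)
  let ?v = "s *\<^sub>R e"
  have m: "shift_phys e s \<in> cyl \<rightarrow>\<^sub>M cyl" unfolding shift_phys_def[abs_def] by measurable
  fix A assume A: "A \<in> sets (distr cyl cyl (shift_phys e s))"
  then have [measurable]: "A \<in> sets borel" by simp
  have [measurable]: "shift_phys e s \<in> borel \<rightarrow>\<^sub>M borel" unfolding shift_phys_def[abs_def] by measurable
  have c: "indicator cylinder z = (indicator cylinder (?v + z) :: ennreal)" for z
  proof -
    have "z \<in> cylinder \<longleftrightarrow> snd (snd z) \<in> {0..2 * pi}" for z by (cases z) (auto simp: cylinder_def)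
    then show ?thesis using assms by (simp add: indicator_def)
  qed
  have "emeasure (distr cyl cyl (shift_phys e s)) A = (\<integral>\<^sup>+z. indicator A z \<partial>distr cyl cyl (shift_phys e s))"
    using A by (simp add: nn_integral_indicator)
  also have "\<dots> = (\<integral>\<^sup>+z. indicator A (shift_phys e s z) \<partial>cyl)"
    by (rule nn_integral_distr[OF m]) measurable
  also have "\<dots> = (\<integral>\<^sup>+z. indicator cylinder z * indicator A (?v + z) \<partial>lborel)"
    unfolding cyl_density by (subst nn_integral_density) (auto simp: shift_phys_def add.commute)
  also have "\<dots> = (\<integral>\<^sup>+z. indicator cylinder (?v + z) * indicator A (?v + z) \<partial>lborel)"
    by (subst c) (rule refl)
  also have "\<dots> = (\<integral>\<^sup>+z. indicator cylinder z * indicator A z \<partial>distr lborel borel (\<lambda>z. ?v + z))"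
    by (subst nn_integral_distr) auto
  also have "\<dots> = (\<integral>\<^sup>+z. indicator cylinder z * indicator A z \<partial>lborel)"
    by (simp only: lborel_distr_plus)
  also have "\<dots> = (\<integral>\<^sup>+z. indicator A z \<partial>cyl)"
    unfolding cyl_density by (subst nn_integral_density) auto
  also have "\<dots> = emeasure cyl A" using A by (simp add: nn_integral_indicator)
  finally show "emeasure (distr cyl cyl (shift_phys e s)) A = emeasure cyl A" .
qed simp

lemma cis_vderiv: "((\<lambda>h. cis (a + h * k)) has_vector_derivative \<i> * of_real k * cis a) (at 0)"
proof -
  have 1: "((\<lambda>h. a + h * k) has_real_derivative k) (at 0)" by (auto intro!: derivative_eq_intros)
  have "((\<lambda>h. cis (a + h * k)) has_vector_derivative k *\<^sub>R (\<i> * cis (a + 0 * k))) (at 0)"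
    using has_derivative_cis[OF 1[unfolded has_field_derivative_def]]
    by (simp add: has_vector_derivative_def scaleR_conv_of_real mult_ac)
  then show ?thesis by (simp add: scaleR_conv_of_real mult_ac)
qed

text \<open>Multiplication by \<open>t\<close> or \<open>x\<close> becomes a derivative in \<open>\<tau>\<close> or \<open>\<xi>\<close>, by integration by parts.\<close>

lemma ft_mult:
  assumes g: "g \<in> SF" and e: "e \<in> Basis" and g': "g' \<in> SF" "\<And>\<zeta>. ((\<lambda>h. g (shift_freq e h \<zeta>)) has_vector_derivative g' \<zeta>) (at 0)"
  shows "of_real (fst z * fst e + fst (snd z) * snd e) * ft g z = ft (\<lambda>\<zeta>. - \<i> * g' \<zeta>) z"
proof -
  let ?k = "fst z * fst e + fst (snd z) * snd e"
  let ?f = "\<lambda>\<zeta>. cis (- dot z \<zeta>) * g \<zeta>" and ?f' = "\<lambda>\<zeta>. cis (- dot z \<zeta>) * g' \<zeta> + \<i> * of_real (- ?k) * cis (- dot z \<zeta>) * g \<zeta>"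
  have gi: "integrable freq_measure ?f" "integrable freq_measure (\<lambda>\<zeta>. cis (- dot z \<zeta>) * g' \<zeta>)"
    by (intro osc_integrable rapid_integrable g g'; measurable)+
  have i2: "integrable freq_measure (\<lambda>\<zeta>. \<i> * of_real (- ?k) * cis (- dot z \<zeta>) * g \<zeta>)"
    using integrable_mult_right[OF gi(1), of "\<i> * of_real (- ?k)"] by (simp add: mult.assoc)
  have sh: "shift_freq e s = (\<lambda>\<zeta>. (s * fst e, s * snd e, 0) + \<zeta>)" for s
    by (auto simp: fun_eq_iff shift_freq_def)
  have "(LINT \<zeta>|freq_measure. ?f' \<zeta>) = 0"
  proof (rule integral_of_derivative_zero[OF freq.sigma_finite_measure_axioms, where sh = "shift_freq e" and f = ?f])
    show "(\<lambda>p. shift_freq e (fst p) (snd p)) \<in> lborel \<Otimes>\<^sub>M freq_measure \<rightarrow>\<^sub>M freq_measure"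
    proof -
      have "(\<lambda>p::real \<times> freq. (fst p * fst e, fst p * snd e, 0::int)) \<in> lborel \<Otimes>\<^sub>M freq_measure \<rightarrow>\<^sub>M borel"
        by (rule measurable_triple) measurable
      note [measurable] = this
      show ?thesis unfolding sh by measurable
    qed
    show "distr freq_measure freq_measure (shift_freq e s) = freq_measure" for s
      unfolding sh by (rule freq_distr_shift)
    show "shift_freq e (s + h) \<zeta> = shift_freq e h (shift_freq e s \<zeta>)" for s h \<zeta> by (simp add: shift_freq_def algebra_simps)
    show "integrable freq_measure ?f" by (rule gi)
    show "integrable freq_measure ?f'" using gi i2 by (rule_tac Bochner_Integration.integrable_add)
    show "((\<lambda>h. ?f (shift_freq e h \<zeta>)) has_vector_derivative ?f' \<zeta>) (at 0)" for \<zeta>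
    proof -
      have c: "((\<lambda>h. cis (- dot z (shift_freq e h \<zeta>))) has_vector_derivative \<i> * of_real (- ?k) * cis (- dot z \<zeta>)) (at 0)"
      proof -
        have "- dot z (shift_freq e h \<zeta>) = - dot z \<zeta> + h * (- ?k)" for h by (simp add: dot_shift_freq algebra_simps)
        then show ?thesis by (simp only:) (rule cis_vderiv)
      qed
      from has_vector_derivative_mult[OF c g'(2)[of \<zeta>]] show ?thesis by simp
    qed
    show "continuous_on UNIV (\<lambda>s. ?f' (shift_freq e s \<zeta>))" for \<zeta>
    proof -
      have shc: "continuous_on UNIV (\<lambda>s. shift_freq e s \<zeta>)" unfolding shift_freq_def by (intro continuous_intros)
      have "continuous_on UNIV ?f'"
        by (intro continuous_intros rapid_continuous[OF g] rapid_continuous[OF g'(1)] dot_continuous)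
      from continuous_on_compose2[OF this shc] show ?thesis by simp
    qed
  qed simp
  then have "ft g' z + \<i> * of_real (- ?k) * ft g z = 0"
    unfolding ft_def using Bochner_Integration.integral_add[OF gi(2) i2] by (simp add: mult.assoc)
  then have "\<i> * (of_real ?k * ft g z) = ft g' z" by (simp add: algebra_simps)
  then have "- \<i> * (\<i> * (of_real ?k * ft g z)) = - \<i> * ft g' z" by simp
  moreover have "- \<i> * (\<i> * X) = X" for X by (simp add: mult.assoc[symmetric])
  ultimately have "of_real ?k * ft g z = - \<i> * ft g' z" by simp
  also have "\<dots> = ft (\<lambda>\<zeta>. - \<i> * g' \<zeta>) z" unfolding ft_def
    by (subst integral_mult_right_zero[symmetric]) (simp add: mult_ac)
  finally show ?thesis .
qed

lemma ft_deriv: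
  assumes g: "g \<in> SF" and e: "e \<in> Basis"
  shows "(\<lambda>\<zeta>. - \<i> * (of_real (dot e \<zeta>) * g \<zeta>)) \<in> SF"
    "((\<lambda>h. ft g (shift_phys e h z)) has_vector_derivative ft (\<lambda>\<zeta>. - \<i> * (of_real (dot e \<zeta>) * g \<zeta>)) z) (at 0)"
proof -
  have eg: "(\<lambda>\<zeta>. of_real (dot e \<zeta>) * g \<zeta>) \<in> SF"
    using e SF_coord[OF g] unfolding Basis_phys by (auto simp: dot_def)
  show "(\<lambda>\<zeta>. - \<i> * (of_real (dot e \<zeta>) * g \<zeta>)) \<in> SF" by (rule SF_cmult[OF eg])
  have mg: "(\<lambda>\<zeta>. of_real (- dot e \<zeta>) * g \<zeta>) \<in> SF"
    using SF_cmult[OF eg, of "-1"] by simp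
  have "((\<lambda>h. LINT \<zeta>|freq_measure. cis (- dot z \<zeta> + h * (- dot e \<zeta>)) * g \<zeta>) has_vector_derivative
    (LINT \<zeta>|freq_measure. cis (- dot z \<zeta>) * (\<i> * (of_real (- dot e \<zeta>) * g \<zeta>)))) (at 0)"
    by (rule osc_derivative) (use rapid_integrable(2)[OF g] rapid_integrable(2)[OF mg] in measurable)
  then show "((\<lambda>h. ft g (shift_phys e h z)) has_vector_derivative ft (\<lambda>\<zeta>. - \<i> * (of_real (dot e \<zeta>) * g \<zeta>)) z) (at 0)"
    unfolding ft_def by (simp add: dot_shift_phys)
qed

lemma cis_add_2pi: "cis (a + 2 * pi * real_of_int n) = cis a"
proof -
  have "cis (a + 2 * pi * real_of_int n) = cis a * cis (2 * pi * real_of_int n)" by (simp only: cis_mult)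
  also have "cis (2 * pi * real_of_int n) = 1" by (rule cis_multiple_2pi) simp
  finally show ?thesis by simp
qed

lemma ft_periodic: "y_periodic (ft g)"
proof -
  have "cis (- dot (t, x, y + 2 * pi) \<zeta>) = cis (- dot (t, x, y) \<zeta>)" for t x y \<zeta>
  proof -
    have "- dot (t, x, y + 2 * pi) \<zeta> = - dot (t, x, y) \<zeta> + 2 * pi * real_of_int (- snd (snd \<zeta>))"
      by (simp add: dot_def qq_def algebra_simps)
    then show ?thesis by (simp only: cis_add_2pi)
  qed
  then show ?thesis unfolding y_periodic_def ft_def by simp
qed

text \<open>The image of the frequency class is bounded and closed under derivatives and under multiplication by \<open>t\<close> and \<open>x\<close>, so
  coinduction applies.\<close>

lemma ft_SP:
  assumes "g \<in> SF"
  shows "ft g \<in> SP"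
proof (rule rapid_coinduct[where S = "ft ` SF"])
  show "ft g \<in> ft ` SF" using assms by blast
next
  fix f assume "f \<in> ft ` SF"
  then obtain g where g: "g \<in> SF" "f = ft g" by blast
  show "continuous_on UNIV f"
    unfolding g(2) ft_def[abs_def] by (rule osc_continuous[OF rapid_integrable(2)[OF g(1)]]) (auto intro!: continuous_intros dot_continuous)
next
  fix f and N :: nat assume f: "f \<in> ft ` SF"
  let ?I = "{\<lambda>z::phys. fst z, \<lambda>z. fst (snd z)}"
  have ne: "(\<lambda>z::phys. fst z) \<noteq> (\<lambda>z. fst (snd z))"
  proof
    assume "(\<lambda>z::phys. fst z) = (\<lambda>z. fst (snd z))"
    from fun_cong[OF this, of "(1, 0, 0)"] show False by simp
  qed
  show "\<exists>C. \<forall>z. weight_phys z ^ N * cmod (f z) \<le> C"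
  proof (rule rapid_from_mult[where S = "ft ` SF" and I = ?I])
    show "weight_phys z \<le> 1 + (\<Sum>m\<in>?I. \<bar>m z\<bar>)" for z using ne by (simp add: weight_phys_def)
    show "0 \<le> weight_phys z" for z using weight_phys_ge1[of z] by simp
    show "\<exists>C. \<forall>z. cmod (f z) \<le> C" if fS: "f \<in> ft ` SF" for f
    proof -
      obtain g where "f = ft g" using fS by blast
      then show ?thesis by (intro exI[of _ "LINT \<zeta>|freq_measure. cmod (g \<zeta>)"]) (simp add: ft_def osc_bound)
    qed
    show "(\<lambda>z. complex_of_real (m z) * f z) \<in> ft ` SF" if f: "f \<in> ft ` SF" and m: "m \<in> ?I" for f m
    proof -
      obtain g where g: "g \<in> SF" "f = ft g" using f by blast
      obtain e :: "real \<times> real" where e: "e \<in> Basis" "\<And>z. m z = fst z * fst e + fst (snd z) * snd e"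
      proof (cases "m = (\<lambda>z. fst z)")
        case True
        show thesis by (rule that[of "(1, 0)"]) (simp_all add: Basis_r2 True)
      next
        case False
        then have "m = (\<lambda>z. fst (snd z))" using m by simp
        then show thesis by (intro that[of "(0, 1)"]) (simp_all add: Basis_r2)
      qed
      obtain g' where g': "g' \<in> SF" "\<And>\<zeta>. ((\<lambda>h. g (shift_freq e h \<zeta>)) has_vector_derivative g' \<zeta>) (at 0)"
        by (rule rapid_deriv[OF g(1) e(1)]) (rule that)
      have "(\<lambda>z. complex_of_real (m z) * f z) = ft (\<lambda>\<zeta>. - \<i> * g' \<zeta>)"
        unfolding g(2) e(2) using ft_mult[OF g(1) e(1) g'] by (simp add: fun_eq_iff)
      then show ?thesis using SF_cmult[OF g'(1), of "- \<i>"] by blast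
    qed
  qed (use f in auto)
next
  fix f and e :: phys assume "f \<in> ft ` SF" and e: "e \<in> Basis"
  then obtain g where g: "g \<in> SF" "f = ft g" by blast
  show "\<exists>f'\<in>ft ` SF. \<forall>z. ((\<lambda>h. f (shift_phys e h z)) has_vector_derivative f' z) (at 0)"
    unfolding g(2) using ft_deriv[OF g(1) e] by blast
qed

lemma ft_schwartz: "g \<in> schwartz_freq \<Longrightarrow> ft g \<in> schwartz"
  by (simp add: schwartz_rapid schwartz_freq_rapid ft_SP ft_periodic)

lemma periodic_deriv:
  assumes "y_periodic \<phi>" "\<And>z. ((\<lambda>h. \<phi> (shift_phys e h z)) has_vector_derivative \<phi>' z) (at 0)"
  shows "y_periodic \<phi>'"
  unfolding y_periodic_def
proof (intro allI)
  fix t x y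
  have e: "\<phi> (shift_phys e h (t, x, y + 2 * pi)) = \<phi> (shift_phys e h (t, x, y))" for h
    using assms(1)[unfolded y_periodic_def, rule_format, of "t + h * fst e" "x + h * fst (snd e)" "y + h * snd (snd e)"]
    by (cases e) (simp add: shift_phys_def algebra_simps)
  from assms(2)[of "(t, x, y + 2 * pi)"] assms(2)[of "(t, x, y)"] show "\<phi>' (t, x, y + 2 * pi) = \<phi>' (t, x, y)"
    unfolding e by (rule vector_derivative_unique_at)
qed

lemma integral_cyl_y_derivative:
  fixes f f' :: "phys \<Rightarrow> complex"
  assumes f': "integrable cyl f'" and per: "y_periodic f" and c: "continuous_on UNIV f'"
    and der: "\<And>z. ((\<lambda>h. f (shift_phys (0, 0, 1) h z)) has_vector_derivative f' z) (at 0)"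
  shows "(LINT z|cyl. f' z) = 0"
proof -
  have inner: "(LINT y|circle_measure. f' (t, x, y)) = 0" for t x
  proof -
    have d: "((\<lambda>y. f (t, x, y)) has_vector_derivative f' (t, x, y)) (at y)" for y
    proof -
      have e: "(\<lambda>y'. f (t, x, y')) = (\<lambda>h. f (shift_phys (0, 0, 1) h (t, x, y))) \<circ> (\<lambda>y'. y' - y)"
        by (auto simp: fun_eq_iff shift_phys_def)
      have "((\<lambda>y'. y' - y) has_vector_derivative 1) (at y)" by (auto intro!: derivative_eq_intros)
      from vector_diff_chain_at[OF this, of "\<lambda>h. f (shift_phys (0, 0, 1) h (t, x, y))" "f' (t, x, y)"] der[of "(t, x, y)"]
      show ?thesis unfolding e by simp
    qed
    have cc: "continuous_on UNIV (\<lambda>y. f' (t, x, y))"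
      by (rule continuous_on_compose2[OF c]) (auto intro!: continuous_intros)
    have "has_bochner_integral lborel (\<lambda>y. indicator {0..2*pi} y *\<^sub>R f' (t, x, y)) (f (t, x, 2 * pi) - f (t, x, 0))"
      by (rule has_bochner_integral_FTC_Icc) (auto intro!: has_vector_derivative_at_within d continuous_on_subset[OF cc])
    moreover have "f (t, x, 2 * pi) = f (t, x, 0)"
      using per[unfolded y_periodic_def, rule_format, of t x 0] by simp
    ultimately have "(LINT y|lborel. indicator {0..2*pi} y *\<^sub>R f' (t, x, y)) = 0"
      by (simp add: has_bochner_integral_integral_eq)
    moreover have "(LINT y|circle_measure. f' (t, x, y)) = (LINT y|lborel. indicator {0..2*pi} y *\<^sub>R f' (t, x, y))"
    proof -
      have l: "circle_measure = density lborel (\<lambda>y. ennreal (indicator {0..2*pi} y))"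
        unfolding circle_measure_def by (intro density_cong) (auto simp: indicator_def)
      show ?thesis unfolding l
        by (rule integral_density) (use borel_measurable_continuous_onI[OF cc] in auto)
    qed
    ultimately show ?thesis by simp
  qed
  have "(LINT p|(lborel \<Otimes>\<^sub>M circle_measure). f' (t, p)) = 0" for t
  proof (cases "integrable (lborel \<Otimes>\<^sub>M circle_measure) (\<lambda>p. f' (t, p))")
    case True
    from lly.integral_fst'[OF True] show ?thesis by (simp add: inner)
  qed (rule not_integrable_integral_eq)
  then show ?thesis
    using llly.integral_fst'[of f'] f' unfolding cyl_def by simp
qed

text \<open>Multiplication by a frequency component becomes a derivative. In the \<open>y\<close>-direction the boundary terms
  cancel because both \<open>\<phi>\<close> and the character are periodic; this is where the frequency dual to \<open>y\<close> has to
  be an integer.\<close>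

lemma bt_mult:
  assumes p: "\<phi> \<in> SP" "y_periodic \<phi>" and e: "e \<in> Basis"
    and p': "\<phi>' \<in> SP" "\<And>z. ((\<lambda>h. \<phi> (shift_phys e h z)) has_vector_derivative \<phi>' z) (at 0)"
  shows "of_real (dot e \<zeta>) * bt \<phi> \<zeta> = bt (\<lambda>z. \<i> * \<phi>' z) \<zeta>"
proof -
  let ?k = "dot e \<zeta>"
  let ?f = "\<lambda>z. cis (dot z \<zeta>) * \<phi> z" and ?f' = "\<lambda>z. cis (dot z \<zeta>) * \<phi>' z + \<i> * of_real ?k * cis (dot z \<zeta>) * \<phi> z"
  have gi: "integrable cyl ?f" "integrable cyl (\<lambda>z. cis (dot z \<zeta>) * \<phi>' z)"
    by (intro osc_integrable rapid_integrable p p'; measurable)+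
  have i2: "integrable cyl (\<lambda>z. \<i> * of_real ?k * cis (dot z \<zeta>) * \<phi> z)"
    using integrable_mult_right[OF gi(1), of "\<i> * of_real ?k"] by (simp add: mult.assoc)
  have f'i: "integrable cyl ?f'" using gi i2 by (rule_tac Bochner_Integration.integrable_add)
  have der: "((\<lambda>h. ?f (shift_phys e h z)) has_vector_derivative ?f' z) (at 0)" for z
  proof -
    have c: "((\<lambda>h. cis (dot (shift_phys e h z) \<zeta>)) has_vector_derivative \<i> * of_real ?k * cis (dot z \<zeta>)) (at 0)"
      using cis_vderiv[of "dot z \<zeta>" ?k] by (simp add: dot_shift_phys)
    from has_vector_derivative_mult[OF c p'(2)[of z]] show ?thesis by simp
  qed
  have cont: "continuous_on UNIV ?f'"
    by (intro continuous_intros rapid_continuous[OF p(1)] rapid_continuous[OF p'(1)] dot_continuous)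
  have "(LINT z|cyl. ?f' z) = 0"
  proof (cases "e = (0, 0, 1)")
    case True
    show ?thesis
    proof (rule integral_cyl_y_derivative[OF f'i _ cont, where f = ?f])
      have "cis (dot (t, x, y + 2 * pi) \<zeta>) = cis (dot (t, x, y) \<zeta>)" for t x y
      proof -
        have "dot (t, x, y + 2 * pi) \<zeta> = dot (t, x, y) \<zeta> + 2 * pi * real_of_int (snd (snd \<zeta>))"
          by (simp add: dot_def qq_def algebra_simps)
        then show ?thesis by (simp only: cis_add_2pi)
      qed
      then show "y_periodic ?f" using p(2) by (simp add: y_periodic_def)
      show "((\<lambda>h. ?f (shift_phys (0, 0, 1) h z)) has_vector_derivative ?f' z) (at 0)" for z
        using der[of z] True by simp
    qed
  next
    case False
    then have e0: "snd (snd e) = 0" using e unfolding Basis_phys by auto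
    show ?thesis
    proof (rule integral_of_derivative_zero[OF cyl.sigma_finite_measure_axioms, where sh = "shift_phys e" and f = ?f])
      show "(\<lambda>p. shift_phys e (fst p) (snd p)) \<in> lborel \<Otimes>\<^sub>M cyl \<rightarrow>\<^sub>M cyl" unfolding shift_phys_def by measurable
      show "distr cyl cyl (shift_phys e s) = cyl" for s by (rule cyl_distr_shift[OF e0])
      show "shift_phys e (s + h) z = shift_phys e h (shift_phys e s z)" for s h z by (simp add: shift_phys_def algebra_simps)
      show "continuous_on UNIV (\<lambda>s. ?f' (shift_phys e s z))" for z
      proof -
        have shc: "continuous_on UNIV (\<lambda>s. shift_phys e s z)" unfolding shift_phys_def by (intro continuous_intros)
        from continuous_on_compose2[OF cont shc] show ?thesis by simp
      qed
    qed (use gi f'i der in simp_all)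
  qed
  then have "bt \<phi>' \<zeta> + \<i> * of_real ?k * bt \<phi> \<zeta> = 0"
    unfolding bt_def using Bochner_Integration.integral_add[OF gi(2) i2] by (simp add: mult.assoc)
  then have "\<i> * (of_real ?k * bt \<phi> \<zeta>) = - bt \<phi>' \<zeta>" by (simp add: algebra_simps add_eq_0_iff)
  then have "- \<i> * (\<i> * (of_real ?k * bt \<phi> \<zeta>)) = - \<i> * - bt \<phi>' \<zeta>" by simp
  moreover have "- \<i> * (\<i> * X) = X" for X by (simp add: mult.assoc[symmetric])
  ultimately have "of_real ?k * bt \<phi> \<zeta> = \<i> * bt \<phi>' \<zeta>" by simp
  also have "\<dots> = bt (\<lambda>z. \<i> * \<phi>' z) \<zeta>" unfolding bt_def
    by (subst integral_mult_right_zero[symmetric]) (simp add: mult_ac)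
  finally show ?thesis .
qed

lemma bt_deriv:
  assumes p: "\<phi> \<in> SP" and e: "e \<in> Basis"
  shows "((\<lambda>h. bt \<phi> (shift_freq e h \<zeta>)) has_vector_derivative bt (\<lambda>z. \<i> * (of_real (fst z * fst e + fst (snd z) * snd e) * \<phi> z)) \<zeta>) (at 0)"
proof -
  have "((\<lambda>h. LINT z|cyl. cis (dot z \<zeta> + h * (fst z * fst e + fst (snd z) * snd e)) * \<phi> z) has_vector_derivative
    (LINT z|cyl. cis (dot z \<zeta>) * (\<i> * (of_real (fst z * fst e + fst (snd z) * snd e) * \<phi> z)))) (at 0)"
    by (rule osc_derivative) (use rapid_integrable(1)[OF p] rapid_integrable(1)[OF SP_coord[OF p]] in measurable)
  then show ?thesis unfolding bt_def by (simp add: dot_shift_freq)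
qed

lemma bt_SF:
  assumes "\<phi> \<in> schwartz"
  shows "bt \<phi> \<in> SF"
proof (rule rapid_coinduct[where S = "bt ` schwartz"])
  show "bt \<phi> \<in> bt ` schwartz" using assms by blast
next
  fix f assume "f \<in> bt ` schwartz"
  then obtain g where g: "g \<in> schwartz" "f = bt g" by blast
  then have gs: "g \<in> SP" by (simp add: schwartz_rapid)
  show "continuous_on UNIV f"
    unfolding g(2) bt_def[abs_def] by (rule osc_continuous[OF rapid_integrable(1)[OF gs]]) (auto intro!: continuous_intros dot_continuous)
next
  fix f and N :: nat assume f: "f \<in> bt ` schwartz"
  let ?I = "{tau, xi, qq}"
  have ne: "tau \<noteq> xi" "tau \<noteq> qq" "xi \<noteq> qq"
    by (metis coord_simps(1) coord_simps(2) zero_neq_one, metis coord_simps(1) coord_simps(3) of_int_0 zero_neq_one,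
       metis coord_simps(2) coord_simps(3) of_int_0 zero_neq_one)
  show "\<exists>C. \<forall>z. weight_freq z ^ N * cmod (f z) \<le> C"
  proof (rule rapid_from_mult[where S = "bt ` schwartz" and I = ?I])
    show "weight_freq z \<le> 1 + (\<Sum>m\<in>?I. \<bar>m z\<bar>)" for z using ne by (simp add: weight_freq_def)
    show "0 \<le> weight_freq z" for z using weight_freq_ge1[of z] by simp
    show "\<exists>C. \<forall>z. cmod (f z) \<le> C" if fS: "f \<in> bt ` schwartz" for f
    proof -
      obtain g where "f = bt g" using fS by blast
      then show ?thesis by (intro exI[of _ "LINT z|cyl. cmod (g z)"]) (simp add: bt_def osc_bound)
    qed
    show "(\<lambda>z. complex_of_real (m z) * f z) \<in> bt ` schwartz" if f: "f \<in> bt ` schwartz" and m: "m \<in> ?I" for f m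
    proof -
      obtain g where g: "g \<in> schwartz" "f = bt g" using f by blast
      then have gs: "g \<in> SP" "y_periodic g" by (simp_all add: schwartz_rapid)
      obtain e :: phys where e: "e \<in> Basis" "\<And>z. m z = dot e z"
      proof -
        from m consider "m = tau" | "m = xi" | "m = qq" by blast
        then show thesis
        proof cases
          case 1 then show thesis by (intro that[of "(1, 0, 0)"]) (simp_all add: Basis_phys dot_def)
        next
          case 2 then show thesis by (intro that[of "(0, 1, 0)"]) (simp_all add: Basis_phys dot_def)
        next
          case 3 then show thesis by (intro that[of "(0, 0, 1)"]) (simp_all add: Basis_phys dot_def)
        qed
      qed
      obtain g' where g': "g' \<in> SP" "\<And>z. ((\<lambda>h. g (shift_phys e h z)) has_vector_derivative g' z) (at 0)"
        by (rule rapid_deriv[OF gs(1) e(1)]) (rule that)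
      have "(\<lambda>z. complex_of_real (m z) * f z) = bt (\<lambda>z. \<i> * g' z)"
        unfolding g(2) e(2) using bt_mult[OF gs e(1) g'] by (simp add: fun_eq_iff)
      moreover have "(\<lambda>z. \<i> * g' z) \<in> schwartz"
        using SP_cmult[OF g'(1), of "\<i>"] periodic_deriv[OF gs(2) g'(2)] by (simp add: schwartz_rapid y_periodic_def)
      ultimately show ?thesis by blast
    qed
  qed (use f in auto)
next
  fix f and e :: "real \<times> real" assume "f \<in> bt ` schwartz" and e: "e \<in> Basis"
  then obtain g where g: "g \<in> schwartz" "f = bt g" by blast
  then have gs: "g \<in> SP" "y_periodic g" by (simp_all add: schwartz_rapid)
  have "(\<lambda>z. \<i> * (of_real (fst z * fst e + fst (snd z) * snd e) * g z)) \<in> schwartz"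
    using SP_cmult[OF SP_coord[OF gs(1)], of "\<i>"] gs(2) by (simp add: schwartz_rapid y_periodic_def)
  then show "\<exists>f'\<in>bt ` schwartz. \<forall>z. ((\<lambda>h. f (shift_freq e h z)) has_vector_derivative f' z) (at 0)"
    unfolding g(2) using bt_deriv[OF gs(1) e] by blast
qed

text \<open>The joint integrability that Fubini's theorem asks for in the duality below.\<close>

lemma (in pair_sigma_finite) integrable_product:
  fixes f :: "'a \<Rightarrow> complex" and g :: "'b \<Rightarrow> complex"
  assumes f: "integrable M1 f" and g: "integrable M2 g"
  shows "integrable (M1 \<Otimes>\<^sub>M M2) (\<lambda>p. f (fst p) * g (snd p))"
proof (rule Fubini_integrable)
  have [measurable]: "f \<in> borel_measurable M1" "g \<in> borel_measurable M2" using f g by auto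
  show "(\<lambda>p. f (fst p) * g (snd p)) \<in> borel_measurable (M1 \<Otimes>\<^sub>M M2)" by measurable
  show "integrable M1 (\<lambda>x. LINT y|M2. norm (f (fst (x, y)) * g (snd (x, y))))"
    using f by (simp add: norm_mult)
  show "AE x in M1. integrable M2 (\<lambda>y. f (fst (x, y)) * g (snd (x, y)))" using g by simp
qed

lemma osc_Fubini:
  assumes g: "integrable freq_measure g" and p: "integrable cyl \<phi>"
  shows "(LINT z|cyl. (LINT \<zeta>|freq_measure. cis (\<sigma> * dot z \<zeta>) * g \<zeta>) * \<phi> z) =
    (LINT \<zeta>|freq_measure. g \<zeta> * (LINT z|cyl. cis (\<sigma> * dot z \<zeta>) * \<phi> z))"
proof -
  have [measurable]: "g \<in> borel_measurable freq_measure" "\<phi> \<in> borel_measurable cyl" using g p by auto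
  have dm: "(\<lambda>p. \<sigma> * dot (fst p) (snd p)) \<in> borel_measurable (cyl \<Otimes>\<^sub>M freq_measure)" by measurable
  have "integrable (cyl \<Otimes>\<^sub>M freq_measure) (\<lambda>p. cis (\<sigma> * dot (fst p) (snd p)) * (\<phi> (fst p) * g (snd p)))"
    by (rule osc_integrable[OF cylfreq.integrable_product[OF p g] dm])
  then have i: "integrable (cyl \<Otimes>\<^sub>M freq_measure) (case_prod (\<lambda>z \<zeta>. cis (\<sigma> * dot z \<zeta>) * (\<phi> z * g \<zeta>)))"
    by (simp add: case_prod_beta')
  have "(LINT z|cyl. (LINT \<zeta>|freq_measure. cis (\<sigma> * dot z \<zeta>) * g \<zeta>) * \<phi> z) = (LINT z|cyl. LINT \<zeta>|freq_measure. cis (\<sigma> * dot z \<zeta>) * (\<phi> z * g \<zeta>))"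
    by (intro Bochner_Integration.integral_cong refl) (simp add: integral_mult_left_zero[symmetric] mult_ac)
  also have "\<dots> = (LINT \<zeta>|freq_measure. LINT z|cyl. cis (\<sigma> * dot z \<zeta>) * (\<phi> z * g \<zeta>))"
    by (rule cylfreq.Fubini_integral[OF i, symmetric])
  also have "\<dots> = (LINT \<zeta>|freq_measure. g \<zeta> * (LINT z|cyl. cis (\<sigma> * dot z \<zeta>) * \<phi> z))"
    by (intro Bochner_Integration.integral_cong refl) (simp add: integral_mult_right_zero[symmetric] mult_ac)
  finally show ?thesis .
qed

lemma synth_duality:
  assumes "integrable freq_measure g" "integrable cyl \<phi>"
  shows "(LINT z|cyl. synth g z * \<phi> z) = (LINT \<zeta>|freq_measure. g \<zeta> * bt \<phi> \<zeta>)"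
  using osc_Fubini[OF assms, of 1] by (simp add: synth_def bt_def)

lemma ft_duality:
  assumes "integrable freq_measure g" "integrable cyl \<phi>"
  shows "(LINT z|cyl. ft g z * \<phi> z) = (LINT \<zeta>|freq_measure. g \<zeta> * (LINT z|cyl. cis (- dot z \<zeta>) * \<phi> z))"
  using osc_Fubini[OF assms, of "-1"] by (simp add: ft_def)

section \<open>Fourier inversion\<close>

text \<open>Suppose that \<open>D z0\<close> is not zero, and rotate it to the positive axis. Close to \<open>z0\<close> the real part stays above a
  positive constant, and the powers of \<open>W\<close> on a small neighbourhood are at least \<open>a ^ n\<close>; away
  from \<open>z0\<close> they are at most \<open>b ^ n\<close> with \<open>b < a\<close>. For large \<open>n\<close> the integral against \<open>W ^ n\<close> cannot vanish.

  The lemma replaces approximate identities in both inversion theorems: as \<open>W\<close> one takes functions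
  whose powers have an explicit transform.\<close>

lemma peak_orthogonal_zero:
  fixes D :: "'a::topological_space \<Rightarrow> complex" and W :: "'a \<Rightarrow> real"
  assumes sets: "sets M = sets borel" and D: "integrable M D" "continuous_on UNIV D"
    and W: "continuous_on UNIV W" "\<And>z. 0 \<le> W z" "\<And>z. W z \<le> 1" "W z0 = 1"
    and pos: "\<And>U. open U \<Longrightarrow> z0 \<in> U \<Longrightarrow> \<exists>V\<in>sets M. V \<subseteq> U \<and> 0 < emeasure M V \<and> emeasure M V < \<infinity>"
    and peak: "\<And>U. open U \<Longrightarrow> z0 \<in> U \<Longrightarrow> \<exists>b<1. AE z in M. z \<notin> U \<longrightarrow> W z \<le> b"
    and orth: "\<And>n. n \<ge> 1 \<Longrightarrow> (LINT z|M. D z * of_real (W z ^ n)) = 0"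
  shows "D z0 = 0"
proof (rule ccontr)
  assume "D z0 \<noteq> 0"
  define R where "R z = Re (cnj (D z0) * D z)" for z
  define c where "c = R z0 / 2"
  have "R z0 = (cmod (D z0))\<^sup>2" unfolding cmod_power2 by (simp add: R_def power2_eq_square)
  then have R0: "R z0 > 0" using \<open>D z0 \<noteq> 0\<close> by simp
  then have c: "c > 0" "c < R z0" by (simp_all add: c_def)
  have Rc: "continuous_on UNIV R" unfolding R_def by (intro continuous_intros D(2))
  define U where "U = {z. c < R z}"
  have U: "open U" "z0 \<in> U" using c(2) unfolding U_def
    by (auto intro!: open_Collect_less continuous_on_const Rc)
  obtain b0 where b0: "b0 < 1" "AE z in M. z \<notin> U \<longrightarrow> W z \<le> b0" using peak[OF U] by blast
  define b where "b = max b0 0"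
  have b: "0 \<le> b" "b < 1" "AE z in M. z \<notin> U \<longrightarrow> W z \<le> b" 
    using b0 by (auto simp: b_def elim!: eventually_mono)
  define a where "a = (1 + b) / 2"
  have a: "b < a" "a < 1" "a > 0" using b by (auto simp: a_def)
  \<comment> \<open>On this smaller neighbourhood the powers of \<open>W\<close> beat their values outside of \<open>U\<close>.\<close>
  define U' where "U' = U \<inter> {z. a < W z}"
  have U': "open U'" "z0 \<in> U'" using U a W(4) unfolding U'_def
    by (auto intro!: open_Int open_Collect_less continuous_on_const W(1))
  obtain V where V: "V \<in> sets M" "V \<subseteq> U'" "0 < emeasure M V" "emeasure M V < \<infinity>" using pos[OF U'] by blast
  define m where "m = measure M V"
  have m: "m > 0" using V(3,4) unfolding m_def by (simp add: measure_def enn2real_positive_iff)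
  have [measurable]: "R \<in> borel_measurable M" "W \<in> borel_measurable M"
    using borel_measurable_continuous_onI[OF Rc] borel_measurable_continuous_onI[OF W(1)] by (simp_all add: measurable_cong_sets[OF sets refl])
  have Ri: "integrable M R" unfolding R_def by (intro integrable_Re integrable_mult_right D)
  define K where "K = (LINT z|M. \<bar>R z\<bar>)"
  have W1: "\<bar>W z ^ n\<bar> \<le> 1" for z n using W(2,3)[of z] by (simp add: power_le_one)
  have RWi: "integrable M (\<lambda>z. R z * W z ^ n)" for n
    by (rule Bochner_Integration.integrable_bound[OF Ri]) (use W1 in \<open>auto simp: abs_mult intro!: mult_left_le\<close>)
  have DWi: "integrable M (\<lambda>z. D z * of_real (W z ^ n))" for n
  proof (rule Bochner_Integration.integrable_bound[OF D(1)])
    have [measurable]: "D \<in> borel_measurable M" using D(1) by simp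
    show "(\<lambda>z. D z * of_real (W z ^ n)) \<in> borel_measurable M" by measurable
    show "AE z in M. norm (D z * of_real (W z ^ n)) \<le> norm (D z)"
      using W1 by (auto simp: norm_mult simp del: of_real_power intro!: mult_left_le)
  qed
  have zero: "(LINT z|M. R z * W z ^ n) = 0" if "n \<ge> 1" for n
  proof -
    have "(LINT z|M. R z * W z ^ n) = (LINT z|M. Re (cnj (D z0) * (D z * of_real (W z ^ n))))"
      unfolding R_def by (intro Bochner_Integration.integral_cong refl) (simp add: algebra_simps flip: of_real_power)
    also have "\<dots> = Re (LINT z|M. cnj (D z0) * (D z * of_real (W z ^ n)))"
      by (rule integral_Re) (intro integrable_mult_right DWi)
    also have "\<dots> = 0" using orth[OF that] by simp
    finally show ?thesis .
  qed
  have ineq: "c * m * a ^ n \<le> K * b ^ n" if n: "n \<ge> 1" for n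
  proof -
    have Vi: "integrable M (\<lambda>z. c * a ^ n * indicator V z)" using V by (intro integrable_mult_right) auto
    have Ki: "integrable M (\<lambda>z. \<bar>R z\<bar> * b ^ n)" using Ri by simp
    have "(LINT z|M. c * a ^ n * indicator V z - \<bar>R z\<bar> * b ^ n) \<le> (LINT z|M. R z * W z ^ n)"
    proof (rule integral_mono_AE[OF _ RWi])
      show "integrable M (\<lambda>z. c * a ^ n * indicator V z - \<bar>R z\<bar> * b ^ n)" using Vi Ki by simp
      show "AE z in M. c * a ^ n * indicator V z - \<bar>R z\<bar> * b ^ n \<le> R z * W z ^ n"
        using b(3)
      proof eventually_elim
        case (elim z)
        have bn: "0 \<le> \<bar>R z\<bar> * b ^ n" using b by simp
        consider "z \<in> V" | "z \<in> U" "z \<notin> V" | "z \<notin> U" by blast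
        then show ?case
        proof cases
          case 1
          then have "c < R z" "a < W z" using V(2) by (auto simp: U'_def U_def)
          then have "c * a ^ n \<le> R z * W z ^ n" using c a by (intro mult_mono power_mono) auto
          then show ?thesis using 1 bn by simp
        next
          case 2
          then have "0 < R z" using c by (auto simp: U_def)
          then have "0 \<le> R z * W z ^ n" using W(2)[of z] by simp
          then show ?thesis using 2 bn by simp
        next
          case 3
          then have v: "z \<notin> V" using V(2) by (auto simp: U'_def)
          have "W z ^ n \<le> b ^ n" using 3 elim W(2)[of z] by (intro power_mono) auto
          then have "\<bar>R z * W z ^ n\<bar> \<le> \<bar>R z\<bar> * b ^ n" using W(2)[of z] by (simp add: abs_mult mult_left_mono)
          then show ?thesis using v by simp
        qed
      qed
    qed
    moreover have "(LINT z|M. c * a ^ n * indicator V z - \<bar>R z\<bar> * b ^ n) = c * a ^ n * m - K * b ^ n"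
      using Bochner_Integration.integral_diff[OF Vi Ki] V(1) by (simp add: m_def K_def)
    ultimately show ?thesis using zero[OF n] by (simp add: mult_ac)
  qed
  have "(\<lambda>n. K * (b / a) ^ n) \<longlonglongrightarrow> K * 0"
    using a b by (intro tendsto_intros LIMSEQ_realpow_zero) (auto simp: field_simps)
  moreover have "eventually (\<lambda>n. c * m \<le> K * (b / a) ^ n) sequentially"
    using eventually_ge_at_top[of 1]
  proof eventually_elim
    case (elim n)
    have "a ^ n > 0" using a by simp
    then show ?case using ineq[OF elim] by (simp add: power_divide field_simps)
  qed
  ultimately have "c * m \<le> K * 0" by (rule tendsto_lowerbound) simp
  then show False using c m by (simp add: mult_le_0_iff)
qed

lemma shifted_gaussian_fourier: 
  assumes "a > 0"
  shows "integrable lborel (\<lambda>v::real. complex_of_real (exp (- (a * (v - v0)\<^sup>2 / 2))))"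
    "(LINT v|lborel. cis (s * v) * complex_of_real (exp (- (a * (v - v0)\<^sup>2 / 2)))) =
      cis (s * v0) * complex_of_real (sqrt (2 * pi / a) * exp (- (s\<^sup>2 / (2 * a))))"
proof -
  have i1: "integrable lborel (\<lambda>v::real. complex_of_real (exp (- (v\<^sup>2 / 2))))"
  proof -
    have "integrable lborel std_normal_density" by (rule integrable_normal_density) simp
    then have "integrable lborel (\<lambda>v. sqrt (2 * pi) * std_normal_density v)" by (rule integrable_mult_right)
    then have "integrable lborel (\<lambda>v::real. exp (- (v\<^sup>2 / 2)))" by (simp add: std_normal_density_def)
    then show ?thesis by (rule integrable_of_real)
  qed
  have f1: "(LINT v|lborel. cis (s * v) * complex_of_real (exp (- (v\<^sup>2 / 2)))) = complex_of_real (sqrt (2 * pi) * exp (- (s\<^sup>2 / 2)))" for s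
  proof -
    have "char std_normal_distribution s = (LINT v|lborel. std_normal_density v *\<^sub>R iexp (s * v))"
      unfolding char_def by (subst integral_density) (auto simp: mult_ac)
    also have "\<dots> = (LINT v|lborel. complex_of_real (1 / sqrt (2 * pi)) * (cis (s * v) * complex_of_real (exp (- (v\<^sup>2 / 2)))))"
      by (intro Bochner_Integration.integral_cong refl) (simp add: std_normal_density_def scaleR_conv_of_real cis_conv_exp)
    also have "\<dots> = complex_of_real (1 / sqrt (2 * pi)) * (LINT v|lborel. cis (s * v) * complex_of_real (exp (- (v\<^sup>2 / 2))))"
      by (rule integral_mult_right_zero)
    finally have "complex_of_real (1 / sqrt (2 * pi)) * (LINT v|lborel. cis (s * v) * complex_of_real (exp (- (v\<^sup>2 / 2)))) = complex_of_real (exp (- (s\<^sup>2) / 2))"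
      unfolding char_std_normal_distribution by simp
    then show ?thesis by (simp add: field_simps)
  qed
  define r where "r = sqrt a"
  have r: "r > 0" "r\<^sup>2 = a" using assms by (auto simp: r_def)
  have e: "exp (- (a * (v0 + (1 / r) * v - v0)\<^sup>2 / 2)) = exp (- (v\<^sup>2 / 2))" for v
    using r by (simp add: power_divide r(2)[symmetric])
  show i2: "integrable lborel (\<lambda>v::real. complex_of_real (exp (- (a * (v - v0)\<^sup>2 / 2))))"
    using lborel_integrable_real_affine_iff[of "1 / r" "\<lambda>v. complex_of_real (exp (- (a * (v - v0)\<^sup>2 / 2)))" v0] i1 r(1)
    unfolding e by simp
  have "(LINT v|lborel. cis (s * v) * complex_of_real (exp (- (a * (v - v0)\<^sup>2 / 2)))) = 
    \<bar>1 / r\<bar> *\<^sub>R (LINT v|lborel. cis (s * (v0 + (1 / r) * v)) * complex_of_real (exp (- (a * (v0 + (1 / r) * v - v0)\<^sup>2 / 2))))"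
    by (rule lborel_integral_real_affine) (use r in simp)
  also have "(LINT v|lborel. cis (s * (v0 + (1 / r) * v)) * complex_of_real (exp (- (a * (v0 + (1 / r) * v - v0)\<^sup>2 / 2)))) =
    (LINT v|lborel. cis (s * v0) * (cis (s / r * v) * complex_of_real (exp (- (v\<^sup>2 / 2)))))"
    unfolding e by (intro Bochner_Integration.integral_cong refl) (simp add: cis_mult distrib_left mult.assoc[symmetric])
  also have "\<dots> = cis (s * v0) * complex_of_real (sqrt (2 * pi) * exp (- ((s / r)\<^sup>2 / 2)))"
    by (simp only: integral_mult_right_zero f1)
  also have "\<bar>1 / r\<bar> *\<^sub>R \<dots> = cis (s * v0) * complex_of_real (sqrt (2 * pi / a) * exp (- (s\<^sup>2 / (2 * a))))"
    using r by (simp add: scaleR_conv_of_real real_sqrt_divide r_def[symmetric] power_divide mult_ac)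
  finally show "(LINT v|lborel. cis (s * v) * complex_of_real (exp (- (a * (v - v0)\<^sup>2 / 2)))) =
      cis (s * v0) * complex_of_real (sqrt (2 * pi / a) * exp (- (s\<^sup>2 / (2 * a))))" .
qed

lemma (in pair_sigma_finite) integral_product:
  fixes f :: "'a \<Rightarrow> complex" and g :: "'b \<Rightarrow> complex"
  assumes f: "integrable M1 f" and g: "integrable M2 g"
  shows "(LINT p|(M1 \<Otimes>\<^sub>M M2). f (fst p) * g (snd p)) = (LINT x|M1. f x) * (LINT y|M2. g y)"
  using integral_fst'[OF integrable_product[OF f g]] by simp

lemma freq_product:
  fixes f g :: "real \<Rightarrow> complex" and h :: "int \<Rightarrow> complex"
  assumes "integrable lborel f" "integrable lborel g" "integrable (count_space UNIV) h"
  shows "integrable freq_measure (\<lambda>\<zeta>. f (tau \<zeta>) * (g (xi \<zeta>) * h (snd (snd \<zeta>))))"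
    "(LINT \<zeta>|freq_measure. f (tau \<zeta>) * (g (xi \<zeta>) * h (snd (snd \<zeta>)))) = (LINT x|lborel. f x) * ((LINT x|lborel. g x) * (LINT q|count_space UNIV. h q))"
  unfolding freq_measure_def tau_def xi_def
  using lbi2.integrable_product[OF assms(1) lbi.integrable_product[OF assms(2,3)]]
    lbi2.integral_product[OF assms(1) lbi.integrable_product[OF assms(2,3)]] lbi.integral_product[OF assms(2,3)]
  by simp_all

lemma cyl_product:
  fixes f g h :: "real \<Rightarrow> complex"
  assumes "integrable lborel f" "integrable lborel g" "integrable circle_measure h"
  shows "integrable cyl (\<lambda>z. f (fst z) * (g (fst (snd z)) * h (snd (snd z))))"
    "(LINT z|cyl. f (fst z) * (g (fst (snd z)) * h (snd (snd z)))) = (LINT x|lborel. f x) * ((LINT x|lborel. g x) * (LINT y|circle_measure. h y))"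
  unfolding cyl_def
  using llly.integrable_product[OF assms(1) lly.integrable_product[OF assms(2,3)]]
    llly.integral_product[OF assms(1) lly.integrable_product[OF assms(2,3)]] lly.integral_product[OF assms(2,3)]
  by simp_all

text \<open>Orthogonality of the characters of the torus.\<close>

lemma circle_measure_character:
  shows "integrable circle_measure (\<lambda>y. cis (y * real_of_int k))"
    "(LINT y|circle_measure. cis (y * real_of_int k)) = (if k = 0 then of_real (2 * pi) else 0)"
proof -
  have m: "(\<lambda>y. cis (y * real_of_int k)) \<in> borel_measurable borel" by measurable
  show "integrable circle_measure (\<lambda>y. cis (y * real_of_int k))"
    by (rule circle_measure.integrable_const_bound[where B = 1]) (use m in \<open>auto simp: measurable_cong_sets[OF sets_circle_measure refl]\<close>)
  have l: "circle_measure = density lborel (\<lambda>y. ennreal (indicator {0..2*pi} y))"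
    unfolding circle_measure_def by (intro density_cong) (auto simp: indicator_def)
  have e: "(LINT y|circle_measure. cis (y * real_of_int k)) = (LINT y|lborel. indicator {0..2*pi} y *\<^sub>R cis (y * real_of_int k))"
    unfolding l by (rule integral_density) (use m in auto)
  show "(LINT y|circle_measure. cis (y * real_of_int k)) = (if k = 0 then of_real (2 * pi) else 0)"
  proof (cases "k = 0")
    case True
    then show ?thesis unfolding e by (simp add: scaleR_conv_of_real)
  next
    case False
    let ?F = "\<lambda>y. cis (y * real_of_int k) / (\<i> * of_int k)"
    have d: "(?F has_vector_derivative cis (y * real_of_int k)) (at y within A)" for y A
    proof -
      have "((\<lambda>y. y * real_of_int k) has_real_derivative real_of_int k) (at y within A)" by (auto intro!: derivative_eq_intros)
      from has_derivative_cis[OF this[unfolded has_field_derivative_def]]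
      have "((\<lambda>y. cis (y * real_of_int k)) has_vector_derivative (of_int k * (\<i> * cis (y * real_of_int k)))) (at y within A)"
        by (simp add: has_vector_derivative_def scaleR_conv_of_real mult_ac)
      from has_vector_derivative_divide[OF this, of "\<i> * of_int k"] show ?thesis using False by simp
    qed
    have "has_bochner_integral lborel (\<lambda>y. indicator {0..2*pi} y *\<^sub>R cis (y * real_of_int k)) (?F (2 * pi) - ?F 0)"
      by (rule has_bochner_integral_FTC_Icc) (auto intro!: d continuous_intros)
    moreover have "?F (2 * pi) = ?F 0" using cis_add_2pi[of 0 k] by simp
    ultimately show ?thesis unfolding e using False by (simp add: has_bochner_integral_integral_eq)
  qed
qed

lemma delta_int:
  shows "integrable (count_space UNIV) (\<lambda>q::int. f q * (if q = q0 then 1 else 0 :: complex))"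
    "(LINT q|count_space UNIV. f q * (if q = q0 then 1 else 0 :: complex)) = f q0"
proof -
  have e: "(\<lambda>q::int. f q * (if q = q0 then 1 else 0 :: complex)) = (\<lambda>q. indicator {q0} q *\<^sub>R f q0)"
    by (auto simp: fun_eq_iff indicator_def)
  show "integrable (count_space UNIV) (\<lambda>q::int. f q * (if q = q0 then 1 else 0 :: complex))"
    unfolding e by (intro integrable_scaleR_left) auto
  show "(LINT q|count_space UNIV. f q * (if q = q0 then 1 else 0 :: complex)) = f q0"
    unfolding e by (simp add: measure_count_space)
qed

definition gauss :: "real \<Rightarrow> real \<Rightarrow> real \<Rightarrow> complex" where
  "gauss a v0 v = complex_of_real (exp (- (a * (v - v0)\<^sup>2 / 2)))"

lemma gauss_integrable: "a > 0 \<Longrightarrow> integrable lborel (gauss a v0)"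
  unfolding gauss_def[abs_def] by (rule shifted_gaussian_fourier)

lemma gauss_osc_integrable: "a > 0 \<Longrightarrow> integrable lborel (\<lambda>v. cis (s * v) * gauss a v0 v)"
  by (rule osc_integrable[OF gauss_integrable]) auto

lemma gauss_fourier: "a > 0 \<Longrightarrow> (LINT v|lborel. cis (s * v) * gauss a v0 v) = cis (s * v0) * (of_real (sqrt (2 * pi / a)) * gauss (1 / a) 0 s)"
  unfolding gauss_def using shifted_gaussian_fourier(2)[of a s v0] by (simp add: mult.commute)

text \<open>Frequency Gaussians on a single integer frequency have Gaussian inverse transforms times a
  character. All computations in the inversion theorems are reduced to these.\<close>

lemma synth_gaussian:
  fixes q0 :: int and \<tau>0 \<xi>0 :: real
  assumes a: "a > 0"
  defines "K \<equiv> \<lambda>\<zeta>. gauss a \<tau>0 (tau \<zeta>) * (gauss a \<xi>0 (xi \<zeta>) * (if snd (snd \<zeta>) = q0 then 1 else 0))"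
  shows "integrable freq_measure K"
    "synth K z = of_real (2 * pi / a) * (cis (fst z * \<tau>0) * gauss (1 / a) 0 (fst z) * (cis (fst (snd z) * \<xi>0) * gauss (1 / a) 0 (fst (snd z)) * cis (snd (snd z) * real_of_int q0)))"
proof -
  show "integrable freq_measure K" unfolding K_def
    using freq_product(1)[OF gauss_integrable[OF a] gauss_integrable[OF a] delta_int(1)[of "\<lambda>_. 1" q0]] by simp
  have e: "cis (dot z \<zeta>) * K \<zeta> = (cis (fst z * tau \<zeta>) * gauss a \<tau>0 (tau \<zeta>)) * ((cis (fst (snd z) * xi \<zeta>) * gauss a \<xi>0 (xi \<zeta>)) *
     (cis (snd (snd z) * real_of_int (snd (snd \<zeta>))) * (if snd (snd \<zeta>) = q0 then 1 else 0)))" for \<zeta>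
    by (simp add: K_def dot_def qq_def cis_mult[symmetric] mult_ac)
  have s: "complex_of_real (sqrt (2 * pi / a)) * complex_of_real (sqrt (2 * pi / a)) = of_real (2 * pi / a)"
    using a by (simp flip: of_real_mult)
  have "synth K z = (cis (fst z * \<tau>0) * (of_real (sqrt (2 * pi / a)) * gauss (1 / a) 0 (fst z))) * ((cis (fst (snd z) * \<xi>0) * (of_real (sqrt (2 * pi / a)) * gauss (1 / a) 0 (fst (snd z)))) *
     cis (snd (snd z) * real_of_int q0))"
    unfolding synth_def e
    by (subst freq_product(2)[OF gauss_osc_integrable[OF a] gauss_osc_integrable[OF a] delta_int(1)[of "\<lambda>q. cis (snd (snd z) * real_of_int q)"]])
       (simp only: gauss_fourier[OF a] delta_int)
  also have "\<dots> = (complex_of_real (sqrt (2 * pi / a)) * complex_of_real (sqrt (2 * pi / a))) * (cis (fst z * \<tau>0) * gauss (1 / a) 0 (fst z) * (cis (fst (snd z) * \<xi>0) * gauss (1 / a) 0 (fst (snd z)) * cis (snd (snd z) * real_of_int q0)))"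
    by (simp only: mult_ac)
  finally show "synth K z = of_real (2 * pi / a) * (cis (fst z * \<tau>0) * gauss (1 / a) 0 (fst z) * (cis (fst (snd z) * \<xi>0) * gauss (1 / a) 0 (fst (snd z)) * cis (snd (snd z) * real_of_int q0)))"
    unfolding s .
qed

lemma gauss_minus: "gauss a 0 (v0 - v) = gauss a v0 v"
  by (simp add: gauss_def power2_commute)

text \<open>Inversion for these particular functions. The constant \<open>(2 pi) ^ 3\<close> collects \<open>2 pi\<close> from each Gaussian pair and
  \<open>2 pi\<close> from the period.\<close>

lemma synth_gaussian_back:
  fixes q0 :: int and \<tau>0 \<xi>0 :: real
  assumes a: "a > 0"
  defines "K \<equiv> \<lambda>\<zeta>. gauss a \<tau>0 (tau \<zeta>) * (gauss a \<xi>0 (xi \<zeta>) * (if snd (snd \<zeta>) = q0 then 1 else 0))"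
  shows "integrable cyl (synth K)" "(LINT z|cyl. cis (- dot z \<zeta>) * synth K z) = of_real ((2 * pi) ^ 3) * K \<zeta>"
proof -
  have a': "1 / a > 0" using a by simp
  let ?g = "gauss (1 / a) 0"
  have g: "(\<lambda>v. cis (v * s) * ?g v) = (\<lambda>v. cis (s * v) * ?g v)" for s by (simp add: mult.commute)
  have gi: "integrable lborel (\<lambda>v. cis (v * s) * ?g v)" for s unfolding g by (rule gauss_osc_integrable[OF a'])
  have "integrable cyl (\<lambda>z. cis (fst z * \<tau>0) * ?g (fst z) * (cis (fst (snd z) * \<xi>0) * ?g (fst (snd z)) * cis (snd (snd z) * real_of_int q0)))"
    by (rule cyl_product(1)[OF gi gi circle_measure_character(1)])
  then show "integrable cyl (synth K)"
    unfolding K_def synth_gaussian(2)[OF a, abs_def] by (rule integrable_mult_right)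
  have e: "cis (- dot z \<zeta>) * synth K z = of_real (2 * pi / a) * ((cis (fst z * (\<tau>0 - tau \<zeta>)) * ?g (fst z)) * ((cis (fst (snd z) * (\<xi>0 - xi \<zeta>)) * ?g (fst (snd z))) *
     cis (snd (snd z) * real_of_int (q0 - snd (snd \<zeta>)))))" for z
  proof -
    have "cis (- dot z \<zeta>) = cis (- (fst z * tau \<zeta>)) * cis (- (fst (snd z) * xi \<zeta>)) * cis (- (snd (snd z) * qq \<zeta>))"
      by (simp add: dot_def cis_mult)
    moreover have "cis (fst z * (\<tau>0 - tau \<zeta>)) = cis (fst z * \<tau>0) * cis (- (fst z * tau \<zeta>))"
      "cis (fst (snd z) * (\<xi>0 - xi \<zeta>)) = cis (fst (snd z) * \<xi>0) * cis (- (fst (snd z) * xi \<zeta>))"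
      "cis (snd (snd z) * real_of_int (q0 - snd (snd \<zeta>))) = cis (snd (snd z) * real_of_int q0) * cis (- (snd (snd z) * qq \<zeta>))"
      by (simp_all add: cis_mult algebra_simps qq_def)
    ultimately show ?thesis unfolding K_def synth_gaussian(2)[OF a] by (simp only: mult_ac)
  qed
  have k: "(if q0 - snd (snd \<zeta>) = 0 then complex_of_real (2 * pi) else 0) = of_real (2 * pi) * (if snd (snd \<zeta>) = q0 then 1 else 0)" by auto
  have s: "complex_of_real (sqrt (2 * pi / (1 / a))) * complex_of_real (sqrt (2 * pi / (1 / a))) = of_real (2 * pi * a)"
    using a by (simp flip: of_real_mult)
  have gf: "(LINT v|lborel. cis (v * (v0 - v1)) * ?g v) = of_real (sqrt (2 * pi / (1 / a))) * gauss a v0 v1" for v0 v1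
    unfolding g gauss_fourier[OF a'] using a by (simp add: gauss_minus)
  have "(LINT z|cyl. cis (- dot z \<zeta>) * synth K z) = of_real (2 * pi / a) * ((of_real (sqrt (2 * pi / (1 / a))) * gauss a \<tau>0 (tau \<zeta>)) *
     ((of_real (sqrt (2 * pi / (1 / a))) * gauss a \<xi>0 (xi \<zeta>)) * (of_real (2 * pi) * (if snd (snd \<zeta>) = q0 then 1 else 0))))"
    unfolding e integral_mult_right_zero
    by (subst cyl_product(2)[OF gi gi circle_measure_character(1)]) (simp only: gf circle_measure_character(2) k)
  also have "\<dots> = of_real (2 * pi / a) * (complex_of_real (sqrt (2 * pi / (1 / a))) * complex_of_real (sqrt (2 * pi / (1 / a)))) * of_real (2 * pi) * K \<zeta>"
    unfolding K_def by (simp only: mult_ac)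
  also have "\<dots> = of_real ((2 * pi) ^ 3) * K \<zeta>"
    unfolding s using a by (simp add: power3_eq_cube field_simps)
  finally show "(LINT z|cyl. cis (- dot z \<zeta>) * synth K z) = of_real ((2 * pi) ^ 3) * K \<zeta>" .
qed

lemma freq_nbhd:
  fixes \<tau>0 \<xi>0 :: real and q0 :: int
  assumes "open U" "(\<tau>0, \<xi>0, q0) \<in> U"
  obtains \<eta> where "\<eta> > 0" "\<And>\<tau> \<xi>. \<bar>\<tau> - \<tau>0\<bar> < \<eta> \<Longrightarrow> \<bar>\<xi> - \<xi>0\<bar> < \<eta> \<Longrightarrow> (\<tau>, \<xi>, q0) \<in> U"
proof -
  have "open ((\<lambda>p. (fst p, snd p, q0)) -` U)"
    by (rule open_vimage[OF assms(1)]) (intro continuous_intros)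
  moreover have "(\<tau>0, \<xi>0) \<in> (\<lambda>p. (fst p, snd p, q0)) -` U" using assms(2) by simp
  ultimately obtain r where r: "r > 0" "ball (\<tau>0, \<xi>0) r \<subseteq> (\<lambda>p. (fst p, snd p, q0)) -` U"
    unfolding open_contains_ball by blast
  show thesis
  proof
    show "r / 2 > 0" using r by simp
    fix \<tau> \<xi> assume "\<bar>\<tau> - \<tau>0\<bar> < r / 2" "\<bar>\<xi> - \<xi>0\<bar> < r / 2"
    then have "dist (\<tau>0, \<xi>0) (\<tau>, \<xi>) < r"
      using sqrt_sum_squares_le_sum_abs[of "\<tau>0 - \<tau>" "\<xi>0 - \<xi>"] by (simp add: dist_prod_def dist_real_def abs_minus_commute)
    then have "(\<tau>, \<xi>) \<in> ball (\<tau>0, \<xi>0) r" by simp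
    then show "(\<tau>, \<xi>, q0) \<in> U" using r(2) by auto
  qed
qed

lemma phys_nbhd:
  fixes t0 x0 y0 :: real
  assumes "open U" "(t0, x0, y0) \<in> U"
  obtains \<eta> where "\<eta> > 0" "\<And>t x y. \<bar>t - t0\<bar> < \<eta> \<Longrightarrow> \<bar>x - x0\<bar> < \<eta> \<Longrightarrow> \<bar>y - y0\<bar> < \<eta> \<Longrightarrow> (t, x, y) \<in> U"
proof -
  obtain r where r: "r > 0" "ball (t0, x0, y0) r \<subseteq> U"
    using assms open_contains_ball by blast
  show thesis
  proof
    show "r / 3 > 0" using r by simp
    fix t x y assume a: "\<bar>t - t0\<bar> < r / 3" "\<bar>x - x0\<bar> < r / 3" "\<bar>y - y0\<bar> < r / 3"
    have d1: "dist (t0, x0, y0) (t, x, y) \<le> \<bar>t0 - t\<bar> + \<bar>dist (x0, y0) (x, y)\<bar>"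
      using sqrt_sum_squares_le_sum_abs[of "t0 - t" "dist (x0, y0) (x, y)"] by (subst dist_prod_def) (simp add: dist_real_def)
    have d2: "dist (x0, y0) (x, y) \<le> \<bar>x0 - x\<bar> + \<bar>y0 - y\<bar>"
      using sqrt_sum_squares_le_sum_abs[of "x0 - x" "y0 - y"] by (simp add: dist_prod_def dist_real_def)
    have d3: "\<bar>dist (x0, y0) (x, y)\<bar> = dist (x0, y0) (x, y)" by (rule abs_of_nonneg) simp
    have "dist (t0, x0, y0) (t, x, y) < r" using d1 d2 a unfolding d3 by (simp add: abs_minus_commute)
    then show "(t, x, y) \<in> U" using r(2) by (auto simp: subset_iff)
  qed
qed

lemma exp_sq_le:
  fixes u \<eta> :: real
  assumes "\<eta> \<le> \<bar>u\<bar>" "0 \<le> \<eta>"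
  shows "exp (- (u\<^sup>2 / 2)) \<le> exp (- (\<eta>\<^sup>2 / 2))"
  using power_mono[OF assms, of 2] by simp

lemma gauss_power: "complex_of_real (exp (- ((v - v0)\<^sup>2 / 2)) ^ n) = gauss (real n) v0 v"
  unfolding gauss_def by (simp add: exp_of_nat_mult[symmetric])

lemma bounded_mult_integrable:
  fixes f g :: "'a \<Rightarrow> complex"
  assumes "integrable M f" "g \<in> borel_measurable M" "\<And>z. cmod (g z) \<le> 1"
  shows "integrable M (\<lambda>z. f z * g z)"
proof (rule Bochner_Integration.integrable_bound[OF assms(1)])
  have [measurable]: "f \<in> borel_measurable M" using assms(1) by simp
  note [measurable] = assms(2)
  show "(\<lambda>z. f z * g z) \<in> borel_measurable M" by measurable
  show "AE z in M. norm (f z * g z) \<le> norm (f z)"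
    using assms(3) by (auto simp: norm_mult intro!: mult_left_le)
qed

text \<open>The difference of both sides is orthogonal to the powers of a Gaussian that peaks at \<open>\<zeta>0\<close>: both
  transforms can be moved to the Gaussian, where inversion is explicit. Then \<open>peak_orthogonal_zero\<close>
  shows that the difference vanishes at \<open>\<zeta>0\<close>.\<close>

theorem bt_ft:
  assumes g: "g \<in> SF"
  shows "bt (ft g) \<zeta>0 = of_real ((2 * pi) ^ 3) * g \<zeta>0"
proof -
  obtain \<tau>0 \<xi>0 q0 where z0: "\<zeta>0 = (\<tau>0, \<xi>0, q0)" by (cases \<zeta>0)
  let ?c = "complex_of_real ((2 * pi) ^ 3)"
  define D where "D \<zeta> = (- ?c) * g \<zeta> + bt (ft g) \<zeta>" for \<zeta>
  have fg: "ft g \<in> schwartz" using ft_schwartz g by (simp add: schwartz_freq_rapid)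
  have bfg: "bt (ft g) \<in> SF" by (rule bt_SF[OF fg])
  have D: "D \<in> SF" unfolding D_def[abs_def] by (rule SF_lin[OF g bfg])
  define W where "W \<zeta> = exp (- ((tau \<zeta> - \<tau>0)\<^sup>2 / 2)) * (exp (- ((xi \<zeta> - \<xi>0)\<^sup>2 / 2)) * (if snd (snd \<zeta>) = q0 then 1 else 0 :: real))" for \<zeta>
  have dc: "continuous_on UNIV (\<lambda>\<zeta>::freq. if snd (snd \<zeta>) = q0 then 1 else 0 :: real)"
  proof -
    have "continuous_on UNIV (\<lambda>q::int. if q = q0 then 1 else 0 :: real)" by (rule Topological_Spaces.continuous_on_discrete)
    then show ?thesis by (rule continuous_on_compose2) (auto intro!: continuous_intros)
  qed
  have Wc: "continuous_on UNIV W" unfolding W_def[abs_def]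
    by (intro continuous_intros dc) auto
  have W01: "0 \<le> W \<zeta>" "W \<zeta> \<le> 1" for \<zeta>
    by (auto simp: W_def mult_le_one)
  have "D \<zeta>0 = 0"
  proof (rule peak_orthogonal_zero[OF sets_freq _ _ Wc W01])
    show "integrable freq_measure D" by (rule rapid_integrable(2)[OF D])
    show "continuous_on UNIV D" by (rule rapid_continuous[OF D])
    show "W \<zeta>0 = 1" by (simp add: W_def z0)
  next
    fix U :: "freq set" assume U: "open U" "\<zeta>0 \<in> U"
    obtain \<eta> where e: "\<eta> > 0" "\<And>\<tau> \<xi>. \<bar>\<tau> - \<tau>0\<bar> < \<eta> \<Longrightarrow> \<bar>\<xi> - \<xi>0\<bar> < \<eta> \<Longrightarrow> (\<tau>, \<xi>, q0) \<in> U"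
      by (rule freq_nbhd[OF U(1) U(2)[unfolded z0]]) (rule that)
    let ?A = "{\<tau>0 - \<eta><..<\<tau>0 + \<eta>}" and ?B = "{\<xi>0 - \<eta><..<\<xi>0 + \<eta>}"
    let ?V = "?A \<times> (?B \<times> {q0})"
    have em: "emeasure freq_measure ?V = ennreal (2 * \<eta>) * (ennreal (2 * \<eta>) * 1)"
      unfolding freq_measure_def using e(1)
      by (subst sigma_finite_measure.emeasure_pair_measure_Times[OF lbi.P.sigma_finite_measure_axioms], simp, simp,
          subst sigma_finite_measure.emeasure_pair_measure_Times[OF sigma_finite_int]) auto
    have Vs: "?V \<in> sets freq_measure" unfolding freq_measure_def by (intro pair_measureI) auto
    have "?V \<subseteq> U" using e(2) by (auto simp: abs_less_iff)
    then show "\<exists>V\<in>sets freq_measure. V \<subseteq> U \<and> 0 < emeasure freq_measure V \<and> emeasure freq_measure V < \<infinity>"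
      using Vs em e(1) by (intro bexI[of _ ?V]) (auto simp: ennreal_zero_less_mult_iff ennreal_mult_less_top)
    show "\<exists>b<1. AE z in freq_measure. z \<notin> U \<longrightarrow> W z \<le> b"
    proof (intro exI[of _ "exp (- (\<eta>\<^sup>2 / 2))"] conjI AE_I2 impI)
      show "exp (- (\<eta>\<^sup>2 / 2)) < 1" using e(1) by simp
      fix \<zeta> assume z: "\<zeta> \<notin> U"
      obtain \<tau> \<xi> q where zz: "\<zeta> = (\<tau>, \<xi>, q)" by (cases \<zeta>)
      show "W \<zeta> \<le> exp (- (\<eta>\<^sup>2 / 2))"
      proof (cases "q = q0")
        case True
        then have "\<eta> \<le> \<bar>\<tau> - \<tau>0\<bar> \<or> \<eta> \<le> \<bar>\<xi> - \<xi>0\<bar>" using e(2)[of \<tau> \<xi>] z zz by force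
        then show ?thesis
        proof
          assume "\<eta> \<le> \<bar>\<tau> - \<tau>0\<bar>"
          then have "exp (- ((\<tau> - \<tau>0)\<^sup>2 / 2)) * exp (- ((\<xi> - \<xi>0)\<^sup>2 / 2)) \<le> exp (- (\<eta>\<^sup>2 / 2)) * 1"
            using e(1) by (intro mult_mono exp_sq_le) auto
          then show ?thesis using True by (simp add: W_def zz)
        next
          assume "\<eta> \<le> \<bar>\<xi> - \<xi>0\<bar>"
          then have "exp (- ((\<tau> - \<tau>0)\<^sup>2 / 2)) * exp (- ((\<xi> - \<xi>0)\<^sup>2 / 2)) \<le> 1 * exp (- (\<eta>\<^sup>2 / 2))"
            using e(1) by (intro mult_mono exp_sq_le) auto
          then show ?thesis using True by (simp add: W_def zz)
        qed
      qed (simp add: W_def zz)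
    qed
  next
    fix n :: nat assume n: "n \<ge> 1"
    define K where "K = (\<lambda>\<zeta>. gauss (real n) \<tau>0 (tau \<zeta>) * (gauss (real n) \<xi>0 (xi \<zeta>) * (if snd (snd \<zeta>) = q0 then 1 else 0)))"
    have n0: "real n > 0" using n by simp
    note Kb = synth_gaussian(1)[OF n0, where ?\<tau>0.0 = \<tau>0 and ?\<xi>0.0 = \<xi>0 and ?q0.0 = q0, folded K_def] synth_gaussian_back[OF n0, where ?\<tau>0.0 = \<tau>0 and ?\<xi>0.0 = \<xi>0 and ?q0.0 = q0, folded K_def]
    have KW: "complex_of_real (W \<zeta> ^ n) = K \<zeta>" for \<zeta>
    proof -
      have "complex_of_real (W \<zeta> ^ n) = complex_of_real (exp (- ((tau \<zeta> - \<tau>0)\<^sup>2 / 2)) ^ n) * (complex_of_real (exp (- ((xi \<zeta> - \<xi>0)\<^sup>2 / 2)) ^ n) * (if snd (snd \<zeta>) = q0 then 1 else 0))"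
        using n by (simp add: W_def power_mult_distrib)
      then show ?thesis unfolding gauss_power K_def .
    qed
    have Km: "K \<in> borel_measurable freq_measure" using Kb(1) by simp
    have K1: "cmod (K \<zeta>) \<le> 1" for \<zeta>
      unfolding KW[symmetric] using W01[of \<zeta>] by (simp add: norm_power power_le_one)
    have fgi: "integrable cyl (ft g)" using fg by (intro rapid_integrable) (simp add: schwartz_rapid)
    have gi: "integrable freq_measure g" by (rule rapid_integrable(2)[OF g])
    have "(LINT \<zeta>|freq_measure. K \<zeta> * bt (ft g) \<zeta>) = (LINT z|cyl. synth K z * ft g z)"
      by (rule synth_duality[OF Kb(1) fgi, symmetric])
    also have "\<dots> = (LINT z|cyl. ft g z * synth K z)" by (simp only: mult.commute)
    also have "\<dots> = (LINT \<zeta>|freq_measure. g \<zeta> * (LINT z|cyl. cis (- dot z \<zeta>) * synth K z))"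
      by (rule ft_duality[OF gi Kb(2)])
    finally have dual: "(LINT \<zeta>|freq_measure. K \<zeta> * bt (ft g) \<zeta>) = (LINT \<zeta>|freq_measure. g \<zeta> * (?c * K \<zeta>))"
      unfolding Kb(3) by (simp only: K_def)
    have "(LINT z|freq_measure. D z * complex_of_real (W z ^ n)) = (LINT z|freq_measure. bt (ft g) z * K z - ?c * (g z * K z))"
      unfolding KW D_def by (intro Bochner_Integration.integral_cong refl) (simp add: algebra_simps)
    also have "\<dots> = (LINT z|freq_measure. bt (ft g) z * K z) - (LINT z|freq_measure. ?c * (g z * K z))"
      by (intro Bochner_Integration.integral_diff integrable_mult_right bounded_mult_integrable rapid_integrable bfg g Km K1)
    also have "\<dots> = 0" using dual by (simp add: mult_ac)
    finally show "(LINT z|freq_measure. D z * complex_of_real (W z ^ n)) = 0" .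
  qed
  then show ?thesis by (simp add: D_def)
qed

text \<open>A translation in physical space is a modulation of the frequency function, so Gaussians with any centre occur as
  inverse transforms.\<close>

lemma synth_gaussian_phys:
  fixes q :: int
  assumes n: "n > 0"
  obtains \<kappa> where "integrable freq_measure \<kappa>" "\<And>z. synth \<kappa> z = gauss n t0 (fst z) * gauss n x0 (fst (snd z)) * cis (snd (snd z) * real_of_int q)"
proof -
  define K where "K = (\<lambda>\<zeta>. gauss (1 / n) 0 (tau \<zeta>) * (gauss (1 / n) 0 (xi \<zeta>) * (if snd (snd \<zeta>) = q then 1 else 0)))"
  have n': "1 / n > 0" using n by simp
  note Kb = synth_gaussian[OF n', where ?\<tau>0.0 = 0 and ?\<xi>0.0 = 0 and ?q0.0 = q, folded K_def]
  define \<kappa> where "\<kappa> \<zeta> = complex_of_real (1 / (2 * pi * n)) * (cis (- dot (t0, x0, 0) \<zeta>) * K \<zeta>)" for \<zeta>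
  show thesis
  proof
    show "integrable freq_measure \<kappa>" unfolding \<kappa>_def
      by (intro integrable_mult_right osc_integrable[OF Kb(1)]) measurable
    fix z
    have "synth \<kappa> z = complex_of_real (1 / (2 * pi * n)) * synth K (z - (t0, x0, 0))"
    proof -
      have d: "dot (z - (t0, x0, 0)) \<zeta> = dot z \<zeta> + - dot (t0, x0, 0) \<zeta>" for \<zeta> by (simp add: dot_def algebra_simps)
      have "cis (dot z \<zeta>) * \<kappa> \<zeta> = complex_of_real (1 / (2 * pi * n)) * (cis (dot (z - (t0, x0, 0)) \<zeta>) * K \<zeta>)" for \<zeta>
        unfolding d \<kappa>_def by (simp only: cis_mult[symmetric] mult_ac)
      then show ?thesis unfolding synth_def by simp
    qed
    also have "\<dots> = gauss n t0 (fst z) * gauss n x0 (fst (snd z)) * cis (snd (snd z) * real_of_int q)"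
      unfolding Kb(2) using n by (simp add: gauss_def field_simps)
    finally show "synth \<kappa> z = gauss n t0 (fst z) * gauss n x0 (fst (snd z)) * cis (snd (snd z) * real_of_int q)" .
  qed
qed

lemma gauss_le1: "a > 0 \<Longrightarrow> cmod (gauss a v0 v) \<le> 1"
  by (simp add: gauss_def)

lemma gauss_measurable [measurable]: "gauss a v0 \<in> borel_measurable borel"
  unfolding gauss_def[abs_def] by measurable

lemma cos_le_cos_away:
  fixes \<eta> u :: real
  assumes "0 < \<eta>" "\<eta> \<le> pi" "\<eta> \<le> \<bar>u\<bar>" "\<bar>u\<bar> \<le> 2 * pi - \<eta>"
  shows "cos u \<le> cos \<eta>"
proof (cases "\<bar>u\<bar> \<le> pi")
  case True
  have "cos \<bar>u\<bar> \<le> cos \<eta>" using assms True by (intro cos_monotone_0_pi_le) auto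
  then show ?thesis by (simp add: cos_abs_real)
next
  case False
  have "cos (2 * pi - \<bar>u\<bar>) \<le> cos \<eta>" using assms False by (intro cos_monotone_0_pi_le) auto
  then show ?thesis by (simp add: cos_diff cos_abs_real)
qed

text \<open>In \<open>y\<close> the peak function is \<open>(1 + cos (y - y0)) / 2\<close>. Its powers are trigonometric polynomials, so the powers
  of the product with Gaussians in \<open>t\<close> and \<open>x\<close> are inverse transforms of integrable functions, to
  which a function with vanishing transform is orthogonal. At \<open>y = 0\<close> and \<open>y = 2 pi\<close> the function peaks twice
  in the fundamental domain, so only interior points are treated.\<close>

lemma bt_injective_interior:
  assumes D: "integrable cyl D" "continuous_on UNIV D" "\<And>\<zeta>. bt D \<zeta> = 0"
    and y0: "0 < y0" "y0 < 2 * pi"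
  shows "D (t0, x0, y0) = 0"
proof -
  define w where "w y = (1 + cos (y - y0)) / 2" for y :: real
  have w01: "0 \<le> w y" "w y \<le> 1" for y
  proof -
    have a: "0 \<le> 1 + cos (y - y0)" using cos_ge_minus_one[of "y - y0"] by linarith
    then show "0 \<le> w y" "w y \<le> 1" by (simp_all add: w_def)
  qed
  define W where "W z = exp (- ((fst z - t0)\<^sup>2 / 2)) * (exp (- ((fst (snd z) - x0)\<^sup>2 / 2)) * w (snd (snd z)))" for z :: phys
  have Wc: "continuous_on UNIV W" unfolding W_def[abs_def] w_def by (intro continuous_intros) auto
  have W01: "0 \<le> W z" "W z \<le> 1" for z
    using w01 by (auto simp: W_def intro!: mult_le_one)
  show ?thesis
  proof (rule peak_orthogonal_zero[OF sets_cyl D(1,2) Wc W01])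
    show "W (t0, x0, y0) = 1" by (simp add: W_def w_def)
  next
    fix U :: "phys set" assume U: "open U" "(t0, x0, y0) \<in> U"
    obtain \<eta>0 where e0: "\<eta>0 > 0" "\<And>t x y. \<bar>t - t0\<bar> < \<eta>0 \<Longrightarrow> \<bar>x - x0\<bar> < \<eta>0 \<Longrightarrow> \<bar>y - y0\<bar> < \<eta>0 \<Longrightarrow> (t, x, y) \<in> U"
      by (rule phys_nbhd[OF U]) (rule that)
    define \<eta> where "\<eta> = min \<eta>0 (min y0 (2 * pi - y0))"
    have e: "\<eta> > 0" "\<eta> \<le> \<eta>0" "\<eta> \<le> y0" "\<eta> \<le> 2 * pi - y0" "\<eta> \<le> pi" using e0(1) y0 by (auto simp: \<eta>_def)
    let ?A = "{t0 - \<eta><..<t0 + \<eta>}" and ?B = "{x0 - \<eta><..<x0 + \<eta>}" and ?C = "{y0 - \<eta><..<y0 + \<eta>}"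
    let ?V = "?A \<times> (?B \<times> ?C)"
    have lC: "emeasure circle_measure ?C = ennreal (2 * \<eta>)"
    proof -
      have "emeasure circle_measure ?C = (\<integral>\<^sup>+y. indicator {0..2*pi} y * indicator ?C y \<partial>lborel)"
        unfolding circle_measure_def by (rule emeasure_density) auto
      also have "\<dots> = (\<integral>\<^sup>+y. indicator ?C y \<partial>lborel)"
        using e by (intro nn_integral_cong) (auto simp: indicator_def)
      also have "\<dots> = ennreal (2 * \<eta>)" using e(1) by (simp add: nn_integral_indicator)
      finally show ?thesis .
    qed
    have em: "emeasure cyl ?V = ennreal (2 * \<eta>) * (ennreal (2 * \<eta>) * ennreal (2 * \<eta>))"
      unfolding cyl_def using e(1)
      by (subst sigma_finite_measure.emeasure_pair_measure_Times[OF sigma_finite_pair_measure[OF sigma_finite_lborel circle_measure.sigma_finite_measure_axioms]], simp, simp,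
          subst sigma_finite_measure.emeasure_pair_measure_Times[OF circle_measure.sigma_finite_measure_axioms]) (auto simp: lC)
    have Vs: "?V \<in> sets cyl" unfolding cyl_def by (intro pair_measureI) auto
    have "?V \<subseteq> U" using e0(2) e(2) by (auto simp: abs_less_iff)
    then show "\<exists>V\<in>sets cyl. V \<subseteq> U \<and> 0 < emeasure cyl V \<and> emeasure cyl V < \<infinity>"
      using Vs em e(1) by (intro bexI[of _ ?V]) (auto simp: ennreal_zero_less_mult_iff ennreal_mult_less_top)
    define b where "b = max (exp (- (\<eta>\<^sup>2 / 2))) ((1 + cos \<eta>) / 2)"
    have cos1: "cos \<eta> < 1"
    proof -
      have "cos \<eta> < cos 0" using e by (intro cos_monotone_0_pi) auto
      then show ?thesis by simp
    qed
    show "\<exists>b<1. AE z in cyl. z \<notin> U \<longrightarrow> W z \<le> b"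
    proof (intro exI[of _ b] conjI)
      show "b < 1" using e(1) cos1 by (simp add: b_def)
      show "AE z in cyl. z \<notin> U \<longrightarrow> W z \<le> b"
        using AE_cyl_cylinder
      proof eventually_elim
        case (elim z)
        obtain t x y where zz: "z = (t, x, y)" by (cases z)
        have y: "0 \<le> y" "y \<le> 2 * pi" using elim by (auto simp: zz cylinder_def)
        show ?case
        proof
          assume "z \<notin> U"
          then have "\<eta> \<le> \<bar>t - t0\<bar> \<or> \<eta> \<le> \<bar>x - x0\<bar> \<or> \<eta> \<le> \<bar>y - y0\<bar>" using e0(2)[of t x y] e(2) zz by force
          then show "W z \<le> b"
          proof (elim disjE)
            assume "\<eta> \<le> \<bar>t - t0\<bar>"
            then have "exp (- ((t - t0)\<^sup>2 / 2)) * (exp (- ((x - x0)\<^sup>2 / 2)) * w y) \<le> exp (- (\<eta>\<^sup>2 / 2)) * 1"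
              using e(1) w01 by (intro mult_mono exp_sq_le mult_le_one) auto
            then show ?thesis by (simp add: W_def zz b_def)
          next
            assume "\<eta> \<le> \<bar>x - x0\<bar>"
            then have "exp (- ((x - x0)\<^sup>2 / 2)) * w y \<le> exp (- (\<eta>\<^sup>2 / 2)) * 1"
              using e(1) w01 by (intro mult_mono exp_sq_le) auto
            from mult_mono[OF _ this, of "exp (- ((t - t0)\<^sup>2 / 2))" 1]
            have "exp (- ((t - t0)\<^sup>2 / 2)) * (exp (- ((x - x0)\<^sup>2 / 2)) * w y) \<le> 1 * (exp (- (\<eta>\<^sup>2 / 2)) * 1)"
              using w01 by simp
            then show ?thesis by (simp add: W_def zz b_def)
          next
            assume "\<eta> \<le> \<bar>y - y0\<bar>"
            then have "cos (y - y0) \<le> cos \<eta>" using e y by (intro cos_le_cos_away) auto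
            then have "w y \<le> (1 + cos \<eta>) / 2" by (simp add: w_def)
            then have wb: "w y \<le> b" unfolding b_def by (rule max.coboundedI2)
            have "exp (- ((t - t0)\<^sup>2 / 2)) * exp (- ((x - x0)\<^sup>2 / 2)) \<le> 1" by (intro mult_le_one) auto
            then have "exp (- ((t - t0)\<^sup>2 / 2)) * exp (- ((x - x0)\<^sup>2 / 2)) * w y \<le> 1 * w y"
              using w01 by (intro mult_right_mono) auto
            then show ?thesis using wb by (simp add: W_def zz mult.assoc)
          qed
        qed
      qed
    qed
  next
    fix n :: nat assume n: "n \<ge> 1"
    have n0: "real n > 0" using n by simp
    define H where "H z = D z * (gauss n t0 (fst z) * gauss n x0 (fst (snd z)))" for z
    have Hi: "integrable cyl H" unfolding H_def
    proof (rule bounded_mult_integrable[OF D(1)])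
      show "(\<lambda>z. gauss n t0 (fst z) * gauss n x0 (fst (snd z))) \<in> borel_measurable cyl" by measurable
      show "cmod (gauss n t0 (fst z) * gauss n x0 (fst (snd z))) \<le> 1" for z :: phys
        using gauss_le1[OF n0] by (simp add: norm_mult mult_le_one)
    qed
    let ?T = "\<lambda>k q z. H z * (cis (snd (snd z) * real_of_int q) * of_real (w (snd (snd z)) ^ k))"
    have wm: "(\<lambda>z::phys. w (snd (snd z))) \<in> borel_measurable cyl" unfolding w_def by measurable
    have Ti: "integrable cyl (?T k q)" for k and q :: int
    proof (rule bounded_mult_integrable[OF Hi])
      show "(\<lambda>z::phys. cis (snd (snd z) * real_of_int q) * of_real (w (snd (snd z)) ^ k)) \<in> borel_measurable cyl"
        using wm by measurable
      show "cmod (cis (snd (snd z) * real_of_int q) * of_real (w (snd (snd z)) ^ k)) \<le> 1" for z :: phys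
        using w01 by (simp add: norm_mult norm_power power_le_one)
    qed
    \<comment> \<open>Each factor of \<open>w\<close> only shifts the character by \<open>-1\<close>, \<open>0\<close> or \<open>1\<close>.\<close>
    have T0: "(LINT z|cyl. ?T k q z) = 0" for k and q :: int
    proof (induction k arbitrary: q)
      case 0
      obtain \<kappa> where k: "integrable freq_measure \<kappa>" "\<And>z. synth \<kappa> z = gauss n t0 (fst z) * gauss n x0 (fst (snd z)) * cis (snd (snd z) * real_of_int q)"
        by (rule synth_gaussian_phys[OF n0, of t0 x0 q]) (rule that)
      have "(LINT z|cyl. ?T 0 q z) = (LINT z|cyl. synth \<kappa> z * D z)"
        unfolding k(2) H_def by (intro Bochner_Integration.integral_cong refl) (simp add: mult_ac)
      also have "\<dots> = 0" unfolding synth_duality[OF k(1) D(1)] by (simp add: D(3))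
      finally show ?case .
    next
      case (Suc k)
      have cosw: "complex_of_real (w y) = 1 / 2 + (cis (- y0) / 4 * cis y + cis y0 / 4 * cis (- y))" for y
      proof -
        have "complex_of_real (cos u) = (cis u + cis (- u)) / 2" for u by (simp add: complex_eq_iff)
        from this[of "y - y0"] have "complex_of_real (cos (y - y0)) = (cis (- y0) * cis y + cis y0 * cis (- y)) / 2"
          by (simp add: cis_mult add.commute)
        then have c: "complex_of_real (cos (y - y0)) / 2 = cis (- y0) / 4 * cis y + cis y0 / 4 * cis (- y)"
          by (simp add: add_divide_distrib)
        have "complex_of_real (w y) = 1 / 2 + complex_of_real (cos (y - y0)) / 2" by (simp add: w_def add_divide_distrib)
        then show ?thesis unfolding c .
      qed
      have e: "?T (Suc k) q z = 1 / 2 * ?T k q z + (cis (- y0) / 4 * ?T k (q + 1) z + cis y0 / 4 * ?T k (q - 1) z)" for z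
      proof -
        let ?y = "snd (snd z)"
        have c1: "cis (?y * real_of_int (q + 1)) = cis (?y * real_of_int q) * cis ?y" by (simp add: cis_mult algebra_simps)
        have c2: "cis (?y * real_of_int (q - 1)) = cis (?y * real_of_int q) * cis (- ?y)" by (simp add: cis_mult algebra_simps)
        have "?T (Suc k) q z = (H z * cis (?y * real_of_int q) * of_real (w ?y ^ k)) * of_real (w ?y)"
          by (simp add: mult_ac)
        then show ?thesis unfolding cosw c1 c2 by (simp add: algebra_simps)
      qed
      note iT = integrable_mult_right[OF Ti[where k = k and q = q], of "1 / 2"] integrable_mult_right[OF Ti[where k = k and q = "q + 1"], of "cis (- y0) / 4"]
        integrable_mult_right[OF Ti[where k = k and q = "q - 1"], of "cis y0 / 4"]
      have "(LINT z|cyl. ?T (Suc k) q z) = (LINT z|cyl. 1 / 2 * ?T k q z) + ((LINT z|cyl. cis (- y0) / 4 * ?T k (q + 1) z) + (LINT z|cyl. cis y0 / 4 * ?T k (q - 1) z))"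
        unfolding e Bochner_Integration.integral_add[OF iT(1) Bochner_Integration.integrable_add[OF iT(2,3)]]
          Bochner_Integration.integral_add[OF iT(2,3)] ..
      also have "\<dots> = 0" unfolding integral_mult_right_zero Suc.IH by simp
      finally show ?case .
    qed
    have "D z * complex_of_real (W z ^ n) = ?T n 0 z" for z
    proof -
      have "complex_of_real (W z ^ n) = complex_of_real (exp (- ((fst z - t0)\<^sup>2 / 2)) ^ n) * (complex_of_real (exp (- ((fst (snd z) - x0)\<^sup>2 / 2)) ^ n) * of_real (w (snd (snd z)) ^ n))"
        by (simp add: W_def power_mult_distrib)
      then show ?thesis unfolding gauss_power H_def by (simp add: mult_ac)
    qed
    then show "(LINT z|cyl. D z * complex_of_real (W z ^ n)) = 0" using T0[where k = n and q = 0] by simp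
  qed
qed

lemma y_periodic_int:
  assumes "y_periodic f"
  shows "f (t, x, y + 2 * pi * real_of_int k) = f (t, x, y)"
proof -
  have n: "f (t, x, y + 2 * pi * real n) = f (t, x, y)" for y n
  proof (induction n)
    case (Suc n)
    have "f (t, x, y + 2 * pi * real (Suc n)) = f (t, x, (y + 2 * pi * real n) + 2 * pi)" by (simp add: algebra_simps)
    then show ?case using assms Suc by (simp add: y_periodic_def)
  qed simp
  show ?thesis
  proof (cases "k \<ge> 0")
    case True
    then show ?thesis using n[of y "nat k"] by simp
  next
    case False
    then have "f (t, x, (y + 2 * pi * real_of_int k) + 2 * pi * real (nat (- k))) = f (t, x, y + 2 * pi * real_of_int k)" by (intro n)
    then show ?thesis using False by (simp add: algebra_simps)
  qed
qed

text \<open>By periodicity every point is equivalent to an interior point or to one with \<open>y = 0\<close>; the latter is a limit of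
  interior points.\<close>

theorem bt_injective:
  assumes D: "integrable cyl D" "continuous_on UNIV D" "\<And>\<zeta>. bt D \<zeta> = 0" "y_periodic D"
  shows "D z = 0"
proof -
  obtain t x y where z: "z = (t, x, y)" by (cases z)
  define k where "k = \<lfloor>y / (2 * pi)\<rfloor>"
  define y' where "y' = y - 2 * pi * real_of_int k"
  have "real_of_int k \<le> y / (2 * pi)" "y / (2 * pi) < real_of_int k + 1" unfolding k_def by linarith+
  then have y': "0 \<le> y'" "y' < 2 * pi" by (auto simp: y'_def field_simps)
  have Dz: "D z = D (t, x, y')" using y_periodic_int[OF D(4), of t x y' k] by (simp add: y'_def z)
  show ?thesis
  proof (cases "y' = 0")
    case False
    then show ?thesis unfolding Dz using y' by (intro bt_injective_interior[OF D(1-3)]) auto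
  next
    case True
    have l: "(\<lambda>n. inverse (real (Suc n))) \<longlonglongrightarrow> 0" by (rule LIMSEQ_inverse_real_of_nat)
    have "(\<lambda>n. (t, x, inverse (real (Suc n)))) \<longlonglongrightarrow> (t, x, 0)" by (intro tendsto_Pair tendsto_const l)
    from continuous_on_tendsto_compose[OF D(2) this]
    have "(\<lambda>n. D (t, x, inverse (real (Suc n)))) \<longlonglongrightarrow> D (t, x, 0)" by simp
    moreover have "D (t, x, inverse (real (Suc n))) = 0" for n
    proof (rule bt_injective_interior[OF D(1-3)])
      have "inverse (real (Suc n)) \<le> 1" by (simp add: inverse_le_1_iff)
      then show "inverse (real (Suc n)) < 2 * pi" using pi_gt3 by linarith
    qed simp
    ultimately have "D (t, x, 0) = 0" by (simp add: LIMSEQ_const_iff)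
    then show ?thesis unfolding Dz True .
  qed
qed

text \<open>By \<open>bt_ft\<close> both sides have the same transform, and \<open>bt\<close> is injective.\<close>

theorem ft_bt:
  assumes p: "\<phi> \<in> schwartz"
  shows "ft (\<lambda>\<zeta>. of_real (1 / (2 * pi) ^ 3) * bt \<phi> \<zeta>) = \<phi>"
proof -
  let ?c = "complex_of_real (1 / (2 * pi) ^ 3)"
  define G where "G \<zeta> = ?c * bt \<phi> \<zeta>" for \<zeta>
  have g: "G \<in> SF" unfolding G_def[abs_def] by (rule SF_cmult[OF bt_SF[OF p]])
  have ps: "\<phi> \<in> SP" "y_periodic \<phi>" using p by (simp_all add: schwartz_rapid)
  define D where "D z = - 1 * \<phi> z + ft G z" for z
  have Ds: "D \<in> SP" unfolding D_def[abs_def] by (rule SP_lin[OF ps(1) ft_SP[OF g]])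
  have "D z = 0" for z
  proof (rule bt_injective)
    show "integrable cyl D" by (rule rapid_integrable(1)[OF Ds])
    show "continuous_on UNIV D" by (rule rapid_continuous[OF Ds])
    show "y_periodic D" using ps(2) ft_periodic[of G] by (simp add: D_def y_periodic_def)
    fix \<zeta>
    have i: "integrable cyl (\<lambda>z. cis (dot z \<zeta>) * \<phi> z)" "integrable cyl (\<lambda>z. cis (dot z \<zeta>) * ft G z)"
      by (intro osc_integrable rapid_integrable ps ft_SP[OF g]; measurable)+
    have "bt D \<zeta> = (LINT z|cyl. cis (dot z \<zeta>) * ft G z - cis (dot z \<zeta>) * \<phi> z)"
      unfolding bt_def D_def by (intro Bochner_Integration.integral_cong refl) (simp add: algebra_simps)
    also have "\<dots> = bt (ft G) \<zeta> - bt \<phi> \<zeta>" unfolding bt_def by (rule Bochner_Integration.integral_diff[OF i(2,1)])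
    also have "bt (ft G) \<zeta> = bt \<phi> \<zeta>" unfolding bt_ft[OF g] G_def by simp
    finally show "bt D \<zeta> = 0" by simp
  qed
  then show ?thesis unfolding G_def[abs_def] D_def by (auto simp: fun_eq_iff)
qed

section \<open>Uniqueness of the representing function\<close>

definition sigmoid :: "real \<Rightarrow> real" where "sigmoid x = 1 / (1 + exp (- x))"

lemma sigmoid_bounds: "0 < sigmoid x" "sigmoid x < 1"
  by (auto simp: sigmoid_def add_pos_pos field_simps)

text \<open>The derivative is a polynomial in the function itself. For this reason products of sigmoids and polynomials
  are closed under differentiation.\<close>

lemma sigmoid_deriv: "(sigmoid has_real_derivative sigmoid x * (1 - sigmoid x)) (at x)"
proof -
  have p: "1 + exp (- x) > 0" by (simp add: add_pos_pos)
  have "((\<lambda>x. 1 / (1 + exp (- x))) has_real_derivative (exp (- x) / (1 + exp (- x))\<^sup>2)) (at x)"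
    using p by (auto intro!: derivative_eq_intros simp: power2_eq_square divide_simps)
  moreover have "exp (- x) / (1 + exp (- x))\<^sup>2 = sigmoid x * (1 - sigmoid x)"
    using p unfolding sigmoid_def by (simp add: divide_simps power2_eq_square)
  ultimately show ?thesis unfolding sigmoid_def[abs_def] by simp
qed

lemma sigmoid_continuous [continuous_intros]: "continuous_on A f \<Longrightarrow> continuous_on A (\<lambda>x. sigmoid (f x))"
proof -
  have "1 + exp a \<noteq> 0" for a :: real using exp_gt_zero[of a] by linarith
  then show "continuous_on A f \<Longrightarrow> continuous_on A (\<lambda>x. sigmoid (f x))"
    unfolding sigmoid_def by (intro continuous_intros) auto
qed

text \<open>The shift by \<open>- n\<close> forces the limit \<open>0\<close> at \<open>u = 0\<close>, and the factor \<open>n\<^sup>2\<close> outweighs it for \<open>u > 0\<close>. So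
  the limit is exactly the indicator of an open half-line.\<close>

lemma sigmoid_step_limit: "(\<lambda>n. sigmoid ((real n)\<^sup>2 * u - real n)) \<longlonglongrightarrow> (if u > 0 then 1 else 0)"
proof (cases "u > 0")
  case True
  have "(\<lambda>n. exp (- ((real n)\<^sup>2 * u - real n))) \<longlonglongrightarrow> 0" using True by real_asymp
  then have "(\<lambda>n. 1 / (1 + exp (- ((real n)\<^sup>2 * u - real n)))) \<longlonglongrightarrow> 1 / (1 + 0)" by (intro tendsto_intros) auto
  then show ?thesis using True by (simp add: sigmoid_def)
next
  case False
  have b: "sigmoid ((real n)\<^sup>2 * u - real n) \<le> exp (- real n)" for n
  proof -
    have "(real n)\<^sup>2 * u \<le> 0" using False by (simp add: mult_nonneg_nonpos)
    then have "exp (real n) \<le> exp (- ((real n)\<^sup>2 * u - real n))" by simp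
    also have "\<dots> \<le> 1 + exp (- ((real n)\<^sup>2 * u - real n))" by simp
    finally have "1 / (1 + exp (- ((real n)\<^sup>2 * u - real n))) \<le> 1 / exp (real n)"
      by (intro divide_left_mono) (auto intro!: mult_pos_pos add_pos_pos)
    then show ?thesis by (simp add: sigmoid_def exp_minus inverse_eq_divide)
  qed
  have "(\<lambda>n. sigmoid ((real n)\<^sup>2 * u - real n)) \<longlonglongrightarrow> 0"
  proof (rule tendsto_sandwich[OF _ _ tendsto_const])
    show "\<forall>\<^sub>F n in sequentially. 0 \<le> sigmoid ((real n)\<^sup>2 * u - real n)" by (intro always_eventually allI less_imp_le sigmoid_bounds)
    show "\<forall>\<^sub>F n in sequentially. sigmoid ((real n)\<^sup>2 * u - real n) \<le> exp (- real n)" using b by auto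
    show "(\<lambda>n. exp (- real n)) \<longlonglongrightarrow> 0" by real_asymp
  qed
  then show ?thesis using False by simp
qed

text \<open>A ring of periodic multipliers that is closed under differentiation and has at most polynomial
  growth. It is rich enough for the sigmoids to approximate indicators of boxes.\<close>

inductive_set tame :: "(phys \<Rightarrow> complex) set" where
  const: "(\<lambda>_. c) \<in> tame"
| lin: "(\<lambda>z. of_real (\<alpha> * fst z + \<beta> * fst (snd z))) \<in> tame"
| trig: "(\<lambda>z. of_real (cos (snd (snd z) - c))) \<in> tame"
| sig_lin: "(\<lambda>z. of_real (sigmoid (\<alpha> * fst z + \<beta> * fst (snd z) + \<gamma>))) \<in> tame"
| sig_trig: "(\<lambda>z. of_real (sigmoid (\<alpha> * cos (snd (snd z) - c) + \<gamma>))) \<in> tame"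
| add: "f \<in> tame \<Longrightarrow> g \<in> tame \<Longrightarrow> (\<lambda>z. f z + g z) \<in> tame"
| mult: "f \<in> tame \<Longrightarrow> g \<in> tame \<Longrightarrow> (\<lambda>z. f z * g z) \<in> tame"

lemma tame_cmult: "f \<in> tame \<Longrightarrow> (\<lambda>z. c * f z) \<in> tame"
  using tame.mult[OF tame.const] by simp

lemma tame_continuous: "f \<in> tame \<Longrightarrow> continuous_on UNIV f"
  by (induction rule: tame.induct) (auto intro!: continuous_intros)

lemma tame_periodic: "f \<in> tame \<Longrightarrow> y_periodic f"
proof (induction rule: tame.induct)
  case (trig c)
  have "cos (y + 2 * pi - c) = cos (y - c)" for y
    using cos_periodic[of "y - c"] by (simp add: algebra_simps)
  then show ?case by (simp add: y_periodic_def)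
next
  case (sig_trig \<alpha> c \<gamma>)
  have "cos (y + 2 * pi - c) = cos (y - c)" for y
    using cos_periodic[of "y - c"] by (simp add: algebra_simps)
  then show ?case by (simp add: y_periodic_def)
qed (auto simp: y_periodic_def)

lemma vderiv_of_real:
  "(F has_real_derivative D) (at 0) \<Longrightarrow> ((\<lambda>h. complex_of_real (F h)) has_vector_derivative of_real D) (at 0)"
  by (rule has_vector_derivative_of_real)

lemma tame_deriv:
  "f \<in> tame \<Longrightarrow> \<exists>f'\<in>tame. \<forall>z. ((\<lambda>h. f (shift_phys e h z)) has_vector_derivative f' z) (at 0)"
proof (induction rule: tame.induct)
  case (const c)
  show ?case by (intro bexI[of _ "\<lambda>_. 0"] tame.const) auto
next
  case (lin \<alpha> \<beta>)
  have "((\<lambda>h. complex_of_real (\<alpha> * fst (shift_phys e h z) + \<beta> * fst (snd (shift_phys e h z)))) has_vector_derivative of_real (\<alpha> * fst e + \<beta> * fst (snd e))) (at 0)" for z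
    unfolding shift_phys_def by (rule vderiv_of_real) (auto intro!: derivative_eq_intros)
  then show ?case by (intro bexI[OF _ tame.const] allI)
next
  case (trig c)
  have s: "sin (y - c) = cos (y - (c + pi / 2))" for y
  proof -
    have "y - (c + pi / 2) = - (pi / 2 - (y - c))" by simp
    then show ?thesis using cos_diff[of "pi / 2" "y - c"]
      by (simp only: cos_minus cos_pi_half sin_pi_half mult_zero_left mult_1_left add_0_left)
  qed
  have "((\<lambda>h. complex_of_real (cos (snd (snd (shift_phys e h z)) - c))) has_vector_derivative of_real (- snd (snd e) * cos (snd (snd z) - (c + pi / 2)))) (at 0)" for z
    unfolding shift_phys_def s[symmetric] by (rule vderiv_of_real) (auto intro!: derivative_eq_intros simp: mult_ac)
  then have "\<forall>z. ((\<lambda>h. complex_of_real (cos (snd (snd (shift_phys e h z)) - c))) has_vector_derivative of_real (- snd (snd e)) * of_real (cos (snd (snd z) - (c + pi / 2)))) (at 0)"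
    by simp
  then show ?case by (rule bexI[OF _ tame_cmult[OF tame.trig]])
next
  case (sig_lin \<alpha> \<beta> \<gamma>)
  let ?u = "\<lambda>z. \<alpha> * fst z + \<beta> * fst (snd z) + \<gamma>"
  let ?f = "\<lambda>z::phys. complex_of_real (sigmoid (?u z))"
  have d: "((\<lambda>h. ?f (shift_phys e h z)) has_vector_derivative of_real (\<alpha> * fst e + \<beta> * fst (snd e)) * (?f z * (1 + (-1) * ?f z))) (at 0)" for z
  proof -
    have u: "((\<lambda>h. ?u (shift_phys e h z)) has_real_derivative (\<alpha> * fst e + \<beta> * fst (snd e))) (at 0)"
      unfolding shift_phys_def by (auto intro!: derivative_eq_intros)
    have "((\<lambda>h. sigmoid (?u (shift_phys e h z))) has_real_derivative (sigmoid (?u (shift_phys e 0 z)) * (1 - sigmoid (?u (shift_phys e 0 z)))) * (\<alpha> * fst e + \<beta> * fst (snd e))) (at 0)"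
      by (rule DERIV_chain2[OF sigmoid_deriv u])
    from vderiv_of_real[OF this] show ?thesis by (simp add: mult_ac)
  qed
  have "(\<lambda>z. of_real (\<alpha> * fst e + \<beta> * fst (snd e)) * (?f z * (1 + (-1) * ?f z))) \<in> tame"
    by (intro tame_cmult tame.mult tame.add tame.const tame.sig_lin)
  then show ?case by (rule bexI[rotated]) (rule allI, rule d)
next
  case (sig_trig \<alpha> c \<gamma>)
  let ?u = "\<lambda>z::phys. \<alpha> * cos (snd (snd z) - c) + \<gamma>"
  let ?f = "\<lambda>z::phys. complex_of_real (sigmoid (?u z))"
  have s: "sin (y - c) = cos (y - (c + pi / 2))" for y
  proof -
    have "y - (c + pi / 2) = - (pi / 2 - (y - c))" by simp
    then show ?thesis using cos_diff[of "pi / 2" "y - c"]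
      by (simp only: cos_minus cos_pi_half sin_pi_half mult_zero_left mult_1_left add_0_left)
  qed
  have d: "((\<lambda>h. ?f (shift_phys e h z)) has_vector_derivative (of_real (- \<alpha> * snd (snd e)) * of_real (cos (snd (snd z) - (c + pi / 2)))) * (?f z * (1 + (-1) * ?f z))) (at 0)" for z
  proof -
    have u: "((\<lambda>h. ?u (shift_phys e h z)) has_real_derivative (- \<alpha> * snd (snd e) * sin (snd (snd z) - c))) (at 0)"
      unfolding shift_phys_def by (auto intro!: derivative_eq_intros simp: mult_ac)
    have "((\<lambda>h. sigmoid (?u (shift_phys e h z))) has_real_derivative (sigmoid (?u (shift_phys e 0 z)) * (1 - sigmoid (?u (shift_phys e 0 z)))) * (- \<alpha> * snd (snd e) * sin (snd (snd z) - c))) (at 0)"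
      by (rule DERIV_chain2[OF sigmoid_deriv u])
    from vderiv_of_real[OF this] show ?thesis unfolding s by (simp add: mult_ac)
  qed
  have "(\<lambda>z. (of_real (- \<alpha> * snd (snd e)) * of_real (cos (snd (snd z) - (c + pi / 2)))) * (?f z * (1 + (-1) * ?f z))) \<in> tame"
    by (intro tame_cmult tame.mult tame.add tame.const tame.sig_trig tame.trig)
  then show ?case by (rule bexI[rotated]) (rule allI, rule d)
next
  case (add f g)
  then obtain f' g' where f': "f' \<in> tame" "\<And>z. ((\<lambda>h. f (shift_phys e h z)) has_vector_derivative f' z) (at 0)"
    and g': "g' \<in> tame" "\<And>z. ((\<lambda>h. g (shift_phys e h z)) has_vector_derivative g' z) (at 0)" by blast
  have "((\<lambda>h. f (shift_phys e h z) + g (shift_phys e h z)) has_vector_derivative f' z + g' z) (at 0)" for z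
    by (intro has_vector_derivative_add f' g')
  then show ?case by (intro bexI[OF _ tame.add[OF f'(1) g'(1)]] allI)
next
  case (mult f g)
  then obtain f' g' where f': "f' \<in> tame" "\<And>z. ((\<lambda>h. f (shift_phys e h z)) has_vector_derivative f' z) (at 0)"
    and g': "g' \<in> tame" "\<And>z. ((\<lambda>h. g (shift_phys e h z)) has_vector_derivative g' z) (at 0)" by blast
  have "((\<lambda>h. f (shift_phys e h z) * g (shift_phys e h z)) has_vector_derivative f z * g' z + f' z * g z) (at 0)" for z
    using has_vector_derivative_mult[OF f'(2)[of z] g'(2)[of z]] by simp
  then show ?case by (intro bexI[OF _ tame.add[OF tame.mult[OF mult.hyps(1) g'(1)] tame.mult[OF f'(1) mult.hyps(2)]]] allI)
qed

lemma tame_growth: "f \<in> tame \<Longrightarrow> \<exists>C k. C \<ge> 0 \<and> (\<forall>z. cmod (f z) \<le> C * weight_phys z ^ k)"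
proof (induction rule: tame.induct)
  case (const c)
  show ?case by (intro exI[of _ "cmod c"] exI[of _ 0]) auto
next
  case (lin \<alpha> \<beta>)
  have "cmod (complex_of_real (\<alpha> * fst z + \<beta> * fst (snd z))) \<le> (\<bar>\<alpha>\<bar> + \<bar>\<beta>\<bar>) * weight_phys z ^ 1" for z
  proof -
    have "\<bar>\<alpha> * fst z + \<beta> * fst (snd z)\<bar> \<le> \<bar>\<alpha>\<bar> * \<bar>fst z\<bar> + \<bar>\<beta>\<bar> * \<bar>fst (snd z)\<bar>"
      by (rule order_trans[OF abs_triangle_ineq]) (simp add: abs_mult)
    also have "\<dots> \<le> \<bar>\<alpha>\<bar> * weight_phys z + \<bar>\<beta>\<bar> * weight_phys z" by (intro add_mono mult_left_mono) (auto simp: weight_phys_def)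
    finally show ?thesis by (simp add: distrib_right del: of_real_add of_real_mult)
  qed
  then show ?case by (intro exI[of _ "\<bar>\<alpha>\<bar> + \<bar>\<beta>\<bar>"] exI[of _ 1]) auto
next
  case (trig c)
  show ?case by (intro exI[of _ 1] exI[of _ 0]) auto
next
  case (sig_lin \<alpha> \<beta> \<gamma>)
  show ?case using sigmoid_bounds by (intro exI[of _ 1] exI[of _ 0]) (auto intro: less_imp_le simp: abs_of_pos)
next
  case (sig_trig \<alpha> c \<gamma>)
  show ?case using sigmoid_bounds by (intro exI[of _ 1] exI[of _ 0]) (auto intro: less_imp_le simp: abs_of_pos)
next
  case (add f g)
  then obtain C k D l where C: "C \<ge> 0" "\<And>z. cmod (f z) \<le> C * weight_phys z ^ k" and D: "D \<ge> 0" "\<And>z. cmod (g z) \<le> D * weight_phys z ^ l" by blast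
  have "cmod (f z + g z) \<le> (C + D) * weight_phys z ^ (k + l)" for z
  proof -
    have w: "weight_phys z \<ge> 1" by (rule weight_phys_ge1)
    have "cmod (f z + g z) \<le> C * weight_phys z ^ k + D * weight_phys z ^ l"
      by (rule order_trans[OF norm_triangle_ineq add_mono[OF C(2) D(2)]])
    also have "\<dots> \<le> C * weight_phys z ^ (k + l) + D * weight_phys z ^ (k + l)"
      by (intro add_mono mult_left_mono power_increasing C D w) auto
    finally show ?thesis by (simp add: distrib_right)
  qed
  then show ?case using C(1) D(1) by (intro exI[of _ "C + D"] exI[of _ "k + l"]) auto
next
  case (mult f g)
  then obtain C k D l where C: "C \<ge> 0" "\<And>z. cmod (f z) \<le> C * weight_phys z ^ k" and D: "D \<ge> 0" "\<And>z. cmod (g z) \<le> D * weight_phys z ^ l" by blast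
  have "cmod (f z * g z) \<le> (C * D) * weight_phys z ^ (k + l)" for z
  proof -
    have "weight_phys z \<ge> 0" using weight_phys_ge1[of z] by linarith
    then have "cmod (f z * g z) \<le> (C * weight_phys z ^ k) * (D * weight_phys z ^ l)"
      unfolding norm_mult using C D by (intro mult_mono C D) auto
    then show ?thesis by (simp add: power_add mult_ac)
  qed
  then show ?case using C(1) D(1) by (intro exI[of _ "C * D"] exI[of _ "k + l"]) auto
qed

text \<open>There is no factor in \<open>y\<close>, so the function is periodic.\<close>

definition gauss_tx :: "phys \<Rightarrow> real" where "gauss_tx z = exp (- (((fst z)\<^sup>2 + (fst (snd z))\<^sup>2) / 2))"

lemma gauss_tx_decay: "weight_phys z ^ m * gauss_tx z \<le> 6 ^ m * fact m * exp (1 / 2)"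
proof -
  define u where "u = ((fst z)\<^sup>2 + (fst (snd z))\<^sup>2) / 2"
  have u: "u \<ge> 0" by (simp add: u_def)
  have w: "weight_phys z \<ge> 1" by (rule weight_phys_ge1)
  have "weight_phys z \<le> (weight_phys z)\<^sup>2" using w by (simp add: power2_eq_square)
  also have "\<dots> \<le> 3 * (1 + (fst z)\<^sup>2 + (fst (snd z))\<^sup>2)"
  proof -
    have t: "(1 + a + b)\<^sup>2 \<le> 3 * (1 + a\<^sup>2 + b\<^sup>2)" for a b :: real
      using zero_le_power2[of "1 - a"] zero_le_power2[of "1 - b"] zero_le_power2[of "a - b"] by (simp add: power2_eq_square algebra_simps)
    show ?thesis using t[of "\<bar>fst z\<bar>" "\<bar>fst (snd z)\<bar>"] by (simp add: weight_phys_def)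
  qed
  also have "\<dots> = 6 * (1 / 2 + u)" by (simp add: u_def)
  finally have "weight_phys z ^ m \<le> (6 * (1 / 2 + u)) ^ m" using w by (intro power_mono) auto
  also have "\<dots> = 6 ^ m * (1 / 2 + u) ^ m" by (rule power_mult_distrib)
  also have "\<dots> \<le> 6 ^ m * (fact m * exp (1 / 2 + u))"
  proof (intro mult_left_mono)
    have "(1 / 2 + u) ^ m /\<^sub>R fact m \<le> exp (1 / 2 + u)"
      unfolding exp_def using u sum_le_suminf[OF summable_exp_generic[of "1 / 2 + u"], of "{m}"] by simp
    then show "(1 / 2 + u) ^ m \<le> fact m * exp (1 / 2 + u)" by (simp add: divide_simps mult_ac)
  qed simp
  finally have "weight_phys z ^ m * gauss_tx z \<le> (6 ^ m * (fact m * exp (1 / 2 + u))) * exp (- u)"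
    unfolding gauss_tx_def u_def[symmetric] by (rule mult_right_mono) simp
  also have "\<dots> = 6 ^ m * fact m * exp (1 / 2)" by (simp add: exp_add[symmetric] mult.assoc)
  finally show ?thesis .
qed

text \<open>The products of the Gaussian with tame multipliers form a closed family, since the derivative of the Gaussian is
  the Gaussian times a linear function.\<close>

lemma gauss_tx_tame_schwartz:
  assumes "f \<in> tame"
  shows "(\<lambda>z. of_real (gauss_tx z) * f z) \<in> schwartz"
proof -
  define S where "S = {\<lambda>z. of_real (gauss_tx z) * f z | f. f \<in> tame}"
  have SI: "(\<lambda>z. of_real (gauss_tx z) * f z) \<in> S" if "f \<in> tame" for f
    unfolding S_def using that by blast
  have "(\<lambda>z. of_real (gauss_tx z) * f z) \<in> SP"
  proof (rule rapid_coinduct[where S = S])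
    show "(\<lambda>z. of_real (gauss_tx z) * f z) \<in> S" unfolding S_def using assms by blast
  next
    fix u assume "u \<in> S"
    then obtain f where f: "u = (\<lambda>z. of_real (gauss_tx z) * f z)" "f \<in> tame" unfolding S_def by blast
    show "continuous_on UNIV u" unfolding f(1) gauss_tx_def by (intro continuous_intros tame_continuous f(2)) auto
    fix N
    obtain C k where C: "C \<ge> 0" "\<And>z. cmod (f z) \<le> C * weight_phys z ^ k" using tame_growth[OF f(2)] by blast
    have "weight_phys z ^ N * cmod (u z) \<le> C * (6 ^ (N + k) * fact (N + k) * exp (1 / 2))" for z
    proof -
      have w: "weight_phys z \<ge> 0" using weight_phys_ge1[of z] by linarith
      have g: "gauss_tx z \<ge> 0" by (simp add: gauss_tx_def)
      have "weight_phys z ^ N * cmod (u z) = (weight_phys z ^ N * gauss_tx z) * cmod (f z)" using g by (simp add: f(1) norm_mult)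
      also have "\<dots> \<le> (weight_phys z ^ N * gauss_tx z) * (C * weight_phys z ^ k)" using w g by (intro mult_left_mono C) auto
      also have "\<dots> = C * (weight_phys z ^ (N + k) * gauss_tx z)" by (simp add: power_add mult_ac)
      also have "\<dots> \<le> C * (6 ^ (N + k) * fact (N + k) * exp (1 / 2))" by (intro mult_left_mono gauss_tx_decay C)
      finally show ?thesis .
    qed
    then show "\<exists>C. \<forall>z. weight_phys z ^ N * cmod (u z) \<le> C" by blast
  next
    fix u and e :: phys assume "u \<in> S"
    then obtain f where f: "u = (\<lambda>z. of_real (gauss_tx z) * f z)" "f \<in> tame" unfolding S_def by blast
    obtain f' where f': "f' \<in> tame" "\<And>z. ((\<lambda>h. f (shift_phys e h z)) has_vector_derivative f' z) (at 0)"
      using tame_deriv[OF f(2), of e] by blast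
    have dg: "((\<lambda>h. complex_of_real (gauss_tx (shift_phys e h z))) has_vector_derivative of_real (gauss_tx z * - (fst e * fst z + fst (snd e) * fst (snd z)))) (at 0)" for z
      unfolding gauss_tx_def shift_phys_def by (rule vderiv_of_real) (auto intro!: derivative_eq_intros simp: algebra_simps)
    let ?f' = "\<lambda>z. f' z + (-1) * of_real (fst e * fst z + fst (snd e) * fst (snd z)) * f z"
    have "((\<lambda>h. u (shift_phys e h z)) has_vector_derivative of_real (gauss_tx z) * ?f' z) (at 0)" for z
      using has_vector_derivative_mult[OF dg[of z] f'(2)[of z]] unfolding f(1) by (simp add: algebra_simps)
    moreover have "?f' \<in> tame" by (intro tame.add f' tame.mult tame_cmult tame.lin f(2))
    ultimately show "\<exists>f'\<in>S. \<forall>z. ((\<lambda>h. u (shift_phys e h z)) has_vector_derivative f' z) (at 0)"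
      by (intro bexI[of _ "\<lambda>z. of_real (gauss_tx z) * ?f' z"] allI SI)
  qed
  moreover have "y_periodic (\<lambda>z. of_real (gauss_tx z) * f z)"
    using tame_periodic[OF assms] by (simp add: y_periodic_def gauss_tx_def)
  ultimately show ?thesis by (simp add: schwartz_rapid)
qed

text \<open>An interval in \<open>y\<close> is a superlevel set of a translated cosine. In this way it is accessible to periodic
  test functions.\<close>

lemma arc_interval:
  assumes ab: "0 \<le> \<alpha>" "\<alpha> < \<beta>" "\<beta> \<le> 2 * pi" and y: "0 \<le> y" "y \<le> 2 * pi"
  shows "0 < cos (y - (\<alpha> + \<beta>) / 2) - cos ((\<beta> - \<alpha>) / 2) \<longleftrightarrow> \<alpha> < y \<and> y < \<beta>"
proof -
  define c where "c = (\<alpha> + \<beta>) / 2"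
  define h where "h = (\<beta> - \<alpha>) / 2"
  have h: "0 < h" "h \<le> pi" using ab by (auto simp: h_def)
  have iff: "\<alpha> < y \<and> y < \<beta> \<longleftrightarrow> \<bar>y - c\<bar> < h" by (auto simp: c_def h_def abs_if field_simps)
  have "cos (y - c) > cos h \<longleftrightarrow> \<bar>y - c\<bar> < h"
  proof
    assume a: "\<bar>y - c\<bar> < h"
    have "cos h < cos \<bar>y - c\<bar>" using a h by (intro cos_monotone_0_pi) auto
    then show "cos (y - c) > cos h" by (simp add: cos_abs_real)
  next
    assume a: "cos (y - c) > cos h"
    show "\<bar>y - c\<bar> < h"
    proof (rule ccontr)
      assume "\<not> \<bar>y - c\<bar> < h"
      moreover have "\<bar>y - c\<bar> \<le> 2 * pi - h" using ab y by (auto simp: c_def h_def abs_if field_simps)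
      ultimately have "cos (y - c) \<le> cos h" using h by (intro cos_le_cos_away) auto
      then show False using a by simp
    qed
  qed
  then show ?thesis using iff by (simp add: c_def h_def)
qed

lemma circle_measure_point: "emeasure circle_measure {c} = 0"
proof -
  have "emeasure circle_measure {c} = (\<integral>\<^sup>+y. indicator {0..2*pi} y * indicator {c} y \<partial>lborel)"
    unfolding circle_measure_def by (rule emeasure_density) auto
  also have "\<dots> = (\<integral>\<^sup>+y. indicator ({0..2*pi} \<inter> {c}) y \<partial>lborel)"
    by (intro nn_integral_cong) (auto simp: indicator_def)
  also have "\<dots> = emeasure lborel ({0..2*pi} \<inter> {c})" by (rule nn_integral_indicator) auto
  also have "\<dots> = 0" by (cases "c \<in> {0..2*pi}") auto
  finally show ?thesis .
qed

lemma AE_cyl_y_neq: "AE z in cyl. snd (snd z) \<noteq> c"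
proof -
  have m: "{z::phys. snd (snd z) = c} \<in> sets borel"
  proof -
    have "{z::phys. snd (snd z) = c} = (\<lambda>z. snd (snd z)) -` {c} \<inter> space borel" by auto
    also have "\<dots> \<in> sets borel" by (rule measurable_sets[OF coord_phys(3)]) auto
    finally show ?thesis .
  qed
  have "emeasure cyl {z. snd (snd z) = c} = (\<integral>\<^sup>+z. indicator {z. snd (snd z) = c} z \<partial>cyl)"
    using m by (simp add: nn_integral_indicator)
  also have "\<dots> = (\<integral>\<^sup>+t. \<integral>\<^sup>+x. \<integral>\<^sup>+y. indicator {z. snd (snd z) = c} (t::real, x::real, y) \<partial>circle_measure \<partial>lborel \<partial>lborel)"
    by (rule nn_integral_cyl) (rule borel_measurable_indicator[OF m])
  also have "\<dots> = (\<integral>\<^sup>+t. \<integral>\<^sup>+x. \<integral>\<^sup>+y. indicator {c} y \<partial>circle_measure \<partial>(lborel :: real measure) \<partial>(lborel :: real measure))"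
    by (simp add: indicator_def)
  also have "\<dots> = 0" by (simp add: nn_integral_indicator circle_measure_point)
  finally have "{z. snd (snd z) = c} \<in> null_sets cyl" using m by (auto simp: null_sets_def)
  then show ?thesis by (rule AE_I') auto
qed

text \<open>Times the Gaussian, \<open>V\<close> becomes integrable and is orthogonal to all tame multipliers. Products of sigmoids
  converge boundedly to the indicators of open boxes, so its integral over every box vanishes, and
  by Dynkin's lemma the one over every Borel set.\<close>

lemma annihilates_schwartz_zero:
  fixes V :: "phys \<Rightarrow> complex"
  assumes i: "\<And>\<phi>. \<phi> \<in> schwartz \<Longrightarrow> integrable cyl (\<lambda>z. V z * \<phi> z)"
    and z: "\<And>\<phi>. \<phi> \<in> schwartz \<Longrightarrow> (LINT z|cyl. V z * \<phi> z) = 0"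
  shows "AE z in cyl. V z = 0"
proof -
  define F where "F z = V z * of_real (gauss_tx z)" for z
  have Fi: "integrable cyl F" and F0: "(LINT z|cyl. F z) = 0"
    using i[OF gauss_tx_tame_schwartz[OF tame.const[of 1]]] z[OF gauss_tx_tame_schwartz[OF tame.const[of 1]]] by (simp_all add: F_def[abs_def])
  have Fm[measurable]: "F \<in> borel_measurable cyl" using Fi by simp
  have mono: "(LINT z|cyl. F z * f z) = 0" if "f \<in> tame" for f
    using z[OF gauss_tx_tame_schwartz[OF that]] by (simp add: F_def mult_ac)
  have box: "(LINT z|cyl. indicator (box a b) z *\<^sub>R F z) = 0" for a b :: phys
  proof -
    obtain a1 a2 a3 b1 b2 b3 where ab: "a = (a1, a2, a3)" "b = (b1, b2, b3)" by (cases a; cases b)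
    define \<alpha> where "\<alpha> = max a3 0"
    define \<beta> where "\<beta> = min b3 (2 * pi)"
    have box_iff: "z \<in> box a b \<longleftrightarrow> a1 < fst z \<and> fst z < b1 \<and> a2 < fst (snd z) \<and> fst (snd z) < b2 \<and> a3 < snd (snd z) \<and> snd (snd z) < b3" for z
      by (cases z) (auto simp: ab box_def Basis_phys inner_prod_def)
    have yy: "AE z in cyl. 0 < snd (snd z) \<and> snd (snd z) < 2 * pi"
      using AE_cyl_cylinder AE_cyl_y_neq[of 0] AE_cyl_y_neq[of "2 * pi"]
      by eventually_elim (auto simp: cylinder_def)
    show ?thesis
    proof (cases "\<alpha> < \<beta>")
      case False
      have "AE z in cyl. indicator (box a b) z *\<^sub>R F z = 0"
        using yy
      proof eventually_elim
        case (elim z)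
        then have "z \<notin> box a b" using False unfolding box_iff \<alpha>_def \<beta>_def by auto
        then show ?case by simp
      qed
      then show ?thesis by (rule integral_eq_zero_AE)
    next
      case True
      have ab2: "0 \<le> \<alpha>" "\<beta> \<le> 2 * pi" by (auto simp: \<alpha>_def \<beta>_def)
      define c where "c = (\<alpha> + \<beta>) / 2"
      define d where "d = cos ((\<beta> - \<alpha>) / 2)"
      let ?N = "\<lambda>n. (real n)\<^sup>2"
      define s1 where "s1 n z = complex_of_real (sigmoid (?N n * fst z + 0 * fst (snd z) + (- (?N n) * a1 - real n)))" for n and z :: phys
      define s2 where "s2 n z = complex_of_real (sigmoid (- (?N n) * fst z + 0 * fst (snd z) + (?N n * b1 - real n)))" for n and z :: phys
      define s3 where "s3 n z = complex_of_real (sigmoid (0 * fst z + ?N n * fst (snd z) + (- (?N n) * a2 - real n)))" for n and z :: phys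
      define s4 where "s4 n z = complex_of_real (sigmoid (0 * fst z + (- ?N n) * fst (snd z) + (?N n * b2 - real n)))" for n and z :: phys
      define s5 where "s5 n z = complex_of_real (sigmoid (?N n * cos (snd (snd z) - c) + (- (?N n) * d - real n)))" for n and z :: phys
      define h where "h n z = s1 n z * (s2 n z * (s3 n z * (s4 n z * s5 n z)))" for n z
      have ht: "h n \<in> tame" for n
        unfolding h_def[abs_def] s1_def s2_def s3_def s4_def s5_def
        by (intro tame.mult tame.sig_lin tame.sig_trig)
      have se: "s1 n z = of_real (sigmoid (?N n * (fst z - a1) - real n))" "s2 n z = of_real (sigmoid (?N n * (b1 - fst z) - real n))"
        "s3 n z = of_real (sigmoid (?N n * (fst (snd z) - a2) - real n))" "s4 n z = of_real (sigmoid (?N n * (b2 - fst (snd z)) - real n))"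
        "s5 n z = of_real (sigmoid (?N n * (cos (snd (snd z) - c) - d) - real n))" for n z
        unfolding s1_def s2_def s3_def s4_def s5_def by (simp_all add: algebra_simps)
      have sl: "(\<lambda>n. complex_of_real (sigmoid (?N n * u - real n))) \<longlonglongrightarrow> of_real (if u > 0 then 1 else 0)" for u
        by (intro tendsto_of_real sigmoid_step_limit)
      let ?I = "\<lambda>P. complex_of_real (if P then 1 else 0)"
      have hl: "(\<lambda>n. h n z) \<longlonglongrightarrow> ?I (fst z - a1 > 0) * (?I (b1 - fst z > 0) * (?I (fst (snd z) - a2 > 0) * (?I (b2 - fst (snd z) > 0) * ?I (cos (snd (snd z) - c) - d > 0))))" for z
        unfolding h_def se by (intro tendsto_mult sl)
      have h1: "cmod (h n z) \<le> 1" for n z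
      proof -
        have s: "cmod (complex_of_real (sigmoid u)) \<le> 1" for u using sigmoid_bounds[of u] by simp
        show ?thesis unfolding h_def s1_def s2_def s3_def s4_def s5_def norm_mult
          by (intro mult_le_one mult_nonneg_nonneg norm_ge_zero s)
      qed
      have "(\<lambda>n. LINT z|cyl. F z * h n z) \<longlonglongrightarrow> (LINT z|cyl. indicator (box a b) z *\<^sub>R F z)"
      proof (rule integral_dominated_convergence[where w = "\<lambda>z. cmod (F z)"])
        have bm: "box a b \<in> sets cyl" by simp
        show "(\<lambda>z. indicator (box a b) z *\<^sub>R F z) \<in> borel_measurable cyl" using bm by measurable
        show "(\<lambda>z. F z * h n z) \<in> borel_measurable cyl" for n
        proof -
          have "h n \<in> borel_measurable cyl" using borel_measurable_continuous_onI[OF tame_continuous[OF ht]] by (simp add: measurable_cong_sets[OF sets_cyl refl])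
          then show ?thesis by measurable
        qed
        show "integrable cyl (\<lambda>z. cmod (F z))" using Fi by simp
        show "AE z in cyl. (\<lambda>n. F z * h n z) \<longlonglongrightarrow> indicator (box a b) z *\<^sub>R F z"
          using yy
        proof eventually_elim
          case (elim z)
          have arc: "cos (snd (snd z) - c) - d > 0 \<longleftrightarrow> a3 < snd (snd z) \<and> snd (snd z) < b3"
            using arc_interval[OF ab2(1) True ab2(2), of "snd (snd z)"] elim unfolding c_def d_def \<alpha>_def \<beta>_def by auto
          have "(\<lambda>n. F z * h n z) \<longlonglongrightarrow> F z * (?I (fst z - a1 > 0) * (?I (b1 - fst z > 0) * (?I (fst (snd z) - a2 > 0) * (?I (b2 - fst (snd z) > 0) * ?I (cos (snd (snd z) - c) - d > 0)))))"
            by (intro tendsto_mult tendsto_const hl)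
          moreover have "F z * (?I (fst z - a1 > 0) * (?I (b1 - fst z > 0) * (?I (fst (snd z) - a2 > 0) * (?I (b2 - fst (snd z) > 0) * ?I (cos (snd (snd z) - c) - d > 0))))) = indicator (box a b) z *\<^sub>R F z"
            unfolding arc indicator_def box_iff by auto
          ultimately show ?case by simp
        qed
        show "AE z in cyl. norm (F z * h n z) \<le> cmod (F z)" for n
          using h1 by (auto simp: norm_mult intro!: mult_left_le)
      qed
      then show ?thesis using mono[OF ht] by (simp add: LIMSEQ_const_iff)
    qed
  qed
  have all: "(LINT z|cyl. indicator A z *\<^sub>R F z) = 0" if "A \<in> sets borel" for A
  proof -
    let ?G = "range (\<lambda>(a, b). box a b :: phys set)"
    have Ai: "A \<in> sigma_sets UNIV ?G" using that unfolding borel_eq_box by (simp add: sets_measure_of)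
    have G: "Int_stable ?G"
    proof (rule Int_stableI)
      fix X Y assume "X \<in> ?G" "Y \<in> ?G"
      then obtain a b c d where "X = box a b" "Y = box c d" by auto
      then show "X \<inter> Y \<in> ?G" by (auto simp: Int_interval box_Int_box)
    qed
    have Gp: "?G \<subseteq> Pow UNIV" by simp
    have sb: "X \<in> sets borel" if "X \<in> sigma_sets UNIV ?G" for X :: "phys set"
      using that unfolding borel_eq_box by (simp add: sets_measure_of)
    have ii: "integrable cyl (\<lambda>z. indicator X z *\<^sub>R F z)" if "X \<in> sets borel" for X
      by (rule integrable_mult_indicator[OF _ Fi]) (use that in simp)
    show ?thesis
      using G Gp Ai
    proof (induction rule: sigma_sets_induct_disjoint)
      case (basic X)
      then show ?case using box by auto
    next
      case empty
      show ?case by simp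
    next
      case (compl X)
      have "(LINT z|cyl. indicator (UNIV - X) z *\<^sub>R F z) = (LINT z|cyl. F z - indicator X z *\<^sub>R F z)"
        by (intro Bochner_Integration.integral_cong) (auto simp: indicator_def)
      also have "\<dots> = (LINT z|cyl. F z) - (LINT z|cyl. indicator X z *\<^sub>R F z)"
        by (rule Bochner_Integration.integral_diff[OF Fi ii[OF sb[OF compl(1)]]])
      finally show ?case using compl F0 by simp
    next
      case (union X)
      have Xs: "X n \<in> sets borel" for n :: nat using union(2) sb by auto
      have "(LINT z:(\<Union>n. X n)|cyl. F z) = (\<Sum>n. LINT z:(X n)|cyl. F z)"
      proof (rule lebesgue_integral_countable_add)
        show "\<And>n. X n \<in> sets cyl" using Xs by simp
        show "\<And>i j. i \<noteq> j \<Longrightarrow> X i \<inter> X j = {}" using union(1) by (auto simp: disjoint_family_on_def)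
        show "set_integrable cyl (\<Union>n. X n) F" unfolding set_integrable_def using Xs by (intro ii) auto
      qed
      then show ?case using union(3) by (simp add: set_lebesgue_integral_def)
    qed
  qed
  have "AE z in cyl. F z = 0"
    by (rule cyl.density_zero[OF Fi]) (simp add: set_lebesgue_integral_def all)
  then show ?thesis by eventually_elim (simp add: F_def gauss_tx_def)
qed

section \<open>Convolution on the frequency side\<close>

lemma freq_shift_integral:
  fixes f :: "freq \<Rightarrow> 'b::{banach, second_countable_topology}"
  assumes "f \<in> borel_measurable freq_measure"
  shows "(LINT \<zeta>|freq_measure. f (\<eta> + \<zeta>)) = (LINT \<zeta>|freq_measure. f \<zeta>)"
    "integrable freq_measure (\<lambda>\<zeta>. f (\<eta> + \<zeta>)) \<longleftrightarrow> integrable freq_measure f"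
proof -
  have m: "(\<lambda>\<zeta>. \<eta> + \<zeta>) \<in> freq_measure \<rightarrow>\<^sub>M freq_measure" by measurable
  show "(LINT \<zeta>|freq_measure. f (\<eta> + \<zeta>)) = (LINT \<zeta>|freq_measure. f \<zeta>)"
    using integral_distr[OF m assms] by (simp add: freq_distr_shift)
  show "integrable freq_measure (\<lambda>\<zeta>. f (\<eta> + \<zeta>)) \<longleftrightarrow> integrable freq_measure f"
    using integrable_distr_eq[OF m assms] by (simp add: freq_distr_shift)
qed

definition conv :: "(freq \<Rightarrow> complex) \<Rightarrow> (freq \<Rightarrow> complex) \<Rightarrow> freq \<Rightarrow> complex" where
  "conv g h \<zeta> = (LINT \<eta>|freq_measure. g (\<zeta> - \<eta>) * h \<eta>)"

lemma conv_pair_integrable: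
  fixes g h :: "freq \<Rightarrow> complex"
  assumes g: "integrable freq_measure g" and h: "integrable freq_measure h"
  shows "integrable (freq_measure \<Otimes>\<^sub>M freq_measure) (\<lambda>p. g (snd p - fst p) * h (fst p))"
proof (rule freq2.Fubini_integrable)
  have [measurable]: "g \<in> borel_measurable freq_measure" "h \<in> borel_measurable freq_measure" using g h by auto
  have d: "(\<lambda>p. snd p - fst p) \<in> freq_measure \<Otimes>\<^sub>M freq_measure \<rightarrow>\<^sub>M freq_measure" by measurable
  have [measurable]: "(\<lambda>p. g (snd p - fst p)) \<in> borel_measurable (freq_measure \<Otimes>\<^sub>M freq_measure)"
    by (rule measurable_compose[OF d]) simp
  show "(\<lambda>p. g (snd p - fst p) * h (fst p)) \<in> borel_measurable (freq_measure \<Otimes>\<^sub>M freq_measure)"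
    by measurable
  have gn: "(\<lambda>\<zeta>. norm (g \<zeta>)) \<in> borel_measurable freq_measure" by measurable
  have e: "(LINT \<zeta>|freq_measure. norm (g (\<zeta> - \<eta>) * h \<eta>)) = (LINT \<zeta>|freq_measure. norm (g \<zeta>)) * norm (h \<eta>)" for \<eta>
    using freq_shift_integral(1)[OF gn, of "- \<eta>"] by (simp add: norm_mult)
  show "integrable freq_measure (\<lambda>\<eta>. LINT \<zeta>|freq_measure. norm (g (snd (\<eta>, \<zeta>) - fst (\<eta>, \<zeta>)) * h (fst (\<eta>, \<zeta>))))"
    using h by (simp add: e)
  have "integrable freq_measure (\<lambda>\<zeta>. g (\<zeta> - \<eta>))" for \<eta>
    using freq_shift_integral(2)[of g "- \<eta>"] g by simp
  then show "AE \<eta> in freq_measure. integrable freq_measure (\<lambda>\<zeta>. g (snd (\<eta>, \<zeta>) - fst (\<eta>, \<zeta>)) * h (fst (\<eta>, \<zeta>)))"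
    by simp
qed

lemma conv_integrable:
  fixes g h :: "freq \<Rightarrow> complex"
  assumes g: "integrable freq_measure g" and h: "integrable freq_measure h"
  shows "integrable freq_measure (conv g h)"
proof -
  have "integrable (freq_measure \<Otimes>\<^sub>M freq_measure) (case_prod (\<lambda>\<eta> \<zeta>. g (\<zeta> - \<eta>) * h \<eta>))"
    using conv_pair_integrable[OF g h] by (simp add: case_prod_beta')
  from freq2.integrable_snd[OF this] show ?thesis by (simp add: conv_def[abs_def])
qed

lemma synth_conv:
  fixes g h :: "freq \<Rightarrow> complex"
  assumes g: "integrable freq_measure g" and h: "integrable freq_measure h"
  shows "synth (conv g h) z = synth g z * synth h z"
proof -
  have [measurable]: "g \<in> borel_measurable freq_measure" "h \<in> borel_measurable freq_measure" using g h by auto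
  have dm: "(\<lambda>p. dot z (snd p)) \<in> borel_measurable (freq_measure \<Otimes>\<^sub>M freq_measure)" by measurable
  have i: "integrable (freq_measure \<Otimes>\<^sub>M freq_measure) (case_prod (\<lambda>\<eta> \<zeta>. cis (dot z \<zeta>) * (g (\<zeta> - \<eta>) * h \<eta>)))"
    using osc_integrable[OF conv_pair_integrable[OF g h] dm] by (simp add: case_prod_beta')
  have "synth (conv g h) z = (LINT \<zeta>|freq_measure. LINT \<eta>|freq_measure. cis (dot z \<zeta>) * (g (\<zeta> - \<eta>) * h \<eta>))"
    unfolding synth_def conv_def integral_mult_right_zero ..
  also have "\<dots> = (LINT \<eta>|freq_measure. LINT \<zeta>|freq_measure. cis (dot z \<zeta>) * (g (\<zeta> - \<eta>) * h \<eta>))"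
    by (rule freq2.Fubini_integral[OF i])
  also have "\<dots> = (LINT \<eta>|freq_measure. synth g z * (cis (dot z \<eta>) * h \<eta>))"
  proof (intro Bochner_Integration.integral_cong refl)
    fix \<eta> :: freq
    let ?f = "\<lambda>\<zeta>. cis (dot z \<zeta>) * (g (\<zeta> - \<eta>) * h \<eta>)"
    have d: "(\<lambda>\<zeta>. \<zeta> - \<eta>) \<in> freq_measure \<rightarrow>\<^sub>M freq_measure" by measurable
    have gs[measurable]: "(\<lambda>\<zeta>. g (\<zeta> - \<eta>)) \<in> borel_measurable freq_measure"
      by (rule measurable_compose[OF d]) simp
    have fm: "?f \<in> borel_measurable freq_measure" by measurable
    have "(LINT \<zeta>|freq_measure. ?f \<zeta>) = (LINT \<zeta>|freq_measure. ?f (\<eta> + \<zeta>))"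
      by (rule freq_shift_integral(1)[OF fm, symmetric])
    also have "\<dots> = (LINT \<zeta>|freq_measure. (cis (dot z \<zeta>) * g \<zeta>) * (cis (dot z \<eta>) * h \<eta>))"
    proof (intro Bochner_Integration.integral_cong refl)
      fix \<zeta> :: freq
      have "dot z (\<eta> + \<zeta>) = dot z \<eta> + dot z \<zeta>" by (simp add: dot_def algebra_simps)
      then have "cis (dot z (\<eta> + \<zeta>)) = cis (dot z \<eta>) * cis (dot z \<zeta>)" by (simp only: cis_mult)
      then show "?f (\<eta> + \<zeta>) = (cis (dot z \<zeta>) * g \<zeta>) * (cis (dot z \<eta>) * h \<eta>)" by (simp add: mult_ac)
    qed
    also have "\<dots> = synth g z * (cis (dot z \<eta>) * h \<eta>)" unfolding synth_def by (rule integral_mult_left_zero)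
    finally show "(LINT \<zeta>|freq_measure. ?f \<zeta>) = synth g z * (cis (dot z \<eta>) * h \<eta>)" .
  qed
  also have "\<dots> = synth g z * synth h z" unfolding synth_def[of h] by (rule integral_mult_right_zero)
  finally show ?thesis .
qed

lemma norm_integral_le_nn:
  fixes f :: "'a \<Rightarrow> complex"
  shows "ennreal (cmod (LINT x|M. f x)) \<le> (\<integral>\<^sup>+x. ennreal (cmod (f x)) \<partial>M)"
proof (cases "integrable M f")
  case True
  then show ?thesis by (rule integral_norm_bound_ennreal)
qed (simp add: not_integrable_integral_eq)

text \<open>Where a convolution integral diverges, its default value \<open>0\<close> satisfies the bound.\<close>

lemma conv_conv_le_tri:
  "ennreal (cmod (conv (conv g1 g2) g3 \<zeta>)) \<le>
    tri (\<lambda>a b c. ennreal (cmod (g1 a)) * (ennreal (cmod (g2 b)) * ennreal (cmod (g3 c)))) \<zeta>"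
  if [measurable]: "g1 \<in> borel_measurable borel" "g2 \<in> borel_measurable borel" "g3 \<in> borel_measurable borel"
proof -
  have "ennreal (cmod (conv (conv g1 g2) g3 \<zeta>)) \<le> (\<integral>\<^sup>+c. ennreal (cmod (conv g1 g2 (\<zeta> - c) * g3 c)) \<partial>freq_measure)"
    unfolding conv_def[of "conv g1 g2"] by (rule norm_integral_le_nn)
  also have "\<dots> \<le> (\<integral>\<^sup>+c. \<integral>\<^sup>+b. ennreal (cmod (g1 (\<zeta> - c - b))) * (ennreal (cmod (g2 b)) * ennreal (cmod (g3 c))) \<partial>freq_measure \<partial>freq_measure)"
  proof (rule nn_integral_mono)
    fix c
    have "ennreal (cmod (conv g1 g2 (\<zeta> - c) * g3 c)) = ennreal (cmod (conv g1 g2 (\<zeta> - c))) * ennreal (cmod (g3 c))"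
      by (simp add: norm_mult ennreal_mult)
    also have "\<dots> \<le> (\<integral>\<^sup>+b. ennreal (cmod (g1 (\<zeta> - c - b) * g2 b)) \<partial>freq_measure) * ennreal (cmod (g3 c))"
      unfolding conv_def by (intro mult_right_mono norm_integral_le_nn) simp
    also have "\<dots> = (\<integral>\<^sup>+b. ennreal (cmod (g1 (\<zeta> - c - b) * g2 b)) * ennreal (cmod (g3 c)) \<partial>freq_measure)"
      by (rule nn_integral_multc[symmetric]) measurable
    also have "\<dots> = (\<integral>\<^sup>+b. ennreal (cmod (g1 (\<zeta> - c - b))) * (ennreal (cmod (g2 b)) * ennreal (cmod (g3 c))) \<partial>freq_measure)"
      by (simp add: norm_mult ennreal_mult mult.assoc)
    finally show "ennreal (cmod (conv g1 g2 (\<zeta> - c) * g3 c)) \<le> (\<integral>\<^sup>+b. ennreal (cmod (g1 (\<zeta> - c - b))) * (ennreal (cmod (g2 b)) * ennreal (cmod (g3 c))) \<partial>freq_measure)" .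
  qed
  finally show ?thesis unfolding tri_def .
qed

section \<open>Distributions with integrable Fourier transform\<close>

definition inv_const :: complex where "inv_const = of_real (1 / (2 * pi) ^ 3)"

lemma synth_continuous: "integrable freq_measure g \<Longrightarrow> continuous_on UNIV (synth g)"
  unfolding synth_def[abs_def] by (rule osc_continuous) (auto intro: dot_continuous)

lemma synth_measurable: "integrable freq_measure g \<Longrightarrow> synth g \<in> borel_measurable borel"
  by (intro borel_measurable_continuous_onI synth_continuous)

lemma synth_bound: "cmod (synth g z) \<le> (LINT \<zeta>|freq_measure. cmod (g \<zeta>))"
  unfolding synth_def by (rule osc_bound)

lemma synth_periodic: "y_periodic (synth g)"
proof -
  have "cis (dot (t, x, y + 2 * pi) \<zeta>) = cis (dot (t, x, y) \<zeta>)" for t x y \<zeta>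
  proof -
    have "dot (t, x, y + 2 * pi) \<zeta> = dot (t, x, y) \<zeta> + 2 * pi * real_of_int (snd (snd \<zeta>))"
      by (simp add: dot_def qq_def algebra_simps)
    then show ?thesis by (simp only: cis_add_2pi)
  qed
  then show ?thesis unfolding y_periodic_def synth_def by simp
qed

lemma integrable_mult_bounded:
  fixes f g :: "'a \<Rightarrow> complex"
  assumes "integrable M f" "g \<in> borel_measurable M" "\<And>z. cmod (g z) \<le> C"
  shows "integrable M (\<lambda>z. g z * f z)"
proof (rule Bochner_Integration.integrable_bound)
  show "integrable M (\<lambda>z. C * cmod (f z))" using assms(1) by simp
  have [measurable]: "f \<in> borel_measurable M" using assms(1) by simp
  note [measurable] = assms(2)
  show "(\<lambda>z. g z * f z) \<in> borel_measurable M" by measurable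
  show "AE z in M. norm (g z * f z) \<le> norm (C * cmod (f z))"
  proof (rule AE_I2)
    fix z
    have "C \<ge> 0" using assms(3)[of z] norm_ge_zero order_trans by blast
    then show "norm (g z * f z) \<le> norm (C * cmod (f z))"
      using mult_right_mono[OF assms(3)[of z], of "cmod (f z)"] by (simp add: norm_mult)
  qed
qed

lemma represented_byI:
  assumes "f \<in> borel_measurable borel" "y_periodic f" "\<And>z. cmod (f z) \<le> C"
    and "\<And>\<phi>. \<phi> \<in> schwartz \<Longrightarrow> u \<phi> = (LINT z|cyl. f z * \<phi> z)"
  shows "represented_by u f"
  unfolding represented_by_def
proof (intro conjI ballI)
  show "f \<in> borel_measurable lborel" using assms(1) by simp
  fix \<phi> assume p: "\<phi> \<in> schwartz"
  then have ps: "\<phi> \<in> SP" by (simp add: schwartz_rapid)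
  have [measurable]: "\<phi> \<in> borel_measurable borel" "f \<in> borel_measurable borel"
    using assms(1) borel_measurable_continuous_onI[OF rapid_continuous[OF ps]] by auto
  have m: "(\<lambda>z. f z * \<phi> z) \<in> borel_measurable borel" by measurable
  have "integrable cyl (\<lambda>z. f z * \<phi> z)"
    by (rule integrable_mult_bounded[OF rapid_integrable(1)[OF ps] _ assms(3)]) (use assms(1) in measurable)
  then show "set_integrable lborel cylinder (\<lambda>z. f z * \<phi> z)" using cyl_integrable_iff[OF m] by simp
  show "u \<phi> = (LINT z:cylinder|lborel. f z * \<phi> z)" using assms(4)[OF p] cyl_integral[OF m] by simp
qed (rule assms(2))

lemma represented_byD:
  assumes "represented_by u f"
  shows "f \<in> borel_measurable borel" "\<And>\<phi>. \<phi> \<in> schwartz \<Longrightarrow> integrable cyl (\<lambda>z. f z * \<phi> z)"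
    "\<And>\<phi>. \<phi> \<in> schwartz \<Longrightarrow> u \<phi> = (LINT z|cyl. f z * \<phi> z)"
proof -
  show fm: "f \<in> borel_measurable borel" using assms by (simp add: represented_by_def)
  fix \<phi> assume p: "\<phi> \<in> schwartz"
  then have ps: "\<phi> \<in> SP" by (simp add: schwartz_rapid)
  have m: "(\<lambda>z. f z * \<phi> z) \<in> borel_measurable borel"
    using fm borel_measurable_continuous_onI[OF rapid_continuous[OF ps]] by measurable
  show "integrable cyl (\<lambda>z. f z * \<phi> z)" using assms p cyl_integrable_iff[OF m] unfolding represented_by_def by blast
  show "u \<phi> = (LINT z|cyl. f z * \<phi> z)" using assms p cyl_integral[OF m] unfolding represented_by_def by simp
qed

lemma represented_by_unique:
  assumes "represented_by u f" "represented_by u f'"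
  shows "AE z in cyl. f z = f' z"
proof -
  note D = represented_byD[OF assms(1)] and D' = represented_byD[OF assms(2)]
  have "AE z in cyl. f z - f' z = 0"
  proof (rule annihilates_schwartz_zero)
    fix \<phi> assume p: "\<phi> \<in> schwartz"
    have e: "(f z - f' z) * \<phi> z = f z * \<phi> z - f' z * \<phi> z" for z by (simp add: algebra_simps)
    show "integrable cyl (\<lambda>z. (f z - f' z) * \<phi> z)" unfolding e using D(2)[OF p] D'(2)[OF p] by simp
    show "(LINT z|cyl. (f z - f' z) * \<phi> z) = 0"
      unfolding e Bochner_Integration.integral_diff[OF D(2)[OF p] D'(2)[OF p]] using D(3)[OF p] D'(3)[OF p] by simp
  qed
  then show ?thesis by eventually_elim simp
qed

text \<open>By inversion every test function is a transform, namely of \<open>(2 pi) ^ (-3)\<close> times \<open>bt \<phi>\<close>. The definition of the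
  Fourier transform of \<open>u\<close> by transposition gives \<open>u \<phi>\<close> as an integral of \<open>g\<close> against \<open>bt \<phi>\<close>, and Fubini's
  theorem moves the transform back to \<open>g\<close>.\<close>

lemma has_fourier_represented:
  assumes "has_fourier u g" "integrable freq_measure g"
  shows "represented_by u (\<lambda>z. inv_const * synth g z)"
proof (rule represented_byI)
  show "(\<lambda>z. inv_const * synth g z) \<in> borel_measurable borel"
    using synth_measurable[OF assms(2)] by measurable
  show "y_periodic (\<lambda>z. inv_const * synth g z)" using synth_periodic[of g] by (simp add: y_periodic_def)
  show "cmod (inv_const * synth g z) \<le> cmod inv_const * (LINT \<zeta>|freq_measure. cmod (g \<zeta>))" for z
    unfolding norm_mult by (intro mult_left_mono synth_bound) simp
  fix \<phi> assume p: "\<phi> \<in> schwartz"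
  let ?\<psi> = "\<lambda>\<zeta>. of_real (1 / (2 * pi) ^ 3) * bt \<phi> \<zeta>"
  have ps: "?\<psi> \<in> schwartz_freq" unfolding schwartz_freq_rapid by (rule SF_cmult[OF bt_SF[OF p]])
  have pi: "integrable cyl \<phi>" using p by (intro rapid_integrable) (simp add: schwartz_rapid)
  have "u \<phi> = u (fourier_test ?\<psi>)" unfolding fourier_test_ft ft_bt[OF p] ..
  also have "\<dots> = (LINT \<zeta>|freq_measure. g \<zeta> * ?\<psi> \<zeta>)" using assms(1) ps unfolding has_fourier_def by blast
  also have "\<dots> = inv_const * (LINT \<zeta>|freq_measure. g \<zeta> * bt \<phi> \<zeta>)"
    unfolding inv_const_def by (subst integral_mult_right_zero[symmetric]) (simp only: mult_ac)
  also have "\<dots> = (LINT z|cyl. inv_const * synth g z * \<phi> z)"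
    unfolding synth_duality[OF assms(2) pi, symmetric] by (subst integral_mult_right_zero[symmetric]) (simp only: mult_ac)
  finally show "u \<phi> = (LINT z|cyl. inv_const * synth g z * \<phi> z)" .
qed

text \<open>The inverse transforms witness that representing functions with a representable product exist.
  Whatever functions the choice operator returns, they agree with these almost everywhere.\<close>

lemma distr_prod3_eq:
  assumes u: "has_fourier u1 g1" "has_fourier u2 g2" "has_fourier u3 g3"
    and g: "integrable freq_measure g1" "integrable freq_measure g2" "integrable freq_measure g3"
    and p: "\<phi> \<in> schwartz"
  shows "distr_prod3 u1 u2 u3 \<phi> = (LINT z|cyl. inv_const ^ 3 * synth (conv (conv g1 g2) g3) z * \<phi> z)"
proof -
  define f where "f g z = inv_const * synth g z" for g z
  have fe: "f g = (\<lambda>z. inv_const * synth g z)" for g by (simp add: f_def fun_eq_iff)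
  have r: "represented_by u1 (f g1)" "represented_by u2 (f g2)" "represented_by u3 (f g3)"
    unfolding fe by (intro has_fourier_represented u g)+
  have K: "f g1 z * f g2 z * f g3 z = inv_const ^ 3 * synth (conv (conv g1 g2) g3) z" for z
    unfolding f_def synth_conv[OF conv_integrable[OF g(1,2)] g(3)] synth_conv[OF g(1,2)]
    by (simp add: power3_eq_cube mult_ac)
  have Ki: "integrable freq_measure (conv (conv g1 g2) g3)" by (intro conv_integrable g)
  define p0 :: distr where "p0 = (\<lambda>\<phi>. LINT z|cyl. f g1 z * f g2 z * f g3 z * \<phi> z)"
  have "represented_by p0 (\<lambda>z. f g1 z * f g2 z * f g3 z)"
  proof (rule represented_byI)
    show "(\<lambda>z. f g1 z * f g2 z * f g3 z) \<in> borel_measurable borel" unfolding K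
      using synth_measurable[OF Ki] by measurable
    show "y_periodic (\<lambda>z. f g1 z * f g2 z * f g3 z)" unfolding K
      using synth_periodic[of "conv (conv g1 g2) g3"] by (simp add: y_periodic_def)
    show "cmod (f g1 z * f g2 z * f g3 z) \<le> cmod (inv_const ^ 3) * (LINT \<zeta>|freq_measure. cmod (conv (conv g1 g2) g3 \<zeta>))" for z
      unfolding K norm_mult by (intro mult_left_mono synth_bound) simp
  qed (simp add: p0_def)
  then have "\<exists>p f g h. represented_by u1 f \<and> represented_by u2 g \<and> represented_by u3 h \<and> represented_by p (\<lambda>z. f z * g z * h z)"
    using r by (intro exI[of _ p0] exI[of _ "f g1"] exI[of _ "f g2"] exI[of _ "f g3"] conjI)
  from someI_ex[OF this] obtain f1 f2 f3 where F: "represented_by u1 f1" "represented_by u2 f2" "represented_by u3 f3"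
    "represented_by (distr_prod3 u1 u2 u3) (\<lambda>z. f1 z * f2 z * f3 z)"
    unfolding distr_prod3_def by blast
  have ps: "\<phi> \<in> SP" using p by (simp add: schwartz_rapid)
  have pm: "\<phi> \<in> borel_measurable cyl" using rapid_integrable(1)[OF ps] by simp
  have "distr_prod3 u1 u2 u3 \<phi> = (LINT z|cyl. f1 z * f2 z * f3 z * \<phi> z)"
    by (rule represented_byD(3)[OF F(4) p])
  also have "\<dots> = (LINT z|cyl. inv_const ^ 3 * synth (conv (conv g1 g2) g3) z * \<phi> z)"
  proof (rule integral_cong_AE)
    show "(\<lambda>z. f1 z * f2 z * f3 z * \<phi> z) \<in> borel_measurable cyl"
      using represented_byD(2)[OF F(4) p] by simp
    show "(\<lambda>z. inv_const ^ 3 * synth (conv (conv g1 g2) g3) z * \<phi> z) \<in> borel_measurable cyl"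
      using synth_measurable[OF Ki] pm by measurable
    show "AE z in cyl. f1 z * f2 z * f3 z * \<phi> z = inv_const ^ 3 * synth (conv (conv g1 g2) g3) z * \<phi> z"
      using represented_by_unique[OF F(1) r(1)] represented_by_unique[OF F(2) r(2)] represented_by_unique[OF F(3) r(3)]
      by eventually_elim (simp add: K[symmetric])
  qed
  finally show ?thesis .
qed

lemma partial_deriv_schwartz:
  assumes "\<phi> \<in> schwartz" "e \<in> Basis"
  shows "partial_deriv e \<phi> \<in> schwartz" "((\<lambda>h. \<phi> (shift_phys e h z)) has_vector_derivative partial_deriv e \<phi> z) (at 0)"
proof -
  have ps: "\<phi> \<in> SP" "y_periodic \<phi>" using assms by (auto simp: schwartz_rapid)
  obtain \<phi>' where p': "\<phi>' \<in> SP" "\<And>z. ((\<lambda>h. \<phi> (shift_phys e h z)) has_vector_derivative \<phi>' z) (at 0)"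
    by (rule rapid_deriv[OF ps(1) assms(2)]) (rule that)
  have e: "partial_deriv e \<phi> = \<phi>'"
    unfolding partial_deriv_def using p'(2) unfolding shift_phys_def by (auto simp: fun_eq_iff intro!: vector_derivative_at)
  show "partial_deriv e \<phi> \<in> schwartz" unfolding e using p'(1) periodic_deriv[OF ps(2) p'(2)] by (simp add: schwartz_rapid)
  show "((\<lambda>h. \<phi> (shift_phys e h z)) has_vector_derivative partial_deriv e \<phi> z) (at 0)" unfolding e by (rule p')
qed

lemma partial_deriv_eqI:
  "(\<And>z. ((\<lambda>h. f (shift_phys e h z)) has_vector_derivative f' z) (at 0)) \<Longrightarrow> partial_deriv e f = f'"
  unfolding partial_deriv_def shift_phys_def by (auto simp: fun_eq_iff intro!: vector_derivative_at)

text \<open>The supremum in the seminorm is over a bounded set because only finitely many derivatives occur.\<close>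

lemma seminorm_bound:
  assumes p: "\<phi> \<in> schwartz" and es: "es \<in> lists Basis" "length es \<le> N"
  shows "weight_phys z ^ N * cmod (iter_partial es \<phi> z) \<le> schwartz_seminorm N \<phi>"
proof -
  obtain t x y where z: "z = (t, x, y)" by (cases z)
  let ?F = "\<lambda>(es, t, x, y). (1 + \<bar>t\<bar> + \<bar>x\<bar>) ^ N * cmod (iter_partial es \<phi> (t, x, y))"
  let ?E = "{es \<in> lists Basis. length es \<le> N} :: phys list set"
  have fin: "finite ?E"
    using finite_lists_length_le[of "Basis :: phys set" N] by (simp add: lists_eq_set conj_commute)
  have "\<forall>es\<in>?E. \<exists>C. \<forall>t x y. (1 + \<bar>t\<bar> + \<bar>x\<bar>) ^ N * cmod (iter_partial es \<phi> (t, x, y)) \<le> C"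
    using p unfolding schwartz_def by blast
  then have "\<exists>C. \<forall>es\<in>?E. \<forall>t x y. (1 + \<bar>t\<bar> + \<bar>x\<bar>) ^ N * cmod (iter_partial es \<phi> (t, x, y)) \<le> C es"
    by (rule bchoice)
  then obtain C where C: "\<And>es t x y. es \<in> ?E \<Longrightarrow> (1 + \<bar>t\<bar> + \<bar>x\<bar>) ^ N * cmod (iter_partial es \<phi> (t, x, y)) \<le> C es"
    by blast
  have bdd: "bdd_above (?F ` (?E \<times> UNIV))"
  proof (rule bdd_aboveI2)
    fix w assume w: "w \<in> ?E \<times> (UNIV :: phys set)"
    obtain es t x y where ww: "w = (es, t, x, y)" by (cases w) auto
    then have "es \<in> ?E" using w by auto
    then have "?F w \<le> C es" using C by (simp add: ww)
    also have "\<dots> \<le> Max (C ` ?E)" using fin \<open>es \<in> ?E\<close> by (intro Max_ge) auto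
    finally show "?F w \<le> Max (C ` ?E)" .
  qed
  have "?F (es, t, x, y) \<le> (SUP w\<in>?E \<times> UNIV. ?F w)"
    by (rule cSUP_upper[OF _ bdd]) (use es in auto)
  then show ?thesis unfolding schwartz_seminorm_def z by (simp add: weight_phys_def)
qed

text \<open>The decay of order \<open>4\<close> that makes the derivative of the test function integrable is measured by
  the fourth seminorm.\<close>

lemma tempered_dx_bounded:
  assumes f: "f \<in> borel_measurable borel" "\<And>z. cmod (f z) \<le> M"
    and u: "\<And>\<phi>. \<phi> \<in> schwartz \<Longrightarrow> u \<phi> = (LINT z|cyl. f z * \<phi> z)"
  shows "tempered (dx_distr u)"
proof -
  let ?e = "(0, 1, 0) :: phys"
  have e: "?e \<in> Basis" by (simp add: Basis_phys)
  have i: "integrable cyl (\<lambda>z. f z * \<phi> z)" if "\<phi> \<in> schwartz" for \<phi>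
    by (rule integrable_mult_bounded[OF rapid_integrable(1) _ f(2)]) (use that f(1) in \<open>auto simp: schwartz_rapid measurable_cong_sets[OF sets_cyl refl]\<close>)
  have dx: "dx_distr u \<phi> = - (LINT z|cyl. f z * partial_deriv ?e \<phi> z)" if "\<phi> \<in> schwartz" for \<phi>
    unfolding dx_distr_def using u[OF partial_deriv_schwartz(1)[OF that e]] by simp
  have add: "(\<lambda>z. \<phi> z + \<psi> z) \<in> schwartz \<and> partial_deriv ?e (\<lambda>z. \<phi> z + \<psi> z) = (\<lambda>z. partial_deriv ?e \<phi> z + partial_deriv ?e \<psi> z)"
    if "\<phi> \<in> schwartz" "\<psi> \<in> schwartz" for \<phi> \<psi>
  proof
    show "(\<lambda>z. \<phi> z + \<psi> z) \<in> schwartz" using that SP_lin[of \<phi> \<psi> 1] by (simp add: schwartz_rapid y_periodic_def)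
    show "partial_deriv ?e (\<lambda>z. \<phi> z + \<psi> z) = (\<lambda>z. partial_deriv ?e \<phi> z + partial_deriv ?e \<psi> z)"
      by (rule partial_deriv_eqI) (intro has_vector_derivative_add partial_deriv_schwartz(2) that e)
  qed
  have mul: "(\<lambda>z. c * \<phi> z) \<in> schwartz \<and> partial_deriv ?e (\<lambda>z. c * \<phi> z) = (\<lambda>z. c * partial_deriv ?e \<phi> z)"
    if "\<phi> \<in> schwartz" for \<phi> c
  proof
    show "(\<lambda>z. c * \<phi> z) \<in> schwartz" using that SP_cmult[of \<phi> c] by (simp add: schwartz_rapid y_periodic_def)
    show "partial_deriv ?e (\<lambda>z. c * \<phi> z) = (\<lambda>z. c * partial_deriv ?e \<phi> z)"
      by (rule partial_deriv_eqI) (intro has_vector_derivative_mult_right partial_deriv_schwartz(2) that e)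
  qed
  show ?thesis
    unfolding tempered_def
  proof (intro conjI ballI allI)
    fix \<phi> \<psi> assume p: "\<phi> \<in> schwartz" "\<psi> \<in> schwartz"
    note ii = i[OF partial_deriv_schwartz(1)[OF p(1) e]] i[OF partial_deriv_schwartz(1)[OF p(2) e]]
    show "dx_distr u (\<lambda>z. \<phi> z + \<psi> z) = dx_distr u \<phi> + dx_distr u \<psi>"
      using add[OF p] dx[of "\<lambda>z. \<phi> z + \<psi> z"] dx[OF p(1)] dx[OF p(2)] Bochner_Integration.integral_add[OF ii]
      by (simp add: distrib_left)
  next
    fix c \<phi> assume p: "\<phi> \<in> schwartz"
    have "(LINT z|cyl. f z * (c * partial_deriv ?e \<phi> z)) = c * (LINT z|cyl. f z * partial_deriv ?e \<phi> z)"
      by (subst integral_mult_right_zero[symmetric]) (simp only: mult_ac)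
    then show "dx_distr u (\<lambda>z. c * \<phi> z) = c * dx_distr u \<phi>"
      using mul[OF p, of c] dx[of "\<lambda>z. c * \<phi> z"] dx[OF p] by simp
  next
    show "\<exists>N C. \<forall>\<phi>\<in>schwartz. cmod (dx_distr u \<phi>) \<le> C * schwartz_seminorm N \<phi>"
    proof (intro exI ballI)
      fix \<phi> assume p: "\<phi> \<in> schwartz"
      have M: "M \<ge> 0" using f(2) norm_ge_zero order_trans by blast
      have "cmod (dx_distr u \<phi>) = cmod (LINT z|cyl. f z * partial_deriv ?e \<phi> z)" using dx[OF p] by simp
      also have "\<dots> \<le> (LINT z|cyl. cmod (f z * partial_deriv ?e \<phi> z))" by (rule integral_norm_bound)
      also have "\<dots> \<le> (LINT z|cyl. (M * schwartz_seminorm 4 \<phi>) * inverse (weight_phys z ^ 4))"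
      proof (rule integral_mono)
        show "integrable cyl (\<lambda>z. cmod (f z * partial_deriv ?e \<phi> z))"
          using i[OF partial_deriv_schwartz(1)[OF p e]] by simp
        show "integrable cyl (\<lambda>z. (M * schwartz_seminorm 4 \<phi>) * inverse (weight_phys z ^ 4))"
          by (intro integrable_mult_right integrable_weight_phys)
        fix z
        have w: "weight_phys z ^ 4 > 0" using weight_phys_ge1[of z] by (intro zero_less_power) linarith
        have "weight_phys z ^ 4 * cmod (partial_deriv ?e \<phi> z) \<le> schwartz_seminorm 4 \<phi>"
          using seminorm_bound[OF p, of "[?e]" 4 z] e by simp
        then have "cmod (partial_deriv ?e \<phi> z) \<le> schwartz_seminorm 4 \<phi> * inverse (weight_phys z ^ 4)"
          using w by (simp add: field_simps)
        then show "cmod (f z * partial_deriv ?e \<phi> z) \<le> (M * schwartz_seminorm 4 \<phi>) * inverse (weight_phys z ^ 4)"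
          unfolding norm_mult mult.assoc using f(2) M by (intro mult_mono) auto
      qed
      also have "\<dots> = (M * (LINT z|cyl. inverse (weight_phys z ^ 4))) * schwartz_seminorm 4 \<phi>"
        by simp
      finally show "cmod (dx_distr u \<phi>) \<le> (M * (LINT z|cyl. inverse (weight_phys z ^ 4))) * schwartz_seminorm 4 \<phi>" .
    qed
  qed
qed

text \<open>The derivative is transposed to the test function and becomes multiplication by \<open>- \<i> \<xi>\<close> under \<open>ft\<close>. Each of the
  three inverse transforms contributes \<open>(2 pi) ^ (-3)\<close>, and one of these factors is absorbed by the inversion formula.\<close>

theorem has_fourier_dx_prod3:
  assumes u: "has_fourier u1 g1" "has_fourier u2 g2" "has_fourier u3 g3"
    and g: "integrable freq_measure g1" "integrable freq_measure g2" "integrable freq_measure g3"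
  shows "has_fourier (dx_distr (distr_prod3 u1 u2 u3)) (\<lambda>\<zeta>. inv_const ^ 2 * \<i> * of_real (xi \<zeta>) * conv (conv g1 g2) g3 \<zeta>)"
proof -
  define K where "K = conv (conv g1 g2) g3"
  have Ki: "integrable freq_measure K" unfolding K_def by (intro conv_integrable g)
  let ?p = "distr_prod3 u1 u2 u3"
  let ?e = "(0, 1, 0) :: phys"
  have e: "?e \<in> Basis" by (simp add: Basis_phys)
  have pe: "?p \<phi> = (LINT z|cyl. inv_const ^ 3 * synth K z * \<phi> z)" if "\<phi> \<in> schwartz" for \<phi>
    unfolding K_def by (rule distr_prod3_eq[OF u g that])
  have Km: "K \<in> borel_measurable freq_measure" using Ki by simp
  show ?thesis
    unfolding has_fourier_def K_def[symmetric]
  proof (intro conjI ballI)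
    show "tempered (dx_distr ?p)"
    proof (rule tempered_dx_bounded)
      show "(\<lambda>z. inv_const ^ 3 * synth K z) \<in> borel_measurable borel" using synth_measurable[OF Ki] by measurable
      show "cmod (inv_const ^ 3 * synth K z) \<le> cmod (inv_const ^ 3) * (LINT \<zeta>|freq_measure. cmod (K \<zeta>))" for z
        unfolding norm_mult by (intro mult_left_mono synth_bound) simp
    qed (rule pe)
    show "(\<lambda>\<zeta>. inv_const ^ 2 * \<i> * of_real (xi \<zeta>) * K \<zeta>) \<in> borel_measurable freq_measure"
      using Km by measurable
    fix \<psi> assume ps: "\<psi> \<in> schwartz_freq"
    then have pf: "\<psi> \<in> SF" by (simp add: schwartz_freq_rapid)
    let ?\<chi> = "\<lambda>\<zeta>. - \<i> * (of_real (dot ?e \<zeta>) * \<psi> \<zeta>)"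
    note ch = ft_deriv[OF pf e]
    have de: "dot ?e \<zeta> = xi \<zeta>" for \<zeta> by (simp add: dot_def)
    obtain C where C: "\<And>\<zeta>. weight_freq \<zeta> ^ 0 * cmod (?\<chi> \<zeta>) \<le> C" using rapid_decay[OF ch(1), of 0] by blast
    have chm: "?\<chi> \<in> borel_measurable freq_measure" using rapid_integrable(2)[OF ch(1)] by simp
    have i: "integrable freq_measure (\<lambda>\<zeta>. ?\<chi> \<zeta> * K \<zeta>)"
      by (rule integrable_mult_bounded[OF Ki chm]) (use C in simp)
    have eq: "inv_const ^ 2 * \<i> * of_real (xi \<zeta>) * K \<zeta> * \<psi> \<zeta> = (- (inv_const ^ 2)) * (?\<chi> \<zeta> * K \<zeta>)" for \<zeta>
      by (simp add: de mult_ac)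
    show "integrable freq_measure (\<lambda>\<zeta>. inv_const ^ 2 * \<i> * of_real (xi \<zeta>) * K \<zeta> * \<psi> \<zeta>)"
      unfolding eq by (rule integrable_mult_right[OF i])
    have fs: "ft ?\<chi> \<in> schwartz" by (rule ft_schwartz) (use ch(1) in \<open>simp add: schwartz_freq_rapid\<close>)
    have fi: "integrable cyl (ft ?\<chi>)" by (rule rapid_integrable(1)[OF ft_SP[OF ch(1)]])
    have pd: "partial_deriv ?e (ft \<psi>) = ft ?\<chi>" by (rule partial_deriv_eqI[OF ch(2)])
    have "dx_distr ?p (fourier_test \<psi>) = - (LINT z|cyl. inv_const ^ 3 * synth K z * ft ?\<chi> z)"
      unfolding dx_distr_def fourier_test_ft pd pe[OF fs] ..
    also have "(LINT z|cyl. inv_const ^ 3 * synth K z * ft ?\<chi> z) = inv_const ^ 3 * (LINT z|cyl. synth K z * ft ?\<chi> z)"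
      by (subst integral_mult_right_zero[symmetric]) (simp only: mult.assoc)
    also have "(LINT z|cyl. synth K z * ft ?\<chi> z) = (LINT \<zeta>|freq_measure. K \<zeta> * (of_real ((2 * pi) ^ 3) * ?\<chi> \<zeta>))"
      unfolding synth_duality[OF Ki fi] bt_ft[OF ch(1)] ..
    also have "\<dots> = of_real ((2 * pi) ^ 3) * (LINT \<zeta>|freq_measure. ?\<chi> \<zeta> * K \<zeta>)"
      by (subst integral_mult_right_zero[symmetric]) (simp only: mult_ac)
    also have "- (inv_const ^ 3 * (of_real ((2 * pi) ^ 3) * (LINT \<zeta>|freq_measure. ?\<chi> \<zeta> * K \<zeta>))) = (- (inv_const ^ 2)) * (LINT \<zeta>|freq_measure. ?\<chi> \<zeta> * K \<zeta>)"
    proof -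
      have "inv_const * of_real ((2 * pi) ^ 3) = 1" by (simp add: inv_const_def)
      then have "inv_const ^ 3 * of_real ((2 * pi) ^ 3) = inv_const ^ 2" by (simp add: power3_eq_cube power2_eq_square mult.assoc)
      then show ?thesis by (simp add: mult.assoc[symmetric])
    qed
    also have "\<dots> = (LINT \<zeta>|freq_measure. inv_const ^ 2 * \<i> * of_real (xi \<zeta>) * K \<zeta> * \<psi> \<zeta>)"
      unfolding eq by (rule integral_mult_right_zero[symmetric])
    finally show "dx_distr ?p (fourier_test \<psi>) = (LINT \<zeta>|freq_measure. inv_const ^ 2 * \<i> * of_real (xi \<zeta>) * K \<zeta> * \<psi> \<zeta>)" .
  qed
qed

section \<open>The estimate in Bourgain spaces\<close>

lemma ennreal_power2_le_imp_le: "a\<^sup>2 \<le> b\<^sup>2 \<Longrightarrow> a \<le> b" for a b :: ennreal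
proof (cases a; cases b)
  fix x y :: real assume "a\<^sup>2 \<le> b\<^sup>2" "0 \<le> x" "a = ennreal x" "0 \<le> y" "b = ennreal y"
  then show ?thesis by (auto simp: ennreal_power intro!: ennreal_leI power2_le_imp_le)
qed (auto simp: ennreal_top_mult power2_eq_square top_unique ennreal_mult_eq_top_iff ennreal_mult[symmetric])

lemma L2_norm_freq_sq: "(L2_norm_freq g)\<^sup>2 = (\<integral>\<^sup>+\<zeta>. ennreal ((g \<zeta>)\<^sup>2) \<partial>freq_measure)"
proof (cases "(\<integral>\<^sup>+\<zeta>. ennreal ((g \<zeta>)\<^sup>2) \<partial>freq_measure) = \<infinity>")
  case True
  then show ?thesis by (simp add: L2_norm_freq_def power2_eq_square ennreal_mult_top)
next
  case False
  then show ?thesis by (simp add: L2_norm_freq_def Let_def ennreal_power ennreal_enn2real less_top[symmetric])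
qed

text \<open>The integrand of the Bourgain norm, in the form in which the norm is defined.\<close>

definition X_weight :: "real \<Rightarrow> real \<Rightarrow> (freq \<Rightarrow> complex) \<Rightarrow> freq \<Rightarrow> real" where
  "X_weight s b g = (\<lambda>(\<tau>, \<xi>, q). jbracket (\<tau> - omega \<xi> q) powr b * jbracket (freq_abs \<xi> q) powr s * cmod (g (\<tau>, \<xi>, q)))"

lemma X_weight_eq: "X_weight s b g \<zeta> = mod_weight (- b) \<zeta> * sob_weight s \<zeta> * cmod (g \<zeta>)"
proof -
  obtain \<tau> \<xi> q where z: "\<zeta> = (\<tau>, \<xi>, q)" by (cases \<zeta>)
  have 1: "\<tau> - omega \<xi> q = modulation \<zeta>" by (simp add: z modulation_def phase_def omega_def)
  have 2: "jbracket (freq_abs \<xi> q) powr s = sob_weight s \<zeta>"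
    unfolding jbracket_powr_sq by (simp add: z sob_weight_def freq_sq_def freq_abs_def)
  show ?thesis using 2 unfolding X_weight_def z by (simp add: mod_weight_def 1[unfolded z])
qed

lemma L2_X_weight: "(L2_norm_freq (X_weight s b g))\<^sup>2 = sqnorm (\<lambda>\<zeta>. ennreal (mod_weight (- b) \<zeta> * sob_weight s \<zeta>) * ennreal (cmod (g \<zeta>)))"
  unfolding L2_norm_freq_sq sqnorm_def X_weight_eq
  by (intro nn_integral_cong) (simp add: ennreal_mult[symmetric] ennreal_power less_imp_le)

lemma X_norm_eq: "X_norm s b u = (INF g \<in> {g. has_fourier u g}. L2_norm_freq (X_weight s b g))"
  unfolding X_norm_def X_weight_def ..

text \<open>Cauchy-Schwarz against the reciprocal weight, which is square integrable by \<open>kernel_sobolev\<close>.\<close>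

lemma integrable_from_X:
  assumes s: "s > 1" "b > 1/2" and g: "g \<in> borel_measurable freq_measure" and fin: "L2_norm_freq (X_weight s b g) < \<infinity>"
  shows "integrable freq_measure g"
proof (rule integrableI_bounded[OF g])
  let ?W = "\<lambda>\<zeta>. ennreal (mod_weight (- b) \<zeta> * sob_weight s \<zeta>)" and ?V = "\<lambda>\<zeta>. ennreal (mod_weight b \<zeta> * sob_weight s \<zeta> powr (- 1))"
  have gm[measurable]: "(\<lambda>\<zeta>. ennreal (cmod (g \<zeta>))) \<in> borel_measurable freq_measure" using g by measurable
  have VW: "?V \<zeta> * ?W \<zeta> = 1" for \<zeta>
  proof -
    have "jbracket (modulation \<zeta>) \<noteq> 0" by (metis less_irrefl jbracket_pos)
    then have 1: "mod_weight b \<zeta> * mod_weight (- b) \<zeta> = 1" by (simp add: mod_weight_def powr_add[symmetric])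
    have 2: "sob_weight s \<zeta> powr (- 1) * sob_weight s \<zeta> = 1"
    proof -
      have "sob_weight s \<zeta> powr (- 1) = inverse (sob_weight s \<zeta>)" "sob_weight s \<zeta> \<noteq> 0"
        using sob_weight_pos[of s \<zeta>] by (simp_all add: powr_minus abs_of_pos less_imp_neq[symmetric])
      then show ?thesis by simp
    qed
    have "(mod_weight b \<zeta> * sob_weight s \<zeta> powr (- 1)) * (mod_weight (- b) \<zeta> * sob_weight s \<zeta>) = (mod_weight b \<zeta> * mod_weight (- b) \<zeta>) * (sob_weight s \<zeta> powr (- 1) * sob_weight s \<zeta>)"
      by (simp only: mult_ac)
    then have "(mod_weight b \<zeta> * sob_weight s \<zeta> powr (- 1)) * (mod_weight (- b) \<zeta> * sob_weight s \<zeta>) = 1" unfolding 1 2 mult_1_left .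
    moreover have "?V \<zeta> * ?W \<zeta> = ennreal ((mod_weight b \<zeta> * sob_weight s \<zeta> powr (- 1)) * (mod_weight (- b) \<zeta> * sob_weight s \<zeta>))"
      by (rule ennreal_mult[symmetric]; intro mult_nonneg_nonneg mod_weight_pos powr_ge_zero less_imp_le[OF sob_weight_pos])
    ultimately show ?thesis by (simp only: ennreal_1)
  qed
  have "(\<integral>\<^sup>+\<zeta>. ennreal (cmod (g \<zeta>)) \<partial>freq_measure) = (\<integral>\<^sup>+\<zeta>. ?V \<zeta> * (?W \<zeta> * ennreal (cmod (g \<zeta>))) \<partial>freq_measure)"
    unfolding mult.assoc[symmetric] VW by simp
  then have "(\<integral>\<^sup>+\<zeta>. ennreal (cmod (g \<zeta>)) \<partial>freq_measure)\<^sup>2 = (\<integral>\<^sup>+\<zeta>. ?V \<zeta> * (?W \<zeta> * ennreal (cmod (g \<zeta>))) \<partial>freq_measure)\<^sup>2" by (simp only:)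
  also have "\<dots> \<le> (\<integral>\<^sup>+\<zeta>. (?V \<zeta>)\<^sup>2 \<partial>freq_measure) * (\<integral>\<^sup>+\<zeta>. (?W \<zeta> * ennreal (cmod (g \<zeta>)))\<^sup>2 \<partial>freq_measure)"
    by (rule Cauchy_Schwarz_nn_integral) measurable
  also have "(\<integral>\<^sup>+\<zeta>. (?W \<zeta> * ennreal (cmod (g \<zeta>)))\<^sup>2 \<partial>freq_measure) = (L2_norm_freq (X_weight s b g))\<^sup>2"
    unfolding L2_X_weight sqnorm_def ..
  also have "(\<integral>\<^sup>+\<zeta>. (?V \<zeta>)\<^sup>2 \<partial>freq_measure) = (\<integral>\<^sup>+\<zeta>. ennreal ((sob_weight s \<zeta>) powr (- 2) * jbracket (modulation \<zeta>) powr (- (2 * b))) \<partial>freq_measure)"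
  proof (intro nn_integral_cong)
    fix \<zeta>
    have "(mod_weight b \<zeta> * sob_weight s \<zeta> powr (- 1))\<^sup>2 = sob_weight s \<zeta> powr (- 2) * jbracket (modulation \<zeta>) powr (- (2 * b))"
      by (simp only: power_mult_distrib powr_sq mod_weight_sq) simp
    then show "(?V \<zeta>)\<^sup>2 = ennreal ((sob_weight s \<zeta>) powr (- 2) * jbracket (modulation \<zeta>) powr (- (2 * b)))"
      by (subst ennreal_power) (simp_all only: mult_nonneg_nonneg powr_ge_zero mod_weight_pos)
  qed
  finally have "(\<integral>\<^sup>+\<zeta>. ennreal (cmod (g \<zeta>)) \<partial>freq_measure)\<^sup>2 \<le> 
    (\<integral>\<^sup>+\<zeta>. ennreal ((sob_weight s \<zeta>) powr (- 2) * jbracket (modulation \<zeta>) powr (- (2 * b))) \<partial>freq_measure) * (L2_norm_freq (X_weight s b g))\<^sup>2" .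
  also have "\<dots> < \<infinity>" using kernel_sobolev[OF s] fin by (simp add: ennreal_mult_less_top power2_eq_square)
  finally show "(\<integral>\<^sup>+\<zeta>. ennreal (cmod (g \<zeta>)) \<partial>freq_measure) < \<infinity>"
    by (auto simp: power2_eq_square ennreal_mult_less_top less_top)
qed

text \<open>Here \<open>\<delta> = 1/24\<close>, so \<open>b = 1/2 + \<delta> = 13/24\<close>, and the output exponent is \<open>- 1/2 + 3 \<delta> = - 3/8\<close>. The
  trilinear estimate is applied with \<open>p = 1 - 6 \<delta> = 3/4\<close>; its requirement \<open>p > 1/2\<close> is what limits \<open>\<delta>\<close>.\<close>

theorem X_estimate:
  assumes s: "s > 1"
  obtains C :: real where "C > 0"
    "\<And>u1 u2 u3 g1 g2 g3. has_fourier u1 g1 \<Longrightarrow> has_fourier u2 g2 \<Longrightarrow> has_fourier u3 g3 \<Longrightarrow>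
      L2_norm_freq (X_weight s (13/24) g1) < \<infinity> \<Longrightarrow> L2_norm_freq (X_weight s (13/24) g2) < \<infinity> \<Longrightarrow> L2_norm_freq (X_weight s (13/24) g3) < \<infinity> \<Longrightarrow>
      X_norm s (- (3/8)) (dx_distr (distr_prod3 u1 u2 u3)) \<le>
        ennreal C * (L2_norm_freq (X_weight s (13/24) g1) * L2_norm_freq (X_weight s (13/24) g2) * L2_norm_freq (X_weight s (13/24) g3))"
proof -
  let ?b = "13 / 24 :: real"
  obtain C0 where C0: "C0 < (\<infinity>::ennreal)"
   "\<And>A1 A2 A3. A1 \<in> borel_measurable borel \<Longrightarrow> A2 \<in> borel_measurable borel \<Longrightarrow> A3 \<in> borel_measurable borel \<Longrightarrow>
     sqnorm (\<lambda>\<eta>. ennreal (\<bar>xi \<eta>\<bar> * mod_weight ((3/4)/2) \<eta> * sob_weight s \<eta>) * tri (\<lambda>x y z. A1 x * (A2 y * A3 z)) \<eta>) \<le>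
      C0 * (sqnorm (\<lambda>\<zeta>. ennreal (mod_weight (- ?b) \<zeta> * sob_weight s \<zeta>) * A1 \<zeta>) * sqnorm (\<lambda>\<zeta>. ennreal (mod_weight (- ?b) \<zeta> * sob_weight s \<zeta>) * A2 \<zeta>) *
        sqnorm (\<lambda>\<zeta>. ennreal (mod_weight (- ?b) \<zeta> * sob_weight s \<zeta>) * A3 \<zeta>))"
    by (rule trilinear_estimate[OF s, of ?b "3/4"]) (simp, simp, simp, rule that)
  define c where "c = enn2real C0 + 1"
  have c: "c > 0" "C0 \<le> ennreal c" using C0(1) by (auto simp: c_def ennreal_enn2real add_nonneg_pos ennreal_plus[symmetric] simp del: ennreal_plus)
      (metis C0(1) add.commute ennreal_1 ennreal_enn2real ennreal_leI ennreal_plus enn2real_nonneg infinity_ennreal_def le_add_same_cancel1 less_top zero_le_one add_increasing2 order_refl)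
  define d where "d = cmod (inv_const ^ 2)"
  have d: "d > 0" by (simp add: d_def inv_const_def norm_power)
  show thesis
  proof
    show "d * sqrt c > 0" using c d by simp
    fix u1 u2 u3 :: distr and g1 g2 g3
    assume u: "has_fourier u1 g1" "has_fourier u2 g2" "has_fourier u3 g3"
    assume fin: "L2_norm_freq (X_weight s ?b g1) < \<infinity>" "L2_norm_freq (X_weight s ?b g2) < \<infinity>" "L2_norm_freq (X_weight s ?b g3) < \<infinity>"
    have gm: "g1 \<in> borel_measurable freq_measure" "g2 \<in> borel_measurable freq_measure" "g3 \<in> borel_measurable freq_measure"
      using u by (auto simp: has_fourier_def)
    then have gb[measurable]: "g1 \<in> borel_measurable borel" "g2 \<in> borel_measurable borel" "g3 \<in> borel_measurable borel"
      by (simp_all add: measurable_cong_sets[OF sets_freq refl])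
    have gi: "integrable freq_measure g1" "integrable freq_measure g2" "integrable freq_measure g3"
      by (rule integrable_from_X[OF s _ gm(1) fin(1)] integrable_from_X[OF s _ gm(2) fin(2)] integrable_from_X[OF s _ gm(3) fin(3)], simp)+
    let ?G = "\<lambda>\<zeta>. inv_const ^ 2 * \<i> * of_real (xi \<zeta>) * conv (conv g1 g2) g3 \<zeta>"
    let ?T = "tri (\<lambda>x y z. ennreal (cmod (g1 x)) * (ennreal (cmod (g2 y)) * ennreal (cmod (g3 z))))"
    let ?L = "\<lambda>g. L2_norm_freq (X_weight s ?b g)"
    have Tm: "tri_meas (\<lambda>x y z. ennreal (cmod (g1 x)) * (ennreal (cmod (g2 y)) * ennreal (cmod (g3 z))))"
      unfolding tri_meas_def by measurable
    have "X_norm s (- (3/8)) (dx_distr (distr_prod3 u1 u2 u3)) \<le> L2_norm_freq (X_weight s (- (3/8)) ?G)"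
      unfolding X_norm_eq using has_fourier_dx_prod3[OF u gi] by (intro INF_lower) simp
    also have "L2_norm_freq (X_weight s (- (3/8)) ?G) \<le> ennreal (d * sqrt c) * (?L g1 * ?L g2 * ?L g3)"
    proof (rule ennreal_power2_le_imp_le)
      have "(L2_norm_freq (X_weight s (- (3/8)) ?G))\<^sup>2 = sqnorm (\<lambda>\<zeta>. ennreal (mod_weight (3/8) \<zeta> * sob_weight s \<zeta>) * ennreal (cmod (?G \<zeta>)))"
        unfolding L2_X_weight by simp
      also have "\<dots> \<le> sqnorm (\<lambda>\<zeta>. ennreal d * (ennreal (\<bar>xi \<zeta>\<bar> * mod_weight ((3/4)/2) \<zeta> * sob_weight s \<zeta>) * ?T \<zeta>))"
      proof (rule sqnorm_mono)
        fix \<zeta>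
        have "ennreal (cmod (?G \<zeta>)) = ennreal d * ennreal \<bar>xi \<zeta>\<bar> * ennreal (cmod (conv (conv g1 g2) g3 \<zeta>))"
          using d by (simp add: d_def norm_mult ennreal_mult)
        also have "\<dots> \<le> ennreal d * ennreal \<bar>xi \<zeta>\<bar> * ?T \<zeta>"
          by (intro mult_left_mono conv_conv_le_tri gb) simp
        finally have "ennreal (mod_weight (3/8) \<zeta> * sob_weight s \<zeta>) * ennreal (cmod (?G \<zeta>)) \<le> ennreal (mod_weight (3/8) \<zeta> * sob_weight s \<zeta>) * (ennreal d * ennreal \<bar>xi \<zeta>\<bar> * ?T \<zeta>)"
          by (rule mult_left_mono) simp
        also have "\<dots> = ennreal d * (ennreal (\<bar>xi \<zeta>\<bar> * mod_weight ((3/4)/2) \<zeta> * sob_weight s \<zeta>) * ?T \<zeta>)"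
          by (simp add: ennreal_mult less_imp_le mult_ac)
        finally show "ennreal (mod_weight (3/8) \<zeta> * sob_weight s \<zeta>) * ennreal (cmod (?G \<zeta>)) \<le> ennreal d * (ennreal (\<bar>xi \<zeta>\<bar> * mod_weight ((3/4)/2) \<zeta> * sob_weight s \<zeta>) * ?T \<zeta>)" .
      qed
      also have "\<dots> = (ennreal d)\<^sup>2 * sqnorm (\<lambda>\<zeta>. ennreal (\<bar>xi \<zeta>\<bar> * mod_weight ((3/4)/2) \<zeta> * sob_weight s \<zeta>) * ?T \<zeta>)"
        by (intro sqnorm_cmult borel_measurable_times_ennreal tri_measurable[OF Tm]) measurable
      also have "\<dots> \<le> (ennreal d)\<^sup>2 * (C0 * ((?L g1)\<^sup>2 * (?L g2)\<^sup>2 * (?L g3)\<^sup>2))"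
        unfolding L2_X_weight by (intro mult_left_mono C0(2)) measurable
      also have "\<dots> \<le> (ennreal d)\<^sup>2 * (ennreal c * ((?L g1)\<^sup>2 * (?L g2)\<^sup>2 * (?L g3)\<^sup>2))"
        by (intro mult_left_mono mult_right_mono c) auto
      also have "\<dots> = (ennreal (d * sqrt c) * (?L g1 * ?L g2 * ?L g3))\<^sup>2"
      proof -
        have "(ennreal (d * sqrt c))\<^sup>2 = (ennreal d)\<^sup>2 * ennreal c"
          using c d by (simp add: ennreal_power power_mult_distrib ennreal_mult)
        then show ?thesis by (simp add: power_mult_distrib mult.assoc)
      qed
      finally show "(L2_norm_freq (X_weight s (- (3/8)) ?G))\<^sup>2 \<le> (ennreal (d * sqrt c) * (?L g1 * ?L g2 * ?L g3))\<^sup>2" .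
    qed
    finally show "X_norm s (- (3/8)) (dx_distr (distr_prod3 u1 u2 u3)) \<le> ennreal (d * sqrt c) * (?L g1 * ?L g2 * ?L g3)" .
  qed
qed

lemma X_space_approx:
  assumes "u \<in> X_space s b" "\<epsilon> > 0"
  obtains g where "has_fourier u g" "L2_norm_freq (X_weight s b g) < ennreal (enn2real (X_norm s b u) + \<epsilon>)"
proof -
  have f: "X_norm s b u < \<infinity>" using assms by (simp add: X_space_def)
  have "X_norm s b u = ennreal (enn2real (X_norm s b u))" using f by (simp add: ennreal_enn2real)
  also have "\<dots> < ennreal (enn2real (X_norm s b u) + \<epsilon>)" using assms(2) by (intro ennreal_lessI) (auto simp: add_nonneg_pos)
  finally have "(INF g \<in> {g. has_fourier u g}. L2_norm_freq (X_weight s b g)) < ennreal (enn2real (X_norm s b u) + \<epsilon>)"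
    unfolding X_norm_eq .
  then show thesis unfolding INF_less_iff using that by auto
qed

text \<open>The norm of a distribution is an infimum over its transforms, so \<open>X_estimate\<close> is applied to transforms whose norms
  exceed it by at most \<open>\<epsilon>\<close>, and \<open>\<epsilon>\<close> tends to \<open>0\<close>.\<close>

theorem lemma3p3:
  fixes s :: real
  assumes "s > 1"
  shows "\<exists>\<delta>::real. \<delta> > 0 \<and> (\<exists>C::real. C > 0 \<and>
    (\<forall>u\<^sub>1 \<in> X_space s (1/2 + \<delta>). \<forall>u\<^sub>2 \<in> X_space s (1/2 + \<delta>). \<forall>u\<^sub>3 \<in> X_space s (1/2 + \<delta>).
       X_norm s (- 1/2 + 3 * \<delta>) (dx_distr (distr_prod3 u\<^sub>1 u\<^sub>2 u\<^sub>3))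
         \<le> ennreal C * (X_norm s (1/2 + \<delta>) u\<^sub>1 * X_norm s (1/2 + \<delta>) u\<^sub>2 * X_norm s (1/2 + \<delta>) u\<^sub>3)))"
proof -
  obtain C :: real where C: "C > 0"
    "\<And>u1 u2 u3 g1 g2 g3. has_fourier u1 g1 \<Longrightarrow> has_fourier u2 g2 \<Longrightarrow> has_fourier u3 g3 \<Longrightarrow>
      L2_norm_freq (X_weight s (13/24) g1) < \<infinity> \<Longrightarrow> L2_norm_freq (X_weight s (13/24) g2) < \<infinity> \<Longrightarrow> L2_norm_freq (X_weight s (13/24) g3) < \<infinity> \<Longrightarrow>
      X_norm s (- (3/8)) (dx_distr (distr_prod3 u1 u2 u3)) \<le>
        ennreal C * (L2_norm_freq (X_weight s (13/24) g1) * L2_norm_freq (X_weight s (13/24) g2) * L2_norm_freq (X_weight s (13/24) g3))"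
    by (rule X_estimate[OF assms]) (rule that)
  have b: "1/2 + 1/24 = (13/24 :: real)" "- 1/2 + 3 * (1/24) = (- (3/8) :: real)" by simp_all
  have main: "X_norm s (- (3/8)) (dx_distr (distr_prod3 u1 u2 u3)) \<le> ennreal C * (X_norm s (13/24) u1 * X_norm s (13/24) u2 * X_norm s (13/24) u3)"
    if X: "u1 \<in> X_space s (13/24)" "u2 \<in> X_space s (13/24)" "u3 \<in> X_space s (13/24)" for u1 u2 u3
  proof -
    define x where "x u = enn2real (X_norm s (13/24) u)" for u
    have xe: "X_norm s (13/24) u = ennreal (x u)" if "u \<in> X_space s (13/24)" for u
      using that by (simp add: x_def X_space_def ennreal_enn2real)
    have x0: "x u \<ge> 0" for u by (simp add: x_def)
    let ?N = "X_norm s (- (3/8)) (dx_distr (distr_prod3 u1 u2 u3))"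
    have le: "?N \<le> ennreal (C * ((x u1 + \<epsilon>) * (x u2 + \<epsilon>) * (x u3 + \<epsilon>)))" if e: "\<epsilon> > 0" for \<epsilon>
    proof -
      obtain g1 where g1: "has_fourier u1 g1" "L2_norm_freq (X_weight s (13/24) g1) < ennreal (x u1 + \<epsilon>)"
        by (rule X_space_approx[OF X(1) e], rule that) (simp_all add: x_def)
      obtain g2 where g2: "has_fourier u2 g2" "L2_norm_freq (X_weight s (13/24) g2) < ennreal (x u2 + \<epsilon>)"
        by (rule X_space_approx[OF X(2) e], rule that) (simp_all add: x_def)
      obtain g3 where g3: "has_fourier u3 g3" "L2_norm_freq (X_weight s (13/24) g3) < ennreal (x u3 + \<epsilon>)"
        by (rule X_space_approx[OF X(3) e], rule that) (simp_all add: x_def)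
      have fin: "a < \<infinity>" if "a < ennreal r" for a r using that by (auto simp: top.not_eq_extremum order.strict_trans)
      have "?N \<le> ennreal C * (L2_norm_freq (X_weight s (13/24) g1) * L2_norm_freq (X_weight s (13/24) g2) * L2_norm_freq (X_weight s (13/24) g3))"
        by (rule C(2)[OF g1(1) g2(1) g3(1) fin[OF g1(2)] fin[OF g2(2)] fin[OF g3(2)]])
      also have "\<dots> \<le> ennreal C * (ennreal (x u1 + \<epsilon>) * ennreal (x u2 + \<epsilon>) * ennreal (x u3 + \<epsilon>))"
        using g1(2) g2(2) g3(2) by (intro mult_left_mono mult_mono) (auto intro: less_imp_le)
      also have "\<dots> = ennreal (C * ((x u1 + \<epsilon>) * (x u2 + \<epsilon>) * (x u3 + \<epsilon>)))"
        using C(1) x0 e by (simp add: ennreal_mult add_nonneg_nonneg less_imp_le)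
      finally show ?thesis .
    qed
    have "((\<lambda>\<epsilon>. ennreal (C * ((x u1 + \<epsilon>) * (x u2 + \<epsilon>) * (x u3 + \<epsilon>)))) \<longlongrightarrow> ennreal (C * ((x u1 + 0) * (x u2 + 0) * (x u3 + 0)))) (at_right 0)"
      by (intro tendsto_ennrealI tendsto_intros)
    moreover have "eventually (\<lambda>\<epsilon>. ?N \<le> ennreal (C * ((x u1 + \<epsilon>) * (x u2 + \<epsilon>) * (x u3 + \<epsilon>)))) (at_right 0)"
      using eventually_at_right_less[of 0] by eventually_elim (rule le)
    ultimately have "?N \<le> ennreal (C * ((x u1 + 0) * (x u2 + 0) * (x u3 + 0)))"
      by (rule tendsto_lowerbound) simp
    also have "\<dots> = ennreal C * (X_norm s (13/24) u1 * X_norm s (13/24) u2 * X_norm s (13/24) u3)"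
      using C(1) x0 by (simp add: xe[OF X(1)] xe[OF X(2)] xe[OF X(3)] ennreal_mult)
    finally show ?thesis .
  qed
  show ?thesis
  proof (rule exI[of _ "1/24"], rule conjI)
    show "(0::real) < 1/24" by simp
    show "\<exists>C::real. C > 0 \<and> (\<forall>u\<^sub>1 \<in> X_space s (1/2 + 1/24). \<forall>u\<^sub>2 \<in> X_space s (1/2 + 1/24). \<forall>u\<^sub>3 \<in> X_space s (1/2 + 1/24).
       X_norm s (- 1/2 + 3 * (1/24)) (dx_distr (distr_prod3 u\<^sub>1 u\<^sub>2 u\<^sub>3))
         \<le> ennreal C * (X_norm s (1/2 + 1/24) u\<^sub>1 * X_norm s (1/2 + 1/24) u\<^sub>2 * X_norm s (1/2 + 1/24) u\<^sub>3))"
      unfolding b using C(1) main by (intro exI[of _ C] conjI ballI)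
  qed
qed

end
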